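(* Let $A$ be a representation-hereditary Artin algebra. Then: (a) If $M$ is a non-injective indecomposable module in $\mathrm{Gen}\,DA$, then $M\cong\Omega^{-}(P)$ for some indecomposable projective module $P$. (b) If $M$ is a non-projective indecomposable module in $\mathrm{Cogen}\,A$, then $M\cong\Omega(I)$ for some indecomposable injective module $I$. (c) $A$ is torsionless-finite.
   Context: All modules are finitely generated right $A$-modules; $D$ is the standard duality, so $DA$ is an injective cogenerator. An Artin algebra $A$ is called representation-hereditary if $\mathrm{gl.dim}\,\mathrm{End}_A(A\oplus DA)=3$. $\mathrm{Gen}\,DA$ is the class of modules generated by $DA$ (quotients of modules in $\mathrm{add}\,DA$), and $\mathrm{Cogen}\,A$ is the class of modules cogenerated by $A$ (submodules of modules in $\mathrm{add}\,A$). $\Omega(X)$ denotes the syzygy of $X$ (kernel of the projective cover) and $\Omega^{-}(X)$ the cosyzygy (cokernel of the injective envelope). $A$ is torsionless-finite if there are only finitely many isomorphism classes of indecomposable modules that are submodules of projective modules (equivalently, only finitely many isomorphism classes of indecomposable factor modules of injective modules). *)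

theory Defs
  imports "HOL-Library.Extended_Nat" "HOL-Algebra.Ideal" "HOL-Algebra.Module"
begin

section \<open>Right modules\<close>

text \<open>
  Right modules over a (not necessarily commutative) ring are represented by the library's
  module records; their scalar multiplication is read on the right,
  i.e. \<open>a \<odot>\<^bsub>M\<^esub> x\<close> stands for \<open>x \<cdot> a\<close>.
  Hence the order of the factors in \<open>smult_assoc\<close>.
\<close>

locale right_module = R?: ring R + M?: abelian_group M
  for R (structure) and M :: "('r, 'm) module" (structure) +
  assumes smult_closed [simp, intro]:
      "\<lbrakk>a \<in> carrier R; x \<in> carrier M\<rbrakk> \<Longrightarrow> a \<odot>\<^bsub>M\<^esub> x \<in> carrier M"
    and smult_l_distr:
      "\<lbrakk>a \<in> carrier R; b \<in> carrier R; x \<in> carrier M\<rbrakk> \<Longrightarrow>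
        (a \<oplus> b) \<odot>\<^bsub>M\<^esub> x = a \<odot>\<^bsub>M\<^esub> x \<oplus>\<^bsub>M\<^esub> b \<odot>\<^bsub>M\<^esub> x"
    and smult_r_distr:
      "\<lbrakk>a \<in> carrier R; x \<in> carrier M; y \<in> carrier M\<rbrakk> \<Longrightarrow>
        a \<odot>\<^bsub>M\<^esub> (x \<oplus>\<^bsub>M\<^esub> y) = a \<odot>\<^bsub>M\<^esub> x \<oplus>\<^bsub>M\<^esub> a \<odot>\<^bsub>M\<^esub> y"
    and smult_assoc:
      "\<lbrakk>a \<in> carrier R; b \<in> carrier R; x \<in> carrier M\<rbrakk> \<Longrightarrow>
        (a \<otimes> b) \<odot>\<^bsub>M\<^esub> x = b \<odot>\<^bsub>M\<^esub> (a \<odot>\<^bsub>M\<^esub> x)"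
    and smult_one [simp]: "x \<in> carrier M \<Longrightarrow> \<one> \<odot>\<^bsub>M\<^esub> x = x"

lemma right_module_iff_module:
  assumes "cring R"
  shows "right_module R M \<longleftrightarrow> module R M"
proof -
  interpret cring R by fact
  show ?thesis
    by (auto simp: right_module_def module_def right_module_axioms_def module_axioms_def
        ring_axioms assms) (metis m_comm)+
qed

definition fin_gen :: "('r, 'z) ring_scheme \<Rightarrow> ('r, 'm) module \<Rightarrow> bool" where
  "fin_gen R M \<longleftrightarrow> (\<exists>S. finite S \<and> S \<subseteq> carrier M \<and>
     (\<forall>U. submodule U R M \<and> S \<subseteq> U \<longrightarrow> U = carrier M))"

definition fg_mod :: "('r, 'z) ring_scheme \<Rightarrow> ('r, 'm) module \<Rightarrow> bool" where
  "fg_mod R M \<longleftrightarrow> right_module R M \<and> fin_gen R M"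

text \<open>
  A finitely generated module is a quotient of some \<open>R\<^sup>n\<close>, so up to isomorphism its elements are
  sets of functions from \<open>nat\<close> to \<open>R\<close>. The following type therefore contains every finitely
  generated \<open>R\<close>-module up to isomorphism (lemma \<open>fg_mod_representative\<close> below), and
  quantification over all finitely generated modules is quantification over this type.
\<close>

type_synonym 'r umod = "('r, (nat \<Rightarrow> 'r) set) module"

definition mod_hom ::
  "('r, 'z) ring_scheme \<Rightarrow> ('r, 'm) module \<Rightarrow> ('r, 'n) module \<Rightarrow> ('m \<Rightarrow> 'n) set" where
  "mod_hom R M N = {h \<in> hom (add_monoid M) (add_monoid N).
     \<forall>a\<in>carrier R. \<forall>x\<in>carrier M. h (a \<odot>\<^bsub>M\<^esub> x) = a \<odot>\<^bsub>N\<^esub> h x}"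

definition mod_mono ::
  "('r, 'z) ring_scheme \<Rightarrow> ('r, 'm) module \<Rightarrow> ('r, 'n) module \<Rightarrow> ('m \<Rightarrow> 'n) set" where
  "mod_mono R M N = {h \<in> mod_hom R M N. inj_on h (carrier M)}"

definition mod_epi ::
  "('r, 'z) ring_scheme \<Rightarrow> ('r, 'm) module \<Rightarrow> ('r, 'n) module \<Rightarrow> ('m \<Rightarrow> 'n) set" where
  "mod_epi R M N = {h \<in> mod_hom R M N. h ` carrier M = carrier N}"

definition mod_isomorphic ::
  "('r, 'z) ring_scheme \<Rightarrow> ('r, 'm) module \<Rightarrow> ('r, 'n) module \<Rightarrow> bool" where
  "mod_isomorphic R M N \<longleftrightarrow> (\<exists>h\<in>mod_hom R M N. bij_betw h (carrier M) (carrier N))"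

lemma (in right_module) submoduleI:
  assumes "H \<subseteq> carrier M" "\<zero>\<^bsub>M\<^esub> \<in> H"
    and "\<And>a. a \<in> H \<Longrightarrow> \<ominus>\<^bsub>M\<^esub> a \<in> H"
    and "\<And>a b. \<lbrakk>a \<in> H; b \<in> H\<rbrakk> \<Longrightarrow> a \<oplus>\<^bsub>M\<^esub> b \<in> H"
    and "\<And>a x. \<lbrakk>a \<in> carrier R; x \<in> H\<rbrakk> \<Longrightarrow> a \<odot>\<^bsub>M\<^esub> x \<in> H"
  shows "submodule H R M"
  using assms by (intro submodule.intro subgroup.intro submodule_axioms.intro) (simp_all add: a_inv_def)

lemma (in right_module) smult_l_null:
  assumes "x \<in> carrier M" shows "\<zero> \<odot>\<^bsub>M\<^esub> x = \<zero>\<^bsub>M\<^esub>"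
proof -
  have "\<zero> \<odot>\<^bsub>M\<^esub> x \<oplus>\<^bsub>M\<^esub> \<zero> \<odot>\<^bsub>M\<^esub> x = \<zero> \<odot>\<^bsub>M\<^esub> x"
    using smult_l_distr[of \<zero> \<zero> x] assms by simp
  then show ?thesis using assms by (metis M.add.r_cancel_one' R.zero_closed smult_closed)
qed

lemma (in right_module) smult_l_minus:
  assumes "a \<in> carrier R" "x \<in> carrier M" shows "(\<ominus> a) \<odot>\<^bsub>M\<^esub> x = \<ominus>\<^bsub>M\<^esub> (a \<odot>\<^bsub>M\<^esub> x)"
proof -
  have "(\<ominus> a) \<odot>\<^bsub>M\<^esub> x \<oplus>\<^bsub>M\<^esub> a \<odot>\<^bsub>M\<^esub> x = \<zero>\<^bsub>M\<^esub>"
    using smult_l_distr[of "\<ominus> a" a x] assms by (simp add: R.l_neg smult_l_null)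
  then show ?thesis using assms by (metis M.minus_equality R.a_inv_closed smult_closed)
qed


lemma (in right_module) fin_gen_combinations:
  assumes "fin_gen R M"
  obtains s and n :: nat where "s \<in> {..<n} \<rightarrow> carrier M"
    "\<forall>x\<in>carrier M. \<exists>r\<in>{..<n} \<rightarrow> carrier R. x = (\<Oplus>\<^bsub>M\<^esub>i\<in>{..<n}. r i \<odot>\<^bsub>M\<^esub> s i)"
proof -
  obtain S where S: "finite S" "S \<subseteq> carrier M"
    "\<forall>U. submodule U R M \<and> S \<subseteq> U \<longrightarrow> U = carrier M"
    using assms unfolding fin_gen_def by blast
  obtain n :: nat and s where s: "S = s ` {i. i < n}"
    using S(1) finite_imp_nat_seg_image_inj_on by metis
  have s': "\<And>i. i < n \<Longrightarrow> s i \<in> carrier M" using s S(2) by blast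
  let ?L = "\<lambda>r. \<Oplus>\<^bsub>M\<^esub>i\<in>{..<n}. r i \<odot>\<^bsub>M\<^esub> s i"
  let ?U = "?L ` ({..<n} \<rightarrow> carrier R)"
  have cl: "\<And>r. r \<in> {..<n} \<rightarrow> carrier R \<Longrightarrow> (\<lambda>i. r i \<odot>\<^bsub>M\<^esub> s i) \<in> {..<n} \<rightarrow> carrier M"
    using s' by auto
  have "submodule ?U R M"
  proof (rule submoduleI)
    show "?U \<subseteq> carrier M" using cl by (auto intro!: M.finsum_closed)
    have "?L (\<lambda>_. \<zero>) = (\<Oplus>\<^bsub>M\<^esub>i\<in>{..<n}. \<zero>\<^bsub>M\<^esub>)"
      by (rule M.finsum_cong') (auto simp: smult_l_null s')
    then have z: "\<zero>\<^bsub>M\<^esub> = ?L (\<lambda>_. \<zero>)" by (simp add: M.finsum_zero)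
    show "\<zero>\<^bsub>M\<^esub> \<in> ?U" using z by (rule image_eqI[where x = "\<lambda>_. \<zero>"]) auto
  next
    fix a b assume "a \<in> ?U" "b \<in> ?U"
    then obtain r t where r: "r \<in> {..<n} \<rightarrow> carrier R" "a = ?L r"
      and t: "t \<in> {..<n} \<rightarrow> carrier R" "b = ?L t" by blast
    have "a \<oplus>\<^bsub>M\<^esub> b = (\<Oplus>\<^bsub>M\<^esub>i\<in>{..<n}. r i \<odot>\<^bsub>M\<^esub> s i \<oplus>\<^bsub>M\<^esub> t i \<odot>\<^bsub>M\<^esub> s i)"
      unfolding r t using r t cl by (intro M.finsum_addf[symmetric]) auto
    also have "\<dots> = ?L (\<lambda>i. r i \<oplus> t i)"
      using r t s' by (intro M.finsum_cong') (auto simp: Pi_iff smult_l_distr)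
    finally show "a \<oplus>\<^bsub>M\<^esub> b \<in> ?U"
      by (rule image_eqI[where x = "\<lambda>i. r i \<oplus> t i"]) (use r t in auto)
  next
    fix a x assume a: "a \<in> carrier R" and "x \<in> ?U"
    then obtain r where r: "r \<in> {..<n} \<rightarrow> carrier R" "x = ?L r" by blast
    have "a \<odot>\<^bsub>M\<^esub> (\<Oplus>\<^bsub>M\<^esub>i\<in>{..<m}. r i \<odot>\<^bsub>M\<^esub> s i) = (\<Oplus>\<^bsub>M\<^esub>i\<in>{..<m}. (r i \<otimes> a) \<odot>\<^bsub>M\<^esub> s i)"
      if "m \<le> n" for m using that
    proof (induction m)
      case 0
      have "a \<odot>\<^bsub>M\<^esub> \<zero>\<^bsub>M\<^esub> \<oplus>\<^bsub>M\<^esub> a \<odot>\<^bsub>M\<^esub> \<zero>\<^bsub>M\<^esub> = a \<odot>\<^bsub>M\<^esub> \<zero>\<^bsub>M\<^esub>"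
        using smult_r_distr[of a "\<zero>\<^bsub>M\<^esub>" "\<zero>\<^bsub>M\<^esub>"] a by simp
      then have "a \<odot>\<^bsub>M\<^esub> \<zero>\<^bsub>M\<^esub> = \<zero>\<^bsub>M\<^esub>"
        using a by (metis M.add.r_cancel_one' M.zero_closed smult_closed)
      then show ?case by simp
    next
      case (Suc m)
      have c: "(\<lambda>i. r i \<odot>\<^bsub>M\<^esub> s i) \<in> {..<m} \<rightarrow> carrier M"
        "(\<lambda>i. (r i \<otimes> a) \<odot>\<^bsub>M\<^esub> s i) \<in> {..<m} \<rightarrow> carrier M"
        "r m \<in> carrier R" "s m \<in> carrier M"
        using r s' a Suc.prems by (auto simp: Pi_iff)
      have "(\<Oplus>\<^bsub>M\<^esub>i\<in>{..<m}. r i \<odot>\<^bsub>M\<^esub> s i) \<in> carrier M" using c by (intro M.finsum_closed)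
      then show ?case using c Suc a
        by (simp add: lessThan_Suc M.finsum_insert smult_r_distr smult_assoc)
    qed
    from this[of n] have "a \<odot>\<^bsub>M\<^esub> x = ?L (\<lambda>i. r i \<otimes> a)" unfolding r by simp
    then show "a \<odot>\<^bsub>M\<^esub> x \<in> ?U"
      by (rule image_eqI[where x = "\<lambda>i. r i \<otimes> a"]) (use r a in auto)
  next
    fix a assume "a \<in> ?U"
    then obtain r where r: "r \<in> {..<n} \<rightarrow> carrier R" "a = ?L r" by blast
    have m: "(\<lambda>i. \<ominus> r i) \<in> {..<n} \<rightarrow> carrier R" using r by auto
    have "?L (\<lambda>i. \<ominus> r i) \<oplus>\<^bsub>M\<^esub> a = (\<Oplus>\<^bsub>M\<^esub>i\<in>{..<n}. (\<ominus> r i) \<odot>\<^bsub>M\<^esub> s i \<oplus>\<^bsub>M\<^esub> r i \<odot>\<^bsub>M\<^esub> s i)"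
      unfolding r using r m cl by (intro M.finsum_addf[symmetric]) auto
    also have "\<dots> = (\<Oplus>\<^bsub>M\<^esub>i\<in>{..<n}. \<zero>\<^bsub>M\<^esub>)"
    proof (rule M.finsum_cong')
      fix i assume "i \<in> {..<n}"
      then have "r i \<in> carrier R" "s i \<in> carrier M" using r s' by auto
      then show "(\<ominus> r i) \<odot>\<^bsub>M\<^esub> s i \<oplus>\<^bsub>M\<^esub> r i \<odot>\<^bsub>M\<^esub> s i = \<zero>\<^bsub>M\<^esub>"
        by (simp add: smult_l_minus M.l_neg)
    qed auto
    finally have "?L (\<lambda>i. \<ominus> r i) \<oplus>\<^bsub>M\<^esub> a = \<zero>\<^bsub>M\<^esub>" by (simp add: M.finsum_zero)
    then have "\<ominus>\<^bsub>M\<^esub> a = ?L (\<lambda>i. \<ominus> r i)"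
      using r cl[OF m] cl[OF r(1)] by (intro M.minus_equality) (auto intro!: M.finsum_closed)
    then show "\<ominus>\<^bsub>M\<^esub> a \<in> ?U"
      by (rule image_eqI[where x = "\<lambda>i. \<ominus> r i"]) (use m in auto)
  qed
  moreover have "S \<subseteq> ?U"
  proof
    fix x assume "x \<in> S"
    then obtain j where j: "j < n" "x = s j" using s by blast
    have "?L (\<lambda>i. if j = i then \<one> else \<zero>)
        = (\<Oplus>\<^bsub>M\<^esub>i\<in>{..<n}. if j = i then s i else \<zero>\<^bsub>M\<^esub>)"
      using s' by (intro M.finsum_cong') (auto simp: smult_l_null)
    also have "\<dots> = x"
      using j s' by (simp add: M.finsum_singleton Pi_iff)
    finally have "x = ?L (\<lambda>i. if j = i then \<one> else \<zero>)" ..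
    then show "x \<in> ?U"
      by (rule image_eqI[where x = "\<lambda>i. if j = i then \<one> else \<zero>"]) auto
  qed
  ultimately have "?U = carrier M" by (rule S(3)[rule_format, OF conjI])
  then show ?thesis using s' by (intro that[of s n]) (blast, blast)
qed

lemma fg_mod_representative:
  fixes M :: "('r, 'm) module"
  assumes "fg_mod R M"
  shows "\<exists>N :: 'r umod. fg_mod R N \<and> mod_isomorphic R M N"
proof -
  interpret right_module R M using assms by (simp add: fg_mod_def)
  have "fin_gen R M" using assms by (simp add: fg_mod_def)
  then obtain s and n :: nat where s: "s \<in> {..<n} \<rightarrow> carrier M"
    "\<forall>x\<in>carrier M. \<exists>r\<in>{..<n} \<rightarrow> carrier R. x = (\<Oplus>\<^bsub>M\<^esub>i\<in>{..<n}. r i \<odot>\<^bsub>M\<^esub> s i)"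
    by (rule fin_gen_combinations)
  define g where "g x = {r \<in> {..<n} \<rightarrow> carrier R. x = (\<Oplus>\<^bsub>M\<^esub>i\<in>{..<n}. r i \<odot>\<^bsub>M\<^esub> s i)}" for x
  have inj: "inj_on g (carrier M)"
  proof (rule inj_onI)
    fix x y assume "x \<in> carrier M" "y \<in> carrier M" "g x = g y"
    moreover from \<open>x \<in> carrier M\<close> obtain r where "r \<in> g x" using s(2) unfolding g_def by blast
    ultimately show "x = y" unfolding g_def by auto
  qed
  define f where "f = inv_into (carrier M) g"
  have fg [simp]: "f (g x) = x" if "x \<in> carrier M" for x
    using that inj by (simp add: f_def)
  define N :: "'r umod" where "N = \<lparr>carrier = g ` carrier M, mult = undefined, one = undefined,
     zero = g \<zero>\<^bsub>M\<^esub>, add = (\<lambda>x y. g (f x \<oplus>\<^bsub>M\<^esub> f y)), smult = (\<lambda>a x. g (a \<odot>\<^bsub>M\<^esub> f x))\<rparr>"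
  have "abelian_group N"
  proof (rule abelian_groupI)
    fix x assume "x \<in> carrier N"
    then obtain m where m: "m \<in> carrier M" "x = g m" by (auto simp: N_def)
    then show "\<exists>y\<in>carrier N. y \<oplus>\<^bsub>N\<^esub> x = \<zero>\<^bsub>N\<^esub>"
      by (intro bexI[of _ "g (\<ominus>\<^bsub>M\<^esub> m)"]) (auto simp: N_def M.l_neg)
  qed (auto simp: N_def M.a_ac)
  then have N: "right_module R N"
    by (auto simp: right_module_def right_module_axioms_def R.ring_axioms N_def smult_l_distr
        smult_r_distr smult_assoc)
  have hom: "g \<in> mod_hom R M N"
    by (auto simp: mod_hom_def hom_def N_def)
  have bij: "bij_betw g (carrier M) (carrier N)"
    using inj by (auto simp: bij_betw_def N_def)
  have "fin_gen R N"
  proof -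
    obtain S where S: "finite S" "S \<subseteq> carrier M"
      "\<forall>U. submodule U R M \<and> S \<subseteq> U \<longrightarrow> U = carrier M"
      using \<open>fin_gen R M\<close> unfolding fin_gen_def by blast
    have "U = carrier N" if U: "submodule U R N" "g ` S \<subseteq> U" for U
    proof -
      interpret U: submodule U R N by fact
      interpret N: right_module R N by fact
      let ?V = "{x \<in> carrier M. g x \<in> U}"
      have inv: "g (\<ominus>\<^bsub>M\<^esub> x) = \<ominus>\<^bsub>N\<^esub> (g x)" if "x \<in> carrier M" for x
        using that by (intro N.M.minus_equality[symmetric]) (auto simp: N_def M.l_neg)
      have "submodule ?V R M"
      proof (rule submoduleI)
        show "\<zero>\<^bsub>M\<^esub> \<in> ?V" using U.one_closed by (simp add: N_def)
        show "\<ominus>\<^bsub>M\<^esub> a \<in> ?V" if "a \<in> ?V" for a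
          using that U.m_inv_closed by (simp add: inv a_inv_def[of N])
        show "a \<oplus>\<^bsub>M\<^esub> b \<in> ?V" if "a \<in> ?V" "b \<in> ?V" for a b
          using that U.m_closed[of "g a" "g b"] by (simp add: N_def)
        show "a \<odot>\<^bsub>M\<^esub> x \<in> ?V" if "a \<in> carrier R" "x \<in> ?V" for a x
          using that U.smult_closed[of a "g x"] by (simp add: N_def)
      qed auto
      moreover have "S \<subseteq> ?V" using U(2) S(2) by auto
      ultimately have "?V = carrier M" by (rule S(3)[rule_format, OF conjI])
      then have "carrier N \<subseteq> U" by (auto simp: N_def)
      then show ?thesis using U.subset by auto
    qed
    then show ?thesis unfolding fin_gen_def
      using S by (intro exI[of _ "g ` S"]) (auto simp: N_def)
  qed
  then show ?thesis using N hom bij unfolding fg_mod_def mod_isomorphic_def by blast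
qed

text \<open>
  In the constructions below the fields \<open>mult\<close> and \<open>one\<close>, which module records inherit from
  rings, play no role.
\<close>

definition regular_mod :: "('r, 'z) ring_scheme \<Rightarrow> ('r, 'r) module" where
  "regular_mod R = \<lparr>carrier = carrier R, mult = undefined, one = undefined,
     zero = \<zero>\<^bsub>R\<^esub>, add = add R, smult = (\<lambda>a x. x \<otimes>\<^bsub>R\<^esub> a)\<rparr>"

definition quot_mod :: "('r, 'm) module \<Rightarrow> 'm set \<Rightarrow> ('r, 'm set) module" where
  "quot_mod M U = \<lparr>carrier = a_rcosets\<^bsub>M\<^esub> U, mult = undefined, one = undefined,
     zero = U, add = set_add M, smult = (\<lambda>a C. \<Union>x\<in>C. U +>\<^bsub>M\<^esub> (a \<odot>\<^bsub>M\<^esub> x))\<rparr>"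

definition mod_sum :: "('r, 'm) module \<Rightarrow> ('r, 'n) module \<Rightarrow> ('r, 'm \<times> 'n) module" where
  "mod_sum M N = \<lparr>carrier = carrier M \<times> carrier N, mult = undefined, one = undefined,
     zero = (\<zero>\<^bsub>M\<^esub>, \<zero>\<^bsub>N\<^esub>),
     add = (\<lambda>(x, y) (x', y'). (x \<oplus>\<^bsub>M\<^esub> x', y \<oplus>\<^bsub>N\<^esub> y')),
     smult = (\<lambda>a (x, y). (a \<odot>\<^bsub>M\<^esub> x, a \<odot>\<^bsub>N\<^esub> y))\<rparr>"

definition mod_pow :: "('r, 'm) module \<Rightarrow> nat \<Rightarrow> ('r, nat \<Rightarrow> 'm) module" where
  "mod_pow M n = \<lparr>carrier = {..<n} \<rightarrow>\<^sub>E carrier M, mult = undefined, one = undefined,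
     zero = (\<lambda>i\<in>{..<n}. \<zero>\<^bsub>M\<^esub>),
     add = (\<lambda>f g. \<lambda>i\<in>{..<n}. f i \<oplus>\<^bsub>M\<^esub> g i),
     smult = (\<lambda>a f. \<lambda>i\<in>{..<n}. a \<odot>\<^bsub>M\<^esub> f i)\<rparr>"

definition end_ring :: "('r, 'z) ring_scheme \<Rightarrow> ('r, 'm) module \<Rightarrow> ('m \<Rightarrow> 'm) ring" where
  "end_ring R M = \<lparr>carrier = mod_hom R M M \<inter> extensional (carrier M),
     mult = compose (carrier M), one = (\<lambda>x\<in>carrier M. x),
     zero = (\<lambda>x\<in>carrier M. \<zero>\<^bsub>M\<^esub>),
     add = (\<lambda>f g. \<lambda>x\<in>carrier M. f x \<oplus>\<^bsub>M\<^esub> g x)\<rparr>"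


section \<open>Projective and injective modules, syzygies and cosyzygies\<close>

definition projective_mod :: "('r, 'z) ring_scheme \<Rightarrow> ('r, 'm) module \<Rightarrow> bool" where
  "projective_mod R P \<longleftrightarrow> fg_mod R P \<and>
     (\<forall>(X :: 'r umod) (Y :: 'r umod). \<forall>g\<in>mod_epi R X Y. \<forall>h\<in>mod_hom R P Y.
        fg_mod R X \<and> fg_mod R Y \<longrightarrow>
        (\<exists>l\<in>mod_hom R P X. \<forall>p\<in>carrier P. g (l p) = h p))"

definition injective_mod :: "('r, 'z) ring_scheme \<Rightarrow> ('r, 'm) module \<Rightarrow> bool" where
  "injective_mod R E \<longleftrightarrow> fg_mod R E \<and>
     (\<forall>(X :: 'r umod) (Y :: 'r umod). \<forall>g\<in>mod_mono R X Y. \<forall>h\<in>mod_hom R X E.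
        fg_mod R X \<and> fg_mod R Y \<longrightarrow>
        (\<exists>l\<in>mod_hom R Y E. \<forall>x\<in>carrier X. l (g x) = h x))"

definition indecomposable_mod :: "('r, 'z) ring_scheme \<Rightarrow> ('r, 'm) module \<Rightarrow> bool" where
  "indecomposable_mod R M \<longleftrightarrow> fg_mod R M \<and> carrier M \<noteq> {\<zero>\<^bsub>M\<^esub>} \<and>
     (\<forall>U V. submodule U R M \<and> submodule V R M \<and>
        U <+>\<^bsub>M\<^esub> V = carrier M \<and> U \<inter> V = {\<zero>\<^bsub>M\<^esub>} \<longrightarrow> U = {\<zero>\<^bsub>M\<^esub>} \<or> V = {\<zero>\<^bsub>M\<^esub>})"

definition projective_cover ::
  "('r, 'z) ring_scheme \<Rightarrow> ('r, 'p) module \<Rightarrow> ('p \<Rightarrow> 'm) \<Rightarrow> ('r, 'm) module \<Rightarrow> bool" where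
  "projective_cover R P p M \<longleftrightarrow> projective_mod R P \<and> p \<in> mod_epi R P M \<and>
     (\<forall>V. submodule V R P \<and> V <+>\<^bsub>P\<^esub> a_kernel P M p = carrier P \<longrightarrow> V = carrier P)"

definition injective_envelope ::
  "('r, 'z) ring_scheme \<Rightarrow> ('r, 'm) module \<Rightarrow> ('m \<Rightarrow> 'e) \<Rightarrow> ('r, 'e) module \<Rightarrow> bool" where
  "injective_envelope R M i E \<longleftrightarrow> injective_mod R E \<and> i \<in> mod_mono R M E \<and>
     (\<forall>V. submodule V R E \<and> V \<inter> i ` carrier M = {\<zero>\<^bsub>E\<^esub>} \<longrightarrow> V = {\<zero>\<^bsub>E\<^esub>})"

text \<open>
  Projective covers and injective envelopes are unique up to isomorphism, so \<open>\<Omega>(X)\<close> and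
  \<open>\<Omega>\<^sup>-(X)\<close> are determined up to isomorphism; the following relations say \<open>Z \<cong> \<Omega>(X)\<close> and
  \<open>Z \<cong> \<Omega>\<^sup>-(X)\<close>.
\<close>

definition iso_syzygy ::
  "('r, 'z) ring_scheme \<Rightarrow> ('r, 'n) module \<Rightarrow> ('r, 'm) module \<Rightarrow> bool" where
  "iso_syzygy R Z X \<longleftrightarrow> (\<exists>(P :: 'r umod) p. projective_cover R P p X \<and>
     mod_isomorphic R Z (P\<lparr>carrier := a_kernel P X p\<rparr>))"

definition iso_cosyzygy ::
  "('r, 'z) ring_scheme \<Rightarrow> ('r, 'n) module \<Rightarrow> ('r, 'm) module \<Rightarrow> bool" where
  "iso_cosyzygy R Z X \<longleftrightarrow> (\<exists>(E :: 'r umod) i. injective_envelope R X i E \<and>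
     mod_isomorphic R Z (quot_mod E (i ` carrier X)))"


section \<open>The classes add, Gen and Cogen\<close>

definition in_add ::
  "('r, 'z) ring_scheme \<Rightarrow> ('r, 't) module \<Rightarrow> ('r, 'm) module \<Rightarrow> bool" where
  "in_add R T X \<longleftrightarrow> fg_mod R X \<and> (\<exists>n (Y :: 'r umod).
     fg_mod R Y \<and> mod_isomorphic R (mod_sum X Y) (mod_pow T n))"

definition in_Gen ::
  "('r, 'z) ring_scheme \<Rightarrow> ('r, 't) module \<Rightarrow> ('r, 'm) module \<Rightarrow> bool" where
  "in_Gen R T M \<longleftrightarrow> fg_mod R M \<and> (\<exists>X :: 'r umod. in_add R T X \<and> mod_epi R X M \<noteq> {})"

definition in_Cogen ::
  "('r, 'z) ring_scheme \<Rightarrow> ('r, 't) module \<Rightarrow> ('r, 'm) module \<Rightarrow> bool" where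
  "in_Cogen R T M \<longleftrightarrow> fg_mod R M \<and> (\<exists>X :: 'r umod. in_add R T X \<and> mod_mono R M X \<noteq> {})"


section \<open>Global dimension\<close>

definition proj_resolution ::
  "('r, 'z) ring_scheme \<Rightarrow> ('r, 'm) module \<Rightarrow> (nat \<Rightarrow> 'r umod) \<Rightarrow>
   (nat \<Rightarrow> (nat \<Rightarrow> 'r) set \<Rightarrow> (nat \<Rightarrow> 'r) set) \<Rightarrow> ((nat \<Rightarrow> 'r) set \<Rightarrow> 'm) \<Rightarrow> bool" where
  "proj_resolution R M P d e \<longleftrightarrow>
     (\<forall>i. projective_mod R (P i)) \<and>
     e \<in> mod_epi R (P 0) M \<and>
     (\<forall>i. d i \<in> mod_hom R (P (Suc i)) (P i)) \<and>
     d 0 ` carrier (P (Suc 0)) = a_kernel (P 0) M e \<and>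
     (\<forall>i. d (Suc i) ` carrier (P (Suc (Suc i))) = a_kernel (P (Suc i)) (P i) (d i))"

definition proj_dim :: "('r, 'z) ring_scheme \<Rightarrow> ('r, 'm) module \<Rightarrow> enat" where
  "proj_dim R M = Inf {enat n | n. \<exists>P d e. proj_resolution R M P d e \<and>
     (\<forall>i>n. carrier (P i) = {\<zero>\<^bsub>P i\<^esub>})}"

definition gl_dim :: "('r, 'z) ring_scheme \<Rightarrow> enat" where
  "gl_dim R = (SUP M\<in>{M :: 'r umod. fg_mod R M}. proj_dim R M)"


section \<open>Artin algebras\<close>

definition artinian_cring :: "('r, 'z) ring_scheme \<Rightarrow> bool" where
  "artinian_cring R \<longleftrightarrow> cring R \<and> (\<forall>I :: nat \<Rightarrow> 'r set.
     (\<forall>n. ideal (I n) R) \<and> (\<forall>n. I (Suc n) \<subseteq> I n) \<longrightarrow> (\<exists>n. \<forall>m\<ge>n. I m = I n))"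

text \<open>The record \<open>A\<close> carries both the ring structure of \<open>A\<close> and its \<open>K\<close>-module structure.\<close>

locale artin_algebra = module K A + ring A
  for K (structure) and A :: "('k, 'a) module" (structure) +
  assumes smult_mult_l:
      "\<lbrakk>c \<in> carrier K; x \<in> carrier A; y \<in> carrier A\<rbrakk> \<Longrightarrow>
        (c \<odot>\<^bsub>A\<^esub> x) \<otimes>\<^bsub>A\<^esub> y = c \<odot>\<^bsub>A\<^esub> (x \<otimes>\<^bsub>A\<^esub> y)"
    and smult_mult_r:
      "\<lbrakk>c \<in> carrier K; x \<in> carrier A; y \<in> carrier A\<rbrakk> \<Longrightarrow>
        x \<otimes>\<^bsub>A\<^esub> (c \<odot>\<^bsub>A\<^esub> y) = c \<odot>\<^bsub>A\<^esub> (x \<otimes>\<^bsub>A\<^esub> y)"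
    and artinian_base: "artinian_cring K"
    and fin_gen: "fin_gen K A"

definition jacobson_radical :: "('k, 'z) ring_scheme \<Rightarrow> 'k set" where
  "jacobson_radical K = carrier K \<inter> \<Inter>{I. maximalideal I K}"

text \<open>
  The standard duality is \<open>D = Hom\<^sub>K(-, J)\<close>, where \<open>J\<close> is an injective envelope of the
  \<open>K\<close>-module \<open>K / rad K\<close>.
\<close>

definition dualizing_mod :: "('k, 'z) ring_scheme \<Rightarrow> ('k, 'j) module \<Rightarrow> bool" where
  "dualizing_mod K J \<longleftrightarrow>
     (\<exists>i. injective_envelope K (quot_mod (regular_mod K) (jacobson_radical K)) i J)"

text \<open>
  \<open>DA = Hom\<^sub>K(A, J)\<close>; its right \<open>A\<close>-action \<open>(f \<cdot> a)(x) = f(a x)\<close> comes from the left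
  \<open>A\<close>-module \<open>A\<close>.
\<close>

definition dual_mod ::
  "('k, 'z) ring_scheme \<Rightarrow> ('k, 'a) module \<Rightarrow> ('k, 'j) module \<Rightarrow> ('a, 'a \<Rightarrow> 'j) module" where
  "dual_mod K A J = \<lparr>carrier = mod_hom K A J \<inter> extensional (carrier A),
     mult = undefined, one = undefined,
     zero = (\<lambda>x\<in>carrier A. \<zero>\<^bsub>J\<^esub>),
     add = (\<lambda>f g. \<lambda>x\<in>carrier A. f x \<oplus>\<^bsub>J\<^esub> g x),
     smult = (\<lambda>a f. \<lambda>x\<in>carrier A. f (a \<otimes>\<^bsub>A\<^esub> x))\<rparr>"

definition representation_hereditary ::
  "('k, 'z) ring_scheme \<Rightarrow> ('k, 'j) module \<Rightarrow> ('k, 'a) module \<Rightarrow> bool" where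
  "representation_hereditary K J A \<longleftrightarrow>
     gl_dim (end_ring A (mod_sum (regular_mod A) (dual_mod K A J))) = 3"

definition torsionless_finite :: "('r, 'z) ring_scheme \<Rightarrow> bool" where
  "torsionless_finite R \<longleftrightarrow> finite
     ({M :: 'r umod. indecomposable_mod R M \<and>
         (\<exists>P :: 'r umod. projective_mod R P \<and> mod_mono R M P \<noteq> {})}
      // {(M, N). mod_isomorphic R M N})"

end

theory Submission
  imports Defs
begin

text \<open>
  Put \<open>T = A \<oplus> DA\<close>. Since \<open>T\<close> is a generator and a cogenerator, global dimension at most 3 for
  \<open>End T\<close> says that every \<open>add T\<close>-approximation \<open>G \<rightarrow> M\<close> has its kernel in \<open>add T\<close>.
  For \<open>M\<close> in \<open>Gen DA\<close> a minimal approximation is \<open>E \<rightarrow> M\<close> with \<open>E\<close> injective. If \<open>M\<close> is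
  indecomposable and not injective, its kernel is an indecomposable projective module with injective
  envelope \<open>E\<close>; the case of \<open>Cogen A\<close> is dual. There are only finitely many indecomposable summands
  of \<open>A\<close> and \<open>DA\<close>, and \<open>\<Omega>\<close> is well defined up to isomorphism, so \<open>A\<close> is torsionless-finite.
\<close>

section \<open>Homomorphisms, submodules and quotients\<close>

text \<open>The bound 3 enters as 2 + 1. As T cogenerates, M has a copresentation 0 -> M -> D^k ->
  D^l by powers of D = DA. Prepending an approximation G -> M with kernel U and applying Hom(T, -)
  gives an exact sequence 0 -> Hom(T, U) -> Hom(T, G) -> Hom(T, D^k) -> Hom(T, D^l) whose last three
  terms are projective over End(T). So Hom(T, U) is the third syzygy of the cokernel at the right
  end and therefore projective; since A is a summand of T, the module U is recovered in add T from
  it.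

  Dualizing the argument literally for Cogen A would call for left modules and for the symmetry of
  global dimension. Instead the same statement about kernels of right approximations is applied to
  the cokernel of a left approximation, and a splitting argument finishes.

  Existence of projective covers and injective envelopes is never presupposed. Minimality of an
  approximation is formulated by direct summands of one fixed module of finite length, and all
  further decompositions arise from Fitting's lemma for a suitably chosen endomorphism.\<close>

lemma mod_homI:
  assumes "\<And>x. x \<in> carrier M \<Longrightarrow> h x \<in> carrier N"
    and "\<And>x y. \<lbrakk>x \<in> carrier M; y \<in> carrier M\<rbrakk> \<Longrightarrow> h (x \<oplus>\<^bsub>M\<^esub> y) = h x \<oplus>\<^bsub>N\<^esub> h y"
    and "\<And>a x. \<lbrakk>a \<in> carrier R; x \<in> carrier M\<rbrakk> \<Longrightarrow> h (a \<odot>\<^bsub>M\<^esub> x) = a \<odot>\<^bsub>N\<^esub> h x"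
  shows "h \<in> mod_hom R M N"
  using assms by (auto simp: mod_hom_def hom_def)

lemma mod_hom_closed: "\<lbrakk>h \<in> mod_hom R M N; x \<in> carrier M\<rbrakk> \<Longrightarrow> h x \<in> carrier N"
  by (auto simp: mod_hom_def hom_def)

lemma mod_hom_add:
  "\<lbrakk>h \<in> mod_hom R M N; x \<in> carrier M; y \<in> carrier M\<rbrakk> \<Longrightarrow> h (x \<oplus>\<^bsub>M\<^esub> y) = h x \<oplus>\<^bsub>N\<^esub> h y"
  by (auto simp: mod_hom_def hom_def)

lemma mod_hom_smult:
  "\<lbrakk>h \<in> mod_hom R M N; a \<in> carrier R; x \<in> carrier M\<rbrakk> \<Longrightarrow> h (a \<odot>\<^bsub>M\<^esub> x) = a \<odot>\<^bsub>N\<^esub> h x"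
  by (auto simp: mod_hom_def)

lemma mod_hom_zero:
  assumes "right_module R M" "right_module R N" "h \<in> mod_hom R M N"
  shows "h \<zero>\<^bsub>M\<^esub> = \<zero>\<^bsub>N\<^esub>"
proof -
  interpret M: right_module R M by fact
  interpret N: right_module R N by fact
  have "h \<zero>\<^bsub>M\<^esub> \<oplus>\<^bsub>N\<^esub> h \<zero>\<^bsub>M\<^esub> = h \<zero>\<^bsub>M\<^esub>"
    using mod_hom_add[OF assms(3), of "\<zero>\<^bsub>M\<^esub>" "\<zero>\<^bsub>M\<^esub>"] by simp
  then show ?thesis
    using mod_hom_closed[OF assms(3) M.M.zero_closed] by (simp add: N.M.add.r_cancel_one)
qed

lemma mod_hom_minus:
  assumes "right_module R M" "right_module R N" "h \<in> mod_hom R M N" "x \<in> carrier M"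
  shows "h (\<ominus>\<^bsub>M\<^esub> x) = \<ominus>\<^bsub>N\<^esub> h x"
proof -
  interpret M: right_module R M by fact
  interpret N: right_module R N by fact
  have "h (\<ominus>\<^bsub>M\<^esub> x) \<oplus>\<^bsub>N\<^esub> h x = \<zero>\<^bsub>N\<^esub>"
    using mod_hom_add[OF assms(3), of "\<ominus>\<^bsub>M\<^esub> x" x] assms
    by (simp add: M.M.l_neg mod_hom_zero)
  then show ?thesis
    using mod_hom_closed[OF assms(3)] assms(4) by (metis M.M.a_inv_closed N.M.minus_equality)
qed

lemma mod_hom_diff:
  assumes "right_module R M" "right_module R N" "h \<in> mod_hom R M N"
    "x \<in> carrier M" "y \<in> carrier M"
  shows "h (x \<ominus>\<^bsub>M\<^esub> y) = h x \<ominus>\<^bsub>N\<^esub> h y"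
proof -
  interpret M: right_module R M by fact
  show ?thesis
    using assms by (simp add: a_minus_def mod_hom_add mod_hom_minus)
qed

lemma (in abelian_group) diff_eq_zero_iff:
  assumes "x \<in> carrier G" "y \<in> carrier G"
  shows "x \<ominus> y = \<zero> \<longleftrightarrow> x = y"
  using assms by (metis minus_eq r_neg add.inv_closed add.right_cancel)

lemma (in abelian_group) minus_zero_right: "x \<in> carrier G \<Longrightarrow> x \<ominus> \<zero> = x"
  by (simp add: minus_eq)

lemma (in abelian_group) diff_add_cancel:
  assumes "x \<in> carrier G" "y \<in> carrier G"
  shows "(x \<ominus> y) \<oplus> y = x" "y \<oplus> (x \<ominus> y) = x"
  using assms by (simp_all add: minus_eq a_ac r_neg2 r_neg l_neg)

lemma (in abelian_group) add_diff_cancel: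
  assumes "x \<in> carrier G" "y \<in> carrier G"
  shows "(x \<oplus> y) \<ominus> y = x" "(y \<oplus> x) \<ominus> y = x"
  using assms by (simp_all add: minus_eq a_ac r_neg2 r_neg)

lemma mod_hom_eq_iff:
  assumes "right_module R M" "right_module R N" "h \<in> mod_hom R M N"
    "x \<in> carrier M" "y \<in> carrier M"
  shows "h x = h y \<longleftrightarrow> h (x \<ominus>\<^bsub>M\<^esub> y) = \<zero>\<^bsub>N\<^esub>"
proof -
  interpret N: right_module R N by fact
  show ?thesis
    using assms by (simp add: mod_hom_diff N.M.diff_eq_zero_iff mod_hom_closed)
qed

lemma mod_hom_inj_iff:
  assumes "right_module R M" "right_module R N" "h \<in> mod_hom R M N"
  shows "inj_on h (carrier M) \<longleftrightarrow> (\<forall>x\<in>carrier M. h x = \<zero>\<^bsub>N\<^esub> \<longrightarrow> x = \<zero>\<^bsub>M\<^esub>)"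
proof -
  interpret M: right_module R M by fact
  interpret N: right_module R N by fact
  show ?thesis
  proof
    assume "inj_on h (carrier M)"
    then show "\<forall>x\<in>carrier M. h x = \<zero>\<^bsub>N\<^esub> \<longrightarrow> x = \<zero>\<^bsub>M\<^esub>"
      by (metis M.M.zero_closed assms inj_onD mod_hom_zero)
  next
    assume *: "\<forall>x\<in>carrier M. h x = \<zero>\<^bsub>N\<^esub> \<longrightarrow> x = \<zero>\<^bsub>M\<^esub>"
    show "inj_on h (carrier M)"
      by (rule inj_onI) (metis * M.M.diff_eq_zero_iff M.M.minus_closed assms mod_hom_eq_iff)
  qed
qed

lemma mod_hom_id: "(\<lambda>x. x) \<in> mod_hom R M M"
  by (auto intro: mod_homI)

lemma mod_hom_comp:
  assumes "f \<in> mod_hom R M N" "g \<in> mod_hom R N L"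
  shows "(\<lambda>x. g (f x)) \<in> mod_hom R M L"
  using assms by (intro mod_homI) (auto simp: mod_hom_closed mod_hom_add mod_hom_smult)

text \<open>\<open>mod_hom\<close> constrains values on the carrier only, so a homomorphism may be
  replaced by any function that agrees with it there.\<close>

lemma mod_hom_cong:
  assumes "right_module R M" "f \<in> mod_hom R M N" "\<And>x. x \<in> carrier M \<Longrightarrow> g x = f x"
  shows "g \<in> mod_hom R M N"
proof -
  interpret M: right_module R M by fact
  show ?thesis
    using assms by (intro mod_homI) (auto simp: mod_hom_closed mod_hom_add mod_hom_smult)
qed

lemma (in right_module) smult_r_null: "a \<in> carrier R \<Longrightarrow> a \<odot>\<^bsub>M\<^esub> \<zero>\<^bsub>M\<^esub> = \<zero>\<^bsub>M\<^esub>"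
  by (metis M.zero_closed M.add.r_cancel_one' M.r_zero smult_closed smult_r_distr)

lemma (in right_module) smult_r_minus:
  assumes "a \<in> carrier R" "x \<in> carrier M" shows "a \<odot>\<^bsub>M\<^esub> (\<ominus>\<^bsub>M\<^esub> x) = \<ominus>\<^bsub>M\<^esub> (a \<odot>\<^bsub>M\<^esub> x)"
proof -
  have "a \<odot>\<^bsub>M\<^esub> (\<ominus>\<^bsub>M\<^esub> x) \<oplus>\<^bsub>M\<^esub> a \<odot>\<^bsub>M\<^esub> x = \<zero>\<^bsub>M\<^esub>"
    using smult_r_distr[of a "\<ominus>\<^bsub>M\<^esub> x" x] assms by (simp add: M.l_neg smult_r_null)
  then show ?thesis using assms by (metis M.minus_equality M.a_inv_closed smult_closed)
qed

lemma mod_hom_zero_map: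
  assumes "right_module R N" shows "(\<lambda>x. \<zero>\<^bsub>N\<^esub>) \<in> mod_hom R M N"
proof -
  interpret N: right_module R N by fact
  show ?thesis by (intro mod_homI) (auto simp: N.smult_r_null)
qed

lemma mod_hom_plus:
  assumes "right_module R N" "f \<in> mod_hom R M N" "g \<in> mod_hom R M N"
  shows "(\<lambda>x. f x \<oplus>\<^bsub>N\<^esub> g x) \<in> mod_hom R M N"
proof -
  interpret N: right_module R N by fact
  show ?thesis using assms
    by (intro mod_homI) (auto simp: mod_hom_closed mod_hom_add mod_hom_smult N.smult_r_distr N.M.a_ac)
qed

lemma mod_hom_uminus:
  assumes "right_module R N" "f \<in> mod_hom R M N"
  shows "(\<lambda>x. \<ominus>\<^bsub>N\<^esub> f x) \<in> mod_hom R M N"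
proof -
  interpret N: right_module R N by fact
  show ?thesis using assms
    by (intro mod_homI)
      (auto simp: mod_hom_closed mod_hom_add mod_hom_smult N.smult_r_minus N.M.minus_add)
qed

lemma mod_hom_sub:
  assumes "right_module R N" "f \<in> mod_hom R M N" "g \<in> mod_hom R M N"
  shows "(\<lambda>x. f x \<ominus>\<^bsub>N\<^esub> g x) \<in> mod_hom R M N"
  unfolding a_minus_def by (intro mod_hom_plus mod_hom_uminus assms)

lemma mod_epiD: "h \<in> mod_epi R M N \<Longrightarrow> h \<in> mod_hom R M N" "h \<in> mod_epi R M N \<Longrightarrow> h ` carrier M = carrier N"
  by (auto simp: mod_epi_def)

lemma mod_epi_surj: "\<lbrakk>h \<in> mod_epi R M N; y \<in> carrier N\<rbrakk> \<Longrightarrow> \<exists>x\<in>carrier M. y = h x"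
  by (auto simp: mod_epi_def)

lemma mod_monoD: "h \<in> mod_mono R M N \<Longrightarrow> h \<in> mod_hom R M N" "h \<in> mod_mono R M N \<Longrightarrow> inj_on h (carrier M)"
  by (auto simp: mod_mono_def)

lemma a_kernel_iff: "x \<in> a_kernel M N h \<longleftrightarrow> x \<in> carrier M \<and> h x = \<zero>\<^bsub>N\<^esub>"
  by (auto simp: a_kernel_def kernel_def)

section \<open>Submodules, their sums, images and preimages\<close>

lemma submodule_subset: "submodule U R M \<Longrightarrow> U \<subseteq> carrier M"
  using submodule.axioms(1) subgroup.subset by fastforce

lemma submodule_zero: "submodule U R M \<Longrightarrow> \<zero>\<^bsub>M\<^esub> \<in> U"
  using submodule.axioms(1) subgroup.one_closed by fastforce

lemma submodule_add: "\<lbrakk>submodule U R M; x \<in> U; y \<in> U\<rbrakk> \<Longrightarrow> x \<oplus>\<^bsub>M\<^esub> y \<in> U"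
  using submodule.axioms(1) subgroup.m_closed by fastforce

lemma submodule_uminus: "\<lbrakk>submodule U R M; x \<in> U\<rbrakk> \<Longrightarrow> \<ominus>\<^bsub>M\<^esub> x \<in> U"
  unfolding a_inv_def using submodule.axioms(1) subgroup.m_inv_closed by fastforce

lemma submodule_diff: "\<lbrakk>submodule U R M; x \<in> U; y \<in> U\<rbrakk> \<Longrightarrow> x \<ominus>\<^bsub>M\<^esub> y \<in> U"
  by (simp add: a_minus_def submodule_add submodule_uminus)

lemma submodule_smult: "\<lbrakk>submodule U R M; a \<in> carrier R; x \<in> U\<rbrakk> \<Longrightarrow> a \<odot>\<^bsub>M\<^esub> x \<in> U"
  by (rule submodule.smult_closed)

text \<open>Closure under negation is automatic: -x is x acted on by -1.\<close>

lemma submoduleI':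
  assumes "right_module R M" "U \<subseteq> carrier M" "\<zero>\<^bsub>M\<^esub> \<in> U"
    and "\<And>x y. \<lbrakk>x \<in> U; y \<in> U\<rbrakk> \<Longrightarrow> x \<oplus>\<^bsub>M\<^esub> y \<in> U"
    and "\<And>a x. \<lbrakk>a \<in> carrier R; x \<in> U\<rbrakk> \<Longrightarrow> a \<odot>\<^bsub>M\<^esub> x \<in> U"
  shows "submodule U R M"
proof -
  interpret M: right_module R M by fact
  show ?thesis
  proof (rule M.submoduleI)
    fix x assume "x \<in> U"
    then show "\<ominus>\<^bsub>M\<^esub> x \<in> U"
      using assms(5)[of "\<ominus>\<^bsub>R\<^esub> \<one>\<^bsub>R\<^esub>" x] assms(2) M.smult_l_minus[of "\<one>\<^bsub>R\<^esub>" x] by auto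
  qed (use assms in auto)
qed

lemma submodule_carrier:
  assumes "right_module R M" shows "submodule (carrier M) R M"
proof -
  interpret M: right_module R M by fact
  show ?thesis by (intro submoduleI' assms) auto
qed

lemma submodule_zero_set:
  assumes "right_module R M" shows "submodule {\<zero>\<^bsub>M\<^esub>} R M"
proof -
  interpret M: right_module R M by fact
  show ?thesis by (intro submoduleI' assms) (auto simp: M.smult_r_null)
qed

lemma submodule_Int:
  assumes "right_module R M" "submodule U R M" "submodule V R M"
  shows "submodule (U \<inter> V) R M"
  using assms submodule_subset[OF assms(2)]
  by (intro submoduleI') (auto simp: submodule_zero submodule_add submodule_smult)

lemma submodule_sum_iff: "x \<in> U <+>\<^bsub>M\<^esub> V \<longleftrightarrow> (\<exists>u\<in>U. \<exists>v\<in>V. x = u \<oplus>\<^bsub>M\<^esub> v)"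
  by (auto simp: set_add_def')

lemma submodule_sum:
  assumes "right_module R M" "submodule U R M" "submodule V R M"
  shows "submodule (U <+>\<^bsub>M\<^esub> V) R M" "U \<subseteq> U <+>\<^bsub>M\<^esub> V" "V \<subseteq> U <+>\<^bsub>M\<^esub> V"
proof -
  interpret M: right_module R M by fact
  have c: "\<And>x. x \<in> U \<Longrightarrow> x \<in> carrier M" "\<And>x. x \<in> V \<Longrightarrow> x \<in> carrier M"
    using submodule_subset assms by blast+
  show "submodule (U <+>\<^bsub>M\<^esub> V) R M"
  proof (rule submoduleI'[OF assms(1)])
    show "\<zero>\<^bsub>M\<^esub> \<in> U <+>\<^bsub>M\<^esub> V"
      using submodule_zero[OF assms(2)] submodule_zero[OF assms(3)]
      by (force simp: submodule_sum_iff)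
  next
    fix x y assume "x \<in> U <+>\<^bsub>M\<^esub> V" "y \<in> U <+>\<^bsub>M\<^esub> V"
    then obtain u v u' v' where "u \<in> U" "v \<in> V" "u' \<in> U" "v' \<in> V"
      "x = u \<oplus>\<^bsub>M\<^esub> v" "y = u' \<oplus>\<^bsub>M\<^esub> v'" unfolding submodule_sum_iff by blast
    moreover from this have "x \<oplus>\<^bsub>M\<^esub> y = (u \<oplus>\<^bsub>M\<^esub> u') \<oplus>\<^bsub>M\<^esub> (v \<oplus>\<^bsub>M\<^esub> v')"
      using c by (simp add: M.M.a_ac)
    ultimately show "x \<oplus>\<^bsub>M\<^esub> y \<in> U <+>\<^bsub>M\<^esub> V"
      unfolding submodule_sum_iff using assms submodule_add by metis
  next
    fix a x assume "a \<in> carrier R" "x \<in> U <+>\<^bsub>M\<^esub> V"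
    moreover from this obtain u v where "u \<in> U" "v \<in> V" "x = u \<oplus>\<^bsub>M\<^esub> v"
      unfolding submodule_sum_iff by blast
    ultimately show "a \<odot>\<^bsub>M\<^esub> x \<in> U <+>\<^bsub>M\<^esub> V"
      unfolding submodule_sum_iff
      using assms submodule_smult c by (metis M.smult_r_distr)
  qed (auto simp: submodule_sum_iff c)
  have "u \<oplus>\<^bsub>M\<^esub> \<zero>\<^bsub>M\<^esub> \<in> U <+>\<^bsub>M\<^esub> V" if "u \<in> U" for u
    using that submodule_zero[OF assms(3)] by (auto simp: set_add_def')
  then show "U \<subseteq> U <+>\<^bsub>M\<^esub> V" using c by auto
  have "\<zero>\<^bsub>M\<^esub> \<oplus>\<^bsub>M\<^esub> v \<in> U <+>\<^bsub>M\<^esub> V" if "v \<in> V" for v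
    using that submodule_zero[OF assms(2)] by (auto simp: set_add_def')
  then show "V \<subseteq> U <+>\<^bsub>M\<^esub> V" using c by auto
qed

lemma submodule_image:
  assumes "right_module R M" "right_module R N" "h \<in> mod_hom R M N" "submodule U R M"
  shows "submodule (h ` U) R N"
proof -
  have c: "\<And>x. x \<in> U \<Longrightarrow> x \<in> carrier M"
    using submodule_subset assms by blast
  show ?thesis
  proof (rule submoduleI'[OF assms(2)])
    show "\<zero>\<^bsub>N\<^esub> \<in> h ` U"
      using submodule_zero[OF assms(4)] mod_hom_zero[OF assms(1-3)] by force
  next
    fix x y assume "x \<in> h ` U" "y \<in> h ` U"
    then show "x \<oplus>\<^bsub>N\<^esub> y \<in> h ` U"
      using assms(4) c by (auto simp: mod_hom_add[OF assms(3), symmetric] submodule_add)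
  next
    fix a x assume "a \<in> carrier R" "x \<in> h ` U"
    then show "a \<odot>\<^bsub>N\<^esub> x \<in> h ` U"
      using assms(4) c by (auto simp: mod_hom_smult[OF assms(3), symmetric] submodule_smult)
  qed (use c assms(3) mod_hom_closed in fastforce)
qed

lemma submodule_vimage:
  assumes "right_module R M" "right_module R N" "h \<in> mod_hom R M N" "submodule U R N"
  shows "submodule {x \<in> carrier M. h x \<in> U} R M"
proof -
  interpret M: right_module R M by fact
  show ?thesis
    using assms by (intro submoduleI')
     (auto simp: mod_hom_zero submodule_zero mod_hom_add mod_hom_smult submodule_add submodule_smult)
qed

lemma submodule_kernel:
  assumes "right_module R M" "right_module R N" "h \<in> mod_hom R M N"
  shows "submodule (a_kernel M N h) R M"
proof -
  have "a_kernel M N h = {x \<in> carrier M. h x \<in> {\<zero>\<^bsub>N\<^esub>}}"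
    by (auto simp: a_kernel_iff)
  then show ?thesis
    using submodule_vimage[OF assms submodule_zero_set[OF assms(2)]] by simp
qed

section \<open>Submodules as modules in their own right\<close>

lemma abelian_group_restrict:
  assumes "right_module R M" "submodule U R M"
  shows "abelian_group (M\<lparr>carrier := U\<rparr>)"
proof -
  interpret M: right_module R M by fact
  have c: "\<And>x. x \<in> U \<Longrightarrow> x \<in> carrier M"
    using submodule_subset assms by blast
  show ?thesis
  proof (rule abelian_groupI)
    fix x assume "x \<in> carrier (M\<lparr>carrier := U\<rparr>)"
    then show "\<exists>y\<in>carrier (M\<lparr>carrier := U\<rparr>). y \<oplus>\<^bsub>M\<lparr>carrier := U\<rparr>\<^esub> x = \<zero>\<^bsub>M\<lparr>carrier := U\<rparr>\<^esub>"
      using assms(2) c by (intro bexI[of _ "\<ominus>\<^bsub>M\<^esub> x"]) (auto simp: submodule_uminus M.M.l_neg)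
  qed (use assms(2) c in \<open>auto simp: submodule_add submodule_zero M.M.a_ac\<close>)
qed

lemma right_module_restrict:
  assumes "right_module R M" "submodule U R M"
  shows "right_module R (M\<lparr>carrier := U\<rparr>)"
proof -
  interpret M: right_module R M by fact
  have c: "\<And>x. x \<in> U \<Longrightarrow> x \<in> carrier M"
    using submodule_subset assms by blast
  show ?thesis
    using abelian_group_restrict[OF assms] M.R.ring_axioms assms(2) c
    by (auto simp: right_module_def right_module_axioms_def submodule_smult M.smult_l_distr
        M.smult_r_distr M.smult_assoc)
qed

lemma mod_hom_restrict:
  assumes "h \<in> mod_hom R M N" "U \<subseteq> carrier M"
  shows "h \<in> mod_hom R (M\<lparr>carrier := U\<rparr>) N"
  using assms by (intro mod_homI) (auto simp: mod_hom_add mod_hom_smult mod_hom_closed subset_iff)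

lemma mod_hom_corestrict:
  assumes "h \<in> mod_hom R M N" "h ` carrier M \<subseteq> V"
  shows "h \<in> mod_hom R M (N\<lparr>carrier := V\<rparr>)"
  using assms by (intro mod_homI) (auto simp: mod_hom_add mod_hom_smult)

lemma mod_hom_incl: "U \<subseteq> carrier M \<Longrightarrow> (\<lambda>x. x) \<in> mod_hom R (M\<lparr>carrier := U\<rparr>) M"
  by (rule mod_hom_restrict[OF mod_hom_id])

lemma mod_hom_expand:
  assumes "h \<in> mod_hom R M (N\<lparr>carrier := V\<rparr>)" "V \<subseteq> carrier N"
  shows "h \<in> mod_hom R M N"
  using mod_hom_comp[OF assms(1) mod_hom_incl[OF assms(2)]] .

lemma submodule_restrict_iff:
  assumes "right_module R M" "submodule U R M"
  shows "submodule V R (M\<lparr>carrier := U\<rparr>) \<longleftrightarrow> submodule V R M \<and> V \<subseteq> U"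
proof
  assume V: "submodule V R (M\<lparr>carrier := U\<rparr>)"
  show "submodule V R M \<and> V \<subseteq> U"
    using submodule_image[OF right_module_restrict[OF assms] assms(1)
        mod_hom_incl[OF submodule_subset[OF assms(2)]] V] submodule_subset[OF V] by simp
next
  assume V: "submodule V R M \<and> V \<subseteq> U"
  show "submodule V R (M\<lparr>carrier := U\<rparr>)"
    by (rule submoduleI'[OF right_module_restrict[OF assms]])
      (use V in \<open>auto simp: submodule_zero submodule_add submodule_smult\<close>)
qed

lemma set_add_restrict: "U <+>\<^bsub>M\<lparr>carrier := W\<rparr>\<^esub> V = U <+>\<^bsub>M\<^esub> V"
  by (simp add: set_add_def')

section \<open>Factorization through epimorphisms and monomorphisms, isomorphisms, quotients\<close>

lemma factor_epi:
  assumes M: "right_module R M" and N: "right_module R N" and Y: "right_module R Y"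
    and q: "q \<in> mod_epi R M N" and h: "h \<in> mod_hom R M Y"
    and ker: "\<And>x. \<lbrakk>x \<in> carrier M; q x = \<zero>\<^bsub>N\<^esub>\<rbrakk> \<Longrightarrow> h x = \<zero>\<^bsub>Y\<^esub>"
  shows "\<exists>h'\<in>mod_hom R N Y. \<forall>x\<in>carrier M. h' (q x) = h x"
proof -
  interpret M: right_module R M by fact
  define h' where "h' y = h (SOME x. x \<in> carrier M \<and> q x = y)" for y
  have eq: "h' (q x) = h x" if x: "x \<in> carrier M" for x
  proof -
    define z where "z = (SOME z. z \<in> carrier M \<and> q z = q x)"
    have z: "z \<in> carrier M \<and> q z = q x"
      unfolding z_def by (rule someI[of _ x]) (use x in simp)
    then have "q (z \<ominus>\<^bsub>M\<^esub> x) = \<zero>\<^bsub>N\<^esub>"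
      using mod_hom_eq_iff[OF M N mod_epiD(1)[OF q], of z x] x by simp
    then have "h (z \<ominus>\<^bsub>M\<^esub> x) = \<zero>\<^bsub>Y\<^esub>"
      using x z by (intro ker) auto
    then show ?thesis
      using mod_hom_eq_iff[OF M Y h, of z x] x z by (simp add: h'_def z_def)
  qed
  have sur: "\<exists>x\<in>carrier M. q x = y" if "y \<in> carrier N" for y
    using mod_epiD(2)[OF q] that by (metis imageE)
  have "h' \<in> mod_hom R N Y"
  proof (rule mod_homI)
    show "h' y \<in> carrier Y" if "y \<in> carrier N" for y
      using sur[OF that] eq mod_hom_closed[OF h] by auto
    show "h' (y \<oplus>\<^bsub>N\<^esub> z) = h' y \<oplus>\<^bsub>Y\<^esub> h' z" if yz: "y \<in> carrier N" "z \<in> carrier N" for y z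
    proof -
      obtain a b where "a \<in> carrier M" "q a = y" "b \<in> carrier M" "q b = z"
        using sur yz by metis
      then show ?thesis
        using eq[of "a \<oplus>\<^bsub>M\<^esub> b"] eq[of a] eq[of b]
        by (simp add: mod_hom_add[OF mod_epiD(1)[OF q]] mod_hom_add[OF h])
    qed
    show "h' (a \<odot>\<^bsub>N\<^esub> y) = a \<odot>\<^bsub>Y\<^esub> h' y" if ay: "a \<in> carrier R" "y \<in> carrier N" for a y
    proof -
      obtain b where "b \<in> carrier M" "q b = y"
        using sur ay by metis
      then show ?thesis
        using eq[of "a \<odot>\<^bsub>M\<^esub> b"] eq[of b] ay
        by (simp add: mod_hom_smult[OF mod_epiD(1)[OF q]] mod_hom_smult[OF h])
    qed
  qed
  then show ?thesis using eq by blast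
qed

lemma factor_mono:
  assumes Y: "right_module R Y" and N: "right_module R N" and j: "j \<in> mod_mono R N M"
    and h: "h \<in> mod_hom R Y M" and im: "h ` carrier Y \<subseteq> j ` carrier N"
  shows "\<exists>h'\<in>mod_hom R Y N. \<forall>x\<in>carrier Y. j (h' x) = h x"
proof -
  interpret Y: right_module R Y by fact
  interpret N: right_module R N by fact
  define h' where "h' x = inv_into (carrier N) j (h x)" for x
  have c: "h' x \<in> carrier N" and eq: "j (h' x) = h x" if "x \<in> carrier Y" for x
    using im that by (auto simp: h'_def inv_into_into f_inv_into_f subset_iff)
  note jj = inj_onD[OF mod_monoD(2)[OF j]]
  note jh = mod_monoD(1)[OF j]
  have "h' \<in> mod_hom R Y N"
  proof (rule mod_homI)
    show "h' (x \<oplus>\<^bsub>Y\<^esub> y) = h' x \<oplus>\<^bsub>N\<^esub> h' y" if "x \<in> carrier Y" "y \<in> carrier Y" for x y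
      using that by (intro jj) (auto simp: c eq mod_hom_add[OF h] mod_hom_add[OF jh])
    show "h' (a \<odot>\<^bsub>Y\<^esub> x) = a \<odot>\<^bsub>N\<^esub> h' x" if "a \<in> carrier R" "x \<in> carrier Y" for a x
      using that by (intro jj) (auto simp: c eq mod_hom_smult[OF h] mod_hom_smult[OF jh])
  qed (rule c)
  then show ?thesis using eq by blast
qed

lemma mod_hom_inverse:
  assumes M: "right_module R M" and N: "right_module R N"
    and h: "h \<in> mod_hom R M N" and b: "bij_betw h (carrier M) (carrier N)"
  shows "\<exists>k\<in>mod_hom R N M. (\<forall>x\<in>carrier M. k (h x) = x) \<and> (\<forall>y\<in>carrier N. h (k y) = y)"
proof -
  have hm: "h \<in> mod_mono R M N" and "(\<lambda>x. x) ` carrier N \<subseteq> h ` carrier M"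
    using h b by (auto simp: mod_mono_def bij_betw_def)
  then obtain k where k: "k \<in> mod_hom R N M" "\<forall>y\<in>carrier N. h (k y) = y"
    using factor_mono[OF N M hm mod_hom_id] by blast
  moreover have "k (h x) = x" if x: "x \<in> carrier M" for x
    using b k(2) mod_hom_closed[OF h x] mod_hom_closed[OF k(1), of "h x"] x
    by (auto simp: bij_betw_def dest: inj_onD)
  ultimately show ?thesis by blast
qed

lemma mod_isomorphicE:
  assumes "right_module R M" "right_module R N" "mod_isomorphic R M N"
  obtains h k where "h \<in> mod_hom R M N" "k \<in> mod_hom R N M"
    "\<And>x. x \<in> carrier M \<Longrightarrow> k (h x) = x" "\<And>y. y \<in> carrier N \<Longrightarrow> h (k y) = y"
  using mod_hom_inverse[OF assms(1,2)] assms(3) unfolding mod_isomorphic_def by blast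

lemma mod_isomorphicI:
  assumes "h \<in> mod_hom R M N" "k \<in> mod_hom R N M"
    "\<And>x. x \<in> carrier M \<Longrightarrow> k (h x) = x" "\<And>y. y \<in> carrier N \<Longrightarrow> h (k y) = y"
  shows "mod_isomorphic R M N"
  unfolding mod_isomorphic_def
  by (rule bexI[OF _ assms(1)], rule bij_betw_byWitness[of _ k])
    (use assms mod_hom_closed in auto)

lemma mod_isomorphic_sym:
  assumes "right_module R M" "right_module R N" "mod_isomorphic R M N"
  shows "mod_isomorphic R N M"
  using mod_isomorphicE[OF assms] mod_isomorphicI by metis

lemma mod_isomorphic_trans:
  assumes "mod_isomorphic R M N" "mod_isomorphic R N L"
  shows "mod_isomorphic R M L"
  using assms unfolding mod_isomorphic_def
  by (meson bij_betw_trans[unfolded comp_def] mod_hom_comp)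

text \<open>The record \<open>quot_mod\<close> is unfolded here only; later arguments use the
  projection and its kernel.\<close>

lemma quot_mod_proj:
  assumes "right_module R M" "submodule U R M"
  defines "q \<equiv> \<lambda>x. U +>\<^bsub>M\<^esub> x"
  shows "right_module R (quot_mod M U)" "q \<in> mod_epi R M (quot_mod M U)"
    "\<And>x. x \<in> carrier M \<Longrightarrow> q x = \<zero>\<^bsub>quot_mod M U\<^esub> \<longleftrightarrow> x \<in> U"
proof -
  interpret M: right_module R M by fact
  interpret U: abelian_subgroup U M
    by (rule abelian_subgroupI3) (use assms M.M.abelian_group_axioms in
        \<open>auto simp: submodule_def additive_subgroup_def\<close>)
  have c: "\<And>x. x \<in> U \<Longrightarrow> x \<in> carrier M"
    using submodule_subset assms by blast
  have add: "q x <+>\<^bsub>M\<^esub> q y = q (x \<oplus>\<^bsub>M\<^esub> y)" if "x \<in> carrier M" "y \<in> carrier M" for x y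
    using that unfolding q_def by (rule U.a_rcos_sum)
  have eqiff: "q x = q y \<longleftrightarrow> x \<ominus>\<^bsub>M\<^esub> y \<in> U" if "x \<in> carrier M" "y \<in> carrier M" for x y
    using U.a_rcos_module[OF that(2,1)] U.a_repr_independence'[OF _ that(2), of x]
      U.a_rcos_self[OF that(1)]
    by (auto simp: q_def a_minus_def)
  \<comment> \<open>The scalar multiplication of \<open>quot_mod\<close> is a union over all
    representatives of a coset. Every representative yields the same coset, so the union collapses
    to one.\<close>
  have smult: "(\<Union>y\<in>q x. U +>\<^bsub>M\<^esub> (a \<odot>\<^bsub>M\<^esub> y)) = q (a \<odot>\<^bsub>M\<^esub> x)"
    if "a \<in> carrier R" "x \<in> carrier M" for a x
  proof -
    have "q (a \<odot>\<^bsub>M\<^esub> y) = q (a \<odot>\<^bsub>M\<^esub> x)" if y: "y \<in> q x" for y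
    proof -
      obtain u where u: "u \<in> U" "y = u \<oplus>\<^bsub>M\<^esub> x"
        using y by (auto simp: q_def a_r_coset_def')
      then have "a \<odot>\<^bsub>M\<^esub> y \<ominus>\<^bsub>M\<^esub> a \<odot>\<^bsub>M\<^esub> x = a \<odot>\<^bsub>M\<^esub> u"
        using \<open>a \<in> carrier R\<close> \<open>x \<in> carrier M\<close> c by (simp add: M.smult_r_distr M.M.add_diff_cancel)
      then show ?thesis
        using u \<open>a \<in> carrier R\<close> \<open>x \<in> carrier M\<close> c assms(2)
        by (simp add: eqiff submodule_smult)
    qed
    moreover have "x \<in> q x"
      using \<open>x \<in> carrier M\<close> unfolding q_def by (rule U.a_rcos_self)
    ultimately show ?thesis unfolding q_def by blast
  qed
  have car: "carrier (quot_mod M U) = q ` carrier M"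
    by (auto simp: quot_mod_def A_RCOSETS_def' q_def)
  have zero: "\<zero>\<^bsub>quot_mod M U\<^esub> = q \<zero>\<^bsub>M\<^esub>"
    using c by (force simp: quot_mod_def q_def a_r_coset_def')
  have add': "q x \<oplus>\<^bsub>quot_mod M U\<^esub> q y = q (x \<oplus>\<^bsub>M\<^esub> y)" if "x \<in> carrier M" "y \<in> carrier M" for x y
    using add[OF that] by (simp add: quot_mod_def)
  have smult': "a \<odot>\<^bsub>quot_mod M U\<^esub> q x = q (a \<odot>\<^bsub>M\<^esub> x)" if "a \<in> carrier R" "x \<in> carrier M" for a x
    using smult[OF that] by (simp add: quot_mod_def)
  have "abelian_group (quot_mod M U)"
  proof (rule abelian_groupI)
    fix x assume "x \<in> carrier (quot_mod M U)"
    then obtain y where "y \<in> carrier M" "x = q y" by (auto simp: car)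
    then show "\<exists>y\<in>carrier (quot_mod M U). y \<oplus>\<^bsub>quot_mod M U\<^esub> x = \<zero>\<^bsub>quot_mod M U\<^esub>"
      by (intro bexI[of _ "q (\<ominus>\<^bsub>M\<^esub> y)"]) (auto simp: car add' zero M.M.l_neg)
  qed (auto simp: car zero add' M.M.a_ac)
  then show "right_module R (quot_mod M U)"
    using M.R.ring_axioms
    by (auto simp: right_module_def right_module_axioms_def car smult' add'
        M.smult_l_distr M.smult_r_distr M.smult_assoc)
  show "q \<in> mod_epi R M (quot_mod M U)"
    by (auto simp: mod_epi_def car add' smult' intro!: mod_homI)
  show "q x = \<zero>\<^bsub>quot_mod M U\<^esub> \<longleftrightarrow> x \<in> U" if "x \<in> carrier M" for x
    using that by (simp add: zero eqiff M.M.minus_zero_right)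
qed

lemma mod_isomorphic_quot:
  assumes M: "right_module R M" and N: "right_module R N" and h: "h \<in> mod_epi R M N"
  shows "mod_isomorphic R N (quot_mod M (a_kernel M N h))"
proof -
  let ?U = "a_kernel M N h"
  let ?q = "\<lambda>x. ?U +>\<^bsub>M\<^esub> x"
  have U: "submodule ?U R M" using submodule_kernel[OF M N mod_epiD(1)[OF h]] .
  note q = quot_mod_proj[OF M U]
  have k: "?q x = \<zero>\<^bsub>quot_mod M ?U\<^esub> \<longleftrightarrow> h x = \<zero>\<^bsub>N\<^esub>" if "x \<in> carrier M" for x
    using q(3)[OF that] that by (simp add: a_kernel_iff)
  obtain f where f: "f \<in> mod_hom R N (quot_mod M ?U)" "\<forall>x\<in>carrier M. f (h x) = ?q x"
    using factor_epi[OF M N q(1) h mod_epiD(1)[OF q(2)]] k by blast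
  obtain g where g: "g \<in> mod_hom R (quot_mod M ?U) N" "\<forall>x\<in>carrier M. g (?q x) = h x"
    using factor_epi[OF M q(1) N q(2) mod_epiD(1)[OF h]] k by blast
  show ?thesis
  proof (rule mod_isomorphicI[OF f(1) g(1)])
    show "g (f x) = x" if "x \<in> carrier N" for x
    proof -
      obtain z where "z \<in> carrier M" "x = h z" using mod_epi_surj[OF h \<open>x \<in> carrier N\<close>] by blast
      then show ?thesis using f(2) g(2) by simp
    qed
    show "f (g x) = x" if "x \<in> carrier (quot_mod M ?U)" for x
    proof -
      obtain z where "z \<in> carrier M" "x = ?q z" using mod_epi_surj[OF q(2) \<open>x \<in> carrier (quot_mod M ?U)\<close>] by blast
      then show ?thesis using f(2) g(2) by simp
    qed
  qed
qed

section \<open>Maps through sums of copies of a module\<close>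

text \<open>
  The maps \<open>X \<rightarrow> Y\<close> that factor through some \<open>T\<^sup>n\<close> are the sums of composites \<open>X \<rightarrow> T \<rightarrow> Y\<close>, so
  membership in \<open>add T\<close> can be tested on the identity, without forming powers or complements.
\<close>

inductive_set thru ::
  "('r, 'z) ring_scheme \<Rightarrow> ('r, 't) module \<Rightarrow> ('r, 'm) module \<Rightarrow> ('r, 'n) module \<Rightarrow> ('m \<Rightarrow> 'n) set"
  for R T X Y where
  comp: "\<lbrakk>f \<in> mod_hom R X T; g \<in> mod_hom R T Y; \<And>x. x \<in> carrier X \<Longrightarrow> \<phi> x = g (f x)\<rbrakk>
    \<Longrightarrow> \<phi> \<in> thru R T X Y"
| add: "\<lbrakk>\<phi> \<in> thru R T X Y; \<psi> \<in> thru R T X Y; \<And>x. x \<in> carrier X \<Longrightarrow> \<theta> x = \<phi> x \<oplus>\<^bsub>Y\<^esub> \<psi> x\<rbrakk>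
    \<Longrightarrow> \<theta> \<in> thru R T X Y"

definition summand_of ::
  "('r, 'z) ring_scheme \<Rightarrow> ('r, 't) module \<Rightarrow> ('r, 'm) module \<Rightarrow> bool" where
  "summand_of R T X \<longleftrightarrow> right_module R X \<and> (\<lambda>x. x) \<in> thru R T X X"

lemma thru_cong:
  assumes "\<phi> \<in> thru R T X Y" "\<And>x. x \<in> carrier X \<Longrightarrow> \<psi> x = \<phi> x"
  shows "\<psi> \<in> thru R T X Y"
  using assms(1)
proof cases
  case (comp f g)
  then show ?thesis using assms(2) by (auto intro: thru.comp)
next
  case (add \<phi>' \<psi>')
  then show ?thesis using assms(2) by (auto intro: thru.add)
qed

lemma thru_hom:
  assumes "right_module R X" "right_module R Y" "\<phi> \<in> thru R T X Y"
  shows "\<phi> \<in> mod_hom R X Y"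
  using assms(3)
proof induction
  case (comp f g \<phi>)
  show ?case by (rule mod_hom_cong[OF assms(1) mod_hom_comp[OF comp(1,2)] comp(3)])
next
  case (add \<phi> \<psi> \<theta>)
  show ?case by (rule mod_hom_cong[OF assms(1) mod_hom_plus[OF assms(2) add.IH] add.hyps(3)])
qed

text \<open>The maps through powers of T form a two-sided ideal; this is one side,
  \<open>thru_post\<close> is the other.\<close>

lemma thru_pre:
  assumes "\<phi> \<in> thru R T X Y" "h \<in> mod_hom R X' X"
  shows "(\<lambda>x. \<phi> (h x)) \<in> thru R T X' Y"
  using assms(1)
proof induction
  case (comp f g \<phi>)
  show ?case
    by (rule thru.comp[OF mod_hom_comp[OF assms(2) comp(1)] comp(2)])
      (simp add: comp(3) mod_hom_closed[OF assms(2)])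
next
  case (add \<phi> \<psi> \<theta>)
  show ?case
    by (rule thru.add[OF add.IH]) (simp add: add.hyps(3) mod_hom_closed[OF assms(2)])
qed

lemma thru_post:
  assumes "right_module R X" "right_module R Y" "\<phi> \<in> thru R T X Y" "g \<in> mod_hom R Y Z"
  shows "(\<lambda>x. g (\<phi> x)) \<in> thru R T X Z"
  using assms(3)
proof induction
  case (comp f k \<phi>)
  show ?case
    by (rule thru.comp[OF comp(1) mod_hom_comp[OF comp(2) assms(4)]]) (simp add: comp(3))
next
  case (add \<phi> \<psi> \<theta>)
  have "g (\<theta> x) = g (\<phi> x) \<oplus>\<^bsub>Z\<^esub> g (\<psi> x)" if "x \<in> carrier X" for x
    using mod_hom_add[OF assms(4) mod_hom_closed[OF thru_hom[OF assms(1,2) add.hyps(1)] that]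
        mod_hom_closed[OF thru_hom[OF assms(1,2) add.hyps(2)] that]] add.hyps(3)[OF that] by simp
  then show ?case using add.IH by (blast intro: thru.add)
qed

lemma thru_zero:
  assumes "right_module R T" "right_module R Y"
  shows "(\<lambda>x. \<zero>\<^bsub>Y\<^esub>) \<in> thru R T X Y"
  by (rule thru.comp[OF mod_hom_zero_map[OF assms(1)] mod_hom_zero_map[OF assms(2)]]) simp

lemma thru_summand:
  assumes "summand_of R T F" "f \<in> mod_hom R X F" "g \<in> mod_hom R F Y"
  shows "(\<lambda>x. g (f x)) \<in> thru R T X Y"
  using thru_pre[OF thru_post[of R F F "\<lambda>x. x" T g Y] assms(2)] assms by (simp add: summand_of_def)

lemma summand_of_retract:
  assumes "right_module R X" "summand_of R T F" "s \<in> mod_hom R X F" "r \<in> mod_hom R F X"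
    "\<And>x. x \<in> carrier X \<Longrightarrow> r (s x) = x"
  shows "summand_of R T X"
  using thru_cong[OF thru_summand[OF assms(2-4)]] assms(1,5) by (simp add: summand_of_def)

lemma summand_of_refl: "right_module R T \<Longrightarrow> summand_of R T T"
  by (auto simp: summand_of_def intro: thru.comp mod_hom_id)

lemma thru_trans:
  assumes "right_module R X" "right_module R Y" "\<phi> \<in> thru R F X Y" "summand_of R T F"
  shows "\<phi> \<in> thru R T X Y"
  using assms(3)
proof induction
  case (comp f g \<phi>)
  show ?case by (rule thru_cong[OF thru_summand[OF assms(4) comp(1,2)] comp(3)])
next
  case (add \<phi> \<psi> \<theta>)
  then show ?case by (blast intro: thru.add)
qed

lemma summand_of_trans: "\<lbrakk>summand_of R F X; summand_of R T F\<rbrakk> \<Longrightarrow> summand_of R T X"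
  using thru_trans[of R X X "\<lambda>x. x" F T] by (simp add: summand_of_def)

text \<open>Lifts add up, so it is enough to lift maps out of T. With T regular this is projectivity
  of add T; with q an approximation it carries the approximation property from T to add T.\<close>

lemma thru_lift:
  assumes X: "right_module R X" and Z: "right_module R Z" and q: "q \<in> mod_hom R Z Y"
    and T: "\<And>g. g \<in> mod_hom R T Y \<Longrightarrow> \<exists>g'\<in>mod_hom R T Z. \<forall>t\<in>carrier T. q (g' t) = g t"
    and \<phi>: "\<phi> \<in> thru R T X Y"
  shows "\<exists>\<psi>\<in>mod_hom R X Z. \<forall>x\<in>carrier X. q (\<psi> x) = \<phi> x"
  using \<phi>
proof induction
  case (comp f g \<phi>)
  obtain g' where g': "g' \<in> mod_hom R T Z" "\<forall>t\<in>carrier T. q (g' t) = g t"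
    using T[OF comp(2)] by blast
  show ?case
    by (rule bexI[OF _ mod_hom_comp[OF comp(1) g'(1)]])
      (simp add: g'(2) comp(3) mod_hom_closed[OF comp(1)])
next
  case (add \<phi> \<psi> \<theta>)
  then obtain \<phi>' \<psi>' where "\<phi>' \<in> mod_hom R X Z" "\<psi>' \<in> mod_hom R X Z"
    "\<forall>x\<in>carrier X. q (\<phi>' x) = \<phi> x" "\<forall>x\<in>carrier X. q (\<psi>' x) = \<psi> x" by blast
  then show ?case
    using add.hyps(3) mod_hom_closed by (intro bexI[OF _ mod_hom_plus[OF Z, of \<phi>' X \<psi>']])
      (auto simp: mod_hom_add[OF q] mod_hom_closed[of \<phi>'] mod_hom_closed[of \<psi>'])
qed

text \<open>The dual of \<open>thru_lift\<close>: extension along j is tested on maps into T. It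
  serves injectivity as well as left approximations.\<close>

lemma thru_extend:
  assumes X: "right_module R X" and X': "right_module R X'" and Y: "right_module R Y"
    and j: "j \<in> mod_hom R X X'"
    and T: "\<And>f. f \<in> mod_hom R X T \<Longrightarrow> \<exists>f'\<in>mod_hom R X' T. \<forall>x\<in>carrier X. f' (j x) = f x"
    and \<phi>: "\<phi> \<in> thru R T X Y"
  shows "\<exists>\<psi>\<in>mod_hom R X' Y. \<forall>x\<in>carrier X. \<psi> (j x) = \<phi> x"
  using \<phi>
proof induction
  case (comp f g \<phi>)
  obtain f' where f': "f' \<in> mod_hom R X' T" "\<forall>x\<in>carrier X. f' (j x) = f x"
    using T[OF comp(1)] by blast
  show ?case
    by (rule bexI[OF _ mod_hom_comp[OF f'(1) comp(2)]]) (simp add: f'(2) comp(3))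
next
  case (add \<phi> \<psi> \<theta>)
  then obtain \<phi>' \<psi>' where "\<phi>' \<in> mod_hom R X' Y" "\<psi>' \<in> mod_hom R X' Y"
    "\<forall>x\<in>carrier X. \<phi>' (j x) = \<phi> x" "\<forall>x\<in>carrier X. \<psi>' (j x) = \<psi> x" by blast
  then show ?case
    using add.hyps(3) by (intro bexI[OF _ mod_hom_plus[OF Y, of \<phi>' X' \<psi>']]) auto
qed

text \<open>The set S consists of the images of generators of T under the second factors of the
  composites. For the identity this yields finite generation of the summands of powers of T.\<close>

lemma thru_generated:
  assumes X: "right_module R X" and Y: "right_module R Y" and T: "right_module R T" "fin_gen R T"
    and \<phi>: "\<phi> \<in> thru R T X Y"
  shows "\<exists>S. finite S \<and> S \<subseteq> carrier Y \<and> (\<forall>U. submodule U R Y \<and> S \<subseteq> U \<longrightarrow> \<phi> ` carrier X \<subseteq> U)"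
  using \<phi>
proof induction
  case (comp f g \<phi>)
  obtain S where S: "finite S" "S \<subseteq> carrier T" "\<And>U. \<lbrakk>submodule U R T; S \<subseteq> U\<rbrakk> \<Longrightarrow> U = carrier T"
    using T(2) unfolding fin_gen_def by metis
  have sub: "\<phi> ` carrier X \<subseteq> U" if U: "submodule U R Y" "g ` S \<subseteq> U" for U
  proof -
    have "{t \<in> carrier T. g t \<in> U} = carrier T"
      using S(2) U by (intro S(3) submodule_vimage[OF T(1) Y comp(2)]) auto
    then show ?thesis using comp(3) mod_hom_closed[OF comp(1)] by auto
  qed
  have "g ` S \<subseteq> carrier Y" using mod_hom_closed[OF comp(2)] S(2) by blast
  then show ?case
    using S(1) sub by (intro exI[of _ "g ` S"] conjI allI impI) simp_all
next
  case (add \<phi> \<psi> \<theta>)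
  obtain S where S: "finite S" "S \<subseteq> carrier Y"
    "\<forall>U. submodule U R Y \<and> S \<subseteq> U \<longrightarrow> \<phi> ` carrier X \<subseteq> U" using add.IH(1) by (elim exE conjE)
  obtain S' where S': "finite S'" "S' \<subseteq> carrier Y"
    "\<forall>U. submodule U R Y \<and> S' \<subseteq> U \<longrightarrow> \<psi> ` carrier X \<subseteq> U" using add.IH(2) by (elim exE conjE)
  show ?case
  proof (intro exI[of _ "S \<union> S'"] conjI allI impI)
    fix U assume U: "submodule U R Y \<and> S \<union> S' \<subseteq> U"
    then have "\<phi> ` carrier X \<subseteq> U" "\<psi> ` carrier X \<subseteq> U" using S(3) S'(3) by simp_all
    then show "\<theta> ` carrier X \<subseteq> U"
      using add.hyps(3) submodule_add[OF conjunct1[OF U]] by (simp add: image_subset_iff)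
  qed (use S S' in simp_all)
qed

lemma summand_of_fin_gen:
  assumes "right_module R T" "fin_gen R T" "summand_of R T X"
  shows "fg_mod R X"
proof -
  have "right_module R X" and i: "(\<lambda>x. x) \<in> thru R T X X"
    using assms(3) by (auto simp: summand_of_def)
  moreover have "fin_gen R X"
  proof -
    obtain S where "finite S" "S \<subseteq> carrier X"
      "\<forall>U. submodule U R X \<and> S \<subseteq> U \<longrightarrow> (\<lambda>x. x) ` carrier X \<subseteq> U"
      using thru_generated[OF calculation(1) calculation(1) assms(1,2) i] by blast
    then show ?thesis
      unfolding fin_gen_def by (intro exI[of _ S]) (auto dest: submodule_subset)
  qed
  ultimately show ?thesis by (simp add: fg_mod_def)
qed

section \<open>Modules of finite length\<close>

text \<open>
  Finite length is expressed by a strictly monotone rank on submodules; such ranks restrict to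
  submodules, push forward along quotients and add up along extensions.
\<close>

definition finite_length :: "('r, 'z) ring_scheme \<Rightarrow> ('r, 'm) module \<Rightarrow> bool" where
  "finite_length R M \<longleftrightarrow> (\<exists>\<rho> :: 'm set \<Rightarrow> nat.
     \<forall>U V. submodule U R M \<and> submodule V R M \<and> U \<subset> V \<longrightarrow> \<rho> U < \<rho> V)"

lemma finite_length_rank:
  assumes "finite_length R M"
  obtains \<rho> :: "_ \<Rightarrow> nat" where
    "\<forall>U V. submodule U R M \<longrightarrow> submodule V R M \<longrightarrow> U \<subset> V \<longrightarrow> \<rho> U < \<rho> V"
    "\<forall>U V. submodule U R M \<longrightarrow> submodule V R M \<longrightarrow> U \<subseteq> V \<longrightarrow> \<rho> U \<le> \<rho> V"
proof -
  obtain \<rho> :: "_ \<Rightarrow> nat" where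
    \<rho>: "\<forall>U V. submodule U R M \<and> submodule V R M \<and> U \<subset> V \<longrightarrow> \<rho> U < \<rho> V"
    using assms unfolding finite_length_def by (elim exE)
  have "\<rho> U \<le> \<rho> V" if "submodule U R M" "submodule V R M" "U \<subseteq> V" for U V
    using that \<rho> by (cases "U = V") (simp_all add: psubset_eq less_imp_le)
  then show thesis using \<rho> that[of \<rho>] by simp
qed

text \<open>A member of least rank is minimal, since proper inclusion lowers the rank.\<close>

lemma finite_length_minimal:
  assumes "finite_length R M" "P U0" "\<And>U. P U \<Longrightarrow> submodule U R M"
  obtains U where "P U" "\<forall>V. P V \<longrightarrow> V \<subseteq> U \<longrightarrow> V = U"
proof -
  obtain \<rho> :: "_ \<Rightarrow> nat" where \<rho>: "\<forall>U V. submodule U R M \<longrightarrow> submodule V R M \<longrightarrow> U \<subset> V \<longrightarrow> \<rho> U < \<rho> V"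
    "\<forall>U V. submodule U R M \<longrightarrow> submodule V R M \<longrightarrow> U \<subseteq> V \<longrightarrow> \<rho> U \<le> \<rho> V"
    by (rule finite_length_rank[OF assms(1)])
  note \<rho> = \<rho>[rule_format]
  obtain U where U: "P U" "\<forall>V. P V \<longrightarrow> \<rho> U \<le> \<rho> V"
    using ex_has_least_nat[of P, OF assms(2), of \<rho>] by (elim exE conjE)
  have "V = U" if "P V" "V \<subseteq> U" for V
  proof (rule ccontr)
    assume "V \<noteq> U"
    then have "\<rho> V < \<rho> U" using that U(1) assms(3) by (intro \<rho>(1)) auto
    then show False using U(2) that(1) by (simp add: leD)
  qed
  then show thesis using that[OF U(1)] by simp
qed

text \<open>All ranks are bounded by that of the whole module, so a largest one is attained.\<close>

lemma finite_length_maximal: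
  assumes "right_module R M" "finite_length R M" "P U0" "\<And>U. P U \<Longrightarrow> submodule U R M"
  obtains U where "P U" "\<forall>V. P V \<longrightarrow> U \<subseteq> V \<longrightarrow> V = U"
proof -
  obtain \<rho> :: "_ \<Rightarrow> nat" where \<rho>: "\<forall>U V. submodule U R M \<longrightarrow> submodule V R M \<longrightarrow> U \<subset> V \<longrightarrow> \<rho> U < \<rho> V"
    "\<forall>U V. submodule U R M \<longrightarrow> submodule V R M \<longrightarrow> U \<subseteq> V \<longrightarrow> \<rho> U \<le> \<rho> V"
    by (rule finite_length_rank[OF assms(2)])
  note \<rho> = \<rho>[rule_format]
  have bound: "\<forall>U. P U \<longrightarrow> \<rho> U < Suc (\<rho> (carrier M))"
    using \<rho>(2)[OF assms(4) submodule_carrier[OF assms(1)]] submodule_subset[OF assms(4)]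
    by (simp add: le_imp_less_Suc)
  obtain U where U: "P U" "\<forall>V. P V \<longrightarrow> \<rho> V \<le> \<rho> U"
    using ex_has_greatest_nat[of P, OF assms(3) bound] by (elim exE conjE)
  have "V = U" if "P V" "U \<subseteq> V" for V
  proof (rule ccontr)
    assume "V \<noteq> U"
    then have "\<rho> U < \<rho> V" using that U(1) assms(4) by (intro \<rho>(1)) auto
    then show False using U(2) that(1) by (simp add: leD)
  qed
  then show thesis using that[OF U(1)] by simp
qed

text \<open>U is ranked by its image plus its part in the kernel. If neither changes when U grows to
  V, then U = V by the modular law. As h is an arbitrary homomorphism, embeddings are included, with
  zero kernel.\<close>

lemma finite_length_extension:
  assumes M: "right_module R M" and N: "right_module R N" and h: "h \<in> mod_hom R M N"
    and fN: "finite_length R N" and fK: "finite_length R (M\<lparr>carrier := a_kernel M N h\<rparr>)"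
  shows "finite_length R M"
proof -
  interpret M: right_module R M by fact
  interpret N: right_module R N by fact
  let ?K = "a_kernel M N h"
  have K: "submodule ?K R M" using submodule_kernel[OF M N h] .
  obtain \<rho> :: "_ \<Rightarrow> nat" where \<rho>: "\<forall>U V. submodule U R N \<longrightarrow> submodule V R N \<longrightarrow> U \<subset> V \<longrightarrow> \<rho> U < \<rho> V"
    "\<forall>U V. submodule U R N \<longrightarrow> submodule V R N \<longrightarrow> U \<subseteq> V \<longrightarrow> \<rho> U \<le> \<rho> V"
    by (rule finite_length_rank[OF fN])
  note \<rho> = \<rho>[rule_format]
  let ?K' = "M\<lparr>carrier := ?K\<rparr>"
  obtain \<sigma> :: "_ \<Rightarrow> nat" where \<sigma>: "\<forall>U V. submodule U R ?K' \<longrightarrow> submodule V R ?K' \<longrightarrow> U \<subset> V \<longrightarrow> \<sigma> U < \<sigma> V"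
    "\<forall>U V. submodule U R ?K' \<longrightarrow> submodule V R ?K' \<longrightarrow> U \<subseteq> V \<longrightarrow> \<sigma> U \<le> \<sigma> V"
    by (rule finite_length_rank[OF fK])
  note \<sigma> = \<sigma>[rule_format]
  have "\<rho> (h ` U) + \<sigma> (U \<inter> ?K) < \<rho> (h ` V) + \<sigma> (V \<inter> ?K)"
    if U: "submodule U R M" and V: "submodule V R M" and UV: "U \<subset> V" for U V
  proof -
    note im = submodule_image[OF M N h]
    have int: "submodule (W \<inter> ?K) R ?K'" if "submodule W R M" for W
      using submodule_Int[OF M that K] by (simp add: submodule_restrict_iff[OF M K])
    have "\<rho> (h ` U) \<le> \<rho> (h ` V)" "\<sigma> (U \<inter> ?K) \<le> \<sigma> (V \<inter> ?K)"
      using UV by (intro \<rho>(2) \<sigma>(2) im int U V; blast)+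
    moreover have "h ` U \<subset> h ` V \<or> U \<inter> ?K \<subset> V \<inter> ?K"
    proof (rule ccontr)
      assume "\<not> ?thesis"
      then have eq: "h ` U = h ` V" "U \<inter> ?K = V \<inter> ?K" using UV by blast+
      obtain v where v: "v \<in> V" "v \<notin> U" using UV by blast
      obtain u where u: "u \<in> U" "h u = h v" using eq(1) v(1) by (metis imageE imageI)
      have c: "u \<in> carrier M" "v \<in> carrier M" using u v U V submodule_subset by blast+
      have "v \<ominus>\<^bsub>M\<^esub> u \<in> V \<inter> ?K"
        using u v UV c mod_hom_eq_iff[OF M N h, of v u] by (auto simp: a_kernel_iff submodule_diff[OF V])
      then have "(v \<ominus>\<^bsub>M\<^esub> u) \<oplus>\<^bsub>M\<^esub> u \<in> U"
        using eq(2) u(1) by (auto intro: submodule_add[OF U])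
      then show False using v c by (simp add: M.M.diff_add_cancel)
    qed
    then have "\<rho> (h ` U) < \<rho> (h ` V) \<or> \<sigma> (U \<inter> ?K) < \<sigma> (V \<inter> ?K)"
      using \<rho>(1)[OF im[OF U] im[OF V]] \<sigma>(1)[OF int[OF U] int[OF V]] by blast
    ultimately show ?thesis by linarith
  qed
  then show ?thesis
    unfolding finite_length_def by (intro exI[of _ "\<lambda>U. \<rho> (h ` U) + \<sigma> (U \<inter> ?K)"]) blast
qed

lemma finite_length_trivial:
  assumes "carrier M = {\<zero>\<^bsub>M\<^esub>}"
  shows "finite_length R M"
proof -
  have "\<not> U \<subset> V" if "submodule U R M" "submodule V R M" for U V
    using submodule_zero[OF that(1)] submodule_subset[OF that(2)] assms by auto
  then show ?thesis unfolding finite_length_def by blast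
qed

lemma finite_length_mono:
  assumes M: "right_module R M" and N: "right_module R N" and h: "h \<in> mod_mono R M N"
    and "finite_length R N"
  shows "finite_length R M"
proof (rule finite_length_extension[OF M N mod_monoD(1)[OF h] assms(4)])
  have "\<forall>x\<in>carrier M. h x = \<zero>\<^bsub>N\<^esub> \<longrightarrow> x = \<zero>\<^bsub>M\<^esub>"
    using mod_hom_inj_iff[OF M N mod_monoD(1)[OF h]] mod_monoD(2)[OF h] by simp
  moreover have "\<zero>\<^bsub>M\<^esub> \<in> a_kernel M N h"
    by (rule submodule_zero[OF submodule_kernel[OF M N mod_monoD(1)[OF h]]])
  ultimately have "a_kernel M N h = {\<zero>\<^bsub>M\<^esub>}"
    unfolding set_eq_iff singleton_iff a_kernel_iff by blast
  then show "finite_length R (M\<lparr>carrier := a_kernel M N h\<rparr>)"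
    by (intro finite_length_trivial) simp
qed

lemma finite_length_restrict:
  assumes "right_module R M" "submodule U R M" "finite_length R M"
  shows "finite_length R (M\<lparr>carrier := U\<rparr>)"
proof (rule finite_length_mono[OF right_module_restrict[OF assms(1,2)] assms(1) _ assms(3)])
  show "(\<lambda>x. x) \<in> mod_mono R (M\<lparr>carrier := U\<rparr>) M"
    using mod_hom_incl[OF submodule_subset[OF assms(2)]] by (simp add: mod_mono_def)
qed

text \<open>Submodules of the quotient are ranked by their preimages, and proper inclusions stay
  proper because h is onto.\<close>

lemma finite_length_epi:
  assumes M: "right_module R M" and N: "right_module R N" and h: "h \<in> mod_epi R M N"
    and "finite_length R M"
  shows "finite_length R N"
proof -
  obtain \<rho> :: "_ \<Rightarrow> nat" where \<rho>: "\<forall>U V. submodule U R M \<longrightarrow> submodule V R M \<longrightarrow> U \<subset> V \<longrightarrow> \<rho> U < \<rho> V"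
    "\<forall>U V. submodule U R M \<longrightarrow> submodule V R M \<longrightarrow> U \<subseteq> V \<longrightarrow> \<rho> U \<le> \<rho> V"
    by (rule finite_length_rank[OF assms(4)])
  note \<rho> = \<rho>[rule_format]
  let ?v = "\<lambda>U. {x \<in> carrier M. h x \<in> U}"
  have "?v U \<subset> ?v V" if V: "submodule V R N" and UV: "U \<subset> V" for U V
  proof -
    obtain y where y: "y \<in> V" "y \<notin> U" using UV by blast
    then obtain x where "x \<in> carrier M" "y = h x"
      using mod_epi_surj[OF h, of y] submodule_subset[OF V] by blast
    then have "x \<in> ?v V" "x \<notin> ?v U" using y by simp_all
    then show ?thesis using UV by blast
  qed
  then show ?thesis
    unfolding finite_length_def
    by (intro exI[of _ "\<lambda>U. \<rho> (?v U)"] allI impI \<rho>(1) submodule_vimage[OF M N mod_epiD(1)[OF h]]) simp_all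
qed

text \<open>A submodule maximal among those generated by finitely many elements is everything, since
  one more generator cannot enlarge it.\<close>

lemma finite_length_fin_gen:
  assumes "right_module R M" "finite_length R M"
  shows "fin_gen R M"
proof -
  let ?g = "\<lambda>S U. submodule U R M \<and> S \<subseteq> U \<and> (\<forall>V. submodule V R M \<and> S \<subseteq> V \<longrightarrow> U \<subseteq> V)"
  let ?P = "\<lambda>U. \<exists>S. finite S \<and> S \<subseteq> carrier M \<and> ?g S U"
  have ex: "\<exists>U. ?g S U" if "S \<subseteq> carrier M" for S
  proof -
    let ?U = "\<Inter>{V. submodule V R M \<and> S \<subseteq> V}"
    have "submodule ?U R M"
      using submodule_carrier[OF assms(1)] that
      by (intro submoduleI'[OF assms(1)]) (auto simp: submodule_zero submodule_add submodule_smult)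
    then show ?thesis by (intro exI[of _ ?U]) blast
  qed
  have "?P {\<zero>\<^bsub>M\<^esub>}"
    by (intro exI[of _ "{}"]) (auto simp: submodule_zero submodule_zero_set[OF assms(1)])
  then obtain U where U: "?P U" "\<forall>V. ?P V \<longrightarrow> U \<subseteq> V \<longrightarrow> V = U"
    by (rule finite_length_maximal[OF assms, of ?P]) (elim exE conjE)
  then obtain S where S: "finite S" "S \<subseteq> carrier M" "?g S U" by blast
  have "carrier M \<subseteq> U"
  proof
    fix x assume x: "x \<in> carrier M"
    obtain V where V: "?g (insert x S) V" using ex[of "insert x S"] x S(2) by auto
    have PV: "?P V" using V S(1,2) x by (intro exI[of _ "insert x S"]) simp
    have "U \<subseteq> V" using S(3) V by blast
    then have "V = U" using U(2)[rule_format, OF PV] by simp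
    then show "x \<in> U" using V by blast
  qed
  then show ?thesis
    unfolding fin_gen_def using S submodule_subset[of _ R M] by (intro exI[of _ S]) blast
qed

text \<open>Kernels of powers of \<phi> ascend and images descend, so from some n on both are
  stationary; then the n-th power and its square have the same kernel and the same image, and M
  splits. The conclusion n \<noteq> 0 guarantees that the n-th power kills whatever \<phi>
  kills.\<close>

lemma fitting_decomposition:
  assumes M: "right_module R M" and f: "finite_length R M" and \<phi>: "\<phi> \<in> mod_hom R M M"
  obtains n where "(\<phi> ^^ n) \<in> mod_hom R M M"
    "submodule (a_kernel M M (\<phi> ^^ n)) R M" "submodule ((\<phi> ^^ n) ` carrier M) R M"
    "a_kernel M M (\<phi> ^^ n) \<inter> (\<phi> ^^ n) ` carrier M = {\<zero>\<^bsub>M\<^esub>}"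
    "a_kernel M M (\<phi> ^^ n) <+>\<^bsub>M\<^esub> (\<phi> ^^ n) ` carrier M = carrier M" "n \<noteq> 0"
proof -
  interpret M: right_module R M by fact
  have pow: "(\<phi> ^^ n) \<in> mod_hom R M M" for n
    by (induction n) (auto simp: id_def comp_def intro: mod_hom_id mod_hom_comp \<phi>)
  note cl = mod_hom_closed[OF pow]
  let ?k = "\<lambda>n. a_kernel M M (\<phi> ^^ n)"
  let ?i = "\<lambda>n. (\<phi> ^^ n) ` carrier M"
  note subk = submodule_kernel[OF M M pow]
  note subi = submodule_image[OF M M pow submodule_carrier[OF M]]
  have kmono: "?k n \<subseteq> ?k (m + n)" for n m
    using mod_hom_zero[OF M M pow] by (auto simp: a_kernel_iff funpow_add)
  have imono: "?i (n + m) \<subseteq> ?i n" for n m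
    using cl by (auto simp: funpow_add)
  obtain a where a: "\<forall>m. ?k (m + a) = ?k a"
  proof (rule finite_length_maximal[OF M f, of "\<lambda>U. \<exists>n. U = ?k n" "?k 1"])
    fix U assume U: "\<exists>n. U = ?k n" "\<forall>V. (\<exists>n. V = ?k n) \<longrightarrow> U \<subseteq> V \<longrightarrow> V = U"
    then obtain a where "U = ?k a" by (elim exE)
    then have "?k (m + a) = ?k a" for m
      using U(2)[rule_format, of "?k (m + a)"] kmono[of a m] by blast
    then show thesis by (rule that[OF allI])
  next
    show "\<exists>n. ?k 1 = ?k n" by blast
  next
    show "submodule U R M" if "\<exists>n. U = ?k n" for U using that subk by blast
  qed
  obtain b where b: "\<forall>m. ?i (b + m) = ?i b"
  proof (rule finite_length_minimal[OF f, of "\<lambda>U. \<exists>n. U = ?i n" "?i 1"])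
    fix U assume U: "\<exists>n. U = ?i n" "\<forall>V. (\<exists>n. V = ?i n) \<longrightarrow> V \<subseteq> U \<longrightarrow> V = U"
    then obtain b where "U = ?i b" by (elim exE)
    then have "?i (b + m) = ?i b" for m
      using U(2)[rule_format, of "?i (b + m)"] imono[of b m] by blast
    then show thesis by (rule that[OF allI])
  next
    show "\<exists>n. ?i 1 = ?i n" by blast
  next
    show "submodule U R M" if "\<exists>n. U = ?i n" for U using that subi by blast
  qed
  \<comment> \<open>Kernels are constant from a on, images from b on. Both n and n + n lie beyond
    these stages, and \<open>Suc\<close> keeps n positive.\<close>
  define n where "n = Suc (a + b)"
  have k2: "?k (n + n) = ?k n" and i2: "?i (n + n) = ?i n"
    using a[rule_format, of "Suc (n + b)"] a[rule_format, of "Suc b"]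
      b[rule_format, of "Suc (a + n)"] b[rule_format, of "Suc a"]
    unfolding n_def by (simp_all add: ac_simps del: funpow.simps)
  show thesis
  proof (rule that[of n, OF pow subk subi])
    show "?k n \<inter> ?i n = {\<zero>\<^bsub>M\<^esub>}"
    proof -
      have "x = \<zero>\<^bsub>M\<^esub>" if x: "x \<in> ?k n" "x \<in> ?i n" for x
      proof -
        obtain y where y: "y \<in> carrier M" "x = (\<phi> ^^ n) y" using x(2) by blast
        then have "y \<in> ?k (n + n)" using x(1) by (simp add: a_kernel_iff funpow_add)
        then show ?thesis using k2 y by (simp add: a_kernel_iff)
      qed
      then show ?thesis using submodule_zero[OF subk[of n]] submodule_zero[OF subi[of n]] by blast
    qed
    show "?k n <+>\<^bsub>M\<^esub> ?i n = carrier M"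
    proof
      show "?k n <+>\<^bsub>M\<^esub> ?i n \<subseteq> carrier M"
        by (rule submodule_subset[OF submodule_sum(1)[OF M subk subi]])
      show "carrier M \<subseteq> ?k n <+>\<^bsub>M\<^esub> ?i n"
      proof
        fix x assume x: "x \<in> carrier M"
        then have "(\<phi> ^^ n) x \<in> ?i (n + n)" unfolding i2 by (rule imageI)
        then obtain y where y: "y \<in> carrier M" "(\<phi> ^^ n) x = (\<phi> ^^ n) ((\<phi> ^^ n) y)"
          by (auto simp: funpow_add)
        note c = cl[OF y(1), of n]
        have "x \<ominus>\<^bsub>M\<^esub> (\<phi> ^^ n) y \<in> ?k n"
          using mod_hom_eq_iff[OF M M pow x c] x c y(2) by (simp add: a_kernel_iff)
        moreover have "x = (x \<ominus>\<^bsub>M\<^esub> (\<phi> ^^ n) y) \<oplus>\<^bsub>M\<^esub> (\<phi> ^^ n) y"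
          using x c by (simp add: M.M.diff_add_cancel)
        ultimately show "x \<in> ?k n <+>\<^bsub>M\<^esub> ?i n"
          unfolding submodule_sum_iff using y(1) by blast
      qed
    qed
    show "n \<noteq> 0" by (simp add: n_def)
  qed
qed

section \<open>Endomorphisms of indecomposable modules and the exchange property\<close>

lemma submodule_sum_zero:
  assumes "right_module R M" "submodule V R M"
  shows "{\<zero>\<^bsub>M\<^esub>} <+>\<^bsub>M\<^esub> V = V"
proof -
  interpret M: right_module R M by fact
  have "\<zero>\<^bsub>M\<^esub> \<oplus>\<^bsub>M\<^esub> v = v" if "v \<in> V" for v
    using that submodule_subset[OF assms(2)] by auto
  then show ?thesis by (simp add: set_add_def')
qed

lemma indecomposable_trivial_summand:
  assumes "indecomposable_mod R M" "submodule U R M" "submodule V R M"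
    "U <+>\<^bsub>M\<^esub> V = carrier M" "U \<inter> V = {\<zero>\<^bsub>M\<^esub>}"
  shows "U = {\<zero>\<^bsub>M\<^esub>} \<or> V = {\<zero>\<^bsub>M\<^esub>}"
  using assms by (simp add: indecomposable_mod_def)

text \<open>One half of the Fitting decomposition is zero. A zero kernel makes the power, hence
  \<phi>, bijective; a zero image makes \<phi> nilpotent.\<close>

lemma indecomposable_endo:
  assumes I: "indecomposable_mod R M" and f: "finite_length R M" and \<phi>: "\<phi> \<in> mod_hom R M M"
  shows "bij_betw \<phi> (carrier M) (carrier M) \<or> (\<exists>n. \<forall>x\<in>carrier M. (\<phi> ^^ n) x = \<zero>\<^bsub>M\<^esub>)"
proof -
  have M: "right_module R M" using I by (simp add: indecomposable_mod_def fg_mod_def)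
  interpret M: right_module R M by fact
  obtain n where n: "(\<phi> ^^ n) \<in> mod_hom R M M"
    "submodule (a_kernel M M (\<phi> ^^ n)) R M" "submodule ((\<phi> ^^ n) ` carrier M) R M"
    "a_kernel M M (\<phi> ^^ n) \<inter> (\<phi> ^^ n) ` carrier M = {\<zero>\<^bsub>M\<^esub>}"
    "a_kernel M M (\<phi> ^^ n) <+>\<^bsub>M\<^esub> (\<phi> ^^ n) ` carrier M = carrier M" "n \<noteq> 0"
    by (rule fitting_decomposition[OF M f \<phi>])
  then consider "a_kernel M M (\<phi> ^^ n) = {\<zero>\<^bsub>M\<^esub>}" | "(\<phi> ^^ n) ` carrier M = {\<zero>\<^bsub>M\<^esub>}"
    using indecomposable_trivial_summand[OF I n(2,3,5,4)] by (elim disjE)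
  then show ?thesis
  proof cases
    case 1
    obtain m where m: "n = Suc m" using n(6) not0_implies_Suc by blast
    have cl: "(\<phi> ^^ m) x \<in> carrier M" if "x \<in> carrier M" for x
      using that mod_hom_closed[OF \<phi>] by (induction m) simp_all
    have "carrier M = (\<phi> ^^ n) ` carrier M"
      using n(5) submodule_sum_zero[OF M n(3)] unfolding 1 by simp
    also have "\<dots> \<subseteq> \<phi> ` carrier M" using cl by (auto simp: m)
    finally have s: "\<phi> ` carrier M = carrier M" using mod_hom_closed[OF \<phi>] by blast
    have "x = \<zero>\<^bsub>M\<^esub>" if "x \<in> carrier M" "\<phi> x = \<zero>\<^bsub>M\<^esub>" for x
    proof -
      have "(\<phi> ^^ m) \<zero>\<^bsub>M\<^esub> = \<zero>\<^bsub>M\<^esub>" 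
        by (induction m) (simp_all add: mod_hom_zero[OF M M \<phi>])
      then have "x \<in> a_kernel M M (\<phi> ^^ n)"
        using that by (simp add: m a_kernel_iff funpow_swap1 del: funpow.simps) (simp add: funpow_Suc_right del: funpow.simps)
      then show ?thesis using 1 by simp
    qed
    then have i: "inj_on \<phi> (carrier M)" unfolding mod_hom_inj_iff[OF M M \<phi>] by blast
    show ?thesis using i s by (simp add: bij_betw_def)
  next
    case 2
    then show ?thesis by (intro disjI2 exI[of _ n]) auto
  qed
qed

lemma inj_of_kernel:
  assumes "right_module R M" "right_module R N" "h \<in> mod_hom R M N"
    and "a_kernel M N h = {\<zero>\<^bsub>M\<^esub>}"
  shows "inj_on h (carrier M)"
  using assms(4) unfolding mod_hom_inj_iff[OF assms(1-3)] set_eq_iff a_kernel_iff singleton_iff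
  by blast

text \<open>The endomorphism ring is local. After composition with the inverse of \<theta> the two
  maps add up to the identity. If both are nilpotent, the second is injective, because what it kills
  is fixed by the nilpotent first one; an injective nilpotent map forces M = 0.\<close>

lemma indecomposable_sum_bij:
  assumes I: "indecomposable_mod R M" and fl: "finite_length R M"
    and \<phi>: "\<phi> \<in> mod_hom R M M" and \<psi>: "\<psi> \<in> mod_hom R M M"
    and b: "bij_betw \<theta> (carrier M) (carrier M)"
    and \<theta>: "\<And>x. x \<in> carrier M \<Longrightarrow> \<theta> x = \<phi> x \<oplus>\<^bsub>M\<^esub> \<psi> x"
  shows "bij_betw \<phi> (carrier M) (carrier M) \<or> bij_betw \<psi> (carrier M) (carrier M)"
proof -
  have M: "right_module R M" using I by (simp add: indecomposable_mod_def fg_mod_def)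
  interpret M: right_module R M by fact
  have th: "\<theta> \<in> mod_hom R M M"
    by (rule mod_hom_cong[OF M mod_hom_plus[OF M \<phi> \<psi>] \<theta>])
  obtain k where k: "k \<in> mod_hom R M M" "\<forall>x\<in>carrier M. k (\<theta> x) = x" "\<forall>y\<in>carrier M. \<theta> (k y) = y"
    using mod_hom_inverse[OF M M th b] by blast
  have strip: "bij_betw f (carrier M) (carrier M)"
    if "bij_betw (\<lambda>x. f (k x)) (carrier M) (carrier M)" for f
  proof (rule bij_betw_cong[THEN iffD1, OF _ bij_betw_trans[OF b that]])
    show "((\<lambda>x. f (k x)) \<circ> \<theta>) x = f x" if "x \<in> carrier M" for x
      using k(2) that by simp
  qed
  note a = mod_hom_comp[OF k(1) \<phi>] and c = mod_hom_comp[OF k(1) \<psi>]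
  have one: "\<phi> (k x) \<oplus>\<^bsub>M\<^esub> \<psi> (k x) = x" if "x \<in> carrier M" for x
    using that k(3) \<theta>[of "k x"] mod_hom_closed[OF k(1)] by simp
  show ?thesis
  proof (rule ccontr)
    assume "\<not> ?thesis"
    then have "\<not> bij_betw (\<lambda>x. \<phi> (k x)) (carrier M) (carrier M)"
      "\<not> bij_betw (\<lambda>x. \<psi> (k x)) (carrier M) (carrier M)"
      using strip by blast+
    then obtain n m where n: "\<forall>x\<in>carrier M. ((\<lambda>x. \<phi> (k x)) ^^ n) x = \<zero>\<^bsub>M\<^esub>"
      and m: "\<forall>x\<in>carrier M. ((\<lambda>x. \<psi> (k x)) ^^ m) x = \<zero>\<^bsub>M\<^esub>"
      using indecomposable_endo[OF I fl a] indecomposable_endo[OF I fl c] by metis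
    have inj: "x = \<zero>\<^bsub>M\<^esub>" if x: "x \<in> carrier M" "\<psi> (k x) = \<zero>\<^bsub>M\<^esub>" for x
    proof -
      have "\<phi> (k x) = x"
        using one[OF x(1)] x mod_hom_closed[OF a x(1)] by simp
      then have "((\<lambda>x. \<phi> (k x)) ^^ j) x = x" for j by (induction j) simp_all
      then show ?thesis using n x(1) by metis
    qed
    have "x = \<zero>\<^bsub>M\<^esub>" if "x \<in> carrier M" for x
      using m[rule_format, OF that]
    proof (induction m)
      case (Suc m)
      have "((\<lambda>x. \<psi> (k x)) ^^ j) x \<in> carrier M" for j
        using that mod_hom_closed[OF c] by (induction j) simp_all
      then show ?case using Suc inj by simp
    qed simp
    then have "carrier M = {\<zero>\<^bsub>M\<^esub>}" by blast
    then show False using I by (simp add: indecomposable_mod_def)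
  qed
qed

text \<open>If a sum of composites through T is bijective, one of its terms already is, by locality.
  Descending through the sum leaves a single composite M -> T -> M, so a summand of a power of T is
  a summand of T.\<close>

lemma thru_bij_indecomposable:
  assumes I: "indecomposable_mod R M" and fl: "finite_length R M"
    and \<phi>: "\<phi> \<in> thru R T M M" "bij_betw \<phi> (carrier M) (carrier M)"
  shows "\<exists>f\<in>mod_hom R M T. \<exists>g\<in>mod_hom R T M. \<forall>x\<in>carrier M. g (f x) = x"
proof -
  have M: "right_module R M" using I by (simp add: indecomposable_mod_def fg_mod_def)
  have "\<exists>f\<in>mod_hom R M T. \<exists>g\<in>mod_hom R T M. bij_betw (\<lambda>x. g (f x)) (carrier M) (carrier M)"
    using \<phi>
  proof induction
    case (comp f g \<phi>)
    have "bij_betw (\<lambda>x. g (f x)) (carrier M) (carrier M)"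
      by (rule bij_betw_cong[THEN iffD1, OF comp(3) comp(4)])
    then show ?case using comp(1,2) by blast
  next
    case (add \<phi> \<psi> \<theta>)
    have "bij_betw \<phi> (carrier M) (carrier M) \<or> bij_betw \<psi> (carrier M) (carrier M)"
      by (rule indecomposable_sum_bij[OF I fl thru_hom[OF M M add.hyps(1)] thru_hom[OF M M add.hyps(2)]
            add.prems add.hyps(3)])
    then show ?case using add.IH by (elim disjE) simp_all
  qed
  then obtain f g where fg: "f \<in> mod_hom R M T" "g \<in> mod_hom R T M"
    "bij_betw (\<lambda>x. g (f x)) (carrier M) (carrier M)" by blast
  obtain k where "k \<in> mod_hom R M M" "\<forall>x\<in>carrier M. k (g (f x)) = x"
    using mod_hom_inverse[OF M M mod_hom_comp[OF fg(1,2)] fg(3)] by blast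
  then show ?thesis
    by (intro bexI[OF _ fg(1)] bexI[OF _ mod_hom_comp[OF fg(2)]])
qed

lemma indecomposable_summand:
  assumes "indecomposable_mod R M" "finite_length R M" "summand_of R T M"
  shows "\<exists>f\<in>mod_hom R M T. \<exists>g\<in>mod_hom R T M. \<forall>x\<in>carrier M. g (f x) = x"
  using thru_bij_indecomposable[OF assms(1,2), of "\<lambda>x. x" T] assms(3)
  by (simp add: summand_of_def bij_betw_def)

lemma summand_of_bij:
  assumes M: "right_module R M" and t: "\<phi> \<in> thru R T M M"
    and b: "bij_betw \<phi> (carrier M) (carrier M)"
  shows "summand_of R T M"
proof -
  obtain k where k: "k \<in> mod_hom R M M" "\<forall>x\<in>carrier M. k (\<phi> x) = x"
    using mod_hom_inverse[OF M M thru_hom[OF M M t] b] by blast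
  have "(\<lambda>x. x) \<in> thru R T M M"
    by (rule thru_cong[OF thru_post[OF M M t k(1)]]) (simp add: k(2))
  then show ?thesis using M by (simp add: summand_of_def)
qed

text \<open>The identity of M becomes the sum of a map through T1 and a map through T2, and locality
  makes one of them bijective. Formulated with maps, the statement covers the external sum
  \<open>mod_sum\<close> as well as internal decompositions.\<close>

lemma indecomposable_summand_cases:
  assumes I: "indecomposable_mod R M" and fl: "finite_length R M" and s: "summand_of R T M"
    and a: "a \<in> mod_hom R T T1" "a' \<in> mod_hom R T1 T"
    and b: "b \<in> mod_hom R T T2" "b' \<in> mod_hom R T2 T"
    and one: "\<And>t. t \<in> carrier T \<Longrightarrow> t = a' (a t) \<oplus>\<^bsub>T\<^esub> b' (b t)"
  shows "summand_of R T1 M \<or> summand_of R T2 M"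
proof -
  have M: "right_module R M" using I by (simp add: indecomposable_mod_def fg_mod_def)
  obtain f g where fg: "f \<in> mod_hom R M T" "g \<in> mod_hom R T M" "\<forall>x\<in>carrier M. g (f x) = x"
    using indecomposable_summand[OF I fl s] by blast
  note fc = mod_hom_closed[OF fg(1)]
  note m = mod_hom_comp[OF mod_hom_comp[OF fg(1) a(1)] mod_hom_comp[OF a(2) fg(2)]]
    mod_hom_comp[OF mod_hom_comp[OF fg(1) b(1)] mod_hom_comp[OF b(2) fg(2)]]
  have "bij_betw (\<lambda>x. g (a' (a (f x)))) (carrier M) (carrier M) \<or>
        bij_betw (\<lambda>x. g (b' (b (f x)))) (carrier M) (carrier M)"
  proof (rule indecomposable_sum_bij[OF I fl m, of "\<lambda>x. x"])
    show "bij_betw (\<lambda>x. x) (carrier M) (carrier M)" by (simp add: bij_betw_def)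
    show "x = g (a' (a (f x))) \<oplus>\<^bsub>M\<^esub> g (b' (b (f x)))" if x: "x \<in> carrier M" for x
    proof -
      have "g (f x) = g (a' (a (f x)) \<oplus>\<^bsub>T\<^esub> b' (b (f x)))"
        using one[OF fc[OF x]] by simp
      also have "\<dots> = g (a' (a (f x))) \<oplus>\<^bsub>M\<^esub> g (b' (b (f x)))"
        using fc[OF x] a b by (intro mod_hom_add[OF fg(2)]) (auto intro: mod_hom_closed)
      finally show ?thesis using fg(3) x by simp
    qed
  qed
  moreover have t1: "(\<lambda>x. g (a' (a (f x)))) \<in> thru R T1 M M"
    by (rule thru.comp[OF mod_hom_comp[OF fg(1) a(1)] mod_hom_comp[OF a(2) fg(2)]]) simp
  moreover have t2: "(\<lambda>x. g (b' (b (f x)))) \<in> thru R T2 M M"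
    by (rule thru.comp[OF mod_hom_comp[OF fg(1) b(1)] mod_hom_comp[OF b(2) fg(2)]]) simp
  ultimately show ?thesis using summand_of_bij[OF M t1] summand_of_bij[OF M t2] by blast
qed

section \<open>Direct sum decompositions and finiteness of the list of indecomposable
  summands\<close>

lemma retract_complement:
  assumes M: "right_module R M" and W: "right_module R W"
    and f: "f \<in> mod_hom R M W" and g: "g \<in> mod_hom R W M"
    and gf: "\<And>x. x \<in> carrier M \<Longrightarrow> g (f x) = x"
  shows "submodule (f ` carrier M) R W" "submodule (a_kernel W M g) R W"
    "f ` carrier M <+>\<^bsub>W\<^esub> a_kernel W M g = carrier W"
    "f ` carrier M \<inter> a_kernel W M g = {\<zero>\<^bsub>W\<^esub>}"
proof -
  interpret W: right_module R W by fact
  interpret M: right_module R M by fact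
  show i: "submodule (f ` carrier M) R W"
    by (rule submodule_image[OF M W f submodule_carrier[OF M]])
  show k: "submodule (a_kernel W M g) R W" by (rule submodule_kernel[OF W M g])
  show "f ` carrier M <+>\<^bsub>W\<^esub> a_kernel W M g = carrier W"
  proof
    show "f ` carrier M <+>\<^bsub>W\<^esub> a_kernel W M g \<subseteq> carrier W"
      by (rule submodule_subset[OF submodule_sum(1)[OF W i k]])
    show "carrier W \<subseteq> f ` carrier M <+>\<^bsub>W\<^esub> a_kernel W M g"
    proof
      fix w assume w: "w \<in> carrier W"
      then have c: "g w \<in> carrier M" "f (g w) \<in> carrier W"
        by (auto intro: mod_hom_closed[OF f] mod_hom_closed[OF g])
      then have "w \<ominus>\<^bsub>W\<^esub> f (g w) \<in> a_kernel W M g"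
        using w gf mod_hom_eq_iff[OF W M g w c(2)] by (simp add: a_kernel_iff)
      moreover have "w = f (g w) \<oplus>\<^bsub>W\<^esub> (w \<ominus>\<^bsub>W\<^esub> f (g w))"
        using w c by (simp add: W.M.diff_add_cancel)
      ultimately show "w \<in> f ` carrier M <+>\<^bsub>W\<^esub> a_kernel W M g"
        unfolding submodule_sum_iff using c(1) by blast
    qed
  qed
  show "f ` carrier M \<inter> a_kernel W M g = {\<zero>\<^bsub>W\<^esub>}"
  proof -
    have "f x = \<zero>\<^bsub>W\<^esub>" if "x \<in> carrier M" "g (f x) = \<zero>\<^bsub>M\<^esub>" for x
      using that gf[OF that(1)] mod_hom_zero[OF M W f] by simp
    then have "f ` carrier M \<inter> a_kernel W M g \<subseteq> {\<zero>\<^bsub>W\<^esub>}" by (auto simp: a_kernel_iff)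
    then show ?thesis using submodule_zero[OF i] submodule_zero[OF k] by blast
  qed
qed

text \<open>M is a nonzero summand of W, so the complement, which is the kernel of the retraction,
  has to vanish.\<close>

lemma indecomposable_summand_iso:
  assumes M: "indecomposable_mod R M" and fl: "finite_length R M"
    and W: "indecomposable_mod R W" and s: "summand_of R W M"
  shows "mod_isomorphic R M W"
proof -
  have m: "right_module R M" "right_module R W"
    using M W by (auto simp: indecomposable_mod_def fg_mod_def)
  obtain f g where fg: "f \<in> mod_hom R M W" "g \<in> mod_hom R W M" "\<forall>x\<in>carrier M. g (f x) = x"
    using indecomposable_summand[OF M fl s] by blast
  note rc = retract_complement[OF m fg(1,2) fg(3)[rule_format]]
  have "f ` carrier M = {\<zero>\<^bsub>W\<^esub>} \<or> a_kernel W M g = {\<zero>\<^bsub>W\<^esub>}"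
    by (rule indecomposable_trivial_summand[OF W rc])
  moreover have False if z: "f ` carrier M = {\<zero>\<^bsub>W\<^esub>}"
  proof -
    have "x = \<zero>\<^bsub>M\<^esub>" if "x \<in> carrier M" for x
    proof -
      have "f x = \<zero>\<^bsub>W\<^esub>" using that z by blast
      then have "g (f x) = \<zero>\<^bsub>M\<^esub>" using mod_hom_zero[OF m(2,1) fg(2)] by simp
      then show ?thesis using fg(3) that by simp
    qed
    then have "carrier M = {\<zero>\<^bsub>M\<^esub>}"
      using submodule_zero[OF submodule_carrier[OF m(1)]] by blast
    then show False using M by (simp add: indecomposable_mod_def)
  qed
  ultimately have "a_kernel W M g = {\<zero>\<^bsub>W\<^esub>}" by blast
  then have inj: "inj_on g (carrier W)"
    by (rule inj_of_kernel[OF m(2,1) fg(2)])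
  have fgw: "f (g w) = w" if w: "w \<in> carrier W" for w
  proof (rule inj_onD[OF inj _ _ w])
    have c: "g w \<in> carrier M" using mod_hom_closed[OF fg(2) w] .
    then show "g (f (g w)) = g w" using fg(3) by simp
    show "f (g w) \<in> carrier W" using mod_hom_closed[OF fg(1) c] .
  qed
  show ?thesis by (rule mod_isomorphicI[OF fg(1,2) fg(3)[rule_format] fgw])
qed

lemma (in abelian_group) add_eq_diff:
  assumes "x \<in> carrier G" "y \<in> carrier G" "x' \<in> carrier G" "y' \<in> carrier G"
    and "x \<oplus> y = x' \<oplus> y'"
  shows "x \<ominus> x' = y' \<ominus> y"
proof -
  have "(x \<ominus> x') \<oplus> (x' \<oplus> y) = ((x \<ominus> x') \<oplus> x') \<oplus> y"
    using assms(1-4) by (simp add: a_assoc)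
  also have "\<dots> = x' \<oplus> y'" using assms diff_add_cancel(1)[of x x'] by simp
  also have "\<dots> = x' \<oplus> ((y' \<ominus> y) \<oplus> y)" using assms diff_add_cancel(1)[of y' y] by simp
  also have "\<dots> = (y' \<ominus> y) \<oplus> (x' \<oplus> y)" using assms(1-4) by (simp add: a_lcomm)
  finally show ?thesis using assms(1-4) by simp
qed

lemma direct_sum_projections:
  assumes M: "right_module R M" and U: "submodule U R M" and V: "submodule V R M"
    and s: "U <+>\<^bsub>M\<^esub> V = carrier M" and i: "U \<inter> V = {\<zero>\<^bsub>M\<^esub>}"
  obtains p q where "p \<in> mod_hom R M (M\<lparr>carrier := U\<rparr>)" "q \<in> mod_hom R M (M\<lparr>carrier := V\<rparr>)"
    "\<And>x. x \<in> carrier M \<Longrightarrow> x = p x \<oplus>\<^bsub>M\<^esub> q x"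
    "\<And>u v. \<lbrakk>u \<in> U; v \<in> V\<rbrakk> \<Longrightarrow> p (u \<oplus>\<^bsub>M\<^esub> v) = u \<and> q (u \<oplus>\<^bsub>M\<^esub> v) = v"
proof -
  interpret M: right_module R M by fact
  have c: "\<And>x. x \<in> U \<Longrightarrow> x \<in> carrier M" "\<And>x. x \<in> V \<Longrightarrow> x \<in> carrier M"
    using submodule_subset U V by blast+
  have uniq: "u = u' \<and> v = v'"
    if "u \<in> U" "u' \<in> U" "v \<in> V" "v' \<in> V" "u \<oplus>\<^bsub>M\<^esub> v = u' \<oplus>\<^bsub>M\<^esub> v'" for u u' v v'
  proof -
    have "u \<ominus>\<^bsub>M\<^esub> u' = v' \<ominus>\<^bsub>M\<^esub> v"
      using that c by (intro M.M.add_eq_diff) auto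
    then have "u \<ominus>\<^bsub>M\<^esub> u' \<in> U \<inter> V" "v' \<ominus>\<^bsub>M\<^esub> v \<in> U \<inter> V"
      using that submodule_diff[OF U, of u u'] submodule_diff[OF V, of v' v] by auto
    then have "u \<ominus>\<^bsub>M\<^esub> u' = \<zero>\<^bsub>M\<^esub>" "v' \<ominus>\<^bsub>M\<^esub> v = \<zero>\<^bsub>M\<^esub>" using i by blast+
    then show ?thesis using that c M.M.diff_eq_zero_iff by auto
  qed
  define P where "P x uv \<longleftrightarrow> fst uv \<in> U \<and> snd uv \<in> V \<and> x = fst uv \<oplus>\<^bsub>M\<^esub> snd uv" for x uv
  define d where "d x = (SOME uv. P x uv)" for x
  have d: "P x (d x)" if x: "x \<in> carrier M" for x
  proof -
    obtain u v where "u \<in> U" "v \<in> V" "x = u \<oplus>\<^bsub>M\<^esub> v"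
      using x unfolding s[symmetric] submodule_sum_iff by blast
    then have "P x (u, v)" by (simp add: P_def)
    then show ?thesis unfolding d_def by (rule someI)
  qed
  define p q where "p x = fst (d x)" and "q x = snd (d x)" for x
  have pq: "p x \<in> U" "q x \<in> V" "x = p x \<oplus>\<^bsub>M\<^esub> q x" if "x \<in> carrier M" for x
    using d[OF that] by (auto simp: P_def p_def q_def)
  have val: "p (u \<oplus>\<^bsub>M\<^esub> v) = u \<and> q (u \<oplus>\<^bsub>M\<^esub> v) = v" if "u \<in> U" "v \<in> V" for u v
    using pq[of "u \<oplus>\<^bsub>M\<^esub> v"] that c uniq[of "p (u \<oplus>\<^bsub>M\<^esub> v)" u "q (u \<oplus>\<^bsub>M\<^esub> v)" v] by simp
  have add: "p (x \<oplus>\<^bsub>M\<^esub> y) = p x \<oplus>\<^bsub>M\<^esub> p y \<and> q (x \<oplus>\<^bsub>M\<^esub> y) = q x \<oplus>\<^bsub>M\<^esub> q y"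
    if "x \<in> carrier M" "y \<in> carrier M" for x y
  proof -
    have "x \<oplus>\<^bsub>M\<^esub> y = (p x \<oplus>\<^bsub>M\<^esub> q x) \<oplus>\<^bsub>M\<^esub> (p y \<oplus>\<^bsub>M\<^esub> q y)"
      using pq(3)[OF that(1)] pq(3)[OF that(2)] by simp
    also have "\<dots> = (p x \<oplus>\<^bsub>M\<^esub> p y) \<oplus>\<^bsub>M\<^esub> (q x \<oplus>\<^bsub>M\<^esub> q y)"
      using pq(1,2)[OF that(1)] pq(1,2)[OF that(2)] c by (simp add: M.M.a_ac)
    finally show ?thesis
      using val pq(1,2)[OF that(1)] pq(1,2)[OF that(2)] submodule_add U V by metis
  qed
  have smult: "p (a \<odot>\<^bsub>M\<^esub> x) = a \<odot>\<^bsub>M\<^esub> p x \<and> q (a \<odot>\<^bsub>M\<^esub> x) = a \<odot>\<^bsub>M\<^esub> q x"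
    if "a \<in> carrier R" "x \<in> carrier M" for a x
  proof -
    have "a \<odot>\<^bsub>M\<^esub> x = a \<odot>\<^bsub>M\<^esub> (p x \<oplus>\<^bsub>M\<^esub> q x)"
      using pq(3)[OF that(2)] by simp
    also have "\<dots> = a \<odot>\<^bsub>M\<^esub> p x \<oplus>\<^bsub>M\<^esub> a \<odot>\<^bsub>M\<^esub> q x"
      using pq(1,2)[OF that(2)] c that(1) by (simp add: M.smult_r_distr)
    finally show ?thesis
      using val[OF submodule_smult[OF U that(1) pq(1)[OF that(2)]]
          submodule_smult[OF V that(1) pq(2)[OF that(2)]]] by simp
  qed
  have "p \<in> mod_hom R M (M\<lparr>carrier := U\<rparr>)" "q \<in> mod_hom R M (M\<lparr>carrier := V\<rparr>)"
    using pq(1,2) add smult by (intro mod_homI; simp)+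
  then show thesis using that pq(3) val by blast
qed

text \<open>Induction on the rank of W: it is zero, or indecomposable, or splits into two submodules
  of smaller rank whose lists together serve for W by the exchange property. Staying among
  submodules of one T keeps a single rank function and a single type.\<close>

lemma finitely_many_indecomposable_summands:
  assumes T: "right_module R T" and fl: "finite_length R T" and W: "submodule W R T"
  shows "\<exists>\<D>. finite \<D> \<and> (\<forall>U\<in>\<D>. submodule U R T) \<and>
    (\<forall>M :: ('r, 'm) module. indecomposable_mod R M \<and> finite_length R M \<and>
        summand_of R (T\<lparr>carrier := W\<rparr>) M \<longrightarrow> (\<exists>U\<in>\<D>. mod_isomorphic R M (T\<lparr>carrier := U\<rparr>)))"
    (is "?Q W")
proof -
  obtain \<rho> :: "_ \<Rightarrow> nat" where \<rho>: "\<forall>U V. submodule U R T \<longrightarrow> submodule V R T \<longrightarrow> U \<subset> V \<longrightarrow> \<rho> U < \<rho> V"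
    "\<forall>U V. submodule U R T \<longrightarrow> submodule V R T \<longrightarrow> U \<subseteq> V \<longrightarrow> \<rho> U \<le> \<rho> V"
    by (rule finite_length_rank[OF fl])
  show ?thesis using W
  proof (induction "\<rho> W" arbitrary: W rule: less_induct)
    case less
    note W = \<open>submodule W R T\<close>
    let ?W = "T\<lparr>carrier := W\<rparr>"
    have Wm: "right_module R ?W" and Wfl: "finite_length R ?W"
      using right_module_restrict[OF T W] finite_length_restrict[OF T W fl] by auto
    then have Wfg: "fg_mod R ?W" by (simp add: fg_mod_def finite_length_fin_gen)
    consider "W = {\<zero>\<^bsub>T\<^esub>}" | "indecomposable_mod R ?W"
      | U V where "submodule U R ?W" "submodule V R ?W" "U <+>\<^bsub>?W\<^esub> V = W" "U \<inter> V = {\<zero>\<^bsub>T\<^esub>}"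
        "U \<noteq> {\<zero>\<^bsub>T\<^esub>}" "V \<noteq> {\<zero>\<^bsub>T\<^esub>}"
      using Wfg unfolding indecomposable_mod_def by auto
    then show ?case
    proof cases
      case 1
      have False if M: "indecomposable_mod R M" "finite_length R M" "summand_of R ?W M"
        for M :: "('r, 'm) module"
      proof -
        have m: "right_module R M" using M by (auto simp: indecomposable_mod_def fg_mod_def)
        obtain f g where fg: "f \<in> mod_hom R M ?W" "g \<in> mod_hom R ?W M" "\<forall>x\<in>carrier M. g (f x) = x"
          using indecomposable_summand[OF M] by blast
        have "x = \<zero>\<^bsub>M\<^esub>" if "x \<in> carrier M" for x
        proof -
          have "f x = \<zero>\<^bsub>?W\<^esub>" using mod_hom_closed[OF fg(1) that] 1 by simp
          then have "g (f x) = \<zero>\<^bsub>M\<^esub>" using mod_hom_zero[OF Wm m fg(2)] by simp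
          then show ?thesis using fg(3) that by simp
        qed
        then have "carrier M = {\<zero>\<^bsub>M\<^esub>}"
          using submodule_zero[OF submodule_carrier[OF m]] by blast
        then show False using M(1) by (simp add: indecomposable_mod_def)
      qed
      then show ?thesis by (intro exI[of _ "{}"]) blast
    next
      case 2
      show ?thesis
        by (intro exI[of _ "{W}"]) (use W 2 indecomposable_summand_iso in auto)
    next
      case 3
      have sub: "submodule U R T" "submodule V R T" "U \<subseteq> W" "V \<subseteq> W"
        using 3 submodule_restrict_iff[OF T W] by auto
      \<comment> \<open>If U were all of W, then V = U \<inter> V would be zero, and the same with U
        and V exchanged.\<close>
      have "U \<noteq> W" "V \<noteq> W"
        using 3(4-6) sub by (auto simp: Int_absorb1 Int_absorb2)
      then have lt: "\<rho> U < \<rho> W" "\<rho> V < \<rho> W" using sub W \<rho>(1) by auto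
      obtain D where D: "finite D" "\<forall>U\<in>D. submodule U R T"
        "\<And>M :: ('r, 'm) module. \<lbrakk>indecomposable_mod R M; finite_length R M;
          summand_of R (T\<lparr>carrier := U\<rparr>) M\<rbrakk> \<Longrightarrow> \<exists>U\<in>D. mod_isomorphic R M (T\<lparr>carrier := U\<rparr>)"
        using less.hyps[OF lt(1) sub(1)] by blast
      obtain E where E: "finite E" "\<forall>U\<in>E. submodule U R T"
        "\<And>M :: ('r, 'm) module. \<lbrakk>indecomposable_mod R M; finite_length R M;
          summand_of R (T\<lparr>carrier := V\<rparr>) M\<rbrakk> \<Longrightarrow> \<exists>U\<in>E. mod_isomorphic R M (T\<lparr>carrier := U\<rparr>)"
        using less.hyps[OF lt(2) sub(2)] by blast
      obtain p q where pq: "p \<in> mod_hom R ?W (?W\<lparr>carrier := U\<rparr>)" "q \<in> mod_hom R ?W (?W\<lparr>carrier := V\<rparr>)"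
        "\<And>x. x \<in> carrier ?W \<Longrightarrow> x = p x \<oplus>\<^bsub>?W\<^esub> q x"
        by (rule direct_sum_projections[OF Wm 3(1,2)]) (use 3 in auto)
      have "\<exists>U\<in>D \<union> E. mod_isomorphic R M (T\<lparr>carrier := U\<rparr>)"
        if M: "indecomposable_mod R M" "finite_length R M" "summand_of R ?W M"
        for M :: "('r, 'm) module"
      proof -
        have "summand_of R (?W\<lparr>carrier := U\<rparr>) M \<or> summand_of R (?W\<lparr>carrier := V\<rparr>) M"
          by (rule indecomposable_summand_cases[OF M pq(1) mod_hom_incl pq(2) mod_hom_incl])
            (use pq(3) sub in auto)
        then show ?thesis using D(3) E(3) M by auto
      qed
      then show ?thesis
        using D E by (intro exI[of _ "D \<union> E"]) blast
    qed
  qed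
qed

section \<open>Sums, powers and free modules\<close>

lemma right_module_mod_sum:
  assumes "right_module R M" "right_module R N"
  shows "right_module R (mod_sum M N)"
proof -
  interpret M: right_module R M by fact
  interpret N: right_module R N by fact
  have "abelian_group (mod_sum M N)"
  proof (rule abelian_groupI)
    fix x assume "x \<in> carrier (mod_sum M N)"
    then show "\<exists>y\<in>carrier (mod_sum M N). y \<oplus>\<^bsub>mod_sum M N\<^esub> x = \<zero>\<^bsub>mod_sum M N\<^esub>"
      by (intro bexI[of _ "(\<ominus>\<^bsub>M\<^esub> fst x, \<ominus>\<^bsub>N\<^esub> snd x)"])
        (auto simp: mod_sum_def M.M.l_neg N.M.l_neg)
  qed (auto simp: mod_sum_def M.M.a_ac N.M.a_ac)
  then show ?thesis
    using M.R.ring_axioms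
    by (auto simp: right_module_def right_module_axioms_def mod_sum_def M.smult_l_distr
        M.smult_r_distr M.smult_assoc N.smult_l_distr N.smult_r_distr N.smult_assoc)
qed

lemma mod_hom_fst: "fst \<in> mod_hom R (mod_sum M N) M"
  by (intro mod_homI) (auto simp: mod_sum_def)

lemma mod_hom_snd: "snd \<in> mod_hom R (mod_sum M N) N"
  by (intro mod_homI) (auto simp: mod_sum_def)

lemma mod_hom_inl:
  assumes "right_module R N" shows "(\<lambda>x. (x, \<zero>\<^bsub>N\<^esub>)) \<in> mod_hom R M (mod_sum M N)"
proof -
  interpret N: right_module R N by fact
  show ?thesis by (intro mod_homI) (auto simp: mod_sum_def N.smult_r_null)
qed

lemma mod_hom_inr:
  assumes "right_module R M" shows "(\<lambda>y. (\<zero>\<^bsub>M\<^esub>, y)) \<in> mod_hom R N (mod_sum M N)"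
proof -
  interpret M: right_module R M by fact
  show ?thesis by (intro mod_homI) (auto simp: mod_sum_def M.smult_r_null)
qed

lemma summand_of_mod_sum:
  assumes M: "right_module R M" and N: "right_module R N"
  shows "summand_of R (mod_sum M N) M" "summand_of R (mod_sum M N) N"
  using summand_of_retract[OF M summand_of_refl[OF right_module_mod_sum[OF M N]]
      mod_hom_inl[OF N] mod_hom_fst]
    summand_of_retract[OF N summand_of_refl[OF right_module_mod_sum[OF M N]]
      mod_hom_inr[OF M] mod_hom_snd] by simp_all

lemma mod_pow_nth: "\<lbrakk>t \<in> carrier (mod_pow M n); i < n\<rbrakk> \<Longrightarrow> t i \<in> carrier M"
  by (auto simp: mod_pow_def PiE_iff)

lemma mod_pow_arb: "\<lbrakk>t \<in> carrier (mod_pow M n); \<not> i < n\<rbrakk> \<Longrightarrow> t i = undefined"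
  by (simp add: mod_pow_def PiE_iff extensional_def)

lemma right_module_mod_pow:
  assumes "right_module R M"
  shows "right_module R (mod_pow M n)"
proof -
  interpret M: right_module R M by fact
  have "abelian_group (mod_pow M n)"
  proof (rule abelian_groupI)
    fix x y z assume c: "x \<in> carrier (mod_pow M n)" "y \<in> carrier (mod_pow M n)" "z \<in> carrier (mod_pow M n)"
    note E = mod_pow_nth[OF c(1)] mod_pow_nth[OF c(2)] mod_pow_nth[OF c(3)]
    show "x \<oplus>\<^bsub>mod_pow M n\<^esub> y \<oplus>\<^bsub>mod_pow M n\<^esub> z = x \<oplus>\<^bsub>mod_pow M n\<^esub> (y \<oplus>\<^bsub>mod_pow M n\<^esub> z)"
      by (auto simp: mod_pow_def restrict_def fun_eq_iff E M.M.a_assoc)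
  next
    fix x y assume c: "x \<in> carrier (mod_pow M n)" "y \<in> carrier (mod_pow M n)"
    note E = mod_pow_nth[OF c(1)] mod_pow_nth[OF c(2)]
    show "x \<oplus>\<^bsub>mod_pow M n\<^esub> y = y \<oplus>\<^bsub>mod_pow M n\<^esub> x"
      by (auto simp: mod_pow_def restrict_def fun_eq_iff E M.M.a_comm)
    show "x \<oplus>\<^bsub>mod_pow M n\<^esub> y \<in> carrier (mod_pow M n)"
      by (simp add: mod_pow_def E)
  next
    fix x assume c: "x \<in> carrier (mod_pow M n)"
    note E = mod_pow_nth[OF c]
    show "\<zero>\<^bsub>mod_pow M n\<^esub> \<oplus>\<^bsub>mod_pow M n\<^esub> x = x"
    proof
      fix i
      show "(\<zero>\<^bsub>mod_pow M n\<^esub> \<oplus>\<^bsub>mod_pow M n\<^esub> x) i = x i"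
        by (simp add: mod_pow_def E mod_pow_arb[OF c])
    qed
    show "\<exists>y\<in>carrier (mod_pow M n). y \<oplus>\<^bsub>mod_pow M n\<^esub> x = \<zero>\<^bsub>mod_pow M n\<^esub>"
    proof (rule bexI[of _ "\<lambda>i\<in>{..<n}. \<ominus>\<^bsub>M\<^esub> x i"])
      show "(\<lambda>i\<in>{..<n}. \<ominus>\<^bsub>M\<^esub> x i) \<oplus>\<^bsub>mod_pow M n\<^esub> x = \<zero>\<^bsub>mod_pow M n\<^esub>"
        by (auto simp: mod_pow_def restrict_def fun_eq_iff E M.M.l_neg)
      show "(\<lambda>i\<in>{..<n}. \<ominus>\<^bsub>M\<^esub> x i) \<in> carrier (mod_pow M n)"
        by (simp add: mod_pow_def E)
    qed
  qed (simp add: mod_pow_def)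
  moreover have "right_module_axioms R (mod_pow M n)"
  proof
    fix a x assume a: "a \<in> carrier R" and c: "x \<in> carrier (mod_pow M n)"
    note E = mod_pow_nth[OF c]
    show "a \<odot>\<^bsub>mod_pow M n\<^esub> x \<in> carrier (mod_pow M n)"
      by (simp add: mod_pow_def E a)
    fix b assume b: "b \<in> carrier R"
    show "(a \<oplus>\<^bsub>R\<^esub> b) \<odot>\<^bsub>mod_pow M n\<^esub> x = a \<odot>\<^bsub>mod_pow M n\<^esub> x \<oplus>\<^bsub>mod_pow M n\<^esub> b \<odot>\<^bsub>mod_pow M n\<^esub> x"
      by (auto simp: mod_pow_def restrict_def fun_eq_iff E a b M.smult_l_distr)
    show "(a \<otimes>\<^bsub>R\<^esub> b) \<odot>\<^bsub>mod_pow M n\<^esub> x = b \<odot>\<^bsub>mod_pow M n\<^esub> (a \<odot>\<^bsub>mod_pow M n\<^esub> x)"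
      by (auto simp: mod_pow_def restrict_def fun_eq_iff E a b M.smult_assoc)
  next
    fix a x y assume a: "a \<in> carrier R" and c: "x \<in> carrier (mod_pow M n)" "y \<in> carrier (mod_pow M n)"
    note E = mod_pow_nth[OF c(1)] mod_pow_nth[OF c(2)]
    show "a \<odot>\<^bsub>mod_pow M n\<^esub> (x \<oplus>\<^bsub>mod_pow M n\<^esub> y) =
        a \<odot>\<^bsub>mod_pow M n\<^esub> x \<oplus>\<^bsub>mod_pow M n\<^esub> a \<odot>\<^bsub>mod_pow M n\<^esub> y"
      by (auto simp: mod_pow_def restrict_def fun_eq_iff E a M.smult_r_distr)
  next
    fix x assume c: "x \<in> carrier (mod_pow M n)"
    show "\<one>\<^bsub>R\<^esub> \<odot>\<^bsub>mod_pow M n\<^esub> x = x"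
    proof
      fix i
      show "(\<one>\<^bsub>R\<^esub> \<odot>\<^bsub>mod_pow M n\<^esub> x) i = x i"
        by (simp add: mod_pow_def mod_pow_nth[OF c] mod_pow_arb[OF c])
    qed
  qed
  ultimately show ?thesis
    using M.R.ring_axioms by (simp add: right_module_def)
qed

lemma mod_hom_proj: "i < n \<Longrightarrow> (\<lambda>f. f i) \<in> mod_hom R (mod_pow M n) M"
  by (intro mod_homI) (auto simp: mod_pow_def PiE_iff)

lemma mod_hom_tuple:
  assumes "\<And>i. i < n \<Longrightarrow> f i \<in> mod_hom R X M"
  shows "(\<lambda>x. \<lambda>i\<in>{..<n}. f i x) \<in> mod_hom R X (mod_pow M n)"
  by (intro mod_homI) (auto simp: mod_pow_def mod_hom_closed[OF assms] mod_hom_add[OF assms]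
      mod_hom_smult[OF assms] intro!: restrict_ext)

lemma mod_hom_copair:
  assumes X: "right_module R X" and M: "right_module R M"
    and g: "\<And>i. i < n \<Longrightarrow> g i \<in> mod_hom R M X"
  shows "(\<lambda>t. \<Oplus>\<^bsub>X\<^esub>i\<in>{..<n}. g i (t i)) \<in> mod_hom R (mod_pow M n) X"
  using g
proof (induction n)
  case 0
  interpret X: right_module R X by fact
  show ?case by (intro mod_homI) (simp_all add: X.smult_r_null)
next
  case (Suc n)
  interpret X: right_module R X by fact
  have r: "(\<lambda>t. \<lambda>i\<in>{..<n}. t i) \<in> mod_hom R (mod_pow M (Suc n)) (mod_pow M n)"
    by (rule mod_hom_tuple) (rule mod_hom_proj, simp)
  have "(\<lambda>t. \<Oplus>\<^bsub>X\<^esub>i\<in>{..<n}. g i (t i)) \<in> mod_hom R (mod_pow M n) X"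
    using Suc by simp
  then have s: "(\<lambda>t. \<Oplus>\<^bsub>X\<^esub>i\<in>{..<n}. g i ((\<lambda>i\<in>{..<n}. t i) i)) \<in> mod_hom R (mod_pow M (Suc n)) X"
    by (rule mod_hom_comp[OF r])
  have l: "(\<lambda>t. g n (t n)) \<in> mod_hom R (mod_pow M (Suc n)) X"
    by (rule mod_hom_comp[OF mod_hom_proj Suc.prems]) simp_all
  have eq: "(\<Oplus>\<^bsub>X\<^esub>i\<in>{..<Suc n}. g i (t i)) =
      (\<Oplus>\<^bsub>X\<^esub>i\<in>{..<n}. g i ((\<lambda>i\<in>{..<n}. t i) i)) \<oplus>\<^bsub>X\<^esub> g n (t n)"
    if t: "t \<in> carrier (mod_pow M (Suc n))" for t
  proof -
    have gc: "g i (t i) \<in> carrier X" if "i < Suc n" for i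
      by (rule mod_hom_closed[OF Suc.prems[OF that] mod_pow_nth[OF t that]])
    have "(\<Oplus>\<^bsub>X\<^esub>i\<in>{..<n}. g i ((\<lambda>i\<in>{..<n}. t i) i)) = (\<Oplus>\<^bsub>X\<^esub>i\<in>{..<n}. g i (t i))"
      using gc by (intro X.M.finsum_cong') auto
    then show ?thesis
      using gc mod_hom_closed[OF s t] by (simp add: lessThan_Suc X.M.finsum_insert X.M.a_comm Pi_iff)
  qed
  show ?case
    by (rule mod_hom_cong[OF right_module_mod_pow[OF M] mod_hom_plus[OF X s l] eq])
qed

section \<open>The regular module and its powers\<close>

lemma right_module_regular:
  assumes "ring R" shows "right_module R (regular_mod R)"
proof -
  interpret R: ring R by fact
  have "abelian_group (regular_mod R)"
    by (rule abelian_groupI) (auto simp: regular_mod_def R.a_ac intro: R.a_inv_closed R.l_neg)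
  then show ?thesis
    using R.ring_axioms
    by (auto simp: right_module_def right_module_axioms_def regular_mod_def R.r_distr R.l_distr R.m_assoc)
qed

lemma fin_gen_regular:
  assumes "ring R" shows "fin_gen R (regular_mod R)"
proof -
  interpret R: ring R by fact
  have "carrier R \<subseteq> U" if "submodule U R (regular_mod R)" "\<one>\<^bsub>R\<^esub> \<in> U" for U
  proof
    fix a assume a: "a \<in> carrier R"
    then show "a \<in> U"
      using submodule_smult[OF that(1) a that(2)] by (simp add: regular_mod_def)
  qed
  moreover have "carrier (regular_mod R) = carrier R" by (simp add: regular_mod_def)
  ultimately show ?thesis
    unfolding fin_gen_def using submodule_subset[of _ R "regular_mod R"]
    by (intro exI[of _ "{\<one>\<^bsub>R\<^esub>}"]) auto
qed

lemma mod_hom_regular: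
  assumes "right_module R X" "x \<in> carrier X"
  shows "(\<lambda>a. a \<odot>\<^bsub>X\<^esub> x) \<in> mod_hom R (regular_mod R) X"
proof -
  interpret X: right_module R X by fact
  show ?thesis
    using assms(2) by (intro mod_homI) (auto simp: regular_mod_def X.smult_l_distr X.smult_assoc)
qed

lemma mod_hom_regular_eq:
  assumes "ring R" "g \<in> mod_hom R (regular_mod R) X" "a \<in> carrier R"
  shows "g a = a \<odot>\<^bsub>X\<^esub> g \<one>\<^bsub>R\<^esub>"
proof -
  interpret R: ring R by fact
  show ?thesis
    using mod_hom_smult[OF assms(2,3), of "\<one>\<^bsub>R\<^esub>"] assms(3) by (simp add: regular_mod_def)
qed

text \<open>A map out of R is determined by its value at 1, and that value is lifted along
  q.\<close>

lemma regular_lift: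
  assumes Z: "right_module R Z" and q: "q \<in> mod_epi R Z Y"
    and g: "g \<in> mod_hom R (regular_mod R) Y"
  shows "\<exists>g'\<in>mod_hom R (regular_mod R) Z. \<forall>a\<in>carrier (regular_mod R). q (g' a) = g a"
proof -
  interpret Z: right_module R Z by fact
  have R: "ring R" by unfold_locales
  have "\<one>\<^bsub>R\<^esub> \<in> carrier (regular_mod R)" by (simp add: regular_mod_def)
  then obtain z where z: "z \<in> carrier Z" "g \<one>\<^bsub>R\<^esub> = q z"
    using mod_epi_surj[OF q mod_hom_closed[OF g]] by blast
  have "q (a \<odot>\<^bsub>Z\<^esub> z) = g a" if "a \<in> carrier (regular_mod R)" for a
  proof -
    have a: "a \<in> carrier R" using that by (simp add: regular_mod_def)
    show ?thesis
      using mod_hom_smult[OF mod_epiD(1)[OF q] a z(1)] mod_hom_regular_eq[OF R g a] z(2) by simp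
  qed
  then show ?thesis by (intro bexI[OF _ mod_hom_regular[OF Z z(1)]] ballI)
qed

lemma thru_regular_lift:
  assumes X: "right_module R X" and Z: "right_module R Z" and q: "q \<in> mod_epi R Z Y"
    and \<phi>: "\<phi> \<in> thru R (regular_mod R) X Y"
  shows "\<exists>\<psi>\<in>mod_hom R X Z. \<forall>x\<in>carrier X. q (\<psi> x) = \<phi> x"
  by (rule thru_lift[OF X Z mod_epiD(1)[OF q] regular_lift[OF Z q] \<phi>])

lemma summand_of_regular_lift:
  assumes P: "summand_of R (regular_mod R) P" and Z: "right_module R Z"
    and q: "q \<in> mod_epi R Z Y" and h: "h \<in> mod_hom R P Y"
  shows "\<exists>l\<in>mod_hom R P Z. \<forall>x\<in>carrier P. q (l x) = h x"
proof -
  have Pm: "right_module R P" using P by (simp add: summand_of_def)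
  show ?thesis by (rule thru_regular_lift[OF Pm Z q thru_summand[OF P mod_hom_id h]])
qed

lemma summand_of_mod_pow:
  assumes M: "right_module R M" shows "summand_of R M (mod_pow M n)"
proof -
  interpret M: right_module R M by fact
  note P = right_module_mod_pow[OF M, of n]
  interpret P: right_module R "mod_pow M n" by (rule P)
  \<comment> \<open>\<open>?t m\<close> keeps the first m coordinates. It is a sum of m maps that
    each factor through one copy of M, and \<open>?t n\<close> is the identity.\<close>
  let ?t = "\<lambda>m f. \<lambda>i\<in>{..<n}. if i < m then f i else \<zero>\<^bsub>M\<^esub>"
  have "?t m \<in> thru R M (mod_pow M n) (mod_pow M n)" if "m \<le> n" for m
    using that
  proof (induction m)
    case 0
    show ?case
      by (rule thru_cong[OF thru_zero[OF M P]]) (auto simp: mod_pow_def restrict_def)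
  next
    case (Suc m)
    have m: "m < n" using Suc.prems by simp
    have i: "(\<lambda>x. \<lambda>i\<in>{..<n}. if i = m then x else \<zero>\<^bsub>M\<^esub>) \<in> mod_hom R M (mod_pow M n)"
    proof (rule mod_hom_tuple)
      show "(\<lambda>x. if i = m then x else \<zero>\<^bsub>M\<^esub>) \<in> mod_hom R M M" for i
        by (cases "i = m") (simp_all add: mod_hom_id mod_hom_zero_map[OF M])
    qed
    have c: "(\<lambda>f. \<lambda>i\<in>{..<n}. if i = m then f m else \<zero>\<^bsub>M\<^esub>) \<in> thru R M (mod_pow M n) (mod_pow M n)"
      by (rule thru.comp[OF mod_hom_proj[OF m] i]) simp
    show ?case
    proof (rule thru.add[OF Suc.IH c])
      fix f assume "f \<in> carrier (mod_pow M n)"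
      then have "f i \<in> carrier M" if "i < n" for i
        using that by (rule mod_pow_nth)
      then show "?t (Suc m) f = ?t m f \<oplus>\<^bsub>mod_pow M n\<^esub> (\<lambda>i\<in>{..<n}. if i = m then f m else \<zero>\<^bsub>M\<^esub>)"
        by (auto simp: mod_pow_def less_Suc_eq intro!: restrict_ext)
    qed (use m in simp)
  qed
  from this[of n] have "(\<lambda>f. f) \<in> thru R M (mod_pow M n) (mod_pow M n)"
  proof (rule thru_cong)
    fix f assume "f \<in> carrier (mod_pow M n)"
    then have "restrict f {..<n} = f" by (simp add: mod_pow_def PiE_restrict)
    moreover have "?t n f = restrict f {..<n}" by (auto intro!: restrict_ext)
    ultimately show "f = ?t n f" by simp
  qed simp
  then show ?thesis using P by (simp add: summand_of_def)
qed

text \<open>The last coordinate is a map to M whose kernel embeds in the n-th power by forgetting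
  that coordinate.\<close>

lemma finite_length_mod_pow:
  assumes M: "right_module R M" and f: "finite_length R M"
  shows "finite_length R (mod_pow M n)"
proof (induction n)
  case 0
  show ?case by (rule finite_length_trivial) (auto simp: mod_pow_def)
next
  case (Suc n)
  note P = right_module_mod_pow[OF M]
  let ?e = "\<lambda>f. f n"
  have e: "?e \<in> mod_hom R (mod_pow M (Suc n)) M" by (rule mod_hom_proj) simp
  let ?K = "a_kernel (mod_pow M (Suc n)) M ?e"
  note K = submodule_kernel[OF P M e]
  note Km = right_module_restrict[OF P K]
  have r: "(\<lambda>t. \<lambda>i\<in>{..<n}. t i) \<in> mod_hom R (mod_pow M (Suc n)) (mod_pow M n)"
    by (rule mod_hom_tuple) (rule mod_hom_proj, simp)
  note r' = mod_hom_restrict[OF r submodule_subset[OF K]]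
  show ?case
  proof (rule finite_length_extension[OF P M e f])
    have "inj_on (\<lambda>t. \<lambda>i\<in>{..<n}. t i) ?K"
    proof (rule inj_onI)
      fix s t assume st: "s \<in> ?K" "t \<in> ?K" "(\<lambda>i\<in>{..<n}. s i) = (\<lambda>i\<in>{..<n}. t i)"
      then have E: "s \<in> {..<Suc n} \<rightarrow>\<^sub>E carrier M" "t \<in> {..<Suc n} \<rightarrow>\<^sub>E carrier M" "s n = t n"
        by (simp_all add: a_kernel_iff mod_pow_def)
      have eq: "s i = t i" if "i < Suc n" for i
      proof (cases "i = n")
        case False
        then have "i < n" using that by simp
        then show ?thesis using fun_cong[OF st(3), of i] by simp
      qed (use E in simp)
      show "s = t" by (rule PiE_ext[OF E(1,2)]) (rule eq, simp)
    qed
    then show "finite_length R (mod_pow M (Suc n)\<lparr>carrier := ?K\<rparr>)"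
      using r' by (intro finite_length_mono[OF Km P _ Suc]) (auto simp: mod_mono_def)
  qed
qed

section \<open>Finite generation, projectivity and injectivity\<close>

lemma free_cover:
  assumes X: "fg_mod R X"
  obtains n g where "g \<in> mod_epi R (mod_pow (regular_mod R) n) X"
proof -
  interpret X: right_module R X using X by (simp add: fg_mod_def)
  have Xm: "right_module R X" and f: "fin_gen R X" using X by (simp_all add: fg_mod_def)
  obtain s and n :: nat where s: "s \<in> {..<n} \<rightarrow> carrier X"
    "\<forall>x\<in>carrier X. \<exists>r\<in>{..<n} \<rightarrow> carrier R. x = (\<Oplus>\<^bsub>X\<^esub>i\<in>{..<n}. r i \<odot>\<^bsub>X\<^esub> s i)"
    by (rule X.fin_gen_combinations[OF f])
  let ?g = "\<lambda>r. \<Oplus>\<^bsub>X\<^esub>i\<in>{..<n}. r i \<odot>\<^bsub>X\<^esub> s i"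
  have g: "?g \<in> mod_hom R (mod_pow (regular_mod R) n) X"
    using s(1) by (intro mod_hom_copair[OF Xm right_module_regular[OF X.R.ring_axioms]] mod_hom_regular[OF Xm]) auto
  have "x \<in> ?g ` carrier (mod_pow (regular_mod R) n)" if x: "x \<in> carrier X" for x
  proof -
    obtain r where r: "r \<in> {..<n} \<rightarrow> carrier R" "x = ?g r" using s(2) x by blast
    have "x = ?g (restrict r {..<n})"
      unfolding r(2) using r(1) s(1) by (intro X.M.finsum_cong') (auto simp: Pi_iff)
    moreover have "restrict r {..<n} \<in> carrier (mod_pow (regular_mod R) n)"
      using r(1) by (simp add: mod_pow_def regular_mod_def restrict_PiE_iff Pi_iff)
    ultimately show ?thesis by (rule image_eqI)
  qed
  then have "?g \<in> mod_epi R (mod_pow (regular_mod R) n) X"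
    using g mod_hom_closed[OF g] by (auto simp: mod_epi_def)
  then show thesis by (rule that)
qed

lemma fin_gen_image:
  assumes X: "fg_mod R X" and Y: "right_module R Y" and g: "g \<in> mod_epi R X Y"
  shows "fg_mod R Y"
proof -
  have Xm: "right_module R X" using X by (simp add: fg_mod_def)
  obtain S where S: "finite S" "S \<subseteq> carrier X" "\<forall>U. submodule U R X \<and> S \<subseteq> U \<longrightarrow> U = carrier X"
    using X unfolding fg_mod_def fin_gen_def by (elim exE conjE)
  have "U = carrier Y" if "submodule U R Y \<and> g ` S \<subseteq> U" for U
  proof -
    have "submodule {x \<in> carrier X. g x \<in> U} R X"
      using that by (intro submodule_vimage[OF Xm Y mod_epiD(1)[OF g]]) simp
    moreover have "S \<subseteq> {x \<in> carrier X. g x \<in> U}" using that S(2) by auto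
    ultimately have "{x \<in> carrier X. g x \<in> U} = carrier X"
      by (intro S(3)[rule_format] conjI)
    then have "g ` carrier X \<subseteq> U" by blast
    then show ?thesis
      using that submodule_subset[of U R Y] mod_epiD(2)[OF g] by simp
  qed
  moreover have "g ` S \<subseteq> carrier Y" using S(2) mod_hom_closed[OF mod_epiD(1)[OF g]] by blast
  ultimately show ?thesis
    using Y S(1) unfolding fg_mod_def fin_gen_def
    by (intro conjI exI[of _ "g ` S"] allI impI finite_imageI)
qed

text \<open>Projectivity, injectivity and global dimension quantify over the type
  \<open>umod\<close>. Modules constructed in other types are moved there by this pair of inverse
  maps.\<close>

lemma fg_mod_rep:
  assumes "fg_mod R (M :: ('r, 'm) module)"
  obtains N :: "'r umod" and f g where "fg_mod R N" "f \<in> mod_hom R M N" "g \<in> mod_hom R N M"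
    "\<forall>x\<in>carrier M. g (f x) = x" "\<forall>y\<in>carrier N. f (g y) = y"
proof -
  obtain N :: "'r umod" where N: "fg_mod R N" "mod_isomorphic R M N"
    using fg_mod_representative[OF assms] by blast
  then obtain f where f: "f \<in> mod_hom R M N" "bij_betw f (carrier M) (carrier N)"
    by (auto simp: mod_isomorphic_def)
  have "right_module R M" "right_module R N" using N assms by (simp_all add: fg_mod_def)
  then show thesis
    using mod_hom_inverse[OF _ _ f] that[OF N(1) f(1)] by blast
qed

text \<open>The definition tests lifting against modules of type \<open>umod\<close>; conjugation
  with isomorphisms onto such modules extends it to finitely generated modules of every
  type.\<close>

lemma projective_lift:
  assumes P: "projective_mod R P" and X: "fg_mod R X" and Y: "fg_mod R Y"
    and q: "q \<in> mod_epi R X Y" and h: "h \<in> mod_hom R P Y"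
  shows "\<exists>l\<in>mod_hom R P X. \<forall>p\<in>carrier P. q (l p) = h p"
proof -
  obtain X' :: "'a umod" and f g where X': "fg_mod R X'" "f \<in> mod_hom R X X'" "g \<in> mod_hom R X' X"
    "\<forall>x\<in>carrier X. g (f x) = x" "\<forall>y\<in>carrier X'. f (g y) = y"
    by (rule fg_mod_rep[OF X])
  obtain Y' :: "'a umod" and j k where Y': "fg_mod R Y'" "j \<in> mod_hom R Y Y'" "k \<in> mod_hom R Y' Y"
    "\<forall>x\<in>carrier Y. k (j x) = x" "\<forall>y\<in>carrier Y'. j (k y) = y"
    by (rule fg_mod_rep[OF Y])
  have hom: "(\<lambda>x. j (q (g x))) \<in> mod_hom R X' Y'"
    by (intro mod_hom_comp[OF X'(3)] mod_hom_comp[OF mod_epiD(1)[OF q]] Y'(2))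
  have "y \<in> (\<lambda>x. j (q (g x))) ` carrier X'" if y: "y \<in> carrier Y'" for y
  proof -
    obtain x where x: "x \<in> carrier X" "k y = q x"
      using mod_epi_surj[OF q mod_hom_closed[OF Y'(3) y]] by blast
    then have "y = j (q (g (f x)))" using X'(4) Y'(5) y by (simp flip: x(2))
    then show ?thesis using mod_hom_closed[OF X'(2) x(1)] by blast
  qed
  then have e: "(\<lambda>x. j (q (g x))) \<in> mod_epi R X' Y'"
    using hom mod_hom_closed[OF hom] by (auto simp: mod_epi_def)
  have h': "(\<lambda>x. j (h x)) \<in> mod_hom R P Y'" by (rule mod_hom_comp[OF h Y'(2)])
  obtain l where l: "l \<in> mod_hom R P X'" "\<forall>p\<in>carrier P. j (q (g (l p))) = j (h p)"
    using P e h' X'(1) Y'(1) unfolding projective_mod_def by meson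
  show ?thesis
  proof (intro bexI[OF _ mod_hom_comp[OF l(1) X'(3)]] ballI)
    fix p assume p: "p \<in> carrier P"
    have "q (g (l p)) \<in> carrier Y" "h p \<in> carrier Y"
      using p mod_hom_closed[OF h] mod_hom_closed[OF mod_epiD(1)[OF q]] mod_hom_closed[OF X'(3)]
        mod_hom_closed[OF l(1)] by simp_all
    then show "q (g (l p)) = h p" using l(2) p Y'(4) by metis
  qed
qed

text \<open>The same transport as in \<open>projective_lift\<close>, for extensions.\<close>

lemma injective_extend:
  assumes E: "injective_mod R E" and X: "fg_mod R X" and Y: "fg_mod R Y"
    and q: "q \<in> mod_mono R X Y" and h: "h \<in> mod_hom R X E"
  shows "\<exists>l\<in>mod_hom R Y E. \<forall>x\<in>carrier X. l (q x) = h x"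
proof -
  obtain X' :: "'a umod" and f g where X': "fg_mod R X'" "f \<in> mod_hom R X X'" "g \<in> mod_hom R X' X"
    "\<forall>x\<in>carrier X. g (f x) = x" "\<forall>y\<in>carrier X'. f (g y) = y"
    by (rule fg_mod_rep[OF X])
  obtain Y' :: "'a umod" and j k where Y': "fg_mod R Y'" "j \<in> mod_hom R Y Y'" "k \<in> mod_hom R Y' Y"
    "\<forall>x\<in>carrier Y. k (j x) = x" "\<forall>y\<in>carrier Y'. j (k y) = y"
    by (rule fg_mod_rep[OF Y])
  note gc = mod_hom_closed[OF X'(3)] and qc = mod_hom_closed[OF mod_monoD(1)[OF q]]
  have hom: "(\<lambda>x. j (q (g x))) \<in> mod_hom R X' Y'"
    by (intro mod_hom_comp[OF X'(3)] mod_hom_comp[OF mod_monoD(1)[OF q]] Y'(2))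
  have "inj_on (\<lambda>x. j (q (g x))) (carrier X')"
  proof (rule inj_onI)
    fix x y assume xy: "x \<in> carrier X'" "y \<in> carrier X'" "j (q (g x)) = j (q (g y))"
    then have "k (j (q (g x))) = k (j (q (g y)))" by simp
    then have "q (g x) = q (g y)" using Y'(4) qc[OF gc[OF xy(1)]] qc[OF gc[OF xy(2)]] by simp
    then have "g x = g y" by (rule inj_onD[OF mod_monoD(2)[OF q] _ gc[OF xy(1)] gc[OF xy(2)]])
    then have "f (g x) = f (g y)" by simp
    then show "x = y" using X'(5) xy by simp
  qed
  then have e: "(\<lambda>x. j (q (g x))) \<in> mod_mono R X' Y'"
    using hom by (simp add: mod_mono_def)
  have h': "(\<lambda>x. h (g x)) \<in> mod_hom R X' E" by (rule mod_hom_comp[OF X'(3) h])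
  obtain l where l: "l \<in> mod_hom R Y' E" "\<forall>x\<in>carrier X'. l (j (q (g x))) = h (g x)"
    using E e h' X'(1) Y'(1) unfolding injective_mod_def by meson
  show ?thesis
  proof (intro bexI[OF _ mod_hom_comp[OF Y'(2) l(1)]] ballI)
    fix x assume x: "x \<in> carrier X"
    show "l (j (q x)) = h x"
      using l(2)[rule_format, OF mod_hom_closed[OF X'(2) x]] X'(4) x by simp
  qed
qed

text \<open>In one direction a free cover of P splits; in the other, R lifts along epimorphisms and
  lifting passes to add R. The right-hand side speaks of maps only and no longer involves the type
  \<open>umod\<close>.\<close>

lemma projective_iff_summand:
  assumes R: "ring R"
  shows "projective_mod R P \<longleftrightarrow> summand_of R (regular_mod R) P"
proof
  assume P: "projective_mod R P"
  then have Pf: "fg_mod R P" and Pm: "right_module R P" by (simp_all add: projective_mod_def fg_mod_def)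
  note Rm = right_module_regular[OF R]
  obtain n g where g: "g \<in> mod_epi R (mod_pow (regular_mod R) n) P" by (rule free_cover[OF Pf])
  note F = summand_of_mod_pow[OF Rm, of n]
  have "fg_mod R (mod_pow (regular_mod R) n)"
    by (rule summand_of_fin_gen[OF Rm fin_gen_regular[OF R] F])
  then obtain l where l: "l \<in> mod_hom R P (mod_pow (regular_mod R) n)" "\<forall>p\<in>carrier P. g (l p) = p"
    using projective_lift[OF P _ Pf g mod_hom_id] by blast
  show "summand_of R (regular_mod R) P"
    using l(2) by (intro summand_of_retract[OF Pm F l(1) mod_epiD(1)[OF g]]) simp
next
  assume P: "summand_of R (regular_mod R) P"
  have "fg_mod R P"
    by (rule summand_of_fin_gen[OF right_module_regular[OF R] fin_gen_regular[OF R] P])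
  moreover have "\<exists>l\<in>mod_hom R P X. \<forall>p\<in>carrier P. g (l p) = h p"
    if "g \<in> mod_epi R X Y" "h \<in> mod_hom R P Y" "fg_mod R X" for X Y :: "'a umod" and g h
    using summand_of_regular_lift[OF P _ that(1,2)] that(3) by (simp add: fg_mod_def)
  ultimately show "projective_mod R P" by (auto simp: projective_mod_def)
qed

lemma injective_summand:
  assumes R: "ring R" and T: "injective_mod R T" and E: "summand_of R T E"
  shows "injective_mod R E"
proof -
  have Tf: "right_module R T" "fin_gen R T" using T by (simp_all add: injective_mod_def fg_mod_def)
  have Em: "right_module R E" using E by (simp add: summand_of_def)
  have "\<exists>l\<in>mod_hom R Y E. \<forall>x\<in>carrier X. l (g x) = h x"
    if g: "g \<in> mod_mono R X Y" and h: "h \<in> mod_hom R X E" and f: "fg_mod R X" "fg_mod R Y"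
    for X Y :: "'a umod" and g h
  proof (rule thru_extend[OF _ _ Em mod_monoD(1)[OF g] _ thru_summand[OF E h mod_hom_id]])
    show "right_module R X" "right_module R Y" using f by (simp_all add: fg_mod_def)
    show "\<exists>f'\<in>mod_hom R Y T. \<forall>x\<in>carrier X. f' (g x) = f x" if "f \<in> mod_hom R X T" for f
      by (rule injective_extend[OF T f g that])
  qed
  then show ?thesis
    using summand_of_fin_gen[OF Tf E] by (auto simp: injective_mod_def)
qed

section \<open>Artinian commutative rings have finite length\<close>

lemma ideal_iff_submodule:
  assumes "cring K"
  shows "ideal I K \<longleftrightarrow> submodule I K (regular_mod K)"
proof -
  interpret K: cring K by fact
  have am: "subgroup I (add_monoid (regular_mod K)) \<longleftrightarrow> subgroup I (add_monoid K)"
    unfolding subgroup_def by (simp add: regular_mod_def m_inv_def)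
  have "ideal I K \<longleftrightarrow> subgroup I (add_monoid K) \<and> (\<forall>a\<in>carrier K. \<forall>x\<in>I. x \<otimes>\<^bsub>K\<^esub> a \<in> I)"
  proof (intro iffI conjI ballI)
    assume "subgroup I (add_monoid K) \<and> (\<forall>a\<in>carrier K. \<forall>x\<in>I. x \<otimes>\<^bsub>K\<^esub> a \<in> I)"
    then have s: "subgroup I (add_monoid K)" and m: "\<forall>a\<in>carrier K. \<forall>x\<in>I. x \<otimes>\<^bsub>K\<^esub> a \<in> I" by auto
    have c: "x \<in> carrier K" if "x \<in> I" for x using subgroup.mem_carrier[OF s that] by simp
    show "ideal I K"
    proof (rule idealI[OF K.ring_axioms s])
      fix a x assume "a \<in> I" "x \<in> carrier K"
      moreover from this show ax: "a \<otimes>\<^bsub>K\<^esub> x \<in> I" using m by simp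
      ultimately show "x \<otimes>\<^bsub>K\<^esub> a \<in> I" using c[of a] K.m_comm[of x a] by simp
    qed
  next
    assume "ideal I K"
    then interpret I: ideal I K .
    show "subgroup I (add_monoid K)" by (rule I.a_subgroup)
    show "x \<otimes>\<^bsub>K\<^esub> a \<in> I" if "a \<in> carrier K" "x \<in> I" for a x using I.I_r_closed that by blast
  qed
  then show ?thesis
    unfolding submodule_def submodule_axioms_def am by (auto simp: regular_mod_def)
qed

lemma artinian_dcc:
  assumes "artinian_cring K" "\<forall>n :: nat. ideal (I n) K" "\<forall>n. I (Suc n) \<subseteq> I n"
  shows "\<exists>n. \<forall>m\<ge>n. I m = I n"
proof -
  have "(\<forall>n. ideal (I n) K) \<and> (\<forall>n. I (Suc n) \<subseteq> I n) \<longrightarrow> (\<exists>n. \<forall>m\<ge>n. I m = I n)"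
    using assms(1) unfolding artinian_cring_def by (rule conjunct2[THEN spec])
  then show ?thesis using assms(2,3) by (rule mp[OF _ conjI])
qed

text \<open>The chain condition concerns sequences; it makes proper inclusion well-founded on the
  ideals satisfying P, and a well-founded relation has minimal elements.\<close>

lemma artinian_minimal:
  assumes K: "artinian_cring K" and "P I0" and P: "\<And>I. P I \<Longrightarrow> ideal I K"
  shows "\<exists>I. P I \<and> (\<forall>J. P J \<longrightarrow> J \<subseteq> I \<longrightarrow> J = I)"
proof -
  let ?r = "{(J, I). P J \<and> P I \<and> J \<subset> I}"
  have "wf ?r"
    unfolding wf_iff_no_infinite_down_chain
  proof
    assume "\<exists>f. \<forall>i. (f (Suc i), f i) \<in> ?r"
    then obtain f where f: "\<forall>i. (f (Suc i), f i) \<in> ?r" by (elim exE)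
    have f1: "\<forall>n. ideal (f n) K" and f2: "\<forall>n. f (Suc n) \<subseteq> f n" using f P by auto
    obtain n where n: "\<forall>m\<ge>n. f m = f n"
      using artinian_dcc[OF K f1 f2] by (elim exE)
    have "f (Suc n) = f n" by (rule n[rule_format]) simp
    moreover have "f (Suc n) \<subset> f n" using f by simp
    ultimately show False by blast
  qed
  then have "\<exists>I\<in>Collect P. \<forall>J. (J, I) \<in> ?r \<longrightarrow> J \<notin> Collect P"
    unfolding wf_eq_minimal using \<open>P I0\<close> by blast
  then obtain I where I: "I \<in> Collect P" "\<forall>J. (J, I) \<in> ?r \<longrightarrow> J \<notin> Collect P"
    by (elim bexE)
  have "J = I" if "P J" "J \<subseteq> I" for J
  proof (rule ccontr)
    assume "J \<noteq> I"
    then have "(J, I) \<in> ?r" using that I(1) by blast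
    then have "J \<notin> Collect P" by (rule I(2)[rule_format])
    then show False using that(1) by simp
  qed
  then show ?thesis using I(1) by (intro exI[of _ I]) simp
qed

text \<open>
  If the statement fails, choose an ideal \<open>I\<close> minimal among those of infinite length. Multiplication
  by a scalar is zero or surjective on \<open>I\<close>, so the scalars act through a field; a hyperplane of
  \<open>I\<close> is then a proper subideal with simple quotient, and \<open>I\<close> has finite length after all.
\<close>

lemma artinian_finite_length:
  assumes K: "artinian_cring K"
  shows "finite_length K (regular_mod K)"
proof (rule ccontr)
  assume no: "\<not> ?thesis"
  have Kc: "cring K" using K by (simp add: artinian_cring_def)
  interpret K: cring K by fact
  let ?M = "regular_mod K"
  have M: "right_module K ?M" by (rule right_module_regular[OF K.ring_axioms])
  note id_sub = ideal_iff_submodule[OF Kc]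
  let ?P = "\<lambda>I. submodule I K ?M \<and> \<not> finite_length K (?M\<lparr>carrier := I\<rparr>)"
  have "?P (carrier ?M)" using no submodule_carrier[OF M] by simp
  then obtain I where I: "?P I" "\<forall>J. ?P J \<longrightarrow> J \<subseteq> I \<longrightarrow> J = I"
    using artinian_minimal[OF K, of ?P] id_sub by blast
  define N where "N = ?M\<lparr>carrier := I\<rparr>"
  have Is: "submodule I K ?M" and Nno: "\<not> finite_length K N" using I(1) by (simp_all add: N_def)
  have N: "right_module K N" unfolding N_def by (rule right_module_restrict[OF M Is])
  interpret N: right_module K N by fact
  have proper: "finite_length K (N\<lparr>carrier := V\<rparr>)" if "submodule V K N" "V \<noteq> carrier N" for V
  proof -
    have "submodule V K ?M" "V \<subseteq> I" using that(1) submodule_restrict_iff[OF M Is] by (simp_all add: N_def)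
    moreover have "V \<noteq> I" using that(2) by (simp add: N_def)
    ultimately have "finite_length K (?M\<lparr>carrier := V\<rparr>)" using I(2) by blast
    then show ?thesis by (simp add: N_def)
  qed
  have smult_comm: "c \<odot>\<^bsub>N\<^esub> (d \<odot>\<^bsub>N\<^esub> x) = d \<odot>\<^bsub>N\<^esub> (c \<odot>\<^bsub>N\<^esub> x)"
    if "c \<in> carrier K" "d \<in> carrier K" "x \<in> carrier N" for c d x
    using that N.smult_assoc[of c d x] N.smult_assoc[of d c x] K.m_comm[of c d] by simp
  have hc: "(\<lambda>x. c \<odot>\<^bsub>N\<^esub> x) \<in> mod_hom K N N" if "c \<in> carrier K" for c
    using that by (intro mod_homI) (auto simp: N.smult_r_distr smult_comm)
  \<comment> \<open>If multiplication by c is neither zero nor onto, its kernel and image are both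
    proper, hence of finite length by minimality of I, and N would be an extension of the
    two.\<close>
  have surj: "(\<lambda>x. c \<odot>\<^bsub>N\<^esub> x) ` carrier N = carrier N"
    if c: "c \<in> carrier K" and x: "x \<in> carrier N" "c \<odot>\<^bsub>N\<^esub> x \<noteq> \<zero>\<^bsub>N\<^esub>" for c x
  proof (rule ccontr)
    assume ns: "(\<lambda>x. c \<odot>\<^bsub>N\<^esub> x) ` carrier N \<noteq> carrier N"
    let ?h = "\<lambda>x. c \<odot>\<^bsub>N\<^esub> x"
    let ?L = "N\<lparr>carrier := ?h ` carrier N\<rparr>"
    have s: "submodule (?h ` carrier N) K N"
      by (rule submodule_image[OF N N hc[OF c] submodule_carrier[OF N]])
    have h: "?h \<in> mod_hom K N ?L" by (rule mod_hom_corestrict[OF hc[OF c]]) simp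
    have L: "right_module K ?L" by (rule right_module_restrict[OF N s])
    have "x \<notin> a_kernel N ?L ?h" using x by (simp add: a_kernel_iff)
    then have "a_kernel N ?L ?h \<noteq> carrier N" using x(1) by blast
    then have "finite_length K (N\<lparr>carrier := a_kernel N ?L ?h\<rparr>)"
      by (rule proper[OF submodule_kernel[OF N L h]])
    then have "finite_length K N"
      by (rule finite_length_extension[OF N L h proper[OF s ns]])
    then show False using Nno by contradiction
  qed
  \<comment> \<open>The ideals generated by the powers of c become stationary, which gives c^n = d
    c^(n+1). Since c^n maps N onto N, this relation says that d inverts the action of c.\<close>
  have inverse: "\<exists>d\<in>carrier K. \<forall>y\<in>carrier N. d \<odot>\<^bsub>N\<^esub> (c \<odot>\<^bsub>N\<^esub> y) = y"
    if c: "c \<in> carrier K" and x: "x \<in> carrier N" "c \<odot>\<^bsub>N\<^esub> x \<noteq> \<zero>\<^bsub>N\<^esub>" for c x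
  proof -
    let ?C = "\<lambda>n::nat. (\<lambda>a. a \<otimes>\<^bsub>K\<^esub> (c [^]\<^bsub>K\<^esub> n)) ` carrier K"
    have "ideal (?C n) K" for n
    proof -
      have "(\<lambda>a. a \<odot>\<^bsub>?M\<^esub> (c [^]\<^bsub>K\<^esub> n)) \<in> mod_hom K ?M ?M"
        using c by (intro mod_hom_regular[OF M]) (simp add: regular_mod_def)
      then have "submodule ((\<lambda>a. a \<odot>\<^bsub>?M\<^esub> (c [^]\<^bsub>K\<^esub> n)) ` carrier ?M) K ?M"
        by (rule submodule_image[OF M M _ submodule_carrier[OF M]])
      moreover have "(\<lambda>a. a \<odot>\<^bsub>?M\<^esub> (c [^]\<^bsub>K\<^esub> n)) ` carrier ?M = ?C n"
        using c by (auto simp: regular_mod_def K.m_comm intro!: image_cong)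
      ultimately show ?thesis by (simp add: id_sub)
    qed
    moreover have "?C (Suc n) \<subseteq> ?C n" for n
    proof
      fix z assume "z \<in> ?C (Suc n)"
      then obtain a where a: "a \<in> carrier K" "z = a \<otimes>\<^bsub>K\<^esub> (c [^]\<^bsub>K\<^esub> Suc n)" by blast
      then have "z = (a \<otimes>\<^bsub>K\<^esub> c) \<otimes>\<^bsub>K\<^esub> (c [^]\<^bsub>K\<^esub> n)"
        using c by (simp add: K.m_ac)
      then show "z \<in> ?C n" using a c by (intro image_eqI[of _ _ "a \<otimes>\<^bsub>K\<^esub> c"]) auto
    qed
    ultimately have "\<exists>n. \<forall>m\<ge>n. ?C m = ?C n" by (intro artinian_dcc[OF K] allI)
    then obtain n where n: "\<forall>m\<ge>n. ?C m = ?C n" by (elim exE)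
    have "c [^]\<^bsub>K\<^esub> n \<in> ?C n" using c by (intro image_eqI[of _ _ "\<one>\<^bsub>K\<^esub>"]) auto
    moreover have "?C (Suc n) = ?C n" by (rule n[rule_format]) simp
    ultimately have "c [^]\<^bsub>K\<^esub> n \<in> ?C (Suc n)" by (simp only:)
    then obtain d where d: "d \<in> carrier K" "c [^]\<^bsub>K\<^esub> n = d \<otimes>\<^bsub>K\<^esub> (c [^]\<^bsub>K\<^esub> Suc n)" by blast
    have onto: "\<exists>z\<in>carrier N. y = (c [^]\<^bsub>K\<^esub> m) \<odot>\<^bsub>N\<^esub> z" if "y \<in> carrier N" for y and m :: nat
      using that
    proof (induction m)
      case 0
      then show ?case by (intro bexI[of _ y]) auto
    next
      case (Suc m)
      then obtain z where z: "z \<in> carrier N" "y = (c [^]\<^bsub>K\<^esub> m) \<odot>\<^bsub>N\<^esub> z" by blast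
      have "z \<in> (\<lambda>x. c \<odot>\<^bsub>N\<^esub> x) ` carrier N" using surj[OF c x] z(1) by simp
      then obtain w where w: "w \<in> carrier N" "z = c \<odot>\<^bsub>N\<^esub> w" by blast
      have "y = (c \<otimes>\<^bsub>K\<^esub> (c [^]\<^bsub>K\<^esub> m)) \<odot>\<^bsub>N\<^esub> w" using z w c by (simp add: N.smult_assoc)
      then have "y = (c [^]\<^bsub>K\<^esub> Suc m) \<odot>\<^bsub>N\<^esub> w" using c by (simp add: K.m_comm)
      then show ?case using w(1) by blast
    qed
    have "d \<odot>\<^bsub>N\<^esub> (c \<odot>\<^bsub>N\<^esub> y) = y" if y: "y \<in> carrier N" for y
    proof -
      obtain z where z: "z \<in> carrier N" "y = (c [^]\<^bsub>K\<^esub> n) \<odot>\<^bsub>N\<^esub> z" using onto[OF y, of n] by blast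
      have "d \<odot>\<^bsub>N\<^esub> (c \<odot>\<^bsub>N\<^esub> y) = (d \<otimes>\<^bsub>K\<^esub> (c [^]\<^bsub>K\<^esub> Suc n)) \<odot>\<^bsub>N\<^esub> z"
        using z d(1) c by (simp add: N.smult_assoc smult_comm)
      also have "\<dots> = y" unfolding d(2)[symmetric] using z(2) by (rule sym)
      finally show ?thesis .
    qed
    then show ?thesis using d(1) by blast
  qed
  obtain x0 where x0: "x0 \<in> carrier N" "x0 \<noteq> \<zero>\<^bsub>N\<^esub>"
    using finite_length_trivial[of N K] Nno submodule_zero[OF submodule_carrier[OF N]] by blast
  \<comment> \<open>The hyperplane is obtained by Zorn's lemma, as a submodule maximal among those
    that avoid a chosen nonzero element x0.\<close>
  let ?A = "{W. submodule W K N \<and> x0 \<notin> W}"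
  have "\<exists>W\<in>?A. \<forall>X\<in>?A. W \<subseteq> X \<longrightarrow> X = W"
  proof (rule subset_Zorn_nonempty)
    show "?A \<noteq> {}" using submodule_zero_set[OF N] x0 by blast
    fix \<C> assume C: "\<C> \<noteq> {}" "subset.chain ?A \<C>"
    then have sub: "submodule X K N" "x0 \<notin> X" if "X \<in> \<C>" for X
      using that by (auto simp: subset_chain_def)
    have cmp: "X \<subseteq> Y \<or> Y \<subseteq> X" if "X \<in> \<C>" "Y \<in> \<C>" for X Y
      using C(2) that by (auto simp: subset_chain_def)
    have "submodule (\<Union>\<C>) K N"
    proof (rule submoduleI'[OF N])
      show "\<Union>\<C> \<subseteq> carrier N" using sub(1) submodule_subset by blast
      show "\<zero>\<^bsub>N\<^esub> \<in> \<Union>\<C>" using C(1) sub(1) submodule_zero by blast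
      show "x \<oplus>\<^bsub>N\<^esub> y \<in> \<Union>\<C>" if xy: "x \<in> \<Union>\<C>" "y \<in> \<Union>\<C>" for x y
      proof -
        obtain X Y where "X \<in> \<C>" "Y \<in> \<C>" "x \<in> X" "y \<in> Y" using xy by blast
        then obtain Z where "Z \<in> \<C>" "x \<in> Z" "y \<in> Z" using cmp by blast
        then show ?thesis using submodule_add[OF sub(1)] by blast
      qed
      show "a \<odot>\<^bsub>N\<^esub> x \<in> \<Union>\<C>" if ax: "a \<in> carrier K" "x \<in> \<Union>\<C>" for a x
        using ax submodule_smult[OF sub(1)] by blast
    qed
    then show "\<Union>\<C> \<in> ?A" using sub(2) by blast
  qed
  then obtain W where W: "submodule W K N" "x0 \<notin> W"
    "\<And>X. \<lbrakk>submodule X K N; x0 \<notin> X; W \<subseteq> X\<rbrakk> \<Longrightarrow> X = W" by blast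
  note q = quot_mod_proj[OF N W(1)]
  let ?q = "\<lambda>x. W +>\<^bsub>N\<^esub> x"
  let ?Q = "quot_mod N W"
  \<comment> \<open>W is a maximal submodule. For y outside W, maximality puts x0 into W + Ky, so x0
    = w + cy with c acting invertibly; any V properly above W contains x0, hence cy, hence
    y.\<close>
  have top: "V = carrier N" if V: "submodule V K N" "W \<subseteq> V" "V \<noteq> W" for V
  proof -
    have x0V: "x0 \<in> V" using W(3) V by blast
    have "y \<in> V" if y: "y \<in> carrier N" for y
    proof (cases "y \<in> W")
      case False
      let ?Y = "(\<lambda>a. a \<odot>\<^bsub>N\<^esub> y) ` carrier ?M"
      have Y: "submodule ?Y K N"
        by (rule submodule_image[OF M N mod_hom_regular[OF N y] submodule_carrier[OF M]])
      note s = submodule_sum[OF N W(1) Y]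
      have "\<one>\<^bsub>K\<^esub> \<odot>\<^bsub>N\<^esub> y \<in> ?Y" by (rule imageI) (simp add: regular_mod_def)
      then have "y \<in> W <+>\<^bsub>N\<^esub> ?Y" using s(3) y by auto
      then have "x0 \<in> W <+>\<^bsub>N\<^esub> ?Y" using W(3)[OF s(1) _ s(2)] False by blast
      then obtain w c where wc: "w \<in> W" "c \<in> carrier K" "x0 = w \<oplus>\<^bsub>N\<^esub> (c \<odot>\<^bsub>N\<^esub> y)"
        by (auto simp: submodule_sum_iff regular_mod_def)
      have wN: "w \<in> carrier N" using wc(1) submodule_subset[OF W(1)] by blast
      have "c \<odot>\<^bsub>N\<^esub> y \<noteq> \<zero>\<^bsub>N\<^esub>"
      proof
        assume "c \<odot>\<^bsub>N\<^esub> y = \<zero>\<^bsub>N\<^esub>"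
        then show False using wc W(2) wN by simp
      qed
      then obtain d where d: "d \<in> carrier K" "d \<odot>\<^bsub>N\<^esub> (c \<odot>\<^bsub>N\<^esub> y) = y"
        using inverse[OF wc(2) y] y by blast
      have "x0 \<ominus>\<^bsub>N\<^esub> w = c \<odot>\<^bsub>N\<^esub> y"
        using wc(2,3) wN y by (simp add: N.M.add_diff_cancel)
      moreover have "x0 \<ominus>\<^bsub>N\<^esub> w \<in> V" using x0V wc(1) V(2) by (intro submodule_diff[OF V(1)]) auto
      ultimately show ?thesis using submodule_smult[OF V(1) d(1), of "c \<odot>\<^bsub>N\<^esub> y"] d(2) by simp
    qed (use V in blast)
    then show ?thesis using submodule_subset[OF V(1)] by blast
  qed
  have simple: "U = carrier ?Q" if U: "submodule U K ?Q" "U \<noteq> {\<zero>\<^bsub>?Q\<^esub>}" for U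
  proof -
    let ?V = "{x \<in> carrier N. ?q x \<in> U}"
    have V: "submodule ?V K N" by (rule submodule_vimage[OF N q(1) mod_epiD(1)[OF q(2)] U(1)])
    have WV: "W \<subseteq> ?V"
    proof
      fix w assume w: "w \<in> W"
      then have "w \<in> carrier N" using submodule_subset[OF W(1)] by blast
      then show "w \<in> ?V" using w q(3)[of w] submodule_zero[OF U(1)] by simp
    qed
    obtain u where u: "u \<in> U" "u \<noteq> \<zero>\<^bsub>?Q\<^esub>" using U(2) submodule_zero[OF U(1)] by blast
    then obtain x where x: "x \<in> carrier N" "u = ?q x"
      using mod_epi_surj[OF q(2)] submodule_subset[OF U(1)] by blast
    have xV: "x \<in> ?V" using x u(1) by (intro CollectI conjI) simp_all
    have xW: "x \<notin> W" using u(2) unfolding x(2) q(3)[OF x(1)] .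
    have "?V \<noteq> W" using xW equalityD1[THEN subsetD, OF _ xV, of W] by blast
    then have "?V = carrier N" by (rule top[OF V WV])
    then have "?q ` carrier N \<subseteq> U" by blast
    then have "carrier ?Q \<subseteq> U" unfolding mod_epiD(2)[OF q(2)] .
    then show ?thesis using submodule_subset[OF U(1)] by (rule subset_antisym[rotated])
  qed
  \<comment> \<open>The quotient is simple, so the two values 0 and 1 form a rank.\<close>
  have "finite_length K ?Q"
    unfolding finite_length_def
  proof (intro exI[of _ "\<lambda>U. if U = {\<zero>\<^bsub>?Q\<^esub>} then 0 else 1"] allI impI)
    fix U V assume UV: "submodule U K ?Q \<and> submodule V K ?Q \<and> U \<subset> V"
    then have "U \<noteq> carrier ?Q" using submodule_subset[of V K ?Q] by blast
    then have "U = {\<zero>\<^bsub>?Q\<^esub>}" using simple UV by blast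
    moreover have "V \<noteq> {\<zero>\<^bsub>?Q\<^esub>}" using UV calculation by blast
    ultimately show "(if U = {\<zero>\<^bsub>?Q\<^esub>} then 0 else 1) < (if V = {\<zero>\<^bsub>?Q\<^esub>} then 0 else (1::nat))" by simp
  qed
  moreover have "a_kernel N ?Q ?q = W"
    using q(3) submodule_subset[OF W(1)] unfolding set_eq_iff a_kernel_iff by blast
  moreover have "W \<noteq> carrier N" using W(2) x0 by blast
  ultimately have "finite_length K N"
    using proper[OF W(1)] by (intro finite_length_extension[OF N q(1) mod_epiD(1)[OF q(2)]]) simp_all
  then show False using Nno by contradiction
qed

lemma fg_finite_length:
  assumes "artinian_cring K" "fg_mod K X"
  shows "finite_length K X"
proof -
  have K: "ring K" using assms(1) by (simp add: artinian_cring_def cring.axioms(1))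
  have X: "right_module K X" using assms(2) by (simp add: fg_mod_def)
  obtain n g where g: "g \<in> mod_epi K (mod_pow (regular_mod K) n) X"
    by (rule free_cover[OF assms(2)])
  note M = right_module_regular[OF K]
  show ?thesis
    by (rule finite_length_epi[OF right_module_mod_pow[OF M] X g
          finite_length_mod_pow[OF M artinian_finite_length[OF assms(1)]]])
qed

section \<open>Restriction of scalars and the standard duality\<close>

text \<open>Equality of homomorphisms may be checked on generators, because the equalizer is a
  submodule.\<close>

lemma mod_hom_eq_on:
  assumes M: "right_module R M" and f: "f \<in> mod_hom R M N" and g: "g \<in> mod_hom R M N"
    and N: "right_module R N"
  shows "submodule {x \<in> carrier M. f x = g x} R M"
proof -
  interpret M: right_module R M by fact
  show ?thesis
    by (intro submoduleI'[OF M])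
      (auto simp: mod_hom_zero[OF M N f] mod_hom_zero[OF M N g] mod_hom_add[OF f] mod_hom_add[OF g]
        mod_hom_smult[OF f] mod_hom_smult[OF g])
qed

lemma fin_gen_enum:
  assumes "fin_gen R M"
  obtains n :: nat and s where "\<forall>i<n. s i \<in> carrier M"
    "\<forall>U. submodule U R M \<longrightarrow> (\<forall>i<n. s i \<in> U) \<longrightarrow> U = carrier M"
proof -
  obtain S where S: "finite S" "S \<subseteq> carrier M" "\<forall>U. submodule U R M \<and> S \<subseteq> U \<longrightarrow> U = carrier M"
    using assms unfolding fin_gen_def by (elim exE conjE)
  obtain n :: nat and s where s: "S = s ` {i. i < n}"
    using finite_imp_nat_seg_image_inj_on[OF S(1)] by (elim exE conjE)
  have "\<forall>i<n. s i \<in> carrier M" using S(2) s by blast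
  moreover have "\<forall>U. submodule U R M \<longrightarrow> (\<forall>i<n. s i \<in> U) \<longrightarrow> U = carrier M"
  proof (intro allI impI)
    fix U assume "submodule U R M" "\<forall>i<n. s i \<in> U"
    then show "U = carrier M" using s by (intro S(3)[rule_format] conjI) auto
  qed
  ultimately show thesis by (rule that)
qed

lemma restrict_mod_hom:
  assumes "right_module R M" "f \<in> mod_hom R M N"
  shows "restrict f (carrier M) \<in> mod_hom R M N"
  by (rule mod_hom_cong[OF assms]) simp

text \<open>\<open>dual_mod\<close>, \<open>end_ring\<close> and \<open>hom_mod\<close> carry the
  same pointwise addition of extensional homomorphisms; this settles the group axioms for all
  three.\<close>

lemma abelian_group_homs:
  assumes M: "right_module R M" and Y: "right_module R Y"
    and c: "carrier N = mod_hom R M Y \<inter> extensional (carrier M)"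
    and z: "\<zero>\<^bsub>N\<^esub> = (\<lambda>x\<in>carrier M. \<zero>\<^bsub>Y\<^esub>)"
    and a: "add N = (\<lambda>f g. \<lambda>x\<in>carrier M. f x \<oplus>\<^bsub>Y\<^esub> g x)"
  shows "abelian_group N"
proof -
  interpret Y: right_module R Y by fact
  note r = restrict_mod_hom[OF M]
  have cl: "f x \<in> carrier Y" if "f \<in> carrier N" "x \<in> carrier M" for f x
    using that mod_hom_closed[of f R M Y x] by (simp add: c)
  show ?thesis
  proof (rule abelian_groupI)
    show "\<zero>\<^bsub>N\<^esub> \<in> carrier N" by (simp add: c z r mod_hom_zero_map[OF Y])
  next
    fix f assume f: "f \<in> carrier N"
    show "\<zero>\<^bsub>N\<^esub> \<oplus>\<^bsub>N\<^esub> f = f"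
    proof
      fix x show "(\<zero>\<^bsub>N\<^esub> \<oplus>\<^bsub>N\<^esub> f) x = f x"
        using f cl[OF f, of x] by (cases "x \<in> carrier M") (simp_all add: a z c extensional_def)
    qed
    have h: "(\<lambda>x. \<ominus>\<^bsub>Y\<^esub> f x) \<in> mod_hom R M Y"
      using f by (intro mod_hom_uminus[OF Y]) (simp add: c)
    show "\<exists>g\<in>carrier N. g \<oplus>\<^bsub>N\<^esub> f = \<zero>\<^bsub>N\<^esub>"
    proof (rule bexI[of _ "\<lambda>x\<in>carrier M. \<ominus>\<^bsub>Y\<^esub> f x"])
      show "(\<lambda>x\<in>carrier M. \<ominus>\<^bsub>Y\<^esub> f x) \<oplus>\<^bsub>N\<^esub> f = \<zero>\<^bsub>N\<^esub>"
        using cl[OF f] by (auto simp: a z restrict_def fun_eq_iff Y.M.l_neg)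
    qed (simp add: c r[OF h])
    fix g assume g: "g \<in> carrier N"
    show "f \<oplus>\<^bsub>N\<^esub> g = g \<oplus>\<^bsub>N\<^esub> f"
      using cl[OF f] cl[OF g] by (auto simp: a restrict_def fun_eq_iff Y.M.a_comm)
    have "(\<lambda>x. f x \<oplus>\<^bsub>Y\<^esub> g x) \<in> mod_hom R M Y"
      using f g by (intro mod_hom_plus[OF Y]) (simp_all add: c)
    then show "f \<oplus>\<^bsub>N\<^esub> g \<in> carrier N" by (simp add: c a r)
    fix h assume h: "h \<in> carrier N"
    show "f \<oplus>\<^bsub>N\<^esub> g \<oplus>\<^bsub>N\<^esub> h = f \<oplus>\<^bsub>N\<^esub> (g \<oplus>\<^bsub>N\<^esub> h)"
      using cl[OF f] cl[OF g] cl[OF h] by (auto simp: a restrict_def fun_eq_iff Y.M.a_assoc)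
  qed
qed

text \<open>X regarded as a K-module, with c acting as the element c 1 of A. Finite length over A is
  deduced from finite length over K by way of this record.\<close>

definition scalar_mod :: "('k, 'a) module \<Rightarrow> ('a, 'm) module \<Rightarrow> ('k, 'm) module" where
  "scalar_mod A X = \<lparr>carrier = carrier X, mult = undefined, one = undefined, zero = \<zero>\<^bsub>X\<^esub>,
     add = add X, smult = (\<lambda>c x. (c \<odot>\<^bsub>A\<^esub> \<one>\<^bsub>A\<^esub>) \<odot>\<^bsub>X\<^esub> x)\<rparr>"

section \<open>Restriction of scalars from A to K\<close>

context artin_algebra
begin

lemma rings: "cring K" "ring K" "ring A" "right_module K A"
proof -
  show K: "cring K" "ring K" by unfold_locales
  show "ring A" by unfold_locales
  show "right_module K A" using right_module_iff_module[OF K(1)] module_axioms by blast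
qed

lemma scalar_closed: "c \<in> carrier K \<Longrightarrow> c \<odot>\<^bsub>A\<^esub> \<one>\<^bsub>A\<^esub> \<in> carrier A"
  by (rule smult_closed) simp_all

lemma scalar_left: "\<lbrakk>c \<in> carrier K; a \<in> carrier A\<rbrakk> \<Longrightarrow> (c \<odot>\<^bsub>A\<^esub> \<one>\<^bsub>A\<^esub>) \<otimes>\<^bsub>A\<^esub> a = c \<odot>\<^bsub>A\<^esub> a"
  using smult_mult_l[of c "\<one>\<^bsub>A\<^esub>" a] by simp

lemma scalar_right: "\<lbrakk>c \<in> carrier K; a \<in> carrier A\<rbrakk> \<Longrightarrow> a \<otimes>\<^bsub>A\<^esub> (c \<odot>\<^bsub>A\<^esub> \<one>\<^bsub>A\<^esub>) = c \<odot>\<^bsub>A\<^esub> a"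
  using smult_mult_r[of c a "\<one>\<^bsub>A\<^esub>"] by simp

lemma scalar_add:
  "\<lbrakk>c \<in> carrier K; d \<in> carrier K\<rbrakk> \<Longrightarrow>
    (c \<oplus>\<^bsub>K\<^esub> d) \<odot>\<^bsub>A\<^esub> \<one>\<^bsub>A\<^esub> = c \<odot>\<^bsub>A\<^esub> \<one>\<^bsub>A\<^esub> \<oplus>\<^bsub>A\<^esub> d \<odot>\<^bsub>A\<^esub> \<one>\<^bsub>A\<^esub>"
  by (rule smult_l_distr) simp_all

lemma scalar_mult:
  assumes "c \<in> carrier K" "d \<in> carrier K"
  shows "(c \<otimes>\<^bsub>K\<^esub> d) \<odot>\<^bsub>A\<^esub> \<one>\<^bsub>A\<^esub> = (c \<odot>\<^bsub>A\<^esub> \<one>\<^bsub>A\<^esub>) \<otimes>\<^bsub>A\<^esub> (d \<odot>\<^bsub>A\<^esub> \<one>\<^bsub>A\<^esub>)"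
  using assms smult_assoc1[of c d "\<one>\<^bsub>A\<^esub>"] scalar_left[of c "d \<odot>\<^bsub>A\<^esub> \<one>\<^bsub>A\<^esub>"] scalar_closed by simp

lemma scalar_one: "\<one>\<^bsub>K\<^esub> \<odot>\<^bsub>A\<^esub> \<one>\<^bsub>A\<^esub> = \<one>\<^bsub>A\<^esub>"
  by (rule smult_one) simp

lemma right_module_scalar:
  assumes "right_module A X" shows "right_module K (scalar_mod A X)"
proof -
  interpret X: right_module A X by fact
  have "abelian_group (scalar_mod A X)"
  proof (rule abelian_groupI)
    fix x assume "x \<in> carrier (scalar_mod A X)"
    then show "\<exists>y\<in>carrier (scalar_mod A X). y \<oplus>\<^bsub>scalar_mod A X\<^esub> x = \<zero>\<^bsub>scalar_mod A X\<^esub>"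
      by (intro bexI[of _ "\<ominus>\<^bsub>X\<^esub> x"]) (auto simp: scalar_mod_def X.M.l_neg)
  qed (auto simp: scalar_mod_def X.M.a_ac)
  moreover have "right_module_axioms K (scalar_mod A X)"
    by unfold_locales (simp_all add: scalar_mod_def scalar_closed scalar_add scalar_mult scalar_one
        X.smult_l_distr X.smult_r_distr X.smult_assoc)
  ultimately show ?thesis using rings(2) by (simp add: right_module_def)
qed

lemma mod_hom_scalar:
  "f \<in> mod_hom A X Y \<Longrightarrow> f \<in> mod_hom K (scalar_mod A X) (scalar_mod A Y)"
  by (intro mod_homI) (simp_all add: scalar_mod_def mod_hom_closed mod_hom_add mod_hom_smult scalar_closed)

lemma submodule_scalar:
  assumes "right_module A X" "submodule U A X"
  shows "submodule U K (scalar_mod A X)"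
proof (rule submoduleI'[OF right_module_scalar[OF assms(1)]])
  show "U \<subseteq> carrier (scalar_mod A X)" using submodule_subset[OF assms(2)] by (simp add: scalar_mod_def)
qed (simp_all add: scalar_mod_def submodule_zero[OF assms(2)] submodule_add[OF assms(2)]
      submodule_smult[OF assms(2)] scalar_closed)

text \<open>A-submodules are K-submodules, so a rank over K is also a rank over A.\<close>

lemma finite_length_of_scalar:
  assumes "right_module A X" "finite_length K (scalar_mod A X)"
  shows "finite_length A X"
proof -
  obtain \<rho> :: "_ \<Rightarrow> nat" where
    \<rho>: "\<forall>U V. submodule U K (scalar_mod A X) \<longrightarrow> submodule V K (scalar_mod A X) \<longrightarrow> U \<subset> V \<longrightarrow> \<rho> U < \<rho> V"
    "\<forall>U V. submodule U K (scalar_mod A X) \<longrightarrow> submodule V K (scalar_mod A X) \<longrightarrow> U \<subseteq> V \<longrightarrow> \<rho> U \<le> \<rho> V"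
    by (rule finite_length_rank[OF assms(2)])
  show ?thesis
    unfolding finite_length_def
    by (intro exI[of _ \<rho>] allI impI \<rho>(1)[rule_format] submodule_scalar[OF assms(1)]) simp_all
qed

text \<open>A is finitely generated over the artinian ring K, and the identity matches its given
  K-structure with right multiplication by c 1.\<close>

lemma finite_length_regular: "finite_length K (scalar_mod A (regular_mod A))"
proof (rule finite_length_epi[OF rings(4) right_module_scalar[OF right_module_regular[OF rings(3)]]])
  have "(\<lambda>x. x) \<in> mod_hom K A (scalar_mod A (regular_mod A))"
    by (intro mod_homI) (simp_all add: scalar_mod_def regular_mod_def scalar_right)
  then show "(\<lambda>x. x) \<in> mod_epi K A (scalar_mod A (regular_mod A))"
    by (simp add: mod_epi_def scalar_mod_def regular_mod_def)
  show "finite_length K A"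
    by (rule fg_finite_length[OF artinian_base]) (simp add: fg_mod_def rings(4) fin_gen)
qed

lemma scalar_mod_pow: "scalar_mod A (mod_pow X n) = mod_pow (scalar_mod A X) n"
  by (simp add: scalar_mod_def mod_pow_def)

lemma fg_scalar_finite_length:
  assumes "fg_mod A X" shows "finite_length K (scalar_mod A X)"
proof -
  have X: "right_module A X" using assms by (simp add: fg_mod_def)
  obtain n g where g: "g \<in> mod_epi A (mod_pow (regular_mod A) n) X"
    by (rule free_cover[OF assms])
  note M = right_module_scalar[OF right_module_regular[OF rings(3)]]
  have "g \<in> mod_epi K (mod_pow (scalar_mod A (regular_mod A)) n) (scalar_mod A X)"
    using mod_hom_scalar[OF mod_epiD(1)[OF g]] mod_epiD(2)[OF g]
    by (simp add: mod_epi_def scalar_mod_pow[symmetric]) (simp add: scalar_mod_def)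
  then show ?thesis
    by (rule finite_length_epi[OF right_module_mod_pow[OF M] right_module_scalar[OF X] _
          finite_length_mod_pow[OF M finite_length_regular]])
qed

lemma fg_finite_length_A:
  assumes "fg_mod A X" shows "finite_length A X"
  by (rule finite_length_of_scalar[OF _ fg_scalar_finite_length[OF assms]])
    (use assms in \<open>simp add: fg_mod_def\<close>)

lemma fg_of_finite_length: "\<lbrakk>right_module A X; finite_length A X\<rbrakk> \<Longrightarrow> fg_mod A X"
  by (simp add: fg_mod_def finite_length_fin_gen)

lemma fg_restrict:
  assumes "fg_mod A X" "submodule U A X" shows "fg_mod A (X\<lparr>carrier := U\<rparr>)"
proof -
  have X: "right_module A X" using assms by (simp add: fg_mod_def)
  show ?thesis
    by (rule fg_of_finite_length[OF right_module_restrict[OF X assms(2)]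
          finite_length_restrict[OF X assms(2) fg_finite_length_A[OF assms(1)]]])
qed

text \<open>The element c 1 is central in A, so acting with it commutes with the action of
  A.\<close>

lemma mod_hom_scalar_smult:
  assumes "right_module A X" "c \<in> carrier K"
  shows "(\<lambda>x. (c \<odot>\<^bsub>A\<^esub> \<one>\<^bsub>A\<^esub>) \<odot>\<^bsub>X\<^esub> x) \<in> mod_hom A X X"
proof -
  interpret X: right_module A X by fact
  note c = scalar_closed[OF assms(2)]
  show ?thesis
  proof (rule mod_homI)
    fix a x assume "a \<in> carrier A" "x \<in> carrier X"
    then show "(c \<odot>\<^bsub>A\<^esub> \<one>\<^bsub>A\<^esub>) \<odot>\<^bsub>X\<^esub> (a \<odot>\<^bsub>X\<^esub> x) = a \<odot>\<^bsub>X\<^esub> ((c \<odot>\<^bsub>A\<^esub> \<one>\<^bsub>A\<^esub>) \<odot>\<^bsub>X\<^esub> x)"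
      using c assms(2) by (simp flip: X.smult_assoc add: scalar_left scalar_right)
  qed (simp_all add: c X.smult_r_distr)
qed

lemma finsum_scalar_mod:
  assumes X: "right_module A X" and f: "\<And>i. i < (n::nat) \<Longrightarrow> f i \<in> carrier X"
  shows "(\<Oplus>\<^bsub>scalar_mod A X\<^esub>i\<in>{..<n}. f i) = (\<Oplus>\<^bsub>X\<^esub>i\<in>{..<n}. f i)"
proof -
  interpret X: right_module A X by fact
  interpret S: right_module K "scalar_mod A X" by (rule right_module_scalar[OF X])
  have f': "f i \<in> carrier (scalar_mod A X)" if "i < n" for i
    using f[OF that] by (simp add: scalar_mod_def)
  have "(\<Oplus>\<^bsub>scalar_mod A X\<^esub>i\<in>{..<m}. f i) = (\<Oplus>\<^bsub>X\<^esub>i\<in>{..<m}. f i)" if "m \<le> n" for m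
    using that
  proof (induction m)
    case 0
    show ?case by simp (simp add: scalar_mod_def)
  next
    case (Suc m)
    have "(\<Oplus>\<^bsub>X\<^esub>i\<in>{..<Suc m}. f i) = f m \<oplus>\<^bsub>X\<^esub> (\<Oplus>\<^bsub>X\<^esub>i\<in>{..<m}. f i)"
      using f Suc.prems by (simp add: lessThan_Suc X.M.finsum_insert Pi_iff)
    moreover have "(\<Oplus>\<^bsub>scalar_mod A X\<^esub>i\<in>{..<Suc m}. f i)
        = f m \<oplus>\<^bsub>scalar_mod A X\<^esub> (\<Oplus>\<^bsub>scalar_mod A X\<^esub>i\<in>{..<m}. f i)"
      using f' Suc.prems by (simp add: lessThan_Suc S.M.finsum_insert Pi_iff)
    moreover have "add (scalar_mod A X) = add X" by (simp add: scalar_mod_def)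
    ultimately show ?case using Suc by simp
  qed
  then show ?thesis by simp
qed

section \<open>Finite generation of Hom over K and approximations\<close>

lemma mod_hom_finsum:
  assumes M: "right_module R M" and N: "right_module R N" and h: "h \<in> mod_hom R M N"
    and f: "\<And>i. i < (n::nat) \<Longrightarrow> f i \<in> carrier M"
  shows "h (\<Oplus>\<^bsub>M\<^esub>i\<in>{..<n}. f i) = (\<Oplus>\<^bsub>N\<^esub>i\<in>{..<n}. h (f i))"
proof -
  interpret M: right_module R M by fact
  interpret N: right_module R N by fact
  have hf: "h (f i) \<in> carrier N" if "i < n" for i by (rule mod_hom_closed[OF h f[OF that]])
  have "h (\<Oplus>\<^bsub>M\<^esub>i\<in>{..<m}. f i) = (\<Oplus>\<^bsub>N\<^esub>i\<in>{..<m}. h (f i))" if "m \<le> n" for m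
    using that
  proof (induction m)
    case 0
    show ?case by (simp add: mod_hom_zero[OF M N h])
  next
    case (Suc m)
    have c: "(\<Oplus>\<^bsub>M\<^esub>i\<in>{..<m}. f i) \<in> carrier M" "f m \<in> carrier M"
      using f Suc.prems by (auto intro!: M.M.finsum_closed)
    have "(\<Oplus>\<^bsub>M\<^esub>i\<in>{..<Suc m}. f i) = f m \<oplus>\<^bsub>M\<^esub> (\<Oplus>\<^bsub>M\<^esub>i\<in>{..<m}. f i)"
      using f Suc.prems by (simp add: lessThan_Suc M.M.finsum_insert Pi_iff)
    moreover have "(\<Oplus>\<^bsub>N\<^esub>i\<in>{..<Suc m}. h (f i)) = h (f m) \<oplus>\<^bsub>N\<^esub> (\<Oplus>\<^bsub>N\<^esub>i\<in>{..<m}. h (f i))"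
      using hf Suc.prems by (simp add: lessThan_Suc N.M.finsum_insert Pi_iff)
    ultimately show ?case
      using mod_hom_add[OF h c(2,1)] Suc by simp
  qed
  then show ?thesis by simp
qed

text \<open>Evaluation at k generators of T embeds Hom(T, X) as a K-submodule into the k-th power of
  X. That power has finite length over K, so Hom(T, X) is finitely generated.\<close>

lemma hom_fin_gen:
  fixes T :: "(_, 't) module" and X :: "(_, 'x) module"
  assumes T: "fg_mod A T" and X: "fg_mod A X"
  obtains n :: nat and g where "\<forall>i<n. g i \<in> mod_hom A T X"
    "\<forall>h\<in>mod_hom A T X. \<exists>r\<in>{..<n} \<rightarrow> carrier K. \<forall>t\<in>carrier T.
       h t = (\<Oplus>\<^bsub>X\<^esub>i\<in>{..<n}. (r i \<odot>\<^bsub>A\<^esub> \<one>\<^bsub>A\<^esub>) \<odot>\<^bsub>X\<^esub> g i t)"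
proof -
  have Tm: "right_module A T" and Tf: "fin_gen A T" and Xm: "right_module A X"
    using T X by (simp_all add: fg_mod_def)
  interpret X: right_module A X by fact
  obtain k :: nat and t where t: "\<forall>j<k. t j \<in> carrier T"
    "\<forall>U. submodule U A T \<longrightarrow> (\<forall>j<k. t j \<in> U) \<longrightarrow> U = carrier T"
    by (rule fin_gen_enum[OF Tf])
  let ?S = "scalar_mod A X"
  let ?P = "mod_pow ?S k"
  have S: "right_module K ?S" by (rule right_module_scalar[OF Xm])
  have P: "right_module K ?P" by (rule right_module_mod_pow[OF S])
  have Pl: "finite_length K ?P" by (rule finite_length_mod_pow[OF S fg_scalar_finite_length[OF X]])
  define ev :: "('t \<Rightarrow> 'x) \<Rightarrow> nat \<Rightarrow> 'x" where "ev = (\<lambda>h. \<lambda>j\<in>{..<k}. h (t j))"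
  let ?H = "ev ` mod_hom A T X"
  have sub: "submodule ?H K ?P"
  proof (rule submoduleI'[OF P])
    have "ev h \<in> carrier ?P" if "h \<in> mod_hom A T X" for h
      using t(1) mod_hom_closed[OF that] by (simp add: ev_def mod_pow_def scalar_mod_def)
    then show "?H \<subseteq> carrier ?P" by blast
    show "\<zero>\<^bsub>?P\<^esub> \<in> ?H"
      by (rule image_eqI[OF _ mod_hom_zero_map[OF Xm]]) (simp add: ev_def mod_pow_def scalar_mod_def)
    show "x \<oplus>\<^bsub>?P\<^esub> y \<in> ?H" if xy: "x \<in> ?H" "y \<in> ?H" for x y
    proof -
      obtain f g where fg: "f \<in> mod_hom A T X" "g \<in> mod_hom A T X" "x = ev f" "y = ev g"
        using xy by blast
      show ?thesis
        by (rule image_eqI[OF _ mod_hom_plus[OF Xm fg(1,2)]])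
          (auto simp: fg ev_def mod_pow_def scalar_mod_def restrict_def fun_eq_iff)
    qed
    show "a \<odot>\<^bsub>?P\<^esub> x \<in> ?H" if ax: "a \<in> carrier K" "x \<in> ?H" for a x
    proof -
      obtain f where f: "f \<in> mod_hom A T X" "x = ev f" using ax(2) by blast
      show ?thesis
        by (rule image_eqI[OF _ mod_hom_comp[OF f(1) mod_hom_scalar_smult[OF Xm ax(1)]]])
          (auto simp: f ev_def mod_pow_def scalar_mod_def restrict_def fun_eq_iff)
    qed
  qed
  let ?N = "?P\<lparr>carrier := ?H\<rparr>"
  have N: "right_module K ?N" by (rule right_module_restrict[OF P sub])
  interpret N: right_module K ?N by (rule N)
  have "fin_gen K ?N" by (rule finite_length_fin_gen[OF N finite_length_restrict[OF P sub Pl]])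
  then obtain s and n :: nat where s: "s \<in> {..<n} \<rightarrow> carrier ?N"
    "\<forall>x\<in>carrier ?N. \<exists>r\<in>{..<n} \<rightarrow> carrier K. x = (\<Oplus>\<^bsub>?N\<^esub>i\<in>{..<n}. r i \<odot>\<^bsub>?N\<^esub> s i)"
    by (rule N.fin_gen_combinations)
  have "\<forall>i\<in>{..<n}. \<exists>g. g \<in> mod_hom A T X \<and> s i = ev g" using s(1) by (auto simp: Pi_iff)
  then obtain g where g: "\<forall>i\<in>{..<n}. g i \<in> mod_hom A T X \<and> s i = ev (g i)"
    using bchoice by metis
  have "\<exists>r\<in>{..<n} \<rightarrow> carrier K. \<forall>t\<in>carrier T.
       h t = (\<Oplus>\<^bsub>X\<^esub>i\<in>{..<n}. (r i \<odot>\<^bsub>A\<^esub> \<one>\<^bsub>A\<^esub>) \<odot>\<^bsub>X\<^esub> g i t)" if h: "h \<in> mod_hom A T X" for h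
  proof -
    have "ev h \<in> carrier ?N" using h by simp
    then obtain r where r: "r \<in> {..<n} \<rightarrow> carrier K"
      "ev h = (\<Oplus>\<^bsub>?N\<^esub>i\<in>{..<n}. r i \<odot>\<^bsub>?N\<^esub> s i)" using s(2) by blast
    let ?h = "\<lambda>t. (\<Oplus>\<^bsub>X\<^esub>i\<in>{..<n}. (r i \<odot>\<^bsub>A\<^esub> \<one>\<^bsub>A\<^esub>) \<odot>\<^bsub>X\<^esub> g i t)"
    have ri: "r i \<in> carrier K" and gi: "g i \<in> mod_hom A T X" if "i < n" for i
      using r(1) g that by auto
    have hh: "?h \<in> mod_hom A T X"
    proof (rule mod_hom_cong[OF Tm mod_hom_comp[OF mod_hom_tuple mod_hom_copair[OF Xm Xm]]])
      show "g i \<in> mod_hom A T X" if "i < n" for i using gi[OF that] .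
      show "(\<lambda>x. (r i \<odot>\<^bsub>A\<^esub> \<one>\<^bsub>A\<^esub>) \<odot>\<^bsub>X\<^esub> x) \<in> mod_hom A X X" if "i < n" for i
        by (rule mod_hom_scalar_smult[OF Xm ri[OF that]])
      fix x assume x: "x \<in> carrier T"
      show "?h x = (\<Oplus>\<^bsub>X\<^esub>i\<in>{..<n}. (r i \<odot>\<^bsub>A\<^esub> \<one>\<^bsub>A\<^esub>) \<odot>\<^bsub>X\<^esub> ((\<lambda>i\<in>{..<n}. g i x) i))"
        using ri scalar_closed mod_hom_closed[OF gi x] by (intro X.M.finsum_cong') auto
    qed
    have "h (t j) = ?h (t j)" if j: "j < k" for j
    proof -
      have p: "(\<lambda>f. f j) \<in> mod_hom K ?N ?S"
        by (rule mod_hom_restrict[OF mod_hom_proj[OF j] submodule_subset[OF sub]])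
      have sc: "r i \<odot>\<^bsub>?N\<^esub> s i \<in> carrier ?N" if "i < n" for i
        using ri[OF that] s(1) that by (intro N.smult_closed) auto
      have "h (t j) = ev h j" using j by (simp add: ev_def)
      also have "\<dots> = (\<Oplus>\<^bsub>?S\<^esub>i\<in>{..<n}. (r i \<odot>\<^bsub>?N\<^esub> s i) j)"
        unfolding r(2) by (rule mod_hom_finsum[OF N S p sc])
      also have "\<dots> = (\<Oplus>\<^bsub>X\<^esub>i\<in>{..<n}. (r i \<odot>\<^bsub>?N\<^esub> s i) j)"
        using mod_hom_closed[OF p sc] by (intro finsum_scalar_mod[OF Xm]) (simp add: scalar_mod_def)
      also have "\<dots> = ?h (t j)"
      proof (rule X.M.finsum_cong')
        show "(\<lambda>i. (r i \<odot>\<^bsub>A\<^esub> \<one>\<^bsub>A\<^esub>) \<odot>\<^bsub>X\<^esub> g i (t j)) \<in> {..<n} \<rightarrow> carrier X"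
          using ri scalar_closed mod_hom_closed[OF gi] t(1) j by auto
        fix i assume i: "i \<in> {..<n}"
        then show "(r i \<odot>\<^bsub>?N\<^esub> s i) j = (r i \<odot>\<^bsub>A\<^esub> \<one>\<^bsub>A\<^esub>) \<odot>\<^bsub>X\<^esub> g i (t j)"
          using g j by (simp add: mod_pow_def scalar_mod_def ev_def)
      qed simp
      finally show ?thesis .
    qed
    then have "{x \<in> carrier T. h x = ?h x} = carrier T"
      using t(1) by (intro t(2)[rule_format] mod_hom_eq_on[OF Tm h hh Xm]) simp
    then have "\<forall>x\<in>carrier T. h x = ?h x" by blast
    then show ?thesis using r(1) by blast
  qed
  then show thesis using g by (intro that[of n g]) auto
qed

text \<open>K-generators of Hom(T, X), taken as the entries of a row, form the approximation: if h
  is their combination with coefficients r_i, the column of multiplications by r_i on T lifts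
  h.\<close>

lemma right_approximation:
  assumes T: "fg_mod A T" and X: "fg_mod A X"
  obtains n g where "g \<in> mod_hom A (mod_pow T n) X"
    "\<forall>h\<in>mod_hom A T X. \<exists>b\<in>mod_hom A T (mod_pow T n). \<forall>t\<in>carrier T. g (b t) = h t"
proof -
  have Tm: "right_module A T" and Xm: "right_module A X" using T X by (simp_all add: fg_mod_def)
  interpret X: right_module A X by fact
  interpret T: right_module A T by fact
  obtain n :: nat and g where g: "\<forall>i<n. g i \<in> mod_hom A T X"
    "\<forall>h\<in>mod_hom A T X. \<exists>r\<in>{..<n} \<rightarrow> carrier K. \<forall>t\<in>carrier T.
       h t = (\<Oplus>\<^bsub>X\<^esub>i\<in>{..<n}. (r i \<odot>\<^bsub>A\<^esub> \<one>\<^bsub>A\<^esub>) \<odot>\<^bsub>X\<^esub> g i t)"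
    by (rule hom_fin_gen[OF T X])
  let ?g = "\<lambda>t. \<Oplus>\<^bsub>X\<^esub>i\<in>{..<n}. g i (t i)"
  have gh: "?g \<in> mod_hom A (mod_pow T n) X" using g(1) by (intro mod_hom_copair[OF Xm Tm]) simp
  have "\<exists>b\<in>mod_hom A T (mod_pow T n). \<forall>t\<in>carrier T. ?g (b t) = h t" if h: "h \<in> mod_hom A T X" for h
  proof -
    obtain r where r: "r \<in> {..<n} \<rightarrow> carrier K" "\<forall>t\<in>carrier T.
       h t = (\<Oplus>\<^bsub>X\<^esub>i\<in>{..<n}. (r i \<odot>\<^bsub>A\<^esub> \<one>\<^bsub>A\<^esub>) \<odot>\<^bsub>X\<^esub> g i t)" using bspec[OF g(2) h] by (elim bexE)
    have ri: "r i \<in> carrier K" if "i < n" for i using r(1) that by auto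
    show ?thesis
    proof (rule bexI[OF ballI mod_hom_tuple[OF mod_hom_scalar_smult[OF Tm ri]]])
      fix t assume t: "t \<in> carrier T"
      have gh': "g i \<in> mod_hom A T X" if "i < n" for i using g(1) that by simp
      have gc: "g i t \<in> carrier X" if "i < n" for i by (rule mod_hom_closed[OF gh'[OF that] t])
      have "(\<Oplus>\<^bsub>X\<^esub>i\<in>{..<n}. g i ((\<lambda>i\<in>{..<n}. (r i \<odot>\<^bsub>A\<^esub> \<one>\<^bsub>A\<^esub>) \<odot>\<^bsub>T\<^esub> t) i)) =
          (\<Oplus>\<^bsub>X\<^esub>i\<in>{..<n}. (r i \<odot>\<^bsub>A\<^esub> \<one>\<^bsub>A\<^esub>) \<odot>\<^bsub>X\<^esub> g i t)"
        using gc ri t scalar_closed by (intro X.M.finsum_cong') (auto simp: mod_hom_smult[OF gh'])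
      then show "(\<Oplus>\<^bsub>X\<^esub>i\<in>{..<n}. g i ((\<lambda>i\<in>{..<n}. (r i \<odot>\<^bsub>A\<^esub> \<one>\<^bsub>A\<^esub>) \<odot>\<^bsub>T\<^esub> t) i)) = h t"
        using r(2) t by simp
    qed
  qed
  then show thesis using that[OF gh] by blast
qed

text \<open>Here K-generators of Hom(X, T) form a column, and the coefficients act on the target as
  a row of multiplications.\<close>

lemma left_approximation:
  assumes T: "fg_mod A T" and X: "fg_mod A X"
  obtains n f where "f \<in> mod_hom A X (mod_pow T n)"
    "\<forall>h\<in>mod_hom A X T. \<exists>b\<in>mod_hom A (mod_pow T n) T. \<forall>x\<in>carrier X. b (f x) = h x"
proof -
  have Tm: "right_module A T" and Xm: "right_module A X" using T X by (simp_all add: fg_mod_def)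
  interpret T: right_module A T by fact
  obtain n :: nat and g where g: "\<forall>i<n. g i \<in> mod_hom A X T"
    "\<forall>h\<in>mod_hom A X T. \<exists>r\<in>{..<n} \<rightarrow> carrier K. \<forall>t\<in>carrier X.
       h t = (\<Oplus>\<^bsub>T\<^esub>i\<in>{..<n}. (r i \<odot>\<^bsub>A\<^esub> \<one>\<^bsub>A\<^esub>) \<odot>\<^bsub>T\<^esub> g i t)"
    by (rule hom_fin_gen[OF X T])
  let ?f = "\<lambda>x. \<lambda>i\<in>{..<n}. g i x"
  have fh: "?f \<in> mod_hom A X (mod_pow T n)" using g(1) by (intro mod_hom_tuple) simp
  have "\<exists>b\<in>mod_hom A (mod_pow T n) T. \<forall>x\<in>carrier X. b (?f x) = h x" if h: "h \<in> mod_hom A X T" for h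
  proof -
    obtain r where r: "r \<in> {..<n} \<rightarrow> carrier K" "\<forall>t\<in>carrier X.
       h t = (\<Oplus>\<^bsub>T\<^esub>i\<in>{..<n}. (r i \<odot>\<^bsub>A\<^esub> \<one>\<^bsub>A\<^esub>) \<odot>\<^bsub>T\<^esub> g i t)" using bspec[OF g(2) h] by (elim bexE)
    have ri: "r i \<in> carrier K" if "i < n" for i using r(1) that by auto
    show ?thesis
    proof (rule bexI[OF ballI mod_hom_copair[OF Tm Tm mod_hom_scalar_smult[OF Tm ri]]])
      fix x assume x: "x \<in> carrier X"
      have gc: "g i x \<in> carrier T" if "i < n" for i
        by (rule mod_hom_closed[OF g(1)[rule_format, OF that] x])
      have "(\<Oplus>\<^bsub>T\<^esub>i\<in>{..<n}. (r i \<odot>\<^bsub>A\<^esub> \<one>\<^bsub>A\<^esub>) \<odot>\<^bsub>T\<^esub> (?f x i)) =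
          (\<Oplus>\<^bsub>T\<^esub>i\<in>{..<n}. (r i \<odot>\<^bsub>A\<^esub> \<one>\<^bsub>A\<^esub>) \<odot>\<^bsub>T\<^esub> g i x)"
        using gc ri scalar_closed by (intro T.M.finsum_cong') auto
      then show "(\<Oplus>\<^bsub>T\<^esub>i\<in>{..<n}. (r i \<odot>\<^bsub>A\<^esub> \<one>\<^bsub>A\<^esub>) \<odot>\<^bsub>T\<^esub> (?f x i)) = h x"
        using r(2) x by simp
    qed
  qed
  then show thesis using that[OF fh] by blast
qed

end

section \<open>Separating modules, maximal ideals and the dualizing module\<close>

lemma mod_pow_hom_zero_iff:
  assumes "f \<in> mod_hom R X (mod_pow M n)" "x \<in> carrier X"
  shows "f x = \<zero>\<^bsub>mod_pow M n\<^esub> \<longleftrightarrow> (\<forall>i<n. f x i = \<zero>\<^bsub>M\<^esub>)"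
proof
  assume "\<forall>i<n. f x i = \<zero>\<^bsub>M\<^esub>"
  then show "f x = \<zero>\<^bsub>mod_pow M n\<^esub>"
    using mod_pow_arb[OF mod_hom_closed[OF assms]] by (auto simp: fun_eq_iff mod_pow_def)
qed (simp add: mod_pow_def)

text \<open>Choose a map to a power of M with minimal kernel. A nonzero element of the kernel is
  detected by some map to M, and appending this map as one more coordinate would shrink the
  kernel.\<close>

lemma embedding_of_separating:
  assumes X: "right_module R X" and fl: "finite_length R X" and M: "right_module R M"
    and sep: "\<And>x. \<lbrakk>x \<in> carrier X; x \<noteq> \<zero>\<^bsub>X\<^esub>\<rbrakk> \<Longrightarrow> \<exists>f\<in>mod_hom R X M. f x \<noteq> \<zero>\<^bsub>M\<^esub>"
  obtains n f where "f \<in> mod_mono R X (mod_pow M n)"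
proof -
  let ?P = "\<lambda>U. \<exists>n f. f \<in> mod_hom R X (mod_pow M n) \<and> U = a_kernel X (mod_pow M n) f"
  note pm = right_module_mod_pow[OF M]
  have "?P (a_kernel X (mod_pow M 0) (\<lambda>x. \<zero>\<^bsub>mod_pow M 0\<^esub>))"
    using mod_hom_zero_map[OF pm] by blast
  then obtain U where U: "?P U" "\<forall>V. ?P V \<longrightarrow> V \<subseteq> U \<longrightarrow> V = U"
  proof (rule finite_length_minimal[OF fl, of ?P])
    show "submodule V R X" if "?P V" for V
      using that submodule_kernel[OF X pm] by blast
  qed
  obtain n f where f: "f \<in> mod_hom R X (mod_pow M n)" "U = a_kernel X (mod_pow M n) f"
    using U(1) by (elim exE conjE)
  have Us: "submodule U R X" unfolding f(2) by (rule submodule_kernel[OF X pm f(1)])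
  have "x = \<zero>\<^bsub>X\<^esub>" if x: "x \<in> U" for x
  proof (rule ccontr)
    assume nz: "x \<noteq> \<zero>\<^bsub>X\<^esub>"
    have xc: "x \<in> carrier X" using x submodule_subset[OF Us] by blast
    obtain g where g: "g \<in> mod_hom R X M" "g x \<noteq> \<zero>\<^bsub>M\<^esub>" using sep[OF xc nz] by blast
    let ?h = "\<lambda>y. \<lambda>i\<in>{..<Suc n}. (if i < n then f y i else g y)"
    have h: "?h \<in> mod_hom R X (mod_pow M (Suc n))"
    proof (rule mod_hom_tuple)
      show "(\<lambda>y. if i < n then f y i else g y) \<in> mod_hom R X M" for i
        using mod_hom_comp[OF f(1) mod_hom_proj, of i] g(1) by (cases "i < n") simp_all
    qed
    let ?V = "a_kernel X (mod_pow M (Suc n)) ?h"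
    have Vi: "y \<in> ?V \<longleftrightarrow> y \<in> U \<and> g y = \<zero>\<^bsub>M\<^esub>" for y
    proof (cases "y \<in> carrier X")
      case True
      have "?h y = \<zero>\<^bsub>mod_pow M (Suc n)\<^esub> \<longleftrightarrow> (\<forall>i<n. f y i = \<zero>\<^bsub>M\<^esub>) \<and> g y = \<zero>\<^bsub>M\<^esub>"
        unfolding mod_pow_hom_zero_iff[OF h True] by (auto simp: less_Suc_eq)
      then show ?thesis
        using True by (simp add: f(2) a_kernel_iff mod_pow_hom_zero_iff[OF f(1) True])
    qed (simp add: f(2) a_kernel_iff)
    have "?P ?V" using h by blast
    moreover have "?V \<subseteq> U" using Vi by blast
    ultimately have "?V = U" by (rule U(2)[rule_format])
    then have "x \<in> ?V" using x by blast
    then show False using Vi g(2) by blast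
  qed
  then have "a_kernel X (mod_pow M n) f = {\<zero>\<^bsub>X\<^esub>}" using submodule_zero[OF Us] f(2) by blast
  then have "f \<in> mod_mono R X (mod_pow M n)"
    using inj_of_kernel[OF X pm f(1)] f(1) by (simp add: mod_mono_def)
  then show thesis by (rule that)
qed

text \<open>An ideal that is maximal among those containing I and avoiding 1 exists because K has
  finite length over itself, and it is a maximal ideal.\<close>

lemma maximal_ideal_containing:
  assumes K: "artinian_cring K" and I: "ideal I K" "\<one>\<^bsub>K\<^esub> \<notin> I"
  obtains m where "maximalideal m K" "I \<subseteq> m"
proof -
  have Kc: "cring K" using K by (simp add: artinian_cring_def)
  interpret K: cring K by fact
  let ?M = "regular_mod K"
  have M: "right_module K ?M" by (rule right_module_regular[OF K.ring_axioms])
  note eq = ideal_iff_submodule[OF Kc]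
  let ?P = "\<lambda>V. submodule V K ?M \<and> I \<subseteq> V \<and> \<one>\<^bsub>K\<^esub> \<notin> V"
  have "?P I" using I by (simp add: eq)
  then obtain m where m: "?P m" "\<forall>V. ?P V \<longrightarrow> m \<subseteq> V \<longrightarrow> V = m"
    by (rule finite_length_maximal[OF M artinian_finite_length[OF K], of ?P]) simp
  have "maximalideal m K"
  proof (rule maximalidealI)
    show "ideal m K" using m(1) by (simp add: eq)
    show "carrier K \<noteq> m" using m(1) by blast
    fix J assume J: "ideal J K" "m \<subseteq> J" "J \<subseteq> carrier K"
    show "J = m \<or> J = carrier K"
    proof (cases "\<one>\<^bsub>K\<^esub> \<in> J")
      case True
      then show ?thesis using ideal.one_imp_carrier[OF J(1)] by simp
    next
      case False
      have "?P J" using J m(1) False by (auto simp: eq)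
      then have "J = m" using J(2) by (rule m(2)[rule_format])
      then show ?thesis ..
    qed
  qed
  moreover have "I \<subseteq> m" using m(1) by (elim conjE)
  ultimately show thesis by (rule that)
qed

text \<open>
  An ideal \<open>L\<close> minimal among those not contained in the maximal ideal \<open>m\<close> lies in every other
  maximal ideal, so an element of \<open>L - m\<close> spans a copy of \<open>K / m\<close> in \<open>K / rad K\<close>.
\<close>

lemma simple_in_semisimple:
  assumes K: "artinian_cring K" and m: "maximalideal m K"
  obtains e where "e \<in> carrier K" "e \<notin> jacobson_radical K"
    "\<forall>c\<in>m. e \<otimes>\<^bsub>K\<^esub> c \<in> jacobson_radical K"
proof -
  have Kc: "cring K" using K by (simp add: artinian_cring_def)
  interpret K: cring K by fact
  interpret m: maximalideal m K by fact
  interpret p: primeideal m K by (rule K.maximalideal_prime[OF m])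
  let ?P = "\<lambda>L. ideal L K \<and> \<not> L \<subseteq> m"
  have "?P (carrier K)" using K.oneideal m.I_notcarr m.a_subset by blast
  then obtain L where L: "?P L" "\<forall>J. ?P J \<longrightarrow> J \<subseteq> L \<longrightarrow> J = L"
    using artinian_minimal[OF K, of ?P] by blast
  interpret L: ideal L K using L(1) by simp
  obtain e where e: "e \<in> L" "e \<notin> m" using L(1) by blast
  have ec: "e \<in> carrier K" using e(1) L.a_subset by blast
  have other: "L \<subseteq> n" if n: "maximalideal n K" "n \<noteq> m" for n
  proof -
    interpret n: maximalideal n K by fact
    have "\<not> n \<subseteq> m"
    proof
      assume "n \<subseteq> m"
      then have "m = n \<or> m = carrier K"
        using n.I_maximal[OF m.is_ideal _ m.a_subset] by simp
      then show False using n(2) m.I_notcarr by blast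
    qed
    then obtain t where t: "t \<in> n" "t \<notin> m" by blast
    have tc: "t \<in> carrier K" using t(1) n.a_subset by blast
    have "e \<otimes>\<^bsub>K\<^esub> t \<in> L" "e \<otimes>\<^bsub>K\<^esub> t \<in> n"
      using e(1) t(1) L.I_r_closed n.I_l_closed ec tc by simp_all
    moreover have "e \<otimes>\<^bsub>K\<^esub> t \<notin> m" using p.I_prime[OF ec tc] e(2) t(2) by blast
    ultimately have "?P (L \<inter> n)" using K.i_intersect[OF L.is_ideal n.is_ideal] by blast
    then have "L \<inter> n = L" by (rule L(2)[rule_format]) simp
    then show ?thesis by blast
  qed
  show thesis
  proof (rule that[OF ec])
    show "e \<notin> jacobson_radical K" using m e(2) by (auto simp: jacobson_radical_def)
    show "\<forall>c\<in>m. e \<otimes>\<^bsub>K\<^esub> c \<in> jacobson_radical K"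
    proof
      fix c assume c: "c \<in> m"
      have cc: "c \<in> carrier K" using c m.a_subset by blast
      have "e \<otimes>\<^bsub>K\<^esub> c \<in> n" if n: "maximalideal n K" for n
      proof (cases "n = m")
        case True
        then show ?thesis using m.I_l_closed[OF c ec] by simp
      next
        case False
        interpret n: maximalideal n K by fact
        have "e \<in> n" using other[OF n False] e(1) by blast
        then show ?thesis using n.I_r_closed cc by simp
      qed
      then show "e \<otimes>\<^bsub>K\<^esub> c \<in> jacobson_radical K" using ec cc by (simp add: jacobson_radical_def)
    qed
  qed
qed

lemma dualizing_mod_injective: "dualizing_mod K J \<Longrightarrow> injective_mod K J"
  by (auto simp: dualizing_mod_def injective_envelope_def)

lemma jacobson_radical_ideal:
  assumes "artinian_cring K" shows "submodule (jacobson_radical K) K (regular_mod K)"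
proof -
  have Kc: "cring K" using assms by (simp add: artinian_cring_def)
  interpret K: cring K by fact
  have sub: "submodule I K (regular_mod K)" if "maximalideal I K" for I
    using that ideal_iff_submodule[OF Kc] by (simp add: maximalideal_def)
  show ?thesis
  proof (rule submoduleI'[OF right_module_regular[OF K.ring_axioms]])
    show "jacobson_radical K \<subseteq> carrier (regular_mod K)"
      by (auto simp: jacobson_radical_def regular_mod_def)
    show "\<zero>\<^bsub>regular_mod K\<^esub> \<in> jacobson_radical K"
      using submodule_zero[OF sub] by (simp add: jacobson_radical_def) (simp add: regular_mod_def)
    show "x \<oplus>\<^bsub>regular_mod K\<^esub> y \<in> jacobson_radical K"
      if "x \<in> jacobson_radical K" "y \<in> jacobson_radical K" for x y
      using that submodule_add[OF sub, of _ x y] by (simp add: jacobson_radical_def) (simp add: regular_mod_def)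
    show "a \<odot>\<^bsub>regular_mod K\<^esub> x \<in> jacobson_radical K"
      if "a \<in> carrier K" "x \<in> jacobson_radical K" for a x
      using that submodule_smult[OF sub, of _ a x] by (simp add: jacobson_radical_def) (simp add: regular_mod_def)
  qed
qed

text \<open>The annihilator of x lies in a maximal ideal m, and J, containing K / rad K, has a
  nonzero element j killed by m. So ax -> aj is well defined on Kx, and injectivity of J extends it
  to X.\<close>

lemma dualizing_mod_separates:
  assumes K: "artinian_cring K" and J: "dualizing_mod K J" and X: "fg_mod K X"
    and x: "x \<in> carrier X" "x \<noteq> \<zero>\<^bsub>X\<^esub>"
  shows "\<exists>f\<in>mod_hom K X J. f x \<noteq> \<zero>\<^bsub>J\<^esub>"
proof -
  have Kc: "cring K" using K by (simp add: artinian_cring_def)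
  interpret K: cring K by fact
  let ?M = "regular_mod K"
  have M: "right_module K ?M" by (rule right_module_regular[OF K.ring_axioms])
  have Xm: "right_module K X" using X by (simp add: fg_mod_def)
  interpret X: right_module K X by fact
  have Ji: "injective_mod K J" by (rule dualizing_mod_injective[OF J])
  have Jm: "right_module K J" using Ji by (simp add: injective_mod_def fg_mod_def)
  let ?rad = "jacobson_radical K"
  let ?Q = "quot_mod ?M ?rad"
  obtain i where i: "i \<in> mod_mono K ?Q J"
    using J by (auto simp: dualizing_mod_def injective_envelope_def)
  note q = quot_mod_proj[OF M jacobson_radical_ideal[OF K]]
  let ?q = "\<lambda>a. ?rad +>\<^bsub>?M\<^esub> a"
  let ?h = "\<lambda>a. a \<odot>\<^bsub>X\<^esub> x"
  have h: "?h \<in> mod_hom K ?M X" by (rule mod_hom_regular[OF Xm x(1)])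
  let ?ann = "a_kernel ?M X ?h"
  have ann: "ideal ?ann K"
    using submodule_kernel[OF M Xm h] ideal_iff_submodule[OF Kc] by simp
  have one: "\<one>\<^bsub>K\<^esub> \<notin> ?ann" using x by (simp add: a_kernel_iff)
  obtain m where m: "maximalideal m K" "?ann \<subseteq> m"
    by (rule maximal_ideal_containing[OF K ann one])
  obtain e where e: "e \<in> carrier K" "e \<notin> ?rad" "\<forall>c\<in>m. e \<otimes>\<^bsub>K\<^esub> c \<in> ?rad"
    by (rule simple_in_semisimple[OF K m(1)])
  have eM: "e \<in> carrier ?M" using e(1) by (simp add: regular_mod_def)
  define j where "j = i (?q e)"
  have iq: "(\<lambda>a. i (?q a)) \<in> mod_hom K ?M J"
    by (rule mod_hom_comp[OF mod_epiD(1)[OF q(2)] mod_monoD(1)[OF i]])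
  have jc: "j \<in> carrier J" unfolding j_def by (rule mod_hom_closed[OF iq eM])
  have "?q e \<noteq> \<zero>\<^bsub>?Q\<^esub>" using q(3)[OF eM] e(2) by simp
  then have jnz: "j \<noteq> \<zero>\<^bsub>J\<^esub>"
    using mod_monoD(2)[OF i] mod_hom_closed[OF mod_epiD(1)[OF q(2)] eM]
    unfolding j_def mod_hom_inj_iff[OF q(1) Jm mod_monoD(1)[OF i]] by blast
  have jm: "c \<odot>\<^bsub>J\<^esub> j = \<zero>\<^bsub>J\<^esub>" if c: "c \<in> m" for c
  proof -
    have cc: "c \<in> carrier K" using c additive_subgroup.a_subset[OF ideal.axioms(1)[OF maximalideal.axioms(1)[OF m(1)]]] by blast
    have "c \<odot>\<^bsub>J\<^esub> j = i (?q (c \<odot>\<^bsub>?M\<^esub> e))"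
      unfolding j_def using mod_hom_smult[OF iq cc eM] by simp
    also have "c \<odot>\<^bsub>?M\<^esub> e = e \<otimes>\<^bsub>K\<^esub> c" by (simp add: regular_mod_def)
    also have "?q (e \<otimes>\<^bsub>K\<^esub> c) = \<zero>\<^bsub>?Q\<^esub>"
      using q(3)[of "e \<otimes>\<^bsub>K\<^esub> c"] e(1,3) c cc by (simp add: regular_mod_def)
    also have "i \<zero>\<^bsub>?Q\<^esub> = \<zero>\<^bsub>J\<^esub>" by (rule mod_hom_zero[OF q(1) Jm mod_monoD(1)[OF i]])
    finally show ?thesis .
  qed
  let ?Kx = "?h ` carrier ?M"
  have Kx: "submodule ?Kx K X" by (rule submodule_image[OF M Xm h submodule_carrier[OF M]])
  let ?Y = "X\<lparr>carrier := ?Kx\<rparr>"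
  have Y: "right_module K ?Y" by (rule right_module_restrict[OF Xm Kx])
  have he: "?h \<in> mod_epi K ?M ?Y"
    using mod_hom_corestrict[OF h] by (simp add: mod_epi_def)
  have Yf: "fg_mod K ?Y"
    by (rule fin_gen_image[OF _ Y he]) (simp add: fg_mod_def M fin_gen_regular K.ring_axioms)
  have "a \<odot>\<^bsub>J\<^esub> j = \<zero>\<^bsub>J\<^esub>" if "a \<in> carrier ?M" "?h a = \<zero>\<^bsub>?Y\<^esub>" for a
    using that m(2) by (intro jm subsetD[OF m(2)]) (simp add: a_kernel_iff)
  then obtain h' where h': "h' \<in> mod_hom K ?Y J" "\<forall>a\<in>carrier ?M. h' (?h a) = a \<odot>\<^bsub>J\<^esub> j"
    using factor_epi[OF M Y Jm he mod_hom_regular[OF Jm jc]] by blast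
  have incl: "(\<lambda>y. y) \<in> mod_mono K ?Y X"
    using mod_hom_incl[OF submodule_subset[OF Kx]] by (simp add: mod_mono_def)
  obtain l where l: "l \<in> mod_hom K X J" "\<forall>y\<in>carrier ?Y. l y = h' y"
    using injective_extend[OF Ji Yf X incl h'(1)] by blast
  have oneM: "\<one>\<^bsub>K\<^esub> \<in> carrier ?M" by (simp add: regular_mod_def)
  have "l (?h \<one>\<^bsub>K\<^esub>) = h' (?h \<one>\<^bsub>K\<^esub>)" by (rule l(2)[rule_format]) (use oneM in simp)
  also have "\<dots> = \<one>\<^bsub>K\<^esub> \<odot>\<^bsub>J\<^esub> j" by (rule h'(2)[rule_format, OF oneM])
  also have "\<dots> = j" using jc right_module.smult_one[OF Jm] by simp
  finally have "l x = j" using x(1) by simp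
  then show ?thesis using l(1) jnz by (intro bexI[of _ l]) simp_all
qed

section \<open>The module DA as an injective cogenerator\<close>

context artin_algebra
begin

lemma dual_mod_simps [simp]:
  "carrier (dual_mod K A J) = mod_hom K A J \<inter> extensional (carrier A)"
  "\<zero>\<^bsub>dual_mod K A J\<^esub> = (\<lambda>x\<in>carrier A. \<zero>\<^bsub>J\<^esub>)"
  "f \<oplus>\<^bsub>dual_mod K A J\<^esub> g = (\<lambda>x\<in>carrier A. f x \<oplus>\<^bsub>J\<^esub> g x)"
  "a \<odot>\<^bsub>dual_mod K A J\<^esub> f = (\<lambda>x\<in>carrier A. f (a \<otimes>\<^bsub>A\<^esub> x))"
  by (simp_all add: dual_mod_def)

lemma right_module_dual:
  assumes J: "right_module K J" shows "right_module A (dual_mod K A J)"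
proof -
  interpret J: right_module K J by fact
  have "abelian_group (dual_mod K A J)"
    by (rule abelian_group_homs[OF rings(4) J]) (simp_all add: dual_mod_def)
  moreover have "right_module_axioms A (dual_mod K A J)"
  proof
    fix a f assume a: "a \<in> carrier A" and "f \<in> carrier (dual_mod K A J)"
    then have f: "f \<in> mod_hom K A J" "f \<in> extensional (carrier A)" by simp_all
    note cl = mod_hom_closed[OF f(1)]
    have mult: "(\<lambda>x. a \<otimes>\<^bsub>A\<^esub> x) \<in> mod_hom K A A"
      using a by (intro mod_homI) (simp_all add: r_distr smult_mult_r)
    show "a \<odot>\<^bsub>dual_mod K A J\<^esub> f \<in> carrier (dual_mod K A J)"
      using restrict_mod_hom[OF rings(4) mod_hom_comp[OF mult f(1)]] by simp
    fix b assume b: "b \<in> carrier A"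
    show "(a \<oplus>\<^bsub>A\<^esub> b) \<odot>\<^bsub>dual_mod K A J\<^esub> f =
        a \<odot>\<^bsub>dual_mod K A J\<^esub> f \<oplus>\<^bsub>dual_mod K A J\<^esub> b \<odot>\<^bsub>dual_mod K A J\<^esub> f"
      using a b by (auto simp: restrict_def fun_eq_iff l_distr mod_hom_add[OF f(1)])
    show "(a \<otimes>\<^bsub>A\<^esub> b) \<odot>\<^bsub>dual_mod K A J\<^esub> f = b \<odot>\<^bsub>dual_mod K A J\<^esub> (a \<odot>\<^bsub>dual_mod K A J\<^esub> f)"
      using a b by (auto simp: restrict_def fun_eq_iff m_assoc)
  next
    fix a f g assume a: "a \<in> carrier A"
    show "a \<odot>\<^bsub>dual_mod K A J\<^esub> (f \<oplus>\<^bsub>dual_mod K A J\<^esub> g) =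
        a \<odot>\<^bsub>dual_mod K A J\<^esub> f \<oplus>\<^bsub>dual_mod K A J\<^esub> a \<odot>\<^bsub>dual_mod K A J\<^esub> g"
      using a by (auto simp: restrict_def fun_eq_iff)
  next
    fix f assume "f \<in> carrier (dual_mod K A J)"
    then have "f \<in> extensional (carrier A)" by simp
    then show "\<one>\<^bsub>A\<^esub> \<odot>\<^bsub>dual_mod K A J\<^esub> f = f"
      by (auto simp: restrict_def fun_eq_iff extensional_def)
  qed
  ultimately show ?thesis using rings(3) by (simp add: right_module_def)
qed

text \<open>One half of the adjunction between restriction of scalars and Hom_K(A, -): a K-linear f
  corresponds to the A-linear map sending x to the functional a -> f(xa). The other half, evaluation
  at 1, is \<open>hom_scalar_of_dual\<close>.\<close>

lemma hom_dual_of_scalar: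
  assumes X: "right_module A X" and f: "f \<in> mod_hom K (scalar_mod A X) J"
  shows "(\<lambda>x. \<lambda>a\<in>carrier A. f (a \<odot>\<^bsub>X\<^esub> x)) \<in> mod_hom A X (dual_mod K A J)"
proof -
  interpret X: right_module A X by fact
  have add: "f (x \<oplus>\<^bsub>X\<^esub> y) = f x \<oplus>\<^bsub>J\<^esub> f y" if "x \<in> carrier X" "y \<in> carrier X" for x y
    using mod_hom_add[OF f, of x y] that by (simp add: scalar_mod_def)
  show ?thesis
  proof (rule mod_homI)
    fix x assume x: "x \<in> carrier X"
    have "(\<lambda>a. a \<odot>\<^bsub>X\<^esub> x) \<in> mod_hom K A (scalar_mod A X)"
    proof (rule mod_homI)
      fix c a assume "c \<in> carrier K" "a \<in> carrier A"
      then show "(c \<odot>\<^bsub>A\<^esub> a) \<odot>\<^bsub>X\<^esub> x = c \<odot>\<^bsub>scalar_mod A X\<^esub> (a \<odot>\<^bsub>X\<^esub> x)"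
        using x X.smult_assoc[of a "c \<odot>\<^bsub>A\<^esub> \<one>\<^bsub>A\<^esub>" x] by (simp add: scalar_mod_def scalar_closed scalar_right)
    qed (use x in \<open>simp_all add: scalar_mod_def X.smult_l_distr\<close>)
    from restrict_mod_hom[OF rings(4) mod_hom_comp[OF this f]]
    show "(\<lambda>a\<in>carrier A. f (a \<odot>\<^bsub>X\<^esub> x)) \<in> carrier (dual_mod K A J)" by simp
    fix y assume y: "y \<in> carrier X"
    show "(\<lambda>a\<in>carrier A. f (a \<odot>\<^bsub>X\<^esub> (x \<oplus>\<^bsub>X\<^esub> y))) =
        (\<lambda>a\<in>carrier A. f (a \<odot>\<^bsub>X\<^esub> x)) \<oplus>\<^bsub>dual_mod K A J\<^esub> (\<lambda>a\<in>carrier A. f (a \<odot>\<^bsub>X\<^esub> y))"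
      using x y by (auto simp: restrict_def fun_eq_iff X.smult_r_distr add)
  next
    fix b x assume b: "b \<in> carrier A" and x: "x \<in> carrier X"
    show "(\<lambda>a\<in>carrier A. f (a \<odot>\<^bsub>X\<^esub> (b \<odot>\<^bsub>X\<^esub> x))) =
        b \<odot>\<^bsub>dual_mod K A J\<^esub> (\<lambda>a\<in>carrier A. f (a \<odot>\<^bsub>X\<^esub> x))"
      using x b by (auto simp: restrict_def fun_eq_iff X.smult_assoc)
  qed
qed

lemma hom_scalar_of_dual:
  assumes h: "h \<in> mod_hom A X (dual_mod K A J)"
  shows "(\<lambda>x. h x \<one>\<^bsub>A\<^esub>) \<in> mod_hom K (scalar_mod A X) J"
proof -
  have hx: "h x \<in> mod_hom K A J" if "x \<in> carrier X" for x
    using mod_hom_closed[OF h that] by simp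
  show ?thesis
  proof (rule mod_homI)
    fix x y assume "x \<in> carrier (scalar_mod A X)" "y \<in> carrier (scalar_mod A X)"
    then show "h (x \<oplus>\<^bsub>scalar_mod A X\<^esub> y) \<one>\<^bsub>A\<^esub> = h x \<one>\<^bsub>A\<^esub> \<oplus>\<^bsub>J\<^esub> h y \<one>\<^bsub>A\<^esub>"
      by (simp add: scalar_mod_def mod_hom_add[OF h])
  next
    fix c x assume c: "c \<in> carrier K" and "x \<in> carrier (scalar_mod A X)"
    then have x: "x \<in> carrier X" by (simp add: scalar_mod_def)
    have "h (c \<odot>\<^bsub>scalar_mod A X\<^esub> x) \<one>\<^bsub>A\<^esub> = h x ((c \<odot>\<^bsub>A\<^esub> \<one>\<^bsub>A\<^esub>) \<otimes>\<^bsub>A\<^esub> \<one>\<^bsub>A\<^esub>)"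
      using c x by (simp add: scalar_mod_def mod_hom_smult[OF h] scalar_closed)
    also have "\<dots> = c \<odot>\<^bsub>J\<^esub> h x \<one>\<^bsub>A\<^esub>"
      using c mod_hom_smult[OF hx[OF x] c, of "\<one>\<^bsub>A\<^esub>"] by (simp add: scalar_closed)
    finally show "h (c \<odot>\<^bsub>scalar_mod A X\<^esub> x) \<one>\<^bsub>A\<^esub> = c \<odot>\<^bsub>J\<^esub> h x \<one>\<^bsub>A\<^esub>" .
  next
    fix x assume "x \<in> carrier (scalar_mod A X)"
    then show "h x \<one>\<^bsub>A\<^esub> \<in> carrier J"
      by (intro mod_hom_closed[OF hx]) (simp_all add: scalar_mod_def)
  qed
qed

lemma fg_scalar: "fg_mod A X \<Longrightarrow> fg_mod K (scalar_mod A X)"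
  by (simp add: fg_mod_def right_module_scalar finite_length_fin_gen fg_scalar_finite_length)

text \<open>A functional on A is determined by its values on K-generators of A, so DA embeds over K
  in a power of J.\<close>

lemma finite_length_dual:
  assumes J: "fg_mod K J" shows "finite_length K (scalar_mod A (dual_mod K A J))"
proof -
  have Jm: "right_module K J" using J by (simp add: fg_mod_def)
  let ?D = "scalar_mod A (dual_mod K A J)"
  have D: "right_module K ?D" by (rule right_module_scalar[OF right_module_dual[OF Jm]])
  obtain n :: nat and s where s: "\<forall>i<n. s i \<in> carrier A"
    "\<forall>U. submodule U K A \<longrightarrow> (\<forall>i<n. s i \<in> U) \<longrightarrow> U = carrier A"
    by (rule fin_gen_enum[OF fin_gen])
  let ?e = "\<lambda>f. \<lambda>i\<in>{..<n}. f (s i)"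
  have e: "?e \<in> mod_hom K ?D (mod_pow J n)"
  proof (rule mod_hom_tuple)
    fix i assume "i < n"
    then have si: "s i \<in> carrier A" using s(1) by simp
    show "(\<lambda>f. f (s i)) \<in> mod_hom K ?D J"
    proof (rule mod_homI)
      fix f assume "f \<in> carrier ?D"
      then have f: "f \<in> mod_hom K A J" by (simp add: scalar_mod_def)
      show "f (s i) \<in> carrier J" by (rule mod_hom_closed[OF f si])
      fix c assume c: "c \<in> carrier K"
      show "(c \<odot>\<^bsub>?D\<^esub> f) (s i) = c \<odot>\<^bsub>J\<^esub> f (s i)"
        using si c by (simp add: scalar_mod_def scalar_left mod_hom_smult[OF f])
    qed (simp add: scalar_mod_def si)
  qed
  have "inj_on ?e (carrier ?D)"
  proof (rule inj_onI)
    fix f g assume f: "f \<in> carrier ?D" and g: "g \<in> carrier ?D" and eq: "?e f = ?e g"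
    then have fg: "f \<in> mod_hom K A J" "g \<in> mod_hom K A J" "f \<in> extensional (carrier A)" "g \<in> extensional (carrier A)"
      by (simp_all add: scalar_mod_def)
    have "f (s i) = g (s i)" if "i < n" for i using fun_cong[OF eq, of i] that by simp
    then have "{x \<in> carrier A. f x = g x} = carrier A"
      using s(1) by (intro s(2)[rule_format] mod_hom_eq_on[OF rings(4) fg(1,2) Jm]) simp
    then have "f x = g x" if "x \<in> carrier A" for x using that by blast
    then show "f = g" using extensionalityI[OF fg(3,4)] by blast
  qed
  then have "?e \<in> mod_mono K ?D (mod_pow J n)" using e by (simp add: mod_mono_def)
  then show ?thesis
    by (rule finite_length_mono[OF D right_module_mod_pow[OF Jm] _
          finite_length_mod_pow[OF Jm fg_finite_length[OF artinian_base J]]])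
qed

text \<open>Under the adjunction, extending an A-linear map into DA amounts to extending a K-linear
  map into J.\<close>

lemma injective_dual:
  assumes J: "injective_mod K J" shows "injective_mod A (dual_mod K A J)"
proof -
  have Jf: "fg_mod K J" and Jm: "right_module K J" using J by (simp_all add: injective_mod_def fg_mod_def)
  note D = right_module_dual[OF Jm]
  have fg: "fg_mod A (dual_mod K A J)"
    by (rule fg_of_finite_length[OF D finite_length_of_scalar[OF D finite_length_dual[OF Jf]]])
  have "\<exists>l\<in>mod_hom A Y (dual_mod K A J). \<forall>x\<in>carrier X. l (g x) = h x"
    if g: "g \<in> mod_mono A X Y" and h: "h \<in> mod_hom A X (dual_mod K A J)"
      and X: "fg_mod A X" and Y: "fg_mod A Y" for X Y :: "_ umod" and g h
  proof -
    have Ym: "right_module A Y" and Xm: "right_module A X" using Y X by (simp_all add: fg_mod_def)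
    interpret X: right_module A X by fact
    have gs: "g \<in> mod_mono K (scalar_mod A X) (scalar_mod A Y)"
      using mod_hom_scalar[OF mod_monoD(1)[OF g]] mod_monoD(2)[OF g]
      by (simp add: mod_mono_def) (simp add: scalar_mod_def)
    obtain l where l: "l \<in> mod_hom K (scalar_mod A Y) J"
      "\<forall>x\<in>carrier (scalar_mod A X). l (g x) = h x \<one>\<^bsub>A\<^esub>"
      using injective_extend[OF J fg_scalar[OF X] fg_scalar[OF Y] gs hom_scalar_of_dual[OF h]] by blast
    have "(\<lambda>a\<in>carrier A. l (a \<odot>\<^bsub>Y\<^esub> g x)) = h x" if x: "x \<in> carrier X" for x
    proof -
      have hx: "h x \<in> extensional (carrier A)" using mod_hom_closed[OF h x] by simp
      show ?thesis
      proof (rule extensionalityI[OF restrict_extensional hx])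
        fix a assume a: "a \<in> carrier A"
        have "l (a \<odot>\<^bsub>Y\<^esub> g x) = h (a \<odot>\<^bsub>X\<^esub> x) \<one>\<^bsub>A\<^esub>"
          using l(2)[rule_format, of "a \<odot>\<^bsub>X\<^esub> x"] mod_hom_smult[OF mod_monoD(1)[OF g] a x] a x
          by (simp add: scalar_mod_def)
        also have "\<dots> = h x a" using a x by (simp add: mod_hom_smult[OF h])
        finally show "(\<lambda>a\<in>carrier A. l (a \<odot>\<^bsub>Y\<^esub> g x)) a = h x a" using a by simp
      qed
    qed
    then show ?thesis by (intro bexI[OF ballI hom_dual_of_scalar[OF Ym l(1)]])
  qed
  then show ?thesis using fg unfolding injective_mod_def by blast
qed

text \<open>The adjoint of a K-linear f with f(x) nonzero does not vanish at x, as evaluation at 1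
  shows.\<close>

lemma dual_separates:
  assumes J: "dualizing_mod K J" and X: "fg_mod A X" and x: "x \<in> carrier X" "x \<noteq> \<zero>\<^bsub>X\<^esub>"
  shows "\<exists>f\<in>mod_hom A X (dual_mod K A J). f x \<noteq> \<zero>\<^bsub>dual_mod K A J\<^esub>"
proof -
  have Xm: "right_module A X" using X by (simp add: fg_mod_def)
  interpret X: right_module A X by fact
  obtain f where f: "f \<in> mod_hom K (scalar_mod A X) J" "f x \<noteq> \<zero>\<^bsub>J\<^esub>"
    using dualizing_mod_separates[OF artinian_base J fg_scalar[OF X], of x] x
    by (auto simp: scalar_mod_def)
  have "(\<lambda>a\<in>carrier A. f (a \<odot>\<^bsub>X\<^esub> x)) \<noteq> (\<lambda>a\<in>carrier A. \<zero>\<^bsub>J\<^esub>)"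
  proof
    assume "(\<lambda>a\<in>carrier A. f (a \<odot>\<^bsub>X\<^esub> x)) = (\<lambda>a\<in>carrier A. \<zero>\<^bsub>J\<^esub>)"
    from fun_cong[OF this, of "\<one>\<^bsub>A\<^esub>"] show False using f(2) x(1) by simp
  qed
  then show ?thesis by (intro bexI[OF _ hom_dual_of_scalar[OF Xm f(1)]]) simp
qed

lemma dual_embedding:
  assumes J: "dualizing_mod K J" and X: "fg_mod A X"
  obtains n f where "f \<in> mod_mono A X (mod_pow (dual_mod K A J) n)"
proof -
  have Xm: "right_module A X" using X by (simp add: fg_mod_def)
  have Jm: "right_module K J"
    using dualizing_mod_injective[OF J] by (simp add: injective_mod_def fg_mod_def)
  show thesis
    using embedding_of_separating[OF Xm fg_finite_length_A[OF X] right_module_dual[OF Jm]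
        dual_separates[OF J X]] that by blast
qed

end

section \<open>Homomorphism modules over endomorphism rings\<close>

text \<open>Hom_R(T, X) with End(T) acting by precomposition. Elements are extensional, so equality
  of homomorphisms on T is equality of functions, and X = T gives the regular module on the
  nose.\<close>

definition hom_mod ::
  "('r, 'z) ring_scheme \<Rightarrow> ('r, 't) module \<Rightarrow> ('r, 'x) module \<Rightarrow> ('t \<Rightarrow> 't, 't \<Rightarrow> 'x) module" where
  "hom_mod R T X = \<lparr>carrier = mod_hom R T X \<inter> extensional (carrier T), mult = undefined, one = undefined,
     zero = (\<lambda>t\<in>carrier T. \<zero>\<^bsub>X\<^esub>),
     add = (\<lambda>f g. \<lambda>t\<in>carrier T. f t \<oplus>\<^bsub>X\<^esub> g t),
     smult = (\<lambda>b f. compose (carrier T) f b)\<rparr>"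

lemma hom_mod_simps [simp]:
  "carrier (hom_mod R T X) = mod_hom R T X \<inter> extensional (carrier T)"
  "\<zero>\<^bsub>hom_mod R T X\<^esub> = (\<lambda>t\<in>carrier T. \<zero>\<^bsub>X\<^esub>)"
  "f \<oplus>\<^bsub>hom_mod R T X\<^esub> g = (\<lambda>t\<in>carrier T. f t \<oplus>\<^bsub>X\<^esub> g t)"
  "b \<odot>\<^bsub>hom_mod R T X\<^esub> f = compose (carrier T) f b"
  by (simp_all add: hom_mod_def)

lemma end_ring_simps [simp]:
  "carrier (end_ring R T) = mod_hom R T T \<inter> extensional (carrier T)"
  "\<zero>\<^bsub>end_ring R T\<^esub> = (\<lambda>t\<in>carrier T. \<zero>\<^bsub>T\<^esub>)"
  "\<one>\<^bsub>end_ring R T\<^esub> = (\<lambda>t\<in>carrier T. t)"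
  "f \<oplus>\<^bsub>end_ring R T\<^esub> g = (\<lambda>t\<in>carrier T. f t \<oplus>\<^bsub>T\<^esub> g t)"
  "f \<otimes>\<^bsub>end_ring R T\<^esub> g = compose (carrier T) f g"
  by (simp_all add: end_ring_def)

text \<open>An equality of records and not merely an isomorphism: b acts on f as the product f b on
  both sides, and the remaining fields are \<open>undefined\<close> on both sides.\<close>

lemma regular_end_ring: "regular_mod (end_ring R T) = hom_mod R T T"
  by (simp add: regular_mod_def hom_mod_def end_ring_def)

lemma compose_hom:
  assumes T: "right_module R T" and f: "f \<in> mod_hom R T X" and g: "g \<in> mod_hom R X Y"
  shows "compose (carrier T) g f \<in> mod_hom R T Y \<inter> extensional (carrier T)"
  using restrict_mod_hom[OF T mod_hom_comp[OF f g]] by (simp add: compose_def)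

lemma ring_end_ring:
  assumes T: "right_module R T" shows "ring (end_ring R T)"
proof (rule ringI)
  show "abelian_group (end_ring R T)"
    by (rule abelian_group_homs[OF T T]) (simp_all add: end_ring_def)
  show "monoid (end_ring R T)"
  proof (rule monoidI)
    fix f g h assume fgh: "f \<in> carrier (end_ring R T)" "g \<in> carrier (end_ring R T)" "h \<in> carrier (end_ring R T)"
    then show "f \<otimes>\<^bsub>end_ring R T\<^esub> g \<in> carrier (end_ring R T)"
      using compose_hom[OF T, of g T f T] by simp
    show "f \<otimes>\<^bsub>end_ring R T\<^esub> g \<otimes>\<^bsub>end_ring R T\<^esub> h = f \<otimes>\<^bsub>end_ring R T\<^esub> (g \<otimes>\<^bsub>end_ring R T\<^esub> h)"
      using fgh mod_hom_closed[of h R T T] by (auto simp: compose_def restrict_def fun_eq_iff)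
  next
    show "\<one>\<^bsub>end_ring R T\<^esub> \<in> carrier (end_ring R T)"
      using restrict_mod_hom[OF T mod_hom_id] by simp
  next
    fix f assume "f \<in> carrier (end_ring R T)"
    then have f: "f \<in> mod_hom R T T" "f \<in> extensional (carrier T)" by simp_all
    show "\<one>\<^bsub>end_ring R T\<^esub> \<otimes>\<^bsub>end_ring R T\<^esub> f = f"
      using f(2) mod_hom_closed[OF f(1)] by (auto simp: compose_def restrict_def fun_eq_iff extensional_def)
    show "f \<otimes>\<^bsub>end_ring R T\<^esub> \<one>\<^bsub>end_ring R T\<^esub> = f"
      using f(2) by (auto simp: compose_def restrict_def fun_eq_iff extensional_def)
  qed
next
  fix f g h assume fgh: "f \<in> carrier (end_ring R T)" "g \<in> carrier (end_ring R T)" "h \<in> carrier (end_ring R T)"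
  then have h: "h \<in> mod_hom R T T" and c: "\<And>t. t \<in> carrier T \<Longrightarrow> f t \<in> carrier T"
    "\<And>t. t \<in> carrier T \<Longrightarrow> g t \<in> carrier T" "\<And>t. t \<in> carrier T \<Longrightarrow> h t \<in> carrier T"
    using mod_hom_closed[of f R T T] mod_hom_closed[of g R T T] mod_hom_closed[of h R T T] by auto
  show "(f \<oplus>\<^bsub>end_ring R T\<^esub> g) \<otimes>\<^bsub>end_ring R T\<^esub> h =
      f \<otimes>\<^bsub>end_ring R T\<^esub> h \<oplus>\<^bsub>end_ring R T\<^esub> g \<otimes>\<^bsub>end_ring R T\<^esub> h"
    using c by (auto simp: compose_def restrict_def fun_eq_iff)
  show "h \<otimes>\<^bsub>end_ring R T\<^esub> (f \<oplus>\<^bsub>end_ring R T\<^esub> g) =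
      h \<otimes>\<^bsub>end_ring R T\<^esub> f \<oplus>\<^bsub>end_ring R T\<^esub> h \<otimes>\<^bsub>end_ring R T\<^esub> g"
    using c by (auto simp: compose_def restrict_def fun_eq_iff mod_hom_add[OF h])
qed

section \<open>The functor Hom(T, -)\<close>

lemma right_module_hom_mod:
  assumes T: "right_module R T" and X: "right_module R X"
  shows "right_module (end_ring R T) (hom_mod R T X)"
proof -
  have "abelian_group (hom_mod R T X)"
    by (rule abelian_group_homs[OF T X]) (simp_all add: hom_mod_def)
  moreover have "right_module_axioms (end_ring R T) (hom_mod R T X)"
  proof
    fix a f assume "a \<in> carrier (end_ring R T)" "f \<in> carrier (hom_mod R T X)"
    then have a: "a \<in> mod_hom R T T" and f: "f \<in> mod_hom R T X" by simp_all
    note ac = mod_hom_closed[OF a]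
    show "a \<odot>\<^bsub>hom_mod R T X\<^esub> f \<in> carrier (hom_mod R T X)"
      using compose_hom[OF T a f] by simp
    fix b assume "b \<in> carrier (end_ring R T)"
    then have b: "b \<in> mod_hom R T T" by simp
    note bc = mod_hom_closed[OF b]
    show "(a \<oplus>\<^bsub>end_ring R T\<^esub> b) \<odot>\<^bsub>hom_mod R T X\<^esub> f =
        a \<odot>\<^bsub>hom_mod R T X\<^esub> f \<oplus>\<^bsub>hom_mod R T X\<^esub> b \<odot>\<^bsub>hom_mod R T X\<^esub> f"
      using ac bc by (auto simp: compose_def restrict_def fun_eq_iff mod_hom_add[OF f])
    show "(a \<otimes>\<^bsub>end_ring R T\<^esub> b) \<odot>\<^bsub>hom_mod R T X\<^esub> f = b \<odot>\<^bsub>hom_mod R T X\<^esub> (a \<odot>\<^bsub>hom_mod R T X\<^esub> f)"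
      using bc by (auto simp: compose_def restrict_def fun_eq_iff)
  next
    fix a f g assume "a \<in> carrier (end_ring R T)"
    then have a: "a \<in> mod_hom R T T" by simp
    show "a \<odot>\<^bsub>hom_mod R T X\<^esub> (f \<oplus>\<^bsub>hom_mod R T X\<^esub> g) =
        a \<odot>\<^bsub>hom_mod R T X\<^esub> f \<oplus>\<^bsub>hom_mod R T X\<^esub> a \<odot>\<^bsub>hom_mod R T X\<^esub> g"
      using mod_hom_closed[OF a] by (auto simp: compose_def restrict_def fun_eq_iff)
  next
    fix f assume "f \<in> carrier (hom_mod R T X)"
    then show "\<one>\<^bsub>end_ring R T\<^esub> \<odot>\<^bsub>hom_mod R T X\<^esub> f = f"
      by (auto simp: compose_def restrict_def fun_eq_iff extensional_def)
  qed
  ultimately show ?thesis using ring_end_ring[OF T] by (simp add: right_module_def)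
qed

lemma hom_mod_map:
  assumes T: "right_module R T" and \<phi>: "\<phi> \<in> mod_hom R X Y"
  shows "(\<lambda>f. compose (carrier T) \<phi> f) \<in> mod_hom (end_ring R T) (hom_mod R T X) (hom_mod R T Y)"
proof (rule mod_homI)
  fix f assume "f \<in> carrier (hom_mod R T X)"
  then have f: "f \<in> mod_hom R T X" by simp
  show "compose (carrier T) \<phi> f \<in> carrier (hom_mod R T Y)" using compose_hom[OF T f \<phi>] by simp
  fix g assume "g \<in> carrier (hom_mod R T X)"
  then have g: "g \<in> mod_hom R T X" by simp
  show "compose (carrier T) \<phi> (f \<oplus>\<^bsub>hom_mod R T X\<^esub> g) =
      compose (carrier T) \<phi> f \<oplus>\<^bsub>hom_mod R T Y\<^esub> compose (carrier T) \<phi> g"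
    using mod_hom_closed[OF f] mod_hom_closed[OF g]
    by (auto simp: compose_def restrict_def fun_eq_iff mod_hom_add[OF \<phi>])
next
  fix b f assume "b \<in> carrier (end_ring R T)"
  then have b: "b \<in> mod_hom R T T" by simp
  show "compose (carrier T) \<phi> (b \<odot>\<^bsub>hom_mod R T X\<^esub> f) = b \<odot>\<^bsub>hom_mod R T Y\<^esub> compose (carrier T) \<phi> f"
    using mod_hom_closed[OF b] by (auto simp: compose_def restrict_def fun_eq_iff)
qed

text \<open>Hom(T, -) respects sums and turns a composite through T into one through Hom(T, T),
  which is the regular module of End(T).\<close>

lemma hom_mod_thru:
  assumes T: "right_module R T" and X: "right_module R X" and Y: "right_module R Y"
    and \<phi>: "\<phi> \<in> thru R T X Y"
  shows "(\<lambda>f. compose (carrier T) \<phi> f) \<in>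
    thru (end_ring R T) (regular_mod (end_ring R T)) (hom_mod R T X) (hom_mod R T Y)"
  using \<phi>
proof induction
  case (comp f g \<phi>)
  show ?case
    unfolding regular_end_ring
  proof (rule thru.comp[OF hom_mod_map[OF T comp(1)] hom_mod_map[OF T comp(2)]])
    fix h assume "h \<in> carrier (hom_mod R T X)"
    then have h: "h \<in> mod_hom R T X" by simp
    show "compose (carrier T) \<phi> h = compose (carrier T) g (compose (carrier T) f h)"
      using comp(3) mod_hom_closed[OF h] by (auto simp: compose_def restrict_def fun_eq_iff)
  qed
next
  case (add \<phi> \<psi> \<theta>)
  show ?case
  proof (rule thru.add[OF add.IH])
    fix h assume "h \<in> carrier (hom_mod R T X)"
    then have h: "h \<in> mod_hom R T X" by simp
    show "compose (carrier T) \<theta> h =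
        compose (carrier T) \<phi> h \<oplus>\<^bsub>hom_mod R T Y\<^esub> compose (carrier T) \<psi> h"
      using add.hyps(3) mod_hom_closed[OF h] by (auto simp: compose_def restrict_def fun_eq_iff)
  qed
qed

lemma hom_mod_summand:
  assumes T: "right_module R T" and F: "summand_of R T F"
  shows "summand_of (end_ring R T) (regular_mod (end_ring R T)) (hom_mod R T F)"
proof -
  have Fm: "right_module R F" and i: "(\<lambda>x. x) \<in> thru R T F F" using F by (simp_all add: summand_of_def)
  have "(\<lambda>f. f) \<in> thru (end_ring R T) (regular_mod (end_ring R T)) (hom_mod R T F) (hom_mod R T F)"
  proof (rule thru_cong[OF hom_mod_thru[OF T Fm Fm i]])
    fix f assume "f \<in> carrier (hom_mod R T F)"
    then show "f = compose (carrier T) (\<lambda>x. x) f"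
      by (auto simp: compose_def restrict_def fun_eq_iff extensional_def)
  qed
  then show ?thesis using right_module_hom_mod[OF T Fm] by (simp add: summand_of_def)
qed

text \<open>
  If \<open>R\<close> is a retract of \<open>T\<close>, then \<open>U\<close> is recovered from \<open>Hom(T, U)\<close> by sending \<open>x\<close> to the map
  \<open>T \<rightarrow> R \<rightarrow> U\<close> determined by \<open>x\<close>.
\<close>

lemma thru_of_hom_mod:
  assumes T: "right_module R T" and U: "right_module R U" and U': "right_module R U'"
    and \<iota>: "\<iota> \<in> mod_hom R (regular_mod R) T" and \<pi>: "\<pi> \<in> mod_hom R T (regular_mod R)"
    and one: "\<And>a. a \<in> carrier R \<Longrightarrow> \<pi> (\<iota> a) = a"
    and \<Phi>: "\<Phi> \<in> thru (end_ring R T) (regular_mod (end_ring R T)) (hom_mod R T U) (hom_mod R T U')"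
  shows "(\<lambda>x. \<Phi> (\<lambda>t\<in>carrier T. \<pi> t \<odot>\<^bsub>U\<^esub> x) (\<iota> \<one>\<^bsub>R\<^esub>)) \<in> thru R T U U'"
proof -
  interpret U: right_module R U by fact
  interpret T: right_module R T by fact
  let ?B = "end_ring R T"
  let ?z = "\<lambda>x. \<lambda>t\<in>carrier T. \<pi> t \<odot>\<^bsub>U\<^esub> x"
  have B: "ring ?B" by (rule ring_end_ring[OF T])
  have \<pi>c: "\<pi> t \<in> carrier R" if "t \<in> carrier T" for t
    using mod_hom_closed[OF \<pi> that] by (simp add: regular_mod_def)
  have \<iota>c: "\<iota> a \<in> carrier T" if "a \<in> carrier R" for a
    using mod_hom_closed[OF \<iota>, of a] that by (simp add: regular_mod_def)
  have z: "?z x \<in> carrier (hom_mod R T U)" if "x \<in> carrier U" for x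
    using restrict_mod_hom[OF T mod_hom_comp[OF \<pi> mod_hom_regular[OF U that]]] by simp
  show ?thesis using \<Phi>
  proof induction
    case (comp f g \<Phi>)
    have oneB: "\<one>\<^bsub>?B\<^esub> \<in> carrier (regular_mod ?B)"
      using restrict_mod_hom[OF T mod_hom_id] by (simp add: regular_end_ring)
    have g1: "g \<one>\<^bsub>?B\<^esub> \<in> mod_hom R T U'" using mod_hom_closed[OF comp(2) oneB] by simp
    have fz: "f (?z x) \<in> carrier ?B" if "x \<in> carrier U" for x
      using mod_hom_closed[OF comp(1) z[OF that]] by (simp add: regular_end_ring)
    \<comment> \<open>f takes values in End(T). Inserting x as \<open>?z x\<close> and evaluating
      the result at \<iota> 1 turns f into a map U -> T.\<close>
    let ?f = "\<lambda>x. f (?z x) (\<iota> \<one>\<^bsub>R\<^esub>)"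
    have f': "?f \<in> mod_hom R U T"
    proof (rule mod_homI)
      fix x assume x: "x \<in> carrier U"
      have fx: "f (?z x) \<in> mod_hom R T T" using fz[OF x] by simp
      show "?f x \<in> carrier T" by (rule mod_hom_closed[OF fx \<iota>c]) simp
      fix y assume y: "y \<in> carrier U"
      have "?z (x \<oplus>\<^bsub>U\<^esub> y) = ?z x \<oplus>\<^bsub>hom_mod R T U\<^esub> ?z y"
        using x y \<pi>c by (auto simp: restrict_def fun_eq_iff U.smult_r_distr)
      then have "f (?z (x \<oplus>\<^bsub>U\<^esub> y)) = f (?z x) \<oplus>\<^bsub>regular_mod ?B\<^esub> f (?z y)"
        by (simp only: mod_hom_add[OF comp(1) z[OF x] z[OF y]])
      then show "?f (x \<oplus>\<^bsub>U\<^esub> y) = ?f x \<oplus>\<^bsub>T\<^esub> ?f y"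
        by (simp add: regular_end_ring \<iota>c)
    next
      fix a x assume a: "a \<in> carrier R" and x: "x \<in> carrier U"
      have fx: "f (?z x) \<in> mod_hom R T T" using fz[OF x] by simp
      \<comment> \<open>\<open>?b\<close> is the endomorphism of T that performs left multiplication
        by a on the summand R. It translates the action of a on x into the action of End(T) on
        \<open>?z x\<close>.\<close>
      let ?b = "\<lambda>t\<in>carrier T. \<iota> (a \<otimes>\<^bsub>R\<^esub> \<pi> t)"
      have "(\<lambda>c. a \<otimes>\<^bsub>R\<^esub> c) \<in> mod_hom R (regular_mod R) (regular_mod R)"
        using a by (intro mod_homI) (simp_all add: regular_mod_def U.R.r_distr U.R.m_assoc)
      then have b: "?b \<in> carrier ?B"
        using restrict_mod_hom[OF T mod_hom_comp[OF mod_hom_comp[OF \<pi>] \<iota>]] by simp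
      have "?z (a \<odot>\<^bsub>U\<^esub> x) = ?b \<odot>\<^bsub>hom_mod R T U\<^esub> ?z x"
        using a x \<pi>c \<iota>c one by (auto simp: compose_def restrict_def fun_eq_iff U.smult_assoc)
      then have "f (?z (a \<odot>\<^bsub>U\<^esub> x)) = ?b \<odot>\<^bsub>regular_mod ?B\<^esub> f (?z x)"
        by (simp only: mod_hom_smult[OF comp(1) b z[OF x]])
      then have "?f (a \<odot>\<^bsub>U\<^esub> x) = f (?z x) (?b (\<iota> \<one>\<^bsub>R\<^esub>))"
        using \<iota>c by (simp add: regular_end_ring compose_def)
      also have "?b (\<iota> \<one>\<^bsub>R\<^esub>) = a \<odot>\<^bsub>T\<^esub> \<iota> \<one>\<^bsub>R\<^esub>"
        using a \<iota>c one mod_hom_regular_eq[OF U.R.ring_axioms \<iota> a] by simp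
      also have "f (?z x) (a \<odot>\<^bsub>T\<^esub> \<iota> \<one>\<^bsub>R\<^esub>) = a \<odot>\<^bsub>T\<^esub> ?f x"
        by (rule mod_hom_smult[OF fx a \<iota>c]) simp
      finally show "?f (a \<odot>\<^bsub>U\<^esub> x) = a \<odot>\<^bsub>T\<^esub> ?f x" .
    qed
    show ?case
    proof (rule thru.comp[OF f' g1])
      fix x assume x: "x \<in> carrier U"
      \<comment> \<open>g is determined by its value at 1, a homomorphism T -> U'; applying g to
        \<open>f (?z x)\<close> is therefore composition with that homomorphism.\<close>
      have "\<Phi> (?z x) = g (f (?z x))" by (rule comp(3)[OF z[OF x]])
      also have "\<dots> = f (?z x) \<odot>\<^bsub>hom_mod R T U'\<^esub> g \<one>\<^bsub>?B\<^esub>"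
        by (rule mod_hom_regular_eq[OF B comp(2) fz[OF x]])
      finally show "\<Phi> (?z x) (\<iota> \<one>\<^bsub>R\<^esub>) = g \<one>\<^bsub>?B\<^esub> (?f x)" using \<iota>c by (simp add: compose_def)
    qed
  next
    case (add \<phi> \<psi> \<theta>)
    show ?case
    proof (rule thru.add[OF add.IH])
      fix x assume x: "x \<in> carrier U"
      show "\<theta> (?z x) (\<iota> \<one>\<^bsub>R\<^esub>) = \<phi> (?z x) (\<iota> \<one>\<^bsub>R\<^esub>) \<oplus>\<^bsub>U'\<^esub> \<psi> (?z x) (\<iota> \<one>\<^bsub>R\<^esub>)"
        using add.hyps(3)[OF z[OF x]] \<iota>c by simp
    qed
  qed
qed

text \<open>A converse of \<open>hom_mod_summand\<close>: the identity of Hom(T, U) gives back the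
  identity of U, because the value recovered from x is \<pi> (\<iota> 1) acting on x.\<close>

lemma summand_of_hom_mod:
  assumes T: "right_module R T" and U: "right_module R U"
    and \<iota>: "\<iota> \<in> mod_hom R (regular_mod R) T" and \<pi>: "\<pi> \<in> mod_hom R T (regular_mod R)"
    and one: "\<And>a. a \<in> carrier R \<Longrightarrow> \<pi> (\<iota> a) = a"
    and s: "summand_of (end_ring R T) (regular_mod (end_ring R T)) (hom_mod R T U)"
  shows "summand_of R T U"
proof -
  interpret U: right_module R U by fact
  have \<iota>c: "\<iota> \<one>\<^bsub>R\<^esub> \<in> carrier T"
    by (rule mod_hom_closed[OF \<iota>]) (simp add: regular_mod_def)
  have i: "(\<lambda>x. x) \<in> thru (end_ring R T) (regular_mod (end_ring R T)) (hom_mod R T U) (hom_mod R T U)"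
    using s by (simp add: summand_of_def)
  have "(\<lambda>x. x) \<in> thru R T U U"
    by (rule thru_cong[OF thru_of_hom_mod[OF T U U \<iota> \<pi> one i]]) (simp_all add: \<iota>c one)
  then show ?thesis using U by (simp add: summand_of_def)
qed

section \<open>Syzygies and global dimension\<close>

text \<open>
  A form of Schanuel's lemma: if \<open>X'\<close> is a direct summand of \<open>X \<oplus> R\<^sup>n\<close>, then a syzygy of \<open>X'\<close> is a
  direct summand of a syzygy of \<open>X\<close> plus a free module. Being such a summand is expressed by maps
  \<open>a\<close>, \<open>b\<close> between \<open>X'\<close> and \<open>X\<close> whose composite differs from the identity by a map through \<open>R\<^sup>n\<close>.
\<close>

lemma stable_retract_syzygy:
  assumes X: "right_module R X" and X': "right_module R X'" and K: "right_module R K" and K': "right_module R K'"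
    and P: "summand_of R (regular_mod R) P" and Q: "summand_of R (regular_mod R) Q"
    and p: "p \<in> mod_epi R P X" and q: "q \<in> mod_epi R Q X'"
    and i: "i \<in> mod_mono R K P" "i ` carrier K = a_kernel P X p"
    and j: "j \<in> mod_mono R K' Q" "j ` carrier K' = a_kernel Q X' q"
    and a: "a \<in> mod_hom R X' X" and b: "b \<in> mod_hom R X X'"
    and \<phi>: "\<phi> \<in> thru R (regular_mod R) X' X'"
    and eq: "\<And>x. x \<in> carrier X' \<Longrightarrow> x = b (a x) \<oplus>\<^bsub>X'\<^esub> \<phi> x"
  shows "\<exists>a'\<in>mod_hom R K' K. \<exists>b'\<in>mod_hom R K K'. \<exists>\<psi>\<in>thru R (regular_mod R) K' K'.
    \<forall>x\<in>carrier K'. x = b' (a' x) \<oplus>\<^bsub>K'\<^esub> \<psi> x"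
proof -
  have Pm: "right_module R P" and Qm: "right_module R Q" using P Q by (simp_all add: summand_of_def)
  interpret X': right_module R X' by fact
  interpret Q: right_module R Q by (rule Qm)
  note ph = mod_epiD(1)[OF p] and qh = mod_epiD(1)[OF q]
  note ih = mod_monoD(1)[OF i(1)] and jh = mod_monoD(1)[OF j(1)]
  \<comment> \<open>\<alpha> and \<beta> lift a and b to the covers, and \<sigma> lifts \<phi>. The
    first two restrict to the syzygies as a' and b'.\<close>
  obtain \<alpha> where \<alpha>: "\<alpha> \<in> mod_hom R Q P" "\<forall>x\<in>carrier Q. p (\<alpha> x) = a (q x)"
    using summand_of_regular_lift[OF Q Pm p mod_hom_comp[OF qh a]] by blast
  obtain \<beta> where \<beta>: "\<beta> \<in> mod_hom R P Q" "\<forall>x\<in>carrier P. q (\<beta> x) = b (p x)"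
    using summand_of_regular_lift[OF P Qm q mod_hom_comp[OF ph b]] by blast
  obtain \<sigma> where \<sigma>: "\<sigma> \<in> mod_hom R X' Q" "\<forall>x\<in>carrier X'. q (\<sigma> x) = \<phi> x"
    using thru_regular_lift[OF X' Qm q \<phi>] by blast
  have ker_j: "j x \<in> carrier Q" "q (j x) = \<zero>\<^bsub>X'\<^esub>" if x: "x \<in> carrier K'" for x
  proof -
    have "j x \<in> a_kernel Q X' q" using x j(2) by blast
    then show "j x \<in> carrier Q" "q (j x) = \<zero>\<^bsub>X'\<^esub>" by (simp_all add: a_kernel_iff)
  qed
  have ker_i: "i x \<in> carrier P" "p (i x) = \<zero>\<^bsub>X\<^esub>" if x: "x \<in> carrier K" for x
  proof -
    have "i x \<in> a_kernel P X p" using x i(2) by blast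
    then show "i x \<in> carrier P" "p (i x) = \<zero>\<^bsub>X\<^esub>" by (simp_all add: a_kernel_iff)
  qed
  have "\<exists>a'\<in>mod_hom R K' K. \<forall>x\<in>carrier K'. i (a' x) = \<alpha> (j x)"
  proof (rule factor_mono[OF K' K i(1) mod_hom_comp[OF jh \<alpha>(1)]])
    have "\<alpha> (j x) \<in> a_kernel P X p" if x: "x \<in> carrier K'" for x
      using ker_j[OF x] \<alpha>(2) mod_hom_closed[OF \<alpha>(1)] mod_hom_zero[OF X' X a] by (simp add: a_kernel_iff)
    then show "(\<lambda>x. \<alpha> (j x)) ` carrier K' \<subseteq> i ` carrier K" unfolding i(2) by blast
  qed
  then obtain a' where a': "a' \<in> mod_hom R K' K" "\<forall>x\<in>carrier K'. i (a' x) = \<alpha> (j x)" by blast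
  have "\<exists>b'\<in>mod_hom R K K'. \<forall>x\<in>carrier K. j (b' x) = \<beta> (i x)"
  proof (rule factor_mono[OF K K' j(1) mod_hom_comp[OF ih \<beta>(1)]])
    have "\<beta> (i x) \<in> a_kernel Q X' q" if x: "x \<in> carrier K" for x
      using ker_i[OF x] \<beta>(2) mod_hom_closed[OF \<beta>(1)] mod_hom_zero[OF X X' b] by (simp add: a_kernel_iff)
    then show "(\<lambda>x. \<beta> (i x)) ` carrier K \<subseteq> j ` carrier K'" unfolding j(2) by blast
  qed
  then obtain b' where b': "b' \<in> mod_hom R K K'" "\<forall>x\<in>carrier K. j (b' x) = \<beta> (i x)" by blast
  \<comment> \<open>The defect of \<beta> \<alpha> + \<sigma> q from the identity of Q. It lies over
    1 - b a - \<phi> = 0 and so takes values in the kernel of q. On K' the term \<sigma> q vanishes,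
    and the defect becomes the correction \<psi>, which factors through the projective module
    Q.\<close>
  let ?s = "\<lambda>y. (y \<ominus>\<^bsub>Q\<^esub> \<beta> (\<alpha> y)) \<ominus>\<^bsub>Q\<^esub> \<sigma> (q y)"
  have sh: "?s \<in> mod_hom R Q Q"
    by (intro mod_hom_sub[OF Qm] mod_hom_id mod_hom_comp[OF \<alpha>(1) \<beta>(1)] mod_hom_comp[OF qh \<sigma>(1)])
  have "\<exists>s\<in>mod_hom R Q K'. \<forall>y\<in>carrier Q. j (s y) = ?s y"
  proof (rule factor_mono[OF Qm K' j(1) sh])
    have "?s y \<in> a_kernel Q X' q" if y: "y \<in> carrier Q" for y
    proof -
      have c: "\<alpha> y \<in> carrier P" "q y \<in> carrier X'" "\<beta> (\<alpha> y) \<in> carrier Q" "\<sigma> (q y) \<in> carrier Q"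
        "b (a (q y)) \<in> carrier X'" "\<phi> (q y) \<in> carrier X'"
        using y mod_hom_closed[OF \<alpha>(1)] mod_hom_closed[OF \<beta>(1)] mod_hom_closed[OF qh]
          mod_hom_closed[OF \<sigma>(1)] mod_hom_closed[OF a] mod_hom_closed[OF b]
          mod_hom_closed[OF thru_hom[OF X' X' \<phi>]] by simp_all
      have "q (?s y) = (q y \<ominus>\<^bsub>X'\<^esub> b (a (q y))) \<ominus>\<^bsub>X'\<^esub> \<phi> (q y)"
        using y c \<alpha>(2) \<beta>(2) \<sigma>(2) by (simp add: mod_hom_diff[OF Qm X' qh])
      also have "q y \<ominus>\<^bsub>X'\<^esub> b (a (q y)) = \<phi> (q y)"
        using eq[OF c(2)] c(5,6) by (metis X'.M.add_diff_cancel(2))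
      finally have "q (?s y) = \<zero>\<^bsub>X'\<^esub>" using c by (simp add: X'.M.diff_eq_zero_iff)
      then show ?thesis using mod_hom_closed[OF sh y] by (simp add: a_kernel_iff)
    qed
    then show "?s ` carrier Q \<subseteq> j ` carrier K'" unfolding j(2) by blast
  qed
  then obtain s where s: "s \<in> mod_hom R Q K'" "\<forall>y\<in>carrier Q. j (s y) = ?s y" by blast
  have "x = b' (a' x) \<oplus>\<^bsub>K'\<^esub> s (j x)" if x: "x \<in> carrier K'" for x
  proof (rule inj_onD[OF mod_monoD(2)[OF j(1)] _ x])
    interpret K': right_module R K' by fact
    have c: "a' x \<in> carrier K" "b' (a' x) \<in> carrier K'" "s (j x) \<in> carrier K'" "\<alpha> (j x) \<in> carrier P"
      "\<beta> (\<alpha> (j x)) \<in> carrier Q"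
      using x ker_j(1)[OF x] mod_hom_closed[OF a'(1)] mod_hom_closed[OF b'(1)] mod_hom_closed[OF s(1)]
        mod_hom_closed[OF \<alpha>(1)] mod_hom_closed[OF \<beta>(1)] by simp_all
    show "b' (a' x) \<oplus>\<^bsub>K'\<^esub> s (j x) \<in> carrier K'" using c by simp
    have "j (s (j x)) = j x \<ominus>\<^bsub>Q\<^esub> \<beta> (\<alpha> (j x))"
      using s(2) ker_j[OF x] c mod_hom_zero[OF X' Qm \<sigma>(1)] by (simp add: Q.M.minus_zero_right)
    moreover have "j (b' (a' x)) = \<beta> (\<alpha> (j x))" using b'(2) a'(2) c x by simp
    ultimately have "j (b' (a' x) \<oplus>\<^bsub>K'\<^esub> s (j x)) = j x"
      using c ker_j[OF x] by (simp add: mod_hom_add[OF jh] Q.M.diff_add_cancel)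
    then show "j x = j (b' (a' x) \<oplus>\<^bsub>K'\<^esub> s (j x))" by simp
  qed
  then show ?thesis
    by (intro bexI[OF _ a'(1)] bexI[OF _ b'(1)] bexI[OF _ thru_summand[OF Q jh s(1)]]) blast
qed

section \<open>Resolutions from a bound on the global dimension\<close>

lemma Inf_enat_mem: "(s :: enat) \<in> S \<Longrightarrow> Inf S \<in> S"
  by (auto simp: Inf_enat_def intro: LeastI)

text \<open>\<open>proj_dim\<close> is an infimum in \<open>enat\<close>. A finite bound excludes
  the empty set, whose infimum is \<infinity>, and by well-ordering the infimum is the length of an
  actual resolution.\<close>

lemma gl_dim_le_resolution:
  fixes M :: "'r umod"
  assumes g: "gl_dim R \<le> enat n" and M: "fg_mod R M"
  obtains P d e where "proj_resolution R M P d e" "\<forall>i>n. carrier (P i) = {\<zero>\<^bsub>P i\<^esub>}"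
proof -
  define Q where "Q m \<longleftrightarrow> (\<exists>P d e. proj_resolution R M P d e \<and> (\<forall>i>m. carrier (P i) = {\<zero>\<^bsub>P i\<^esub>}))" for m
  have pd: "proj_dim R M = Inf {enat m | m. Q m}" by (simp add: proj_dim_def Q_def)
  have "proj_dim R M \<le> gl_dim R" unfolding gl_dim_def using M by (intro SUP_upper) simp
  then have le: "Inf {enat m | m. Q m} \<le> enat n" using g unfolding pd by (rule order_trans)
  have "{enat m | m. Q m} \<noteq> {}"
  proof
    assume "{enat m | m. Q m} = {}"
    then have "Inf {enat m | m. Q m} = \<infinity>" by (simp only: Inf_empty top_enat_def)
    then show False using le by simp
  qed
  then obtain m0 where "Q m0" by blast
  then have "enat m0 \<in> {enat m | m. Q m}" by blast
  then have "Inf {enat m | m. Q m} \<in> {enat m | m. Q m}" by (rule Inf_enat_mem)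
  then obtain m where m1: "Inf {enat m | m. Q m} = enat m" "Q m" by blast
  obtain P d e where m: "proj_resolution R M P d e" "\<forall>i>m. carrier (P i) = {\<zero>\<^bsub>P i\<^esub>}"
    using m1(2) unfolding Q_def by (elim exE conjE)
  have "m \<le> n" using le m1(1) by simp
  then have "\<forall>i>n. carrier (P i) = {\<zero>\<^bsub>P i\<^esub>}" using m(2) by simp
  then show thesis by (rule that[OF m(1)])
qed

lemma mod_mono_incl:
  assumes "submodule U R M" shows "(\<lambda>x. x) \<in> mod_mono R (M\<lparr>carrier := U\<rparr>) M"
  using mod_hom_incl[OF submodule_subset[OF assms]] by (simp add: mod_mono_def)

lemma mod_epi_corestrict:
  assumes "h \<in> mod_hom R M N" "h ` carrier M = V" shows "h \<in> mod_epi R M (N\<lparr>carrier := V\<rparr>)"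
  using mod_hom_corestrict[OF assms(1), of V] assms(2) by (simp add: mod_epi_def)

lemma a_kernel_restrict: "a_kernel M (N\<lparr>carrier := V\<rparr>) h = a_kernel M N h"
  unfolding set_eq_iff a_kernel_iff by simp

lemma hom_mod_ext:
  assumes "h \<in> carrier (hom_mod R T X)" "h' \<in> carrier (hom_mod R T X)"
    and "\<And>t. t \<in> carrier T \<Longrightarrow> h t = h' t"
  shows "h = h'"
  using assms extensionalityI[of h "carrier T" h'] by simp

text \<open>
  Applying \<open>Hom(T, -)\<close> to \<open>0 \<rightarrow> U \<rightarrow> F\<^sub>2 \<rightarrow> F\<^sub>1 \<rightarrow> F\<^sub>0\<close> gives the start of a projective resolution
  over \<open>End(T)\<close>, whose third syzygy \<open>Hom(T, U)\<close> is projective when the global dimension is at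
  most 3.
\<close>

lemma kernel_summand_of_gl_dim:
  fixes R :: "('r, 'z) ring_scheme" and T :: "('r, 't) module"
  assumes R: "ring R" and T: "right_module R T" and U: "right_module R U"
    and \<iota>: "\<iota> \<in> mod_hom R (regular_mod R) T" and \<pi>: "\<pi> \<in> mod_hom R T (regular_mod R)"
    and one: "\<And>a. a \<in> carrier R \<Longrightarrow> \<pi> (\<iota> a) = a"
    and gl: "gl_dim (end_ring R T) \<le> enat 3"
    and F0: "summand_of R T F0" and F1: "summand_of R T F1" and F2: "summand_of R T F2"
    and j: "j \<in> mod_mono R U F2" and f: "f \<in> mod_hom R F2 F1" and g: "g \<in> mod_hom R F1 F0"
    and jf: "j ` carrier U = a_kernel F2 F1 f"
    and gf: "\<And>x. x \<in> carrier F2 \<Longrightarrow> g (f x) = \<zero>\<^bsub>F0\<^esub>"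
    and exact: "\<And>h. \<lbrakk>h \<in> mod_hom R T F1; \<And>t. t \<in> carrier T \<Longrightarrow> g (h t) = \<zero>\<^bsub>F0\<^esub>\<rbrakk>
      \<Longrightarrow> \<exists>h'\<in>mod_hom R T F2. \<forall>t\<in>carrier T. f (h' t) = h t"
  shows "summand_of R T U"
proof -
  let ?B = "end_ring R T"
  let ?S = "regular_mod ?B"
  note jh = mod_monoD(1)[OF j]
  have m: "right_module R F0" "right_module R F1" "right_module R F2"
    using F0 F1 F2 by (simp_all add: summand_of_def)
  have B: "ring ?B" by (rule ring_end_ring[OF T])
  define H0 H1 H2 HU where "H0 = hom_mod R T F0" and "H1 = hom_mod R T F1"
    and "H2 = hom_mod R T F2" and "HU = hom_mod R T U"
  note H_def = H0_def H1_def H2_def HU_def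
  have H: "right_module ?B H0" "right_module ?B H1" "right_module ?B H2" "right_module ?B HU"
    unfolding H_def by (intro right_module_hom_mod T m U)+
  have Hs: "summand_of ?B ?S H0" "summand_of ?B ?S H1" "summand_of ?B ?S H2"
    unfolding H_def by (intro hom_mod_summand T F0 F1 F2)+
  define fs gs js where "fs = (\<lambda>h. compose (carrier T) f h)" and "gs = (\<lambda>h. compose (carrier T) g h)"
    and "js = (\<lambda>h. compose (carrier T) j h)"
  have fs: "fs \<in> mod_hom ?B H2 H1" and gs: "gs \<in> mod_hom ?B H1 H0" and js: "js \<in> mod_hom ?B HU H2"
    unfolding H_def fs_def gs_def js_def by (intro hom_mod_map T f g jh)+
  have fs_val: "fs h t = f (h t)" if "t \<in> carrier T" for h t
    using that by (simp add: fs_def compose_def)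
  have js_val: "js h t = j (h t)" if "t \<in> carrier T" for h t
    using that by (simp add: js_def compose_def)
  have gs_zero: "gs h = \<zero>\<^bsub>H0\<^esub> \<longleftrightarrow> (\<forall>t\<in>carrier T. g (h t) = \<zero>\<^bsub>F0\<^esub>)" if "h \<in> carrier H1" for h
    by (auto simp: gs_def H0_def compose_def restrict_def fun_eq_iff)
  have fs_zero: "fs h = \<zero>\<^bsub>H1\<^esub> \<longleftrightarrow> (\<forall>t\<in>carrier T. f (h t) = \<zero>\<^bsub>F1\<^esub>)" if "h \<in> carrier H2" for h
    by (auto simp: fs_def H1_def compose_def restrict_def fun_eq_iff)
  \<comment> \<open>Exactness at Hom(T, F1): one inclusion comes from \<open>gf\<close>, the other
    is the lifting hypothesis \<open>exact\<close>.\<close>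
  have im_f: "fs ` carrier H2 = a_kernel H1 H0 gs"
  proof
    show "fs ` carrier H2 \<subseteq> a_kernel H1 H0 gs"
    proof
      fix y assume "y \<in> fs ` carrier H2"
      then obtain h where h: "h \<in> carrier H2" "y = fs h" by blast
      have hT: "h \<in> mod_hom R T F2" using h(1) by (simp add: H2_def)
      have y: "y \<in> carrier H1" unfolding h(2) by (rule mod_hom_closed[OF fs h(1)])
      have "g (y t) = \<zero>\<^bsub>F0\<^esub>" if "t \<in> carrier T" for t
        unfolding h(2) fs_val[OF that] by (rule gf[OF mod_hom_closed[OF hT that]])
      then show "y \<in> a_kernel H1 H0 gs" using gs_zero[OF y] y by (simp add: a_kernel_iff)
    qed
    show "a_kernel H1 H0 gs \<subseteq> fs ` carrier H2"
    proof
      fix h assume "h \<in> a_kernel H1 H0 gs"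
      then have h: "h \<in> carrier H1" "gs h = \<zero>\<^bsub>H0\<^esub>" by (simp_all add: a_kernel_iff)
      have hT: "h \<in> mod_hom R T F1" using h(1) by (simp add: H1_def)
      have "g (h t) = \<zero>\<^bsub>F0\<^esub>" if "t \<in> carrier T" for t using gs_zero[OF h(1)] h(2) that by blast
      then obtain h' where h': "h' \<in> mod_hom R T F2" "\<forall>t\<in>carrier T. f (h' t) = h t"
        using exact[OF hT] by blast
      let ?h = "restrict h' (carrier T)"
      have hc: "?h \<in> carrier H2" using restrict_mod_hom[OF T h'(1)] by (simp add: H2_def)
      have eq: "fs ?h t = h t" if "t \<in> carrier T" for t
        using h'(2) that unfolding fs_val[OF that] by simp
      have "fs ?h = h"
        by (rule hom_mod_ext[OF mod_hom_closed[OF fs hc, unfolded H1_def] h(1)[unfolded H1_def] eq])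
      then show "h \<in> fs ` carrier H2" using hc by blast
    qed
  qed
  \<comment> \<open>Left exactness of Hom(T, -): a map killed by f has its values in the image of j
    and factors through U.\<close>
  have im_j: "js ` carrier HU = a_kernel H2 H1 fs"
  proof
    show "js ` carrier HU \<subseteq> a_kernel H2 H1 fs"
    proof
      fix y assume "y \<in> js ` carrier HU"
      then obtain h where h: "h \<in> carrier HU" "y = js h" by blast
      have hT: "h \<in> mod_hom R T U" using h(1) by (simp add: HU_def)
      have y: "y \<in> carrier H2" unfolding h(2) by (rule mod_hom_closed[OF js h(1)])
      have "f (y t) = \<zero>\<^bsub>F1\<^esub>" if "t \<in> carrier T" for t
      proof -
        have "j (h t) \<in> a_kernel F2 F1 f" unfolding jf[symmetric] using mod_hom_closed[OF hT that] by blast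
        then show ?thesis unfolding h(2) js_val[OF that] by (simp add: a_kernel_iff)
      qed
      then show "y \<in> a_kernel H2 H1 fs" using fs_zero[OF y] y by (simp add: a_kernel_iff)
    qed
    show "a_kernel H2 H1 fs \<subseteq> js ` carrier HU"
    proof
      fix h assume "h \<in> a_kernel H2 H1 fs"
      then have h: "h \<in> carrier H2" "fs h = \<zero>\<^bsub>H1\<^esub>" by (simp_all add: a_kernel_iff)
      have hT: "h \<in> mod_hom R T F2" using h(1) by (simp add: H2_def)
      have "h t \<in> j ` carrier U" if "t \<in> carrier T" for t
        unfolding jf using fs_zero[OF h(1)] h(2) that mod_hom_closed[OF hT that] by (simp add: a_kernel_iff)
      then have "h ` carrier T \<subseteq> j ` carrier U" by blast
      then obtain h' where h': "h' \<in> mod_hom R T U" "\<forall>t\<in>carrier T. j (h' t) = h t"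
        using factor_mono[OF T U j hT] by blast
      let ?h = "restrict h' (carrier T)"
      have hc: "?h \<in> carrier HU" using restrict_mod_hom[OF T h'(1)] by (simp add: HU_def)
      have eq: "js ?h t = h t" if "t \<in> carrier T" for t
        using h'(2) that unfolding js_val[OF that] by simp
      have "js ?h = h"
        by (rule hom_mod_ext[OF mod_hom_closed[OF js hc, unfolded H2_def] h(1)[unfolded H2_def] eq])
      then show "h \<in> js ` carrier HU" using hc by blast
    qed
  qed
  have "inj_on js (carrier HU)"
  proof (rule inj_onI)
    fix h h' assume hh: "h \<in> carrier HU" "h' \<in> carrier HU" "js h = js h'"
    then have c: "h \<in> mod_hom R T U" "h' \<in> mod_hom R T U" by (simp_all add: HU_def)
    show "h = h'"
    proof (rule hom_mod_ext[OF hh(1,2)[unfolded HU_def]])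
      fix t assume t: "t \<in> carrier T"
      have "j (h t) = j (h' t)" using fun_cong[OF hh(3), of t] unfolding js_val[OF t] .
      then show "h t = h' t"
        by (rule inj_onD[OF mod_monoD(2)[OF j] _ mod_hom_closed[OF c(1) t] mod_hom_closed[OF c(2) t]])
    qed
  qed
  then have js_mono: "js \<in> mod_mono ?B HU H2" using js by (simp add: mod_mono_def)

  \<comment> \<open>The bound on the global dimension is applied to the cokernel of
    \<open>gs\<close>. Its copy X lives in the type \<open>umod\<close> over End(T), over which
    \<open>gl_dim\<close> ranges.\<close>
  let ?I = "gs ` carrier H1"
  have I: "submodule ?I ?B H0" by (rule submodule_image[OF H(2,1) gs submodule_carrier[OF H(2)]])
  note q = quot_mod_proj[OF H(1) I]
  have "fg_mod ?B H0" by (rule summand_of_fin_gen[OF right_module_regular[OF B] fin_gen_regular[OF B] Hs(1)])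
  then have "fg_mod ?B (quot_mod H0 ?I)" by (rule fin_gen_image[OF _ q(1,2)])
  then obtain X :: "('t \<Rightarrow> 't) umod" and u v where X: "fg_mod ?B X"
    "u \<in> mod_hom ?B (quot_mod H0 ?I) X" "v \<in> mod_hom ?B X (quot_mod H0 ?I)"
    "\<forall>x\<in>carrier (quot_mod H0 ?I). v (u x) = x" "\<forall>y\<in>carrier X. u (v y) = y"
    by (rule fg_mod_rep)
  have Xm: "right_module ?B X" using X(1) by (simp add: fg_mod_def)
  interpret X: right_module ?B X by (rule Xm)
  define q0 where "q0 = (\<lambda>h. u (?I +>\<^bsub>H0\<^esub> h))"
  have q0h: "q0 \<in> mod_hom ?B H0 X" unfolding q0_def by (rule mod_hom_comp[OF mod_epiD(1)[OF q(2)] X(2)])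
  have "y \<in> q0 ` carrier H0" if y: "y \<in> carrier X" for y
  proof -
    obtain h where h: "h \<in> carrier H0" "v y = ?I +>\<^bsub>H0\<^esub> h"
      using mod_epi_surj[OF q(2) mod_hom_closed[OF X(3) y]] by blast
    have "y = q0 h" unfolding q0_def h(2)[symmetric] using X(5) y by simp
    then show ?thesis using h(1) by blast
  qed
  then have q0: "q0 \<in> mod_epi ?B H0 X" using q0h mod_hom_closed[OF q0h] by (auto simp: mod_epi_def)
  have kq0: "a_kernel H0 X q0 = ?I"
  proof -
    have "q0 h = \<zero>\<^bsub>X\<^esub> \<longleftrightarrow> h \<in> ?I" if h: "h \<in> carrier H0" for h
    proof
      assume "q0 h = \<zero>\<^bsub>X\<^esub>"
      then have "v (q0 h) = \<zero>\<^bsub>quot_mod H0 ?I\<^esub>" using mod_hom_zero[OF Xm q(1) X(3)] by simp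
      then have "?I +>\<^bsub>H0\<^esub> h = \<zero>\<^bsub>quot_mod H0 ?I\<^esub>"
        unfolding q0_def using X(4) mod_hom_closed[OF mod_epiD(1)[OF q(2)] h] by simp
      then show "h \<in> ?I" using q(3)[OF h] by blast
    next
      assume "h \<in> ?I"
      then have "?I +>\<^bsub>H0\<^esub> h = \<zero>\<^bsub>quot_mod H0 ?I\<^esub>" using q(3)[OF h] by blast
      then show "q0 h = \<zero>\<^bsub>X\<^esub>" unfolding q0_def using mod_hom_zero[OF q(1) Xm X(2)] by simp
    qed
    moreover have "?I \<subseteq> carrier H0" by (rule submodule_subset[OF I])
    ultimately show ?thesis unfolding set_eq_iff a_kernel_iff by blast
  qed

  obtain P d e where res: "proj_resolution ?B X P d e" and van: "\<forall>i>3. carrier (P i) = {\<zero>\<^bsub>P i\<^esub>}"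
    by (rule gl_dim_le_resolution[OF gl X(1)])
  have Ps: "summand_of ?B ?S (P i)" for i
    using res projective_iff_summand[OF B, of "P i"] by (simp add: proj_resolution_def)
  then have Pm: "right_module ?B (P i)" for i by (simp add: summand_of_def)
  have e: "e \<in> mod_epi ?B (P 0) X" and dh: "\<And>i. d i \<in> mod_hom ?B (P (Suc i)) (P i)"
    and d0: "d 0 ` carrier (P (Suc 0)) = a_kernel (P 0) X e"
    and dS: "\<And>i. d (Suc i) ` carrier (P (Suc (Suc i))) = a_kernel (P (Suc i)) (P i) (d i)"
    using res unfolding proj_resolution_def by simp_all
  let ?P3 = "P (Suc (Suc (Suc 0)))" and ?P2 = "P (Suc (Suc 0))" and ?d2 = "d (Suc (Suc 0))"
  \<comment> \<open>The resolution vanishes from degree 4 on, so the term of degree 3 embeds in that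
    of degree 2 and is the third syzygy of X.\<close>
  have "carrier (P (Suc (Suc (Suc (Suc 0))))) = {\<zero>\<^bsub>P (Suc (Suc (Suc (Suc 0))))\<^esub>}"
    by (rule van[rule_format]) simp
  then have "a_kernel ?P3 ?P2 ?d2 = {\<zero>\<^bsub>?P3\<^esub>}"
    using dS[of "Suc (Suc 0)"] mod_hom_zero[OF Pm Pm dh[of "Suc (Suc (Suc 0))"]] by simp
  then have d2: "?d2 \<in> mod_mono ?B ?P3 ?P2"
    using inj_of_kernel[OF Pm Pm dh] dh by (simp add: mod_mono_def)

  let ?L1 = "P 0\<lparr>carrier := a_kernel (P 0) X e\<rparr>" and ?L1' = "H0\<lparr>carrier := a_kernel H0 X q0\<rparr>"
  note k1 = submodule_kernel[OF Pm Xm mod_epiD(1)[OF e]] submodule_kernel[OF H(1) Xm q0h]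
  note L1 = right_module_restrict[OF Pm k1(1)] right_module_restrict[OF H(1) k1(2)]
  \<comment> \<open>The comparison of the two resolutions starts at X with identity maps and zero
    correction, and climbs three syzygies.\<close>
  have "\<exists>a\<in>mod_hom ?B ?L1' ?L1. \<exists>b\<in>mod_hom ?B ?L1 ?L1'. \<exists>\<psi>\<in>thru ?B ?S ?L1' ?L1'.
      \<forall>x\<in>carrier ?L1'. x = b (a x) \<oplus>\<^bsub>?L1'\<^esub> \<psi> x"
    by (rule stable_retract_syzygy[OF Xm Xm L1 Ps Hs(1) e q0 mod_mono_incl[OF k1(1)] _ mod_mono_incl[OF k1(2)] _
          mod_hom_id mod_hom_id thru_zero[OF right_module_regular[OF B] Xm]]) simp_all
  then obtain a1 b1 \<psi>1 where s1: "a1 \<in> mod_hom ?B ?L1' ?L1" "b1 \<in> mod_hom ?B ?L1 ?L1'"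
    "\<psi>1 \<in> thru ?B ?S ?L1' ?L1'" "\<forall>x\<in>carrier ?L1'. x = b1 (a1 x) \<oplus>\<^bsub>?L1'\<^esub> \<psi>1 x" by blast
  have e2: "d 0 \<in> mod_epi ?B (P (Suc 0)) ?L1" "gs \<in> mod_epi ?B H1 ?L1'"
    by (rule mod_epi_corestrict[OF dh d0]) (rule mod_epi_corestrict[OF gs kq0[symmetric]])
  let ?L2 = "P (Suc 0)\<lparr>carrier := a_kernel (P (Suc 0)) (P 0) (d 0)\<rparr>"
    and ?L2' = "H1\<lparr>carrier := a_kernel H1 H0 gs\<rparr>"
  note k2 = submodule_kernel[OF Pm Pm dh[of 0]] submodule_kernel[OF H(2,1) gs]
  note L2 = right_module_restrict[OF Pm k2(1)] right_module_restrict[OF H(2) k2(2)]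
  have "\<exists>a\<in>mod_hom ?B ?L2' ?L2. \<exists>b\<in>mod_hom ?B ?L2 ?L2'. \<exists>\<psi>\<in>thru ?B ?S ?L2' ?L2'.
      \<forall>x\<in>carrier ?L2'. x = b (a x) \<oplus>\<^bsub>?L2'\<^esub> \<psi> x"
    by (rule stable_retract_syzygy[OF L1 L2 Ps Hs(2) e2 mod_mono_incl[OF k2(1)] _ mod_mono_incl[OF k2(2)] _
          s1(1-3) s1(4)[rule_format]]) (simp_all add: a_kernel_restrict)
  then obtain a2 b2 \<psi>2 where s2: "a2 \<in> mod_hom ?B ?L2' ?L2" "b2 \<in> mod_hom ?B ?L2 ?L2'"
    "\<psi>2 \<in> thru ?B ?S ?L2' ?L2'" "\<forall>x\<in>carrier ?L2'. x = b2 (a2 x) \<oplus>\<^bsub>?L2'\<^esub> \<psi>2 x" by blast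
  have e3: "d (Suc 0) \<in> mod_epi ?B ?P2 ?L2" "fs \<in> mod_epi ?B H2 ?L2'"
    by (rule mod_epi_corestrict[OF dh dS]) (rule mod_epi_corestrict[OF fs im_f])
  have "\<exists>a\<in>mod_hom ?B HU ?P3. \<exists>b\<in>mod_hom ?B ?P3 HU. \<exists>\<psi>\<in>thru ?B ?S HU HU.
      \<forall>x\<in>carrier HU. x = b (a x) \<oplus>\<^bsub>HU\<^esub> \<psi> x"
    by (rule stable_retract_syzygy[OF L2 Pm H(4) Ps Hs(3) e3 d2 _ js_mono _ s2(1-3) s2(4)[rule_format]])
      (simp_all add: a_kernel_restrict dS im_j)
  then obtain a3 b3 \<psi>3 where s3: "a3 \<in> mod_hom ?B HU ?P3" "b3 \<in> mod_hom ?B ?P3 HU"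
    "\<psi>3 \<in> thru ?B ?S HU HU" "\<forall>x\<in>carrier HU. x = b3 (a3 x) \<oplus>\<^bsub>HU\<^esub> \<psi>3 x" by blast
  \<comment> \<open>The identity of Hom(T, U) is a map through the projective \<open>?P3\<close>
    plus a correction through the regular module.\<close>
  have "(\<lambda>x. x) \<in> thru ?B ?S HU HU"
    by (rule thru.add[OF thru_summand[OF Ps s3(1,2)] s3(3) s3(4)[rule_format]])
  then have s: "summand_of ?B ?S HU" using H(4) by (simp add: summand_of_def)
  show ?thesis by (rule summand_of_hom_mod[OF T U \<iota> \<pi> _ s[unfolded HU_def]]) (rule one)
qed

text \<open>Two approximations of M that factor through each other have the same kernel up to add T.
  On the kernel of g the identity is l m, which passes through the other kernel, plus 1 - l m, which
  is defined on all of F with values in the kernel and thus factors through F.\<close>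

lemma kernel_summand_transfer:
  assumes F: "summand_of R T F" and F': "right_module R F'" and M: "right_module R M"
    and g: "g \<in> mod_hom R F M" and g': "g' \<in> mod_hom R F' M"
    and k: "summand_of R T (F'\<lparr>carrier := a_kernel F' M g'\<rparr>)"
    and l: "l \<in> mod_hom R F' F" "\<And>x. x \<in> carrier F' \<Longrightarrow> g (l x) = g' x"
    and m: "m \<in> mod_hom R F F'" "\<And>x. x \<in> carrier F \<Longrightarrow> g' (m x) = g x"
  shows "summand_of R T (F\<lparr>carrier := a_kernel F M g\<rparr>)"
proof -
  have Fm: "right_module R F" using F by (simp add: summand_of_def)
  interpret F: right_module R F by (rule Fm)
  interpret M: right_module R M by (rule M)
  let ?U = "a_kernel F M g" and ?U' = "a_kernel F' M g'"
  let ?K = "F\<lparr>carrier := ?U\<rparr>" and ?K' = "F'\<lparr>carrier := ?U'\<rparr>"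
  note U = submodule_kernel[OF Fm M g] and U' = submodule_kernel[OF F' M g']
  note K = right_module_restrict[OF Fm U]
  have m': "m \<in> mod_hom R ?K ?K'"
    by (rule mod_hom_corestrict[OF mod_hom_restrict[OF m(1) submodule_subset[OF U]]])
      (auto simp: a_kernel_iff m(2) mod_hom_closed[OF m(1)])
  have l': "l \<in> mod_hom R ?K' ?K"
    by (rule mod_hom_corestrict[OF mod_hom_restrict[OF l(1) submodule_subset[OF U']]])
      (auto simp: a_kernel_iff l(2) mod_hom_closed[OF l(1)])
  let ?s = "\<lambda>y. y \<ominus>\<^bsub>F\<^esub> l (m y)"
  have sh: "?s \<in> mod_hom R F F" by (intro mod_hom_sub[OF Fm] mod_hom_id mod_hom_comp[OF m(1) l(1)])
  have s: "?s \<in> mod_hom R F ?K"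
  proof (rule mod_hom_corestrict[OF sh], rule image_subsetI)
    fix y assume y: "y \<in> carrier F"
    have c: "m y \<in> carrier F'" "l (m y) \<in> carrier F"
      using y mod_hom_closed[OF m(1)] mod_hom_closed[OF l(1)] by simp_all
    have "g (?s y) = \<zero>\<^bsub>M\<^esub>"
      using y c mod_hom_closed[OF g y]
      by (simp add: mod_hom_diff[OF Fm M g] l(2) m(2) M.M.diff_eq_zero_iff)
    then show "?s y \<in> ?U" using mod_hom_closed[OF sh y] by (simp add: a_kernel_iff)
  qed
  have "(\<lambda>x. x) \<in> thru R T ?K ?K"
  proof (rule thru.add[OF thru_summand[OF k m' l'] thru_summand[OF F mod_hom_incl[OF submodule_subset[OF U]] s]])
    fix x assume "x \<in> carrier ?K"
    then have x: "x \<in> carrier F" by (simp add: a_kernel_iff)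
    have "l (m x) \<in> carrier F" using x mod_hom_closed[OF m(1)] mod_hom_closed[OF l(1)] by simp
    then show "x = l (m x) \<oplus>\<^bsub>?K\<^esub> ?s x" using x by (simp add: F.M.diff_add_cancel)
  qed
  then show ?thesis using K by (simp add: summand_of_def)
qed

section \<open>Kernels of approximations by add (A + DA)\<close>

context artin_algebra
begin

abbreviation (input) "gencogen J \<equiv> mod_sum (regular_mod A) (dual_mod K A J)"

text \<open>X embeds in a power of DA, and so does the cokernel of this embedding. Together with an
  approximation of X these maps form the complex required by
  \<open>kernel_summand_of_gl_dim\<close>.\<close>

lemma approximation_kernel:
  assumes J: "dualizing_mod K J" and gl: "gl_dim (end_ring A (gencogen J)) \<le> enat 3"
    and X: "fg_mod A X"
  obtains n g where "g \<in> mod_epi A (mod_pow (gencogen J) n) X"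
    "\<forall>h\<in>mod_hom A (gencogen J) X. \<exists>b\<in>mod_hom A (gencogen J) (mod_pow (gencogen J) n).
       \<forall>t\<in>carrier (gencogen J). g (b t) = h t"
    "summand_of A (gencogen J) ((mod_pow (gencogen J) n)\<lparr>carrier := a_kernel (mod_pow (gencogen J) n) X g\<rparr>)"
proof -
  let ?D = "dual_mod K A J" and ?T = "gencogen J"
  have Xm: "right_module A X" using X by (simp add: fg_mod_def)
  interpret X: right_module A X by (rule Xm)
  have Df: "fg_mod A ?D"
    using injective_dual[OF dualizing_mod_injective[OF J]] by (simp add: injective_mod_def)
  have D: "right_module A ?D" using Df by (simp add: fg_mod_def)
  note Rm = right_module_regular[OF rings(3)]
  have T: "right_module A ?T" by (rule right_module_mod_sum[OF Rm D])
  have Rf: "fg_mod A (regular_mod A)" by (simp add: fg_mod_def Rm fin_gen_regular rings(3))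
  have "finite_length A ?T"
  proof (rule finite_length_extension[OF T D mod_hom_snd fg_finite_length_A[OF Df]])
    note k = submodule_kernel[OF T D mod_hom_snd]
    have "inj_on fst (a_kernel ?T ?D snd)"
      by (rule inj_onI) (auto simp: a_kernel_iff prod_eq_iff)
    then have "fst \<in> mod_mono A (?T\<lparr>carrier := a_kernel ?T ?D snd\<rparr>) (regular_mod A)"
      using mod_hom_restrict[OF mod_hom_fst submodule_subset[OF k]] by (simp add: mod_mono_def)
    then show "finite_length A (?T\<lparr>carrier := a_kernel ?T ?D snd\<rparr>)"
      by (rule finite_length_mono[OF right_module_restrict[OF T k] Rm _ fg_finite_length_A[OF Rf]])
  qed
  then have Tf: "fg_mod A ?T" by (rule fg_of_finite_length[OF T])
  obtain n g where g: "g \<in> mod_hom A (mod_pow ?T n) X"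
    "\<forall>h\<in>mod_hom A ?T X. \<exists>b\<in>mod_hom A ?T (mod_pow ?T n). \<forall>t\<in>carrier ?T. g (b t) = h t"
    by (rule right_approximation[OF Tf X])
  note F2m = right_module_mod_pow[OF T, of n]
  \<comment> \<open>The approximation is onto because A is a summand of T: the map (a, d) -> xa
    factors through g and takes the value x at (1, 0).\<close>
  have "x \<in> g ` carrier (mod_pow ?T n)" if x: "x \<in> carrier X" for x
  proof -
    have oneT: "(\<one>\<^bsub>A\<^esub>, \<zero>\<^bsub>?D\<^esub>) \<in> carrier ?T"
      by (rule mod_hom_closed[OF mod_hom_inl[OF D]]) (simp add: regular_mod_def)
    obtain b where b: "b \<in> mod_hom A ?T (mod_pow ?T n)" "\<forall>t\<in>carrier ?T. g (b t) = fst t \<odot>\<^bsub>X\<^esub> x"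
      using bspec[OF g(2) mod_hom_comp[OF mod_hom_fst mod_hom_regular[OF Xm x]]] by blast
    have "x = g (b (\<one>\<^bsub>A\<^esub>, \<zero>\<^bsub>?D\<^esub>))" using b(2)[rule_format, OF oneT] x by simp
    then show ?thesis using mod_hom_closed[OF b(1) oneT] by blast
  qed
  then have ge: "g \<in> mod_epi A (mod_pow ?T n) X"
    using g(1) mod_hom_closed[OF g(1)] by (auto simp: mod_epi_def)
  obtain k u where u: "u \<in> mod_mono A X (mod_pow ?D k)" by (rule dual_embedding[OF J X])
  note uh = mod_monoD(1)[OF u]
  note F1m = right_module_mod_pow[OF D, of k]
  have sD: "summand_of A ?T (mod_pow ?D m)" for m
    by (rule summand_of_trans[OF summand_of_mod_pow[OF D] summand_of_mod_sum(2)[OF Rm D]])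
  have I: "submodule (u ` carrier X) A (mod_pow ?D k)"
    by (rule submodule_image[OF Xm F1m uh submodule_carrier[OF Xm]])
  note q = quot_mod_proj[OF F1m I]
  let ?C = "quot_mod (mod_pow ?D k) (u ` carrier X)" and ?q = "\<lambda>x. u ` carrier X +>\<^bsub>mod_pow ?D k\<^esub> x"
  have "fg_mod A (mod_pow ?D k)"
    by (rule summand_of_fin_gen[OF D _ summand_of_mod_pow[OF D]]) (use Df in \<open>simp add: fg_mod_def\<close>)
  then have "fg_mod A ?C" by (rule fin_gen_image[OF _ q(1,2)])
  then obtain l v where v: "v \<in> mod_mono A ?C (mod_pow ?D l)" by (rule dual_embedding[OF J])
  note vh = mod_monoD(1)[OF v] and qh = mod_epiD(1)[OF q(2)]
  note F0m = right_module_mod_pow[OF D, of l]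
  have vq: "v (?q x) = \<zero>\<^bsub>mod_pow ?D l\<^esub> \<longleftrightarrow> x \<in> u ` carrier X" if x: "x \<in> carrier (mod_pow ?D k)" for x
  proof -
    have "v (?q x) = \<zero>\<^bsub>mod_pow ?D l\<^esub> \<longleftrightarrow> ?q x = \<zero>\<^bsub>?C\<^esub>"
      using mod_monoD(2)[OF v] mod_hom_zero[OF q(1) F0m vh] mod_hom_closed[OF qh x]
      unfolding mod_hom_inj_iff[OF q(1) F0m vh] by metis
    then show ?thesis using q(3)[OF x] by simp
  qed
  note k = submodule_kernel[OF F2m Xm g(1)]
  let ?U = "(mod_pow ?T n)\<lparr>carrier := a_kernel (mod_pow ?T n) X g\<rparr>"
  have "summand_of A ?T ?U"
  proof (rule kernel_summand_of_gl_dim[OF rings(3) T right_module_restrict[OF F2m k] mod_hom_inl[OF D] mod_hom_fst _ gl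
        sD sD summand_of_mod_pow[OF T] mod_mono_incl[OF k] mod_hom_comp[OF g(1) uh] mod_hom_comp[OF qh vh]])
    have u0: "u x = \<zero>\<^bsub>mod_pow ?D k\<^esub> \<longleftrightarrow> x = \<zero>\<^bsub>X\<^esub>" if "x \<in> carrier X" for x
      using mod_monoD(2)[OF u] mod_hom_zero[OF Xm F1m uh] that
      unfolding mod_hom_inj_iff[OF Xm F1m uh] by metis
    show "(\<lambda>x. x) ` carrier ?U = a_kernel (mod_pow ?T n) (mod_pow ?D k) (\<lambda>x. u (g x))"
    proof (rule Set.set_eqI)
      fix x show "x \<in> (\<lambda>x. x) ` carrier ?U \<longleftrightarrow> x \<in> a_kernel (mod_pow ?T n) (mod_pow ?D k) (\<lambda>x. u (g x))"
        using u0[OF mod_hom_closed[OF g(1)], of x]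
        by (cases "x \<in> carrier (mod_pow ?T n)") (simp_all add: a_kernel_iff)
    qed
    show "v (?q (u (g x))) = \<zero>\<^bsub>mod_pow ?D l\<^esub>" if "x \<in> carrier (mod_pow ?T n)" for x
      using vq mod_hom_closed[OF uh] mod_hom_closed[OF g(1) that] by blast
    fix h assume h: "h \<in> mod_hom A ?T (mod_pow ?D k)"
      "\<And>t. t \<in> carrier ?T \<Longrightarrow> v (?q (h t)) = \<zero>\<^bsub>mod_pow ?D l\<^esub>"
    \<comment> \<open>A map into the power of DA that dies in the cokernel has its values in X, and
      as a map to X it lifts along g.\<close>
    have "h ` carrier ?T \<subseteq> u ` carrier X"
      using vq[OF mod_hom_closed[OF h(1)]] h(2) by blast
    then obtain h1 where h1: "h1 \<in> mod_hom A ?T X" "\<forall>t\<in>carrier ?T. u (h1 t) = h t"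
      using factor_mono[OF T Xm u h(1)] by blast
    obtain b where b: "b \<in> mod_hom A ?T (mod_pow ?T n)" "\<forall>t\<in>carrier ?T. g (b t) = h1 t"
      using bspec[OF g(2) h1(1)] by blast
    show "\<exists>h'\<in>mod_hom A ?T (mod_pow ?T n). \<forall>t\<in>carrier ?T. u (g (h' t)) = h t"
      using b h1(2) by (intro bexI[OF _ b(1)]) simp
  qed simp
  then show thesis by (rule that[OF ge g(2)])
qed

text \<open>The exchange property places U under A or under DA, hence among the projectives or among
  the injectives.\<close>

lemma indecomposable_gencogen_cases:
  assumes J: "dualizing_mod K J" and U: "indecomposable_mod A U" and s: "summand_of A (gencogen J) U"
  shows "projective_mod A U \<or> injective_mod A U"
proof -
  let ?D = "dual_mod K A J"
  have Di: "injective_mod A ?D" by (rule injective_dual[OF dualizing_mod_injective[OF J]])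
  have D: "right_module A ?D" using Di by (simp add: injective_mod_def fg_mod_def)
  note Rm = right_module_regular[OF rings(3)]
  interpret D: right_module A ?D by (rule D)
  interpret R: right_module A "regular_mod A" by (rule Rm)
  have fl: "finite_length A U" by (rule fg_finite_length_A) (use U in \<open>simp add: indecomposable_mod_def\<close>)
  have "summand_of A (regular_mod A) U \<or> summand_of A ?D U"
  proof (rule indecomposable_summand_cases[OF U fl s mod_hom_fst mod_hom_inl[OF D] mod_hom_snd mod_hom_inr[OF Rm]])
    fix t assume "t \<in> carrier (gencogen J)"
    then have "fst t \<in> carrier (regular_mod A)" "snd t \<in> carrier ?D"
      by (rule mod_hom_closed[OF mod_hom_fst], rule mod_hom_closed[OF mod_hom_snd])
    then show "t = (fst t, \<zero>\<^bsub>?D\<^esub>) \<oplus>\<^bsub>gencogen J\<^esub> (\<zero>\<^bsub>regular_mod A\<^esub>, snd t)"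
      by (simp add: mod_sum_def R.M.r_zero D.M.l_zero del: dual_mod_simps)
  qed
  then show ?thesis
    using projective_iff_summand[OF rings(3)] injective_summand[OF rings(3) Di] by blast
qed

end

section \<open>Minimal approximations\<close>

lemma indecomposable_nonzero:
  assumes "indecomposable_mod R M" obtains x where "x \<in> carrier M" "x \<noteq> \<zero>\<^bsub>M\<^esub>"
proof -
  have "right_module R M" "carrier M \<noteq> {\<zero>\<^bsub>M\<^esub>}"
    using assms by (simp_all add: indecomposable_mod_def fg_mod_def)
  then show thesis using submodule_zero[OF submodule_carrier] that by blast
qed

lemma indecomposableI:
  assumes M: "fg_mod R M" and nz: "x \<in> carrier M" "x \<noteq> \<zero>\<^bsub>M\<^esub>"
    and d: "\<And>U V. \<lbrakk>submodule U R M; submodule V R M; U <+>\<^bsub>M\<^esub> V = carrier M; U \<inter> V = {\<zero>\<^bsub>M\<^esub>}\<rbrakk>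
      \<Longrightarrow> U = {\<zero>\<^bsub>M\<^esub>} \<or> V = {\<zero>\<^bsub>M\<^esub>}"
  shows "indecomposable_mod R M"
  unfolding indecomposable_mod_def
proof (intro conjI allI impI)
  show "carrier M \<noteq> {\<zero>\<^bsub>M\<^esub>}" using nz by blast
  fix U V assume "submodule U R M \<and> submodule V R M \<and> U <+>\<^bsub>M\<^esub> V = carrier M \<and> U \<inter> V = {\<zero>\<^bsub>M\<^esub>}"
  then show "U = {\<zero>\<^bsub>M\<^esub>} \<or> V = {\<zero>\<^bsub>M\<^esub>}" by (elim conjE) (rule d)
qed (rule M)

lemma indecomposable_decomposition:
  assumes I: "indecomposable_mod R M" and U: "submodule U R M" and V: "submodule V R M"
    and s: "\<And>x. x \<in> carrier M \<Longrightarrow> \<exists>u\<in>U. \<exists>v\<in>V. x = u \<oplus>\<^bsub>M\<^esub> v"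
    and i: "\<And>x. \<lbrakk>x \<in> U; x \<in> V\<rbrakk> \<Longrightarrow> x = \<zero>\<^bsub>M\<^esub>"
  shows "U = {\<zero>\<^bsub>M\<^esub>} \<or> V = {\<zero>\<^bsub>M\<^esub>}"
proof (rule indecomposable_trivial_summand[OF I U V])
  have M: "right_module R M" using I by (simp add: indecomposable_mod_def fg_mod_def)
  show "U <+>\<^bsub>M\<^esub> V = carrier M"
  proof
    show "U <+>\<^bsub>M\<^esub> V \<subseteq> carrier M" by (rule submodule_subset[OF submodule_sum(1)[OF M U V]])
    show "carrier M \<subseteq> U <+>\<^bsub>M\<^esub> V"
    proof
      fix x assume "x \<in> carrier M"
      then show "x \<in> U <+>\<^bsub>M\<^esub> V" unfolding submodule_sum_iff by (rule s)
    qed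
  qed
  show "U \<inter> V = {\<zero>\<^bsub>M\<^esub>}"
    using i submodule_zero[OF U] submodule_zero[OF V] by blast
qed

lemma funpow_fixed: "f x = x \<Longrightarrow> (f ^^ n) x = x"
  by (induction n) simp_all

lemma funpow_killed:
  assumes "right_module R M" "f \<in> mod_hom R M M" "f x = \<zero>\<^bsub>M\<^esub>" "n \<noteq> 0"
  shows "(f ^^ n) x = \<zero>\<^bsub>M\<^esub>"
proof -
  obtain m where "n = Suc m" using assms(4) not0_implies_Suc by blast
  moreover have "(f ^^ m) \<zero>\<^bsub>M\<^esub> = \<zero>\<^bsub>M\<^esub>"
    by (rule funpow_fixed[of f "\<zero>\<^bsub>M\<^esub>", OF mod_hom_zero[OF assms(1,1,2)]])
  ultimately show ?thesis using assms(3) by (simp add: funpow_Suc_right del: funpow.simps)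
qed

text \<open>I is minimal among the direct summands of F on which g is still an approximation. If W
  is a summand of I killed by g, its complement in I is again such a summand, hence equal to I, and
  W = 0.\<close>

lemma minimal_right_approximation:
  assumes F: "right_module R F" and fl: "finite_length R F" and M: "right_module R M" and D: "right_module R D"
    and g: "g \<in> mod_hom R F M"
    and ap: "\<And>h. h \<in> mod_hom R D M \<Longrightarrow> \<exists>b\<in>mod_hom R D F. \<forall>t\<in>carrier D. g (b t) = h t"
  obtains I r where "submodule I R F" "r \<in> mod_hom R F (F\<lparr>carrier := I\<rparr>)" "\<forall>x\<in>I. r x = x"
    "\<forall>h\<in>mod_hom R D M. \<exists>b\<in>mod_hom R D (F\<lparr>carrier := I\<rparr>). \<forall>t\<in>carrier D. g (b t) = h t"
    "\<forall>W W'. submodule W R (F\<lparr>carrier := I\<rparr>) \<longrightarrow> submodule W' R (F\<lparr>carrier := I\<rparr>) \<longrightarrow>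
       W <+>\<^bsub>F\<^esub> W' = I \<longrightarrow> W \<inter> W' = {\<zero>\<^bsub>F\<^esub>} \<longrightarrow> (\<forall>x\<in>W. g x = \<zero>\<^bsub>M\<^esub>) \<longrightarrow> W = {\<zero>\<^bsub>F\<^esub>}"
proof -
  interpret F: right_module R F by (rule F)
  interpret M: right_module R M by (rule M)
  let ?P = "\<lambda>I. submodule I R F \<and> (\<exists>r\<in>mod_hom R F (F\<lparr>carrier := I\<rparr>). \<forall>x\<in>I. r x = x) \<and>
    (\<forall>h\<in>mod_hom R D M. \<exists>b\<in>mod_hom R D (F\<lparr>carrier := I\<rparr>). \<forall>t\<in>carrier D. g (b t) = h t)"
  have "?P (carrier F)"
    using submodule_carrier[OF F] ap by (auto intro!: bexI[OF _ mod_hom_id])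
  then obtain I where I: "?P I" "\<forall>V. ?P V \<longrightarrow> V \<subseteq> I \<longrightarrow> V = I"
    by (rule finite_length_minimal[OF fl, of ?P]) (elim conjE)
  obtain r where r: "r \<in> mod_hom R F (F\<lparr>carrier := I\<rparr>)" "\<forall>x\<in>I. r x = x" using I(1) by blast
  have Is: "submodule I R F" using I(1) by (elim conjE)
  let ?E = "F\<lparr>carrier := I\<rparr>"
  have E: "right_module R ?E" by (rule right_module_restrict[OF F Is])
  have gE: "g \<in> mod_hom R ?E M" by (rule mod_hom_restrict[OF g submodule_subset[OF Is]])
  have apI: "\<forall>h\<in>mod_hom R D M. \<exists>b\<in>mod_hom R D ?E. \<forall>t\<in>carrier D. g (b t) = h t"
    using I(1) by (elim conjE)
  have min: "W = {\<zero>\<^bsub>F\<^esub>}"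
    if W: "submodule W R ?E" and W': "submodule W' R ?E" and s: "W <+>\<^bsub>F\<^esub> W' = I"
      and i: "W \<inter> W' = {\<zero>\<^bsub>F\<^esub>}" and ker: "\<forall>x\<in>W. g x = \<zero>\<^bsub>M\<^esub>" for W W'
  proof -
    have sE: "W <+>\<^bsub>?E\<^esub> W' = carrier ?E" and iE: "W \<inter> W' = {\<zero>\<^bsub>?E\<^esub>}"
      using s i by (simp_all add: set_add_restrict)
    obtain p q where p: "p \<in> mod_hom R ?E (?E\<lparr>carrier := W\<rparr>)" "q \<in> mod_hom R ?E (?E\<lparr>carrier := W'\<rparr>)"
      and eq: "\<And>x. x \<in> carrier ?E \<Longrightarrow> x = p x \<oplus>\<^bsub>?E\<^esub> q x"
      and pq: "\<And>u v. \<lbrakk>u \<in> W; v \<in> W'\<rbrakk> \<Longrightarrow> p (u \<oplus>\<^bsub>?E\<^esub> v) = u \<and> q (u \<oplus>\<^bsub>?E\<^esub> v) = v"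
      by (rule direct_sum_projections[OF E W W' sE iE]) (erule that)
    have sub: "submodule W' R F" "W' \<subseteq> I" "W \<subseteq> I"
      using W W' by (simp_all add: submodule_restrict_iff[OF F Is])
    have q: "q \<in> mod_hom R ?E (F\<lparr>carrier := W'\<rparr>)" using p(2) by simp
    have pc: "p x \<in> W" "q x \<in> W'" if "x \<in> I" for x
      using mod_hom_closed[OF p(1), of x] mod_hom_closed[OF p(2), of x] that by simp_all
    have "?P W'"
    proof (intro conjI ballI)
      show "submodule W' R F" by (rule sub(1))
      show "\<exists>r\<in>mod_hom R F (F\<lparr>carrier := W'\<rparr>). \<forall>x\<in>W'. r x = x"
      proof (rule bexI[OF ballI mod_hom_comp[OF r(1) q]])
        fix x assume x: "x \<in> W'"
        have "\<zero>\<^bsub>F\<^esub> \<oplus>\<^bsub>F\<^esub> x = x" using x submodule_subset[OF sub(1)] by auto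
        moreover have "q (\<zero>\<^bsub>F\<^esub> \<oplus>\<^bsub>F\<^esub> x) = x" using pq[OF submodule_zero[OF W] x] by simp
        moreover have "r x = x" using r(2) x sub(2) by blast
        ultimately show "q (r x) = x" by simp
      qed
      fix h assume "h \<in> mod_hom R D M"
      then obtain b where b: "b \<in> mod_hom R D ?E" "\<forall>t\<in>carrier D. g (b t) = h t" using apI by blast
      show "\<exists>b\<in>mod_hom R D (F\<lparr>carrier := W'\<rparr>). \<forall>t\<in>carrier D. g (b t) = h t"
      proof (rule bexI[OF ballI mod_hom_comp[OF b(1) q]])
        fix t assume t: "t \<in> carrier D"
        have bt: "b t \<in> carrier ?E" by (rule mod_hom_closed[OF b(1) t])
        then have c: "p (b t) \<in> W" "q (b t) \<in> W'" using pc by simp_all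
        have cE: "p (b t) \<in> carrier ?E" "q (b t) \<in> carrier ?E" using c sub by auto
        have "g (b t) = g (p (b t) \<oplus>\<^bsub>?E\<^esub> q (b t))" using eq[OF bt] by simp
        also have "\<dots> = g (p (b t)) \<oplus>\<^bsub>M\<^esub> g (q (b t))" by (rule mod_hom_add[OF gE cE])
        also have "\<dots> = g (q (b t))" using ker c(1) mod_hom_closed[OF gE cE(2)] by simp
        finally show "g (q (b t)) = h t" using b(2) t by simp
      qed
    qed
    then have "W' = I" using sub(2) by (rule I(2)[rule_format])
    then show ?thesis using i sub(3) by blast
  qed
  show thesis by (rule that[OF Is r apI]) (intro allI impI, rule min)
qed

text \<open>I is minimal among the direct summands of F for which f followed by some retraction r
  onto the summand is still an approximation. A summand of I containing the image of r f could
  replace I, so it equals I.\<close>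

lemma minimal_left_approximation:
  assumes F: "right_module R F" and fl: "finite_length R F" and M: "right_module R M" and D: "right_module R D"
    and f: "f \<in> mod_hom R M F"
    and ap: "\<And>h. h \<in> mod_hom R M D \<Longrightarrow> \<exists>b\<in>mod_hom R F D. \<forall>x\<in>carrier M. b (f x) = h x"
  obtains I r where "submodule I R F" "r \<in> mod_hom R F (F\<lparr>carrier := I\<rparr>)" "\<forall>x\<in>I. r x = x"
    "\<forall>h\<in>mod_hom R M D. \<exists>b\<in>mod_hom R (F\<lparr>carrier := I\<rparr>) D. \<forall>x\<in>carrier M. b (r (f x)) = h x"
    "\<forall>W W'. submodule W R (F\<lparr>carrier := I\<rparr>) \<longrightarrow> submodule W' R (F\<lparr>carrier := I\<rparr>) \<longrightarrow>
       W <+>\<^bsub>F\<^esub> W' = I \<longrightarrow> W \<inter> W' = {\<zero>\<^bsub>F\<^esub>} \<longrightarrow> (\<forall>x\<in>carrier M. r (f x) \<in> W) \<longrightarrow> W = I"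
proof -
  interpret F: right_module R F by (rule F)
  let ?Q = "\<lambda>I r. r \<in> mod_hom R F (F\<lparr>carrier := I\<rparr>) \<and> (\<forall>x\<in>I. r x = x) \<and>
    (\<forall>h\<in>mod_hom R M D. \<exists>b\<in>mod_hom R (F\<lparr>carrier := I\<rparr>) D. \<forall>x\<in>carrier M. b (r (f x)) = h x)"
  let ?P = "\<lambda>I. submodule I R F \<and> (\<exists>r. ?Q I r)"
  have "?Q (carrier F) (\<lambda>x. x)" using ap mod_hom_id[of R F] by simp
  then have "?P (carrier F)" using submodule_carrier[OF F] by blast
  then obtain I where I: "?P I" "\<forall>V. ?P V \<longrightarrow> V \<subseteq> I \<longrightarrow> V = I"
    by (rule finite_length_minimal[OF fl, of ?P]) (elim conjE)
  obtain r where r: "r \<in> mod_hom R F (F\<lparr>carrier := I\<rparr>)" "\<forall>x\<in>I. r x = x"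
    "\<forall>h\<in>mod_hom R M D. \<exists>b\<in>mod_hom R (F\<lparr>carrier := I\<rparr>) D. \<forall>x\<in>carrier M. b (r (f x)) = h x"
    using I(1) by (elim exE conjE)
  have Is: "submodule I R F" using I(1) by (elim conjE)
  let ?E = "F\<lparr>carrier := I\<rparr>"
  have E: "right_module R ?E" by (rule right_module_restrict[OF F Is])
  have min: "W = I"
    if W: "submodule W R ?E" and W': "submodule W' R ?E" and s: "W <+>\<^bsub>F\<^esub> W' = I"
      and i: "W \<inter> W' = {\<zero>\<^bsub>F\<^esub>}" and im: "\<forall>x\<in>carrier M. r (f x) \<in> W" for W W'
  proof -
    have sE: "W <+>\<^bsub>?E\<^esub> W' = carrier ?E" and iE: "W \<inter> W' = {\<zero>\<^bsub>?E\<^esub>}"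
      using s i by (simp_all add: set_add_restrict)
    obtain p q where p: "p \<in> mod_hom R ?E (?E\<lparr>carrier := W\<rparr>)"
      and pq: "\<And>u v. \<lbrakk>u \<in> W; v \<in> W'\<rbrakk> \<Longrightarrow> p (u \<oplus>\<^bsub>?E\<^esub> v) = u \<and> q (u \<oplus>\<^bsub>?E\<^esub> v) = v"
      by (rule direct_sum_projections[OF E W W' sE iE]) (erule that)
    have sub: "submodule W R F" "W \<subseteq> I" using W by (simp_all add: submodule_restrict_iff[OF F Is])
    have p': "p \<in> mod_hom R ?E (F\<lparr>carrier := W\<rparr>)" using p by simp
    have pW: "p x = x" if x: "x \<in> W" for x
    proof -
      have "x \<oplus>\<^bsub>F\<^esub> \<zero>\<^bsub>F\<^esub> = x" using x submodule_subset[OF sub(1)] by auto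
      moreover have "p (x \<oplus>\<^bsub>F\<^esub> \<zero>\<^bsub>F\<^esub>) = x" using pq[OF x submodule_zero[OF W']] by simp
      ultimately show ?thesis by simp
    qed
    have "?Q W (\<lambda>x. p (r x))"
    proof (intro conjI ballI)
      show "(\<lambda>x. p (r x)) \<in> mod_hom R F (F\<lparr>carrier := W\<rparr>)" by (rule mod_hom_comp[OF r(1) p'])
      show "p (r x) = x" if "x \<in> W" for x
      proof -
        have "r x = x" using r(2) that sub(2) by blast
        then show ?thesis using pW[OF that] by simp
      qed
      fix h assume "h \<in> mod_hom R M D"
      then obtain b where b: "b \<in> mod_hom R ?E D" "\<forall>x\<in>carrier M. b (r (f x)) = h x" using r(3) by blast
      have "b \<in> mod_hom R (?E\<lparr>carrier := W\<rparr>) D"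
        by (rule mod_hom_restrict[OF b(1) submodule_subset[OF W]])
      then have b': "b \<in> mod_hom R (F\<lparr>carrier := W\<rparr>) D" by simp
      show "\<exists>b\<in>mod_hom R (F\<lparr>carrier := W\<rparr>) D. \<forall>x\<in>carrier M. b (p (r (f x))) = h x"
      proof (rule bexI[OF ballI b'])
        fix x assume x: "x \<in> carrier M"
        have "p (r (f x)) = r (f x)" using im x by (intro pW) blast
        then show "b (p (r (f x))) = h x" using b(2) x by simp
      qed
    qed
    then have "?P W" using sub(1) by blast
    then show ?thesis using sub(2) by (rule I(2)[rule_format])
  qed
  show thesis by (rule that[OF Is r]) (intro allI impI, rule min)
qed

lemma mod_sum_split:
  assumes "right_module R M" "right_module R N" "t \<in> carrier (mod_sum M N)"
  shows "t = (fst t, \<zero>\<^bsub>N\<^esub>) \<oplus>\<^bsub>mod_sum M N\<^esub> (\<zero>\<^bsub>M\<^esub>, snd t)"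
proof -
  interpret M: right_module R M by fact
  interpret N: right_module R N by fact
  show ?thesis using assms(3) by (auto simp: mod_sum_def)
qed

lemma submodule_sum_comm:
  assumes M: "right_module R M" and U: "submodule U R M" and V: "submodule V R M"
  shows "U <+>\<^bsub>M\<^esub> V = V <+>\<^bsub>M\<^esub> U"
proof -
  interpret M: right_module R M by fact
  have "u \<oplus>\<^bsub>M\<^esub> v = v \<oplus>\<^bsub>M\<^esub> u" if "u \<in> U" "v \<in> V" for u v
    using that submodule_subset[OF U] submodule_subset[OF V] by (intro M.M.a_comm) auto
  then show ?thesis unfolding Set.set_eq_iff submodule_sum_iff by metis
qed

context artin_algebra
begin

text \<open>The projection of U + V onto U extends to E by injectivity. Fitting's lemma for the
  extension then splits E into an image containing U and a kernel containing V.\<close>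

lemma injective_projection:
  assumes E: "injective_mod A E" and U: "submodule U A E" and V: "submodule V A E" and i: "U \<inter> V = {\<zero>\<^bsub>E\<^esub>}"
  shows "\<exists>\<phi>\<in>mod_hom A E E. (\<forall>u\<in>U. \<phi> u = u) \<and> (\<forall>v\<in>V. \<phi> v = \<zero>\<^bsub>E\<^esub>)"
proof -
  have Ef: "fg_mod A E" and Em: "right_module A E" using E by (simp_all add: injective_mod_def fg_mod_def)
  interpret E: right_module A E by (rule Em)
  let ?N = "U <+>\<^bsub>E\<^esub> V"
  note N = submodule_sum[OF Em U V]
  let ?EN = "E\<lparr>carrier := ?N\<rparr>"
  have Nm: "right_module A ?EN" by (rule right_module_restrict[OF Em N(1)])
  have sub: "submodule U A ?EN" "submodule V A ?EN" using U V N by (simp_all add: submodule_restrict_iff[OF Em N(1)])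
  have s: "U <+>\<^bsub>?EN\<^esub> V = carrier ?EN" "U \<inter> V = {\<zero>\<^bsub>?EN\<^esub>}" using i by (simp_all add: set_add_restrict)
  obtain p q where p: "p \<in> mod_hom A ?EN (?EN\<lparr>carrier := U\<rparr>)"
    and pq: "\<And>u v. \<lbrakk>u \<in> U; v \<in> V\<rbrakk> \<Longrightarrow> p (u \<oplus>\<^bsub>?EN\<^esub> v) = u \<and> q (u \<oplus>\<^bsub>?EN\<^esub> v) = v"
    by (rule direct_sum_projections[OF Nm sub s]) (erule that)
  have "p \<in> mod_hom A ?EN (E\<lparr>carrier := U\<rparr>)" using p by simp
  then have p': "p \<in> mod_hom A ?EN E" by (rule mod_hom_expand[OF _ submodule_subset[OF U]])
  obtain \<phi> where \<phi>: "\<phi> \<in> mod_hom A E E" "\<forall>x\<in>carrier ?EN. \<phi> x = p x"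
    using injective_extend[OF E fg_restrict[OF Ef N(1)] Ef mod_mono_incl[OF N(1)] p'] by blast
  have "\<phi> u = u" if u: "u \<in> U" for u
  proof -
    have "u \<oplus>\<^bsub>E\<^esub> \<zero>\<^bsub>E\<^esub> = u" using u submodule_subset[OF U] by auto
    then have "p u = u" using pq[OF u submodule_zero[OF V]] by simp
    then show ?thesis using \<phi>(2) u N(2) by auto
  qed
  moreover have "\<phi> v = \<zero>\<^bsub>E\<^esub>" if v: "v \<in> V" for v
  proof -
    have "\<zero>\<^bsub>E\<^esub> \<oplus>\<^bsub>E\<^esub> v = v" using v submodule_subset[OF V] by auto
    then have "p v = \<zero>\<^bsub>E\<^esub>" using pq[OF submodule_zero[OF U] v] by simp
    then show ?thesis using \<phi>(2) v N(3) by auto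
  qed
  ultimately show ?thesis using \<phi>(1) by blast
qed

section \<open>The modules generated by the injective cogenerator\<close>

text \<open>
  Take a minimal right approximation \<open>E \<rightarrow> M\<close> with \<open>E\<close> injective. Its kernel \<open>U\<close> lies in
  \<open>add (A \<oplus> DA)\<close> and contains no direct summand of \<open>E\<close>; decomposing \<open>E\<close> by Fitting's lemma then
  shows that \<open>E\<close> is an injective envelope of \<open>U\<close> and that \<open>U\<close> is indecomposable.
\<close>

lemma generated_cosyzygy:
  fixes M :: "(_, 'm) module"
  assumes J: "dualizing_mod K J" and gl: "gl_dim (end_ring A (gencogen J)) \<le> enat 3"
    and MI: "indecomposable_mod A M" and ni: "\<not> injective_mod A M"
    and e: "e \<in> mod_epi A (mod_pow (dual_mod K A J) k) M"
  shows "\<exists>P :: 'a umod. indecomposable_mod A P \<and> projective_mod A P \<and> iso_cosyzygy A M P"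
proof -
  let ?D = "dual_mod K A J" and ?T = "gencogen J" and ?R = "regular_mod A"
  have Mf: "fg_mod A M" and Mm: "right_module A M" using MI by (simp_all add: indecomposable_mod_def fg_mod_def)
  interpret M: right_module A M by (rule Mm)
  have Di: "injective_mod A ?D" by (rule injective_dual[OF dualizing_mod_injective[OF J]])
  have Df: "fg_mod A ?D" and D: "right_module A ?D" using Di by (simp_all add: injective_mod_def fg_mod_def)
  note Rm = right_module_regular[OF rings(3)]
  have T: "right_module A ?T" by (rule right_module_mod_sum[OF Rm D])
  obtain n g0 where g0: "g0 \<in> mod_hom A (mod_pow ?D n) M"
    "\<forall>h\<in>mod_hom A ?D M. \<exists>b\<in>mod_hom A ?D (mod_pow ?D n). \<forall>t\<in>carrier ?D. g0 (b t) = h t"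
    by (rule right_approximation[OF Df Mf])
  have "fg_mod A (mod_pow ?D n)"
    by (rule summand_of_fin_gen[OF D _ summand_of_mod_pow[OF D]]) (use Df in \<open>simp add: fg_mod_def\<close>)
  \<comment> \<open>The power of DA is replaced by a copy of type \<open>umod\<close>, since the
    envelope in \<open>iso_cosyzygy\<close> has that type.\<close>
  then obtain F :: "'a umod" and u v where F: "fg_mod A F" "u \<in> mod_hom A (mod_pow ?D n) F"
    "v \<in> mod_hom A F (mod_pow ?D n)" "\<forall>x\<in>carrier (mod_pow ?D n). v (u x) = x" "\<forall>y\<in>carrier F. u (v y) = y"
    by (rule fg_mod_rep)
  have Fm: "right_module A F" using F(1) by (simp add: fg_mod_def)
  have Fs: "summand_of A ?D F"
    using F(5) by (intro summand_of_retract[OF Fm summand_of_mod_pow[OF D] F(3,2)]) simp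
  define g where "g = (\<lambda>x. g0 (v x))"
  have g: "g \<in> mod_hom A F M" unfolding g_def by (rule mod_hom_comp[OF F(3) g0(1)])
  have ap: "\<exists>b\<in>mod_hom A ?D F. \<forall>t\<in>carrier ?D. g (b t) = h t" if h: "h \<in> mod_hom A ?D M" for h
  proof -
    obtain b where b: "b \<in> mod_hom A ?D (mod_pow ?D n)" "\<forall>t\<in>carrier ?D. g0 (b t) = h t"
      using bspec[OF g0(2) h] by blast
    show ?thesis
      using b(2) F(4) mod_hom_closed[OF b(1)] by (intro bexI[OF _ mod_hom_comp[OF b(1) F(2)]]) (simp add: g_def)
  qed
  obtain I r where I: "submodule I A F" and r: "r \<in> mod_hom A F (F\<lparr>carrier := I\<rparr>)" "\<forall>x\<in>I. r x = x"
    and apI: "\<forall>h\<in>mod_hom A ?D M. \<exists>b\<in>mod_hom A ?D (F\<lparr>carrier := I\<rparr>). \<forall>t\<in>carrier ?D. g (b t) = h t"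
    and min: "\<forall>W W'. submodule W A (F\<lparr>carrier := I\<rparr>) \<longrightarrow> submodule W' A (F\<lparr>carrier := I\<rparr>) \<longrightarrow>
       W <+>\<^bsub>F\<^esub> W' = I \<longrightarrow> W \<inter> W' = {\<zero>\<^bsub>F\<^esub>} \<longrightarrow> (\<forall>x\<in>W. g x = \<zero>\<^bsub>M\<^esub>) \<longrightarrow> W = {\<zero>\<^bsub>F\<^esub>}"
    by (rule minimal_right_approximation[OF Fm fg_finite_length_A[OF F(1)] Mm D g ap])
  define E where "E = F\<lparr>carrier := I\<rparr>"
  have Em: "right_module A E" unfolding E_def by (rule right_module_restrict[OF Fm I])
  interpret E: right_module A E by (rule Em)
  have Es: "summand_of A ?D E"
    using r(2) by (intro summand_of_retract[OF Em Fs _ r(1)[folded E_def], of "\<lambda>x. x"])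
      (simp_all add: E_def mod_hom_incl[OF submodule_subset[OF I]])
  have Ei: "injective_mod A E" by (rule injective_summand[OF rings(3) Di Es])
  then have Ef: "fg_mod A E" by (simp add: injective_mod_def)
  have El: "finite_length A E" by (rule fg_finite_length_A[OF Ef])
  have gE: "g \<in> mod_hom A E M" unfolding E_def by (rule mod_hom_restrict[OF g submodule_subset[OF I]])
  note apE = apI[folded E_def, rule_format]
  have min': "W = {\<zero>\<^bsub>E\<^esub>}"
    if "submodule W A E" "submodule W' A E" "W <+>\<^bsub>E\<^esub> W' = carrier E" "W \<inter> W' = {\<zero>\<^bsub>E\<^esub>}"
      "\<And>x. x \<in> W \<Longrightarrow> g x = \<zero>\<^bsub>M\<^esub>" for W W'
    using min[rule_format, of W W'] that by (simp add: E_def set_add_restrict)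
  \<comment> \<open>The given epimorphism e factors through g by the approximation property, so g is
    onto too.\<close>
  obtain b0 where b0: "b0 \<in> mod_hom A (mod_pow ?D k) E" "\<forall>x\<in>carrier (mod_pow ?D k). g (b0 x) = e x"
    using thru_lift[OF right_module_mod_pow[OF D] Em gE apE
        thru_summand[OF summand_of_mod_pow[OF D] mod_hom_id mod_epiD(1)[OF e]]] by blast
  have "y \<in> g ` carrier E" if y: "y \<in> carrier M" for y
  proof -
    obtain x where x: "x \<in> carrier (mod_pow ?D k)" "y = e x" using mod_epi_surj[OF e y] by blast
    then have "y = g (b0 x)" using b0(2) by simp
    then show ?thesis using mod_hom_closed[OF b0(1) x(1)] by blast
  qed
  then have ge: "g \<in> mod_epi A E M" using gE mod_hom_closed[OF gE] by (auto simp: mod_epi_def)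
  obtain n' g' where g': "g' \<in> mod_epi A (mod_pow ?T n') M"
    "\<forall>h\<in>mod_hom A ?T M. \<exists>b\<in>mod_hom A ?T (mod_pow ?T n'). \<forall>t\<in>carrier ?T. g' (b t) = h t"
    "summand_of A ?T ((mod_pow ?T n')\<lparr>carrier := a_kernel (mod_pow ?T n') M g'\<rparr>)"
    by (rule approximation_kernel[OF J gl Mf])
  note Pm = right_module_mod_pow[OF T, of n'] and g'h = mod_epiD(1)[OF g'(1)]
  \<comment> \<open>g approximates M by add DA. As it is onto and A is projective, it also
    approximates M by add T.\<close>
  have tlift: "\<exists>l\<in>mod_hom A ?T E. \<forall>t\<in>carrier ?T. g (l t) = h t" if h: "h \<in> mod_hom A ?T M" for h
  proof -
    obtain l1 where l1: "l1 \<in> mod_hom A ?R E" "\<forall>a\<in>carrier ?R. g (l1 a) = h (a, \<zero>\<^bsub>?D\<^esub>)"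
      using regular_lift[OF Em ge mod_hom_comp[OF mod_hom_inl[OF D] h]] by blast
    obtain l2 where l2: "l2 \<in> mod_hom A ?D E" "\<forall>a\<in>carrier ?D. g (l2 a) = h (\<zero>\<^bsub>?R\<^esub>, a)"
      using apE[OF mod_hom_comp[OF mod_hom_inr[OF Rm] h]] by blast
    show ?thesis
    proof (rule bexI[OF ballI mod_hom_plus[OF Em mod_hom_comp[OF mod_hom_fst l1(1)] mod_hom_comp[OF mod_hom_snd l2(1)]]])
      fix t assume t: "t \<in> carrier ?T"
      have c: "fst t \<in> carrier ?R" "snd t \<in> carrier ?D"
        by (rule mod_hom_closed[OF mod_hom_fst t], rule mod_hom_closed[OF mod_hom_snd t])
      have "h t = h ((fst t, \<zero>\<^bsub>?D\<^esub>) \<oplus>\<^bsub>?T\<^esub> (\<zero>\<^bsub>?R\<^esub>, snd t))"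
        using mod_sum_split[OF Rm D t] by simp
      also have "\<dots> = h (fst t, \<zero>\<^bsub>?D\<^esub>) \<oplus>\<^bsub>M\<^esub> h (\<zero>\<^bsub>?R\<^esub>, snd t)"
        by (rule mod_hom_add[OF h mod_hom_closed[OF mod_hom_inl[OF D] c(1)] mod_hom_closed[OF mod_hom_inr[OF Rm] c(2)]])
      also have "\<dots> = g (l1 (fst t)) \<oplus>\<^bsub>M\<^esub> g (l2 (snd t))"
        using l1(2) l2(2) c by (simp del: dual_mod_simps)
      also have "\<dots> = g (l1 (fst t) \<oplus>\<^bsub>E\<^esub> l2 (snd t))"
        by (rule mod_hom_add[OF gE mod_hom_closed[OF l1(1) c(1)] mod_hom_closed[OF l2(1) c(2)], symmetric])
      finally show "g (l1 (fst t) \<oplus>\<^bsub>E\<^esub> l2 (snd t)) = h t" by simp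
    qed
  qed
  have EsT: "summand_of A ?T E" by (rule summand_of_trans[OF Es summand_of_mod_sum(2)[OF Rm D]])
  \<comment> \<open>l and m compare g with the approximation whose kernel is already known to lie in
    add T.\<close>
  obtain l where l: "l \<in> mod_hom A (mod_pow ?T n') E" "\<forall>x\<in>carrier (mod_pow ?T n'). g (l x) = g' x"
    using thru_lift[OF Pm Em gE tlift thru_summand[OF summand_of_mod_pow[OF T] mod_hom_id g'h]] by blast
  obtain m where m: "m \<in> mod_hom A E (mod_pow ?T n')" "\<forall>x\<in>carrier E. g' (m x) = g x"
    using thru_lift[OF Em Pm g'h g'(2)[rule_format] thru_summand[OF EsT mod_hom_id gE]] by blast
  define U where "U = a_kernel E M g"
  have Us: "submodule U A E" unfolding U_def by (rule submodule_kernel[OF Em Mm gE])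
  have Ui: "x \<in> U \<longleftrightarrow> x \<in> carrier E \<and> g x = \<zero>\<^bsub>M\<^esub>" for x unfolding U_def by (rule a_kernel_iff)
  let ?U = "E\<lparr>carrier := U\<rparr>"
  have sU: "summand_of A ?T ?U" unfolding U_def
    by (rule kernel_summand_transfer[OF EsT Pm Mm gE g'h g'(3) l(1) _ m(1)]) (simp_all add: l(2) m(2))
  have Uf: "fg_mod A ?U" by (rule fg_restrict[OF Ef Us])
  have Um: "right_module A ?U" by (rule right_module_restrict[OF Em Us])
  \<comment> \<open>A zero kernel would make M isomorphic to the injective module E.\<close>
  have Unz: "U \<noteq> {\<zero>\<^bsub>E\<^esub>}"
  proof
    assume "U = {\<zero>\<^bsub>E\<^esub>}"
    then have "inj_on g (carrier E)" unfolding U_def by (rule inj_of_kernel[OF Em Mm gE])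
    then have "bij_betw g (carrier E) (carrier M)" using mod_epiD(2)[OF ge] by (simp add: bij_betw_def)
    then obtain s where s: "s \<in> mod_hom A M E" "\<forall>y\<in>carrier M. g (s y) = y"
      using mod_hom_inverse[OF Em Mm gE] by blast
    have "summand_of A ?D M" using s(2) by (intro summand_of_retract[OF Mm Es s(1) gE]) simp
    then show False using injective_summand[OF rings(3) Di] ni by blast
  qed
  \<comment> \<open>The use made of the indecomposability of M: the images of W and W' span M,
    condition z lets them meet in zero only, and so g kills W or W'.\<close>
  have images: "g ` W = {\<zero>\<^bsub>M\<^esub>} \<or> g ` W' = {\<zero>\<^bsub>M\<^esub>}"
    if W: "submodule W A E" and W': "submodule W' A E" and s: "W <+>\<^bsub>E\<^esub> W' = carrier E"
      and z: "\<And>w w'. \<lbrakk>w \<in> W; w' \<in> W'; w \<ominus>\<^bsub>E\<^esub> w' \<in> U\<rbrakk> \<Longrightarrow> w \<in> U" for W W'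
  proof (rule indecomposable_decomposition[OF MI submodule_image[OF Em Mm gE W] submodule_image[OF Em Mm gE W']])
    have c: "\<And>x. x \<in> W \<Longrightarrow> x \<in> carrier E" "\<And>x. x \<in> W' \<Longrightarrow> x \<in> carrier E"
      using submodule_subset[OF W] submodule_subset[OF W'] by blast+
    fix y assume "y \<in> carrier M"
    then obtain x where x: "x \<in> carrier E" "y = g x" using mod_epi_surj[OF ge] by blast
    then obtain w w' where "w \<in> W" "w' \<in> W'" "x = w \<oplus>\<^bsub>E\<^esub> w'"
      unfolding s[symmetric] submodule_sum_iff by blast
    then show "\<exists>u\<in>g ` W. \<exists>v\<in>g ` W'. y = u \<oplus>\<^bsub>M\<^esub> v"
      using x(2) mod_hom_add[OF gE c(1) c(2)] by blast
  next
    have c: "\<And>x. x \<in> W \<Longrightarrow> x \<in> carrier E" "\<And>x. x \<in> W' \<Longrightarrow> x \<in> carrier E"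
      using submodule_subset[OF W] submodule_subset[OF W'] by blast+
    fix y assume "y \<in> g ` W" "y \<in> g ` W'"
    then obtain w w' where w: "w \<in> W" "w' \<in> W'" "y = g w" "y = g w'" by blast
    have "g (w \<ominus>\<^bsub>E\<^esub> w') = \<zero>\<^bsub>M\<^esub>"
      using mod_hom_eq_iff[OF Em Mm gE c(1)[OF w(1)] c(2)[OF w(2)]] w(3,4) by simp
    then have "w \<ominus>\<^bsub>E\<^esub> w' \<in> U" using w c by (simp add: Ui)
    then have "w \<in> U" by (rule z[OF w(1,2)])
    then show "y = \<zero>\<^bsub>M\<^esub>" using w(3) Ui by simp
  qed
  have in_U: "W \<subseteq> U" if "submodule W A E" "g ` W = {\<zero>\<^bsub>M\<^esub>}" for W
    using that submodule_subset[OF that(1)] Ui by blast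
  \<comment> \<open>A direct summand W of E containing U is all of E. The half that g kills lies in
    U: for W, right minimality would give W = 0 and hence U = 0; for W', it gives W' \<subseteq> U
    \<subseteq> W and hence W' = 0.\<close>
  have top: "W = carrier E"
    if W: "submodule W A E" and W': "submodule W' A E" and s: "W <+>\<^bsub>E\<^esub> W' = carrier E"
      and i: "W \<inter> W' = {\<zero>\<^bsub>E\<^esub>}" and UW: "U \<subseteq> W" for W W'
  proof -
    have c: "\<And>x. x \<in> W \<Longrightarrow> x \<in> carrier E" "\<And>x. x \<in> W' \<Longrightarrow> x \<in> carrier E"
      using submodule_subset[OF W] submodule_subset[OF W'] by blast+
    have "g ` W = {\<zero>\<^bsub>M\<^esub>} \<or> g ` W' = {\<zero>\<^bsub>M\<^esub>}"
    proof (rule images[OF W W' s])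
      fix w w' assume w: "w \<in> W" "w' \<in> W'" "w \<ominus>\<^bsub>E\<^esub> w' \<in> U"
      have "w \<ominus>\<^bsub>E\<^esub> (w \<ominus>\<^bsub>E\<^esub> w') \<in> W" by (rule submodule_diff[OF W]) (use w UW in auto)
      moreover have "w \<ominus>\<^bsub>E\<^esub> (w \<ominus>\<^bsub>E\<^esub> w') = w'"
        using w c by (simp add: a_minus_def E.M.minus_add E.M.r_neg2)
      ultimately have "w' = \<zero>\<^bsub>E\<^esub>" using i w(2) by auto
      then show "w \<in> U" using w(3) c(1)[OF w(1)] by (simp add: E.M.minus_zero_right)
    qed
    then show ?thesis
    proof
      assume "g ` W = {\<zero>\<^bsub>M\<^esub>}"
      then have "W \<subseteq> U" by (rule in_U[OF W])
      then have "W = {\<zero>\<^bsub>E\<^esub>}" using Ui by (intro min'[OF W W' s i]) blast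
      then show ?thesis using UW Unz submodule_zero[OF Us] by blast
    next
      assume "g ` W' = {\<zero>\<^bsub>M\<^esub>}"
      then have "W' \<subseteq> U" by (rule in_U[OF W'])
      then have W'0: "W' = {\<zero>\<^bsub>E\<^esub>}" using UW i submodule_zero[OF W'] by blast
      have "{\<zero>\<^bsub>E\<^esub>} <+>\<^bsub>E\<^esub> W = W" by (rule submodule_sum_zero[OF Em W])
      then show ?thesis using s submodule_sum_comm[OF Em W W'] unfolding W'0 by simp
    qed
  qed
  \<comment> \<open>If V meets U in zero, some endomorphism of E fixes U and kills V. The image of
    its stable power is a summand containing U, hence E, while V lies in the complementary
    kernel.\<close>
  have ess: "V = {\<zero>\<^bsub>E\<^esub>}" if V: "submodule V A E" and i: "V \<inter> U = {\<zero>\<^bsub>E\<^esub>}" for V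
  proof -
    have "U \<inter> V = {\<zero>\<^bsub>E\<^esub>}" using i by blast
    then obtain \<phi> where \<phi>: "\<phi> \<in> mod_hom A E E" "\<forall>u\<in>U. \<phi> u = u" "\<forall>v\<in>V. \<phi> v = \<zero>\<^bsub>E\<^esub>"
      using injective_projection[OF Ei Us V] by blast
    obtain n where n: "(\<phi> ^^ n) \<in> mod_hom A E E"
      "submodule (a_kernel E E (\<phi> ^^ n)) A E" "submodule ((\<phi> ^^ n) ` carrier E) A E"
      "a_kernel E E (\<phi> ^^ n) \<inter> (\<phi> ^^ n) ` carrier E = {\<zero>\<^bsub>E\<^esub>}"
      "a_kernel E E (\<phi> ^^ n) <+>\<^bsub>E\<^esub> (\<phi> ^^ n) ` carrier E = carrier E" "n \<noteq> 0"
      by (rule fitting_decomposition[OF Em El \<phi>(1)])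
    have "U \<subseteq> (\<phi> ^^ n) ` carrier E"
    proof
      fix x assume x: "x \<in> U"
      have "(\<phi> ^^ n) x = x" using \<phi>(2) x by (intro funpow_fixed) blast
      then show "x \<in> (\<phi> ^^ n) ` carrier E" using x submodule_subset[OF Us] by (intro image_eqI[of _ _ x]) auto
    qed
    then have im: "(\<phi> ^^ n) ` carrier E = carrier E"
      using n(4) submodule_sum_comm[OF Em n(3,2)] n(5) by (intro top[OF n(3,2)]) auto
    have "V \<subseteq> a_kernel E E (\<phi> ^^ n)"
    proof
      fix x assume x: "x \<in> V"
      have "\<phi> x = \<zero>\<^bsub>E\<^esub>" using \<phi>(3) x by blast
      then have "(\<phi> ^^ n) x = \<zero>\<^bsub>E\<^esub>" by (rule funpow_killed[OF Em \<phi>(1) _ n(6)])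
      then show "x \<in> a_kernel E E (\<phi> ^^ n)" using x submodule_subset[OF V] unfolding a_kernel_iff by blast
    qed
    moreover have "V \<subseteq> (\<phi> ^^ n) ` carrier E" unfolding im by (rule submodule_subset[OF V])
    ultimately have "V \<subseteq> {\<zero>\<^bsub>E\<^esub>}" unfolding n(4)[symmetric] by (rule Int_greatest)
    then show ?thesis using submodule_zero[OF V] by blast
  qed
  have UI: "indecomposable_mod A ?U"
  proof -
    obtain x where x: "x \<in> U" "x \<noteq> \<zero>\<^bsub>E\<^esub>" using Unz submodule_zero[OF Us] by blast
    show ?thesis
    proof (rule indecomposableI[OF Uf, of x])
      fix U1 U2 assume d: "submodule U1 A ?U" "submodule U2 A ?U" "U1 <+>\<^bsub>?U\<^esub> U2 = carrier ?U" "U1 \<inter> U2 = {\<zero>\<^bsub>?U\<^esub>}"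
      have sub: "submodule U1 A E" "submodule U2 A E" "U1 \<subseteq> U" "U2 \<subseteq> U"
        using d(1,2) by (simp_all add: submodule_restrict_iff[OF Em Us])
      have i12: "U1 \<inter> U2 = {\<zero>\<^bsub>E\<^esub>}" using d(4) by simp
      \<comment> \<open>\<phi> separates U1 from U2, and Fitting's lemma puts them into
        complementary summands of E. This splitting of E is compatible with U, so g kills one half,
        and a summand killed by g is zero.\<close>
      obtain \<phi> where \<phi>: "\<phi> \<in> mod_hom A E E" "\<forall>u\<in>U1. \<phi> u = u" "\<forall>v\<in>U2. \<phi> v = \<zero>\<^bsub>E\<^esub>"
        using injective_projection[OF Ei sub(1,2) i12] by blast
      obtain n where n: "(\<phi> ^^ n) \<in> mod_hom A E E"
        "submodule (a_kernel E E (\<phi> ^^ n)) A E" "submodule ((\<phi> ^^ n) ` carrier E) A E"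
        "a_kernel E E (\<phi> ^^ n) \<inter> (\<phi> ^^ n) ` carrier E = {\<zero>\<^bsub>E\<^esub>}"
        "a_kernel E E (\<phi> ^^ n) <+>\<^bsub>E\<^esub> (\<phi> ^^ n) ` carrier E = carrier E" "n \<noteq> 0"
        by (rule fitting_decomposition[OF Em El \<phi>(1)])
      let ?k = "a_kernel E E (\<phi> ^^ n)" and ?i = "(\<phi> ^^ n) ` carrier E"
      have c: "\<And>x. x \<in> ?k \<Longrightarrow> x \<in> carrier E" "\<And>x. x \<in> ?i \<Longrightarrow> x \<in> carrier E" "\<And>x. x \<in> U \<Longrightarrow> x \<in> carrier E"
        using submodule_subset[OF n(2)] submodule_subset[OF n(3)] submodule_subset[OF Us] by blast+
      have U2k: "U2 \<subseteq> ?k"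
      proof
        fix x assume x: "x \<in> U2"
        have "\<phi> x = \<zero>\<^bsub>E\<^esub>" using \<phi>(3) x by blast
        then have "(\<phi> ^^ n) x = \<zero>\<^bsub>E\<^esub>" by (rule funpow_killed[OF Em \<phi>(1) _ n(6)])
        then show "x \<in> ?k" using x submodule_subset[OF sub(2)] unfolding a_kernel_iff by blast
      qed
      have U1i: "U1 \<subseteq> ?i"
      proof
        fix x assume x: "x \<in> U1"
        have "(\<phi> ^^ n) x = x" using \<phi>(2) x by (intro funpow_fixed) blast
        then show "x \<in> ?i" using x submodule_subset[OF sub(1)] by (intro image_eqI[of _ _ x]) auto
      qed
      have "g ` ?k = {\<zero>\<^bsub>M\<^esub>} \<or> g ` ?i = {\<zero>\<^bsub>M\<^esub>}"
      proof (rule images[OF n(2,3,5)])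
        fix w w' assume w: "w \<in> ?k" "w' \<in> ?i" "w \<ominus>\<^bsub>E\<^esub> w' \<in> U"
        then obtain u1 u2 where u: "u1 \<in> U1" "u2 \<in> U2" "w \<ominus>\<^bsub>E\<^esub> w' = u1 \<oplus>\<^bsub>E\<^esub> u2"
          using d(3) by (auto simp: set_add_restrict submodule_sum_iff[symmetric] set_add_def')
        have uc: "u1 \<in> carrier E" "u2 \<in> carrier E" using u sub c(3) by auto
        have wc: "w \<in> carrier E" "w' \<in> carrier E" using w c by auto
        have "w = (w \<ominus>\<^bsub>E\<^esub> w') \<oplus>\<^bsub>E\<^esub> w'" using wc by (simp add: E.M.diff_add_cancel)
        then have "w = (w' \<oplus>\<^bsub>E\<^esub> u1) \<oplus>\<^bsub>E\<^esub> u2" unfolding u(3) using uc wc by (simp add: E.M.a_ac)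
        then have eq: "w \<ominus>\<^bsub>E\<^esub> u2 = w' \<oplus>\<^bsub>E\<^esub> u1" using uc wc by (metis E.M.add_diff_cancel(1) E.M.a_closed)
        have "w \<ominus>\<^bsub>E\<^esub> u2 \<in> ?k" using w u U2k by (intro submodule_diff[OF n(2)]) auto
        moreover have "w \<ominus>\<^bsub>E\<^esub> u2 \<in> ?i" unfolding eq using w u U1i by (intro submodule_add[OF n(3)]) auto
        ultimately have "w \<ominus>\<^bsub>E\<^esub> u2 = \<zero>\<^bsub>E\<^esub>" using n(4) by blast
        then have "w = u2" using wc uc by (simp add: E.M.diff_eq_zero_iff)
        then show "w \<in> U" using u sub by blast
      qed
      then have "U1 = {\<zero>\<^bsub>E\<^esub>} \<or> U2 = {\<zero>\<^bsub>E\<^esub>}"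
      proof
        assume "g ` ?k = {\<zero>\<^bsub>M\<^esub>}"
        then have "?k = {\<zero>\<^bsub>E\<^esub>}" using in_U[OF n(2)] Ui by (intro min'[OF n(2,3,5,4)]) blast
        then show ?thesis using U2k submodule_zero[OF sub(2)] by blast
      next
        assume gi: "g ` ?i = {\<zero>\<^bsub>M\<^esub>}"
        have s': "?i <+>\<^bsub>E\<^esub> ?k = carrier E" using submodule_sum_comm[OF Em n(3,2)] n(5) by simp
        have i': "?i \<inter> ?k = {\<zero>\<^bsub>E\<^esub>}" using n(4) by blast
        have "g x = \<zero>\<^bsub>M\<^esub>" if "x \<in> ?i" for x using subsetD[OF in_U[OF n(3) gi] that] Ui by blast
        then have "?i = {\<zero>\<^bsub>E\<^esub>}" by (rule min'[OF n(3,2) s' i'])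
        then have "U1 \<subseteq> {\<zero>\<^bsub>E\<^esub>}" using U1i by simp
        then show ?thesis using submodule_zero[OF sub(1)] by blast
      qed
      then show "U1 = {\<zero>\<^bsub>?U\<^esub>} \<or> U2 = {\<zero>\<^bsub>?U\<^esub>}" by simp
    qed (use x in simp_all)
  qed
  \<comment> \<open>An injective U would be a nonzero direct summand of E killed by g, contrary to
    minimality.\<close>
  have "\<not> injective_mod A ?U"
  proof
    assume inj: "injective_mod A ?U"
    obtain \<rho> where \<rho>: "\<rho> \<in> mod_hom A E ?U" "\<forall>x\<in>carrier ?U. \<rho> x = x"
      using injective_extend[OF inj Uf Ef mod_mono_incl[OF Us] mod_hom_id] by blast
    note rc = retract_complement[OF Um Em mod_hom_incl[OF submodule_subset[OF Us]] \<rho>(1) \<rho>(2)[rule_format]]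
    have "(\<lambda>x. x) ` carrier ?U = {\<zero>\<^bsub>E\<^esub>}"
      by (rule min'[OF rc(1,2,3,4)]) (simp_all add: Ui)
    then show False using Unz by simp
  qed
  then have "projective_mod A ?U" using indecomposable_gencogen_cases[OF J UI sU] by blast
  moreover have "iso_cosyzygy A M ?U"
    unfolding iso_cosyzygy_def injective_envelope_def
  proof (intro exI[of _ E] exI[of _ "\<lambda>x. x"] conjI allI impI)
    show "injective_mod A E" by (rule Ei)
    show "(\<lambda>x. x) \<in> mod_mono A ?U E" by (rule mod_mono_incl[OF Us])
    show "V = {\<zero>\<^bsub>E\<^esub>}" if "submodule V A E \<and> V \<inter> (\<lambda>x. x) ` carrier ?U = {\<zero>\<^bsub>E\<^esub>}" for V
      using that ess by simp
    show "mod_isomorphic A M (quot_mod E ((\<lambda>x. x) ` carrier ?U))"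
      using mod_isomorphic_quot[OF Em Mm ge] by (simp add: U_def)
  qed
  ultimately show ?thesis using UI by blast
qed

end

section \<open>The modules cogenerated by the algebra\<close>

context artin_algebra
begin

text \<open>
  Dually, take a minimal left approximation \<open>j : M \<rightarrow> E\<close> with \<open>E\<close> projective. Its cokernel \<open>C\<close> lies
  in \<open>add (A \<oplus> DA)\<close>: a right approximation \<open>G \<rightarrow> C\<close> has kernel \<open>N'\<close> in \<open>add (A \<oplus> DA)\<close>, so the map
  \<open>M \<rightarrow> N'\<close> induced by a lift \<open>E \<rightarrow> G\<close> extends along \<open>j\<close>, and correcting the lift by this extension
  yields a section \<open>C \<rightarrow> G\<close>.
\<close>

lemma cogenerated_syzygy:
  fixes M :: "(_, 'm) module"
  assumes J: "dualizing_mod K J" and gl: "gl_dim (end_ring A (gencogen J)) \<le> enat 3"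
    and MI: "indecomposable_mod A M" and np: "\<not> projective_mod A M"
    and e: "e \<in> mod_mono A M (mod_pow (regular_mod A) k)"
  shows "\<exists>I :: 'a umod. indecomposable_mod A I \<and> injective_mod A I \<and> iso_syzygy A M I"
proof -
  let ?D = "dual_mod K A J" and ?T = "gencogen J" and ?R = "regular_mod A"
  have Mf: "fg_mod A M" and Mm: "right_module A M" using MI by (simp_all add: indecomposable_mod_def fg_mod_def)
  interpret M: right_module A M by (rule Mm)
  have Di: "injective_mod A ?D" by (rule injective_dual[OF dualizing_mod_injective[OF J]])
  have Df: "fg_mod A ?D" and D: "right_module A ?D" using Di by (simp_all add: injective_mod_def fg_mod_def)
  note Rm = right_module_regular[OF rings(3)]
  have Rf: "fg_mod A ?R" by (simp add: fg_mod_def Rm fin_gen_regular rings(3))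
  have T: "right_module A ?T" by (rule right_module_mod_sum[OF Rm D])
  interpret T: right_module A ?T by (rule T)
  obtain n f0 where f0: "f0 \<in> mod_hom A M (mod_pow ?R n)"
    "\<forall>h\<in>mod_hom A M ?R. \<exists>b\<in>mod_hom A (mod_pow ?R n) ?R. \<forall>x\<in>carrier M. b (f0 x) = h x"
    by (rule left_approximation[OF Rf Mf])
  have "fg_mod A (mod_pow ?R n)"
    by (rule summand_of_fin_gen[OF Rm fin_gen_regular[OF rings(3)] summand_of_mod_pow[OF Rm]])
  then obtain F :: "'a umod" and u v where F: "fg_mod A F" "u \<in> mod_hom A (mod_pow ?R n) F"
    "v \<in> mod_hom A F (mod_pow ?R n)" "\<forall>x\<in>carrier (mod_pow ?R n). v (u x) = x" "\<forall>y\<in>carrier F. u (v y) = y"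
    by (rule fg_mod_rep)
  have Fm: "right_module A F" using F(1) by (simp add: fg_mod_def)
  have Fs: "summand_of A ?R F"
    using F(5) by (intro summand_of_retract[OF Fm summand_of_mod_pow[OF Rm] F(3,2)]) simp
  define f where "f = (\<lambda>x. u (f0 x))"
  have f: "f \<in> mod_hom A M F" unfolding f_def by (rule mod_hom_comp[OF f0(1) F(2)])
  have ap: "\<exists>b\<in>mod_hom A F ?R. \<forall>x\<in>carrier M. b (f x) = h x" if h: "h \<in> mod_hom A M ?R" for h
  proof -
    obtain b where b: "b \<in> mod_hom A (mod_pow ?R n) ?R" "\<forall>x\<in>carrier M. b (f0 x) = h x"
      using bspec[OF f0(2) h] by blast
    show ?thesis
      using b(2) F(4) mod_hom_closed[OF f0(1)] by (intro bexI[OF _ mod_hom_comp[OF F(3) b(1)]]) (simp add: f_def)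
  qed
  obtain I r where I: "submodule I A F" and r: "r \<in> mod_hom A F (F\<lparr>carrier := I\<rparr>)" "\<forall>x\<in>I. r x = x"
    and apI: "\<forall>h\<in>mod_hom A M ?R. \<exists>b\<in>mod_hom A (F\<lparr>carrier := I\<rparr>) ?R. \<forall>x\<in>carrier M. b (r (f x)) = h x"
    and min: "\<forall>W W'. submodule W A (F\<lparr>carrier := I\<rparr>) \<longrightarrow> submodule W' A (F\<lparr>carrier := I\<rparr>) \<longrightarrow>
       W <+>\<^bsub>F\<^esub> W' = I \<longrightarrow> W \<inter> W' = {\<zero>\<^bsub>F\<^esub>} \<longrightarrow> (\<forall>x\<in>carrier M. r (f x) \<in> W) \<longrightarrow> W = I"
    by (rule minimal_left_approximation[OF Fm fg_finite_length_A[OF F(1)] Mm Rm f ap])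
  define E where "E = F\<lparr>carrier := I\<rparr>"
  have Em: "right_module A E" unfolding E_def by (rule right_module_restrict[OF Fm I])
  interpret E: right_module A E by (rule Em)
  have Es: "summand_of A ?R E"
    using r(2) by (intro summand_of_retract[OF Em Fs _ r(1)[folded E_def], of "\<lambda>x. x"])
      (simp_all add: E_def mod_hom_incl[OF submodule_subset[OF I]])
  then have Ep: "projective_mod A E" by (simp add: projective_iff_summand[OF rings(3)])
  then have Ef: "fg_mod A E" by (simp add: projective_mod_def)
  have El: "finite_length A E" by (rule fg_finite_length_A[OF Ef])
  define j where "j = (\<lambda>x. r (f x))"
  have j: "j \<in> mod_hom A M E" unfolding j_def E_def by (rule mod_hom_comp[OF f r(1)])
  have apE: "\<exists>b\<in>mod_hom A E ?R. \<forall>x\<in>carrier M. b (j x) = h x" if "h \<in> mod_hom A M ?R" for h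
    using bspec[OF apI that] unfolding E_def j_def .
  have top: "W = carrier E"
    if "submodule W A E" "submodule W' A E" "W <+>\<^bsub>E\<^esub> W' = carrier E" "W \<inter> W' = {\<zero>\<^bsub>E\<^esub>}"
      "\<And>x. x \<in> carrier M \<Longrightarrow> j x \<in> W" for W W'
    using min[rule_format, of W W'] that by (simp add: E_def set_add_restrict j_def)
  \<comment> \<open>The given embedding e factors through j by the approximation property, so j is
    injective too.\<close>
  obtain b0 where b0: "b0 \<in> mod_hom A E (mod_pow ?R k)" "\<forall>x\<in>carrier M. b0 (j x) = e x"
    using thru_extend[OF Mm Em right_module_mod_pow[OF Rm] j apE
        thru_summand[OF summand_of_mod_pow[OF Rm] mod_monoD(1)[OF e] mod_hom_id]] by blast
  have jinj: "inj_on j (carrier M)"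
  proof (rule inj_onI)
    fix x y assume xy: "x \<in> carrier M" "y \<in> carrier M" "j x = j y"
    then have "b0 (j x) = b0 (j y)" by simp
    then have "e x = e y" using b0(2) xy(1,2) by simp
    then show "x = y" by (rule inj_onD[OF mod_monoD(2)[OF e] _ xy(1,2)])
  qed
  have jm: "j \<in> mod_mono A M E" using j jinj by (simp add: mod_mono_def)
  define N where "N = j ` carrier M"
  have Ns: "submodule N A E" unfolding N_def by (rule submodule_image[OF Mm Em j submodule_carrier[OF Mm]])
  have jN: "j x \<in> N" if "x \<in> carrier M" for x using that unfolding N_def by blast
  note q = quot_mod_proj[OF Em Ns]
  have "fg_mod A (quot_mod E N)" by (rule fin_gen_image[OF Ef q(1,2)])
  \<comment> \<open>The cokernel of j, moved to the type \<open>umod\<close> that the conclusion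
    prescribes for I.\<close>
  then obtain C :: "'a umod" and u' v' where C: "fg_mod A C" "u' \<in> mod_hom A (quot_mod E N) C"
    "v' \<in> mod_hom A C (quot_mod E N)" "\<forall>x\<in>carrier (quot_mod E N). v' (u' x) = x" "\<forall>y\<in>carrier C. u' (v' y) = y"
    by (rule fg_mod_rep)
  have Cm: "right_module A C" using C(1) by (simp add: fg_mod_def)
  interpret C: right_module A C by (rule Cm)
  define c where "c = (\<lambda>x. u' (N +>\<^bsub>E\<^esub> x))"
  note qh = mod_epiD(1)[OF q(2)]
  have ch: "c \<in> mod_hom A E C" unfolding c_def by (rule mod_hom_comp[OF qh C(2)])
  have "y \<in> c ` carrier E" if y: "y \<in> carrier C" for y
  proof -
    obtain x where x: "x \<in> carrier E" "v' y = N +>\<^bsub>E\<^esub> x"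
      using mod_epi_surj[OF q(2) mod_hom_closed[OF C(3) y]] by blast
    have "y = c x" unfolding c_def x(2)[symmetric] using C(5) y by simp
    then show ?thesis using x(1) by blast
  qed
  then have ce: "c \<in> mod_epi A E C" using ch mod_hom_closed[OF ch] by (auto simp: mod_epi_def)
  have c0: "c x = \<zero>\<^bsub>C\<^esub> \<longleftrightarrow> x \<in> N" if x: "x \<in> carrier E" for x
  proof
    assume "c x = \<zero>\<^bsub>C\<^esub>"
    then have "v' (c x) = \<zero>\<^bsub>quot_mod E N\<^esub>" using mod_hom_zero[OF Cm q(1) C(3)] by simp
    then have "N +>\<^bsub>E\<^esub> x = \<zero>\<^bsub>quot_mod E N\<^esub>"
      unfolding c_def using C(4) mod_hom_closed[OF qh x] by simp
    then show "x \<in> N" using q(3)[OF x] by blast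
  next
    assume "x \<in> N"
    then have "N +>\<^bsub>E\<^esub> x = \<zero>\<^bsub>quot_mod E N\<^esub>" using q(3)[OF x] by blast
    then show "c x = \<zero>\<^bsub>C\<^esub>" unfolding c_def using mod_hom_zero[OF q(1) Cm C(2)] by simp
  qed
  have Nc: "x \<in> carrier E" if "x \<in> N" for x using that submodule_subset[OF Ns] by blast
  have kc: "a_kernel E C c = N"
    using c0 Nc unfolding Set.set_eq_iff a_kernel_iff by blast

  have CsT: "summand_of A ?T C"
  proof -
    obtain n' g' where g': "g' \<in> mod_epi A (mod_pow ?T n') C"
      "summand_of A ?T ((mod_pow ?T n')\<lparr>carrier := a_kernel (mod_pow ?T n') C g'\<rparr>)"
      by (rule approximation_kernel[OF J gl C(1)])
    let ?G = "mod_pow ?T n'"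
    note Gm = right_module_mod_pow[OF T, of n'] and g'h = mod_epiD(1)[OF g'(1)]
    interpret G: right_module A ?G by (rule Gm)
    have ks: "submodule (a_kernel ?G C g') A ?G" by (rule submodule_kernel[OF Gm Cm g'h])
    let ?N' = "?G\<lparr>carrier := a_kernel ?G C g'\<rparr>"
    have N'm: "right_module A ?N'" by (rule right_module_restrict[OF Gm ks])
    obtain \<delta> where \<delta>: "\<delta> \<in> mod_hom A E ?G" "\<forall>x\<in>carrier E. g' (\<delta> x) = c x"
      using summand_of_regular_lift[OF Es Gm g'(1) ch] by blast
    have \<delta>j: "(\<lambda>x. \<delta> (j x)) \<in> mod_hom A M ?N'"
    proof (rule mod_hom_corestrict[OF mod_hom_comp[OF j \<delta>(1)]], rule image_subsetI)
      fix x assume x: "x \<in> carrier M"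
      have jx: "j x \<in> carrier E" by (rule mod_hom_closed[OF j x])
      have "g' (\<delta> (j x)) = \<zero>\<^bsub>C\<^esub>" using \<delta>(2) jx c0[OF jx] jN[OF x] by simp
      then show "\<delta> (j x) \<in> a_kernel ?G C g'" using mod_hom_closed[OF \<delta>(1) jx] by (simp add: a_kernel_iff)
    qed
    \<comment> \<open>Maps from M to T extend along j componentwise: into A by the approximation
      property, into DA by injectivity.\<close>
    have extT: "\<exists>b\<in>mod_hom A E ?T. \<forall>x\<in>carrier M. b (j x) = h x" if h: "h \<in> mod_hom A M ?T" for h
    proof -
      obtain b1 where b1: "b1 \<in> mod_hom A E ?R" "\<forall>x\<in>carrier M. b1 (j x) = fst (h x)"
        using apE[OF mod_hom_comp[OF h mod_hom_fst]] by blast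
      obtain b2 where b2: "b2 \<in> mod_hom A E ?D" "\<forall>x\<in>carrier M. b2 (j x) = snd (h x)"
        using injective_extend[OF Di Mf Ef jm mod_hom_comp[OF h mod_hom_snd]] by blast
      show ?thesis
      proof (rule bexI[OF ballI mod_hom_plus[OF T mod_hom_comp[OF b1(1) mod_hom_inl[OF D]] mod_hom_comp[OF b2(1) mod_hom_inr[OF Rm]]]])
        fix x assume x: "x \<in> carrier M"
        have "(b1 (j x), \<zero>\<^bsub>?D\<^esub>) \<oplus>\<^bsub>?T\<^esub> (\<zero>\<^bsub>?R\<^esub>, b2 (j x)) = (fst (h x), \<zero>\<^bsub>?D\<^esub>) \<oplus>\<^bsub>?T\<^esub> (\<zero>\<^bsub>?R\<^esub>, snd (h x))"
          using b1(2) b2(2) x by (simp del: dual_mod_simps)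
        also have "\<dots> = h x" by (rule mod_sum_split[OF Rm D mod_hom_closed[OF h x], symmetric])
        finally show "(b1 (j x), \<zero>\<^bsub>?D\<^esub>) \<oplus>\<^bsub>?T\<^esub> (\<zero>\<^bsub>?R\<^esub>, b2 (j x)) = h x" .
      qed
    qed
    obtain \<epsilon> where \<epsilon>: "\<epsilon> \<in> mod_hom A E ?N'" "\<forall>x\<in>carrier M. \<epsilon> (j x) = \<delta> (j x)"
      using thru_extend[OF Mm Em N'm j extT thru_summand[OF g'(2) \<delta>j mod_hom_id]] by blast
    have \<epsilon>G: "\<epsilon> \<in> mod_hom A E ?G" by (rule mod_hom_expand[OF \<epsilon>(1) submodule_subset[OF ks]])
    have dh: "(\<lambda>x. \<delta> x \<ominus>\<^bsub>?G\<^esub> \<epsilon> x) \<in> mod_hom A E ?G" by (rule mod_hom_sub[OF Gm \<delta>(1) \<epsilon>G])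
    have "\<delta> x \<ominus>\<^bsub>?G\<^esub> \<epsilon> x = \<zero>\<^bsub>?G\<^esub>" if x: "x \<in> carrier E" "c x = \<zero>\<^bsub>C\<^esub>" for x
    proof -
      have "x \<in> N" using x c0 by blast
      then obtain y where y: "y \<in> carrier M" "x = j y" unfolding N_def by blast
      have "\<epsilon> x = \<delta> x" using \<epsilon>(2) y by simp
      then show ?thesis using G.M.diff_eq_zero_iff mod_hom_closed[OF \<delta>(1) x(1)] by simp
    qed
    \<comment> \<open>\<delta> - \<epsilon> vanishes on N and induces \<sigma> on C. As \<epsilon>
      takes values in the kernel of g', subtracting it leaves g' \<delta> = c unchanged, which makes
      \<sigma> a section.\<close>
    then obtain \<sigma> where \<sigma>: "\<sigma> \<in> mod_hom A C ?G" "\<forall>x\<in>carrier E. \<sigma> (c x) = \<delta> x \<ominus>\<^bsub>?G\<^esub> \<epsilon> x"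
      using factor_epi[OF Em Cm Gm ce dh] by blast
    have "g' (\<sigma> y) = y" if y: "y \<in> carrier C" for y
    proof -
      obtain x where x: "x \<in> carrier E" "y = c x" using mod_epi_surj[OF ce y] by blast
      have "\<epsilon> x \<in> carrier ?N'" by (rule mod_hom_closed[OF \<epsilon>(1) x(1)])
      then have z: "g' (\<epsilon> x) = \<zero>\<^bsub>C\<^esub>" by (simp add: a_kernel_iff)
      have "g' (\<sigma> y) = g' (\<delta> x \<ominus>\<^bsub>?G\<^esub> \<epsilon> x)" using \<sigma>(2) x by simp
      also have "\<dots> = g' (\<delta> x) \<ominus>\<^bsub>C\<^esub> g' (\<epsilon> x)"
        by (rule mod_hom_diff[OF Gm Cm g'h mod_hom_closed[OF \<delta>(1) x(1)] mod_hom_closed[OF \<epsilon>G x(1)]])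
      also have "\<dots> = y" using \<delta>(2) x z y by (simp add: C.M.minus_zero_right)
      finally show ?thesis .
    qed
    then show ?thesis by (rule summand_of_retract[OF Cm summand_of_mod_pow[OF T] \<sigma>(1) g'h])
  qed

  \<comment> \<open>A complement of N would make M a direct summand of the projective module
    E.\<close>
  have N_not_summand: False if W': "submodule W' A E" and s: "N <+>\<^bsub>E\<^esub> W' = carrier E" and i: "N \<inter> W' = {\<zero>\<^bsub>E\<^esub>}" for W'
  proof -
    obtain p p' where p: "p \<in> mod_hom A E (E\<lparr>carrier := N\<rparr>)"
      and pq: "\<And>u v. \<lbrakk>u \<in> N; v \<in> W'\<rbrakk> \<Longrightarrow> p (u \<oplus>\<^bsub>E\<^esub> v) = u \<and> p' (u \<oplus>\<^bsub>E\<^esub> v) = v"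
      by (rule direct_sum_projections[OF Em Ns W' s i]) (erule that)
    have pE: "p \<in> mod_hom A E E" by (rule mod_hom_expand[OF p submodule_subset[OF Ns]])
    have "p ` carrier E \<subseteq> j ` carrier M" using mod_hom_closed[OF p] unfolding N_def by auto
    then obtain s' where s': "s' \<in> mod_hom A E M" "\<forall>x\<in>carrier E. j (s' x) = p x"
      using factor_mono[OF Em Mm jm pE] by blast
    have "s' (j x) = x" if x: "x \<in> carrier M" for x
    proof (rule inj_onD[OF jinj _ _ x])
      have jx: "j x \<in> carrier E" by (rule mod_hom_closed[OF j x])
      have "p (j x \<oplus>\<^bsub>E\<^esub> \<zero>\<^bsub>E\<^esub>) = j x" using pq[OF jN[OF x] submodule_zero[OF W']] by simp
      then show "j (s' (j x)) = j x" using s'(2) jx by simp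
      show "s' (j x) \<in> carrier M" by (rule mod_hom_closed[OF s'(1) jx])
    qed
    then have "summand_of A ?R M" by (rule summand_of_retract[OF Mm Es j s'(1)])
    then show False using np projective_iff_summand[OF rings(3)] by blast
  qed
  \<comment> \<open>Indecomposability of M transported along j: a decomposition of E that restricts
    to N leaves one of its two parts without share in N.\<close>
  have preimages: "{x \<in> carrier M. j x \<in> W} = {\<zero>\<^bsub>M\<^esub>} \<or> {x \<in> carrier M. j x \<in> W'} = {\<zero>\<^bsub>M\<^esub>}"
    if W: "submodule W A E" and W': "submodule W' A E" and i: "W \<inter> W' = {\<zero>\<^bsub>E\<^esub>}"
      and s: "\<And>y. y \<in> N \<Longrightarrow> \<exists>w\<in>W \<inter> N. \<exists>w'\<in>W' \<inter> N. y = w \<oplus>\<^bsub>E\<^esub> w'" for W W'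
  proof (rule indecomposable_decomposition[OF MI submodule_vimage[OF Mm Em j W] submodule_vimage[OF Mm Em j W']])
    fix x assume x: "x \<in> carrier M"
    obtain w w' where w: "w \<in> W" "w \<in> N" "w' \<in> W'" "w' \<in> N" "j x = w \<oplus>\<^bsub>E\<^esub> w'" using s[OF jN[OF x]] by blast
    obtain a where a: "a \<in> carrier M" "w = j a" using w(2) unfolding N_def by blast
    obtain b where b: "b \<in> carrier M" "w' = j b" using w(4) unfolding N_def by blast
    have "j x = j (a \<oplus>\<^bsub>M\<^esub> b)" using w(5) a b by (simp add: mod_hom_add[OF j])
    then have "x = a \<oplus>\<^bsub>M\<^esub> b" by (rule inj_onD[OF jinj _ x M.M.a_closed[OF a(1) b(1)]])
    then show "\<exists>u\<in>{x \<in> carrier M. j x \<in> W}. \<exists>v\<in>{x \<in> carrier M. j x \<in> W'}. x = u \<oplus>\<^bsub>M\<^esub> v"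
      using a b w(1,3) by blast
  next
    fix x assume "x \<in> {x \<in> carrier M. j x \<in> W}" "x \<in> {x \<in> carrier M. j x \<in> W'}"
    then have x: "x \<in> carrier M" "j x \<in> W \<inter> W'" by simp_all
    have "j x = j \<zero>\<^bsub>M\<^esub>" using x(2) mod_hom_zero[OF Mm Em j] unfolding i by simp
    then show "x = \<zero>\<^bsub>M\<^esub>" by (rule inj_onD[OF jinj _ x(1) M.M.zero_closed])
  qed
  have N_cap: "W \<inter> N = {\<zero>\<^bsub>E\<^esub>}" if "submodule W A E" "{x \<in> carrier M. j x \<in> W} = {\<zero>\<^bsub>M\<^esub>}" for W
  proof -
    have "y = \<zero>\<^bsub>E\<^esub>" if y: "y \<in> W" "y \<in> N" for y
    proof -
      obtain x where x: "x \<in> carrier M" "y = j x" using y(2) unfolding N_def by blast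
      then have "x \<in> {x \<in> carrier M. j x \<in> W}" using y(1) by blast
      then have "x = \<zero>\<^bsub>M\<^esub>" using \<open>{x \<in> carrier M. j x \<in> W} = {\<zero>\<^bsub>M\<^esub>}\<close> by blast
      then show ?thesis using x(2) mod_hom_zero[OF Mm Em j] by simp
    qed
    then show ?thesis using submodule_zero[OF that(1)] submodule_zero[OF Ns] by blast
  qed
  \<comment> \<open>A direct summand W of E inside N is zero. The decomposition restricts to N; if
    it is W' that meets N trivially, then N = W would be a direct summand of E.\<close>
  have small: "W = {\<zero>\<^bsub>E\<^esub>}"
    if W: "submodule W A E" and W': "submodule W' A E" and s: "W <+>\<^bsub>E\<^esub> W' = carrier E"
      and i: "W \<inter> W' = {\<zero>\<^bsub>E\<^esub>}" and WN: "W \<subseteq> N" for W W'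
  proof -
    have dec: "\<exists>w\<in>W \<inter> N. \<exists>w'\<in>W' \<inter> N. y = w \<oplus>\<^bsub>E\<^esub> w'" if y: "y \<in> N" for y
    proof -
      have "y \<in> W <+>\<^bsub>E\<^esub> W'" using Nc[OF y] s by simp
      then obtain w w' where w: "w \<in> W" "w' \<in> W'" "y = w \<oplus>\<^bsub>E\<^esub> w'" unfolding submodule_sum_iff by blast
      have wc: "w \<in> carrier E" "w' \<in> carrier E"
        using w submodule_subset[OF W] submodule_subset[OF W'] by blast+
      have wN: "w \<in> N" using w(1) WN by blast
      have "y \<ominus>\<^bsub>E\<^esub> w = w'" unfolding w(3) using wc by (simp add: E.M.add_diff_cancel)
      then have "w' \<in> N" using submodule_diff[OF Ns y wN] by simp
      then show ?thesis using w wN by blast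
    qed
    have "{x \<in> carrier M. j x \<in> W} = {\<zero>\<^bsub>M\<^esub>} \<or> {x \<in> carrier M. j x \<in> W'} = {\<zero>\<^bsub>M\<^esub>}"
      by (rule preimages[OF W W' i dec])
    then show ?thesis
    proof
      assume "{x \<in> carrier M. j x \<in> W} = {\<zero>\<^bsub>M\<^esub>}"
      then have "W \<inter> N = {\<zero>\<^bsub>E\<^esub>}" by (rule N_cap[OF W])
      then show ?thesis using WN by blast
    next
      assume "{x \<in> carrier M. j x \<in> W'} = {\<zero>\<^bsub>M\<^esub>}"
      then have z: "W' \<inter> N = {\<zero>\<^bsub>E\<^esub>}" by (rule N_cap[OF W'])
      have "N \<subseteq> W"
      proof
        fix y assume y: "y \<in> N"
        obtain w w' where w: "w \<in> W" "w' \<in> W' \<inter> N" "y = w \<oplus>\<^bsub>E\<^esub> w'" using dec[OF y] by blast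
        have "w' = \<zero>\<^bsub>E\<^esub>" using w(2) z by blast
        moreover have "w \<in> carrier E" using w(1) submodule_subset[OF W] by blast
        ultimately show "y \<in> W" using w(1,3) by simp
      qed
      then have "W = N" using WN by blast
      then show ?thesis using N_not_summand[OF W'] s i by blast
    qed
  qed
  have Nnz: "\<exists>y\<in>N. y \<noteq> \<zero>\<^bsub>E\<^esub>"
  proof -
    obtain x where x: "x \<in> carrier M" "x \<noteq> \<zero>\<^bsub>M\<^esub>" by (rule indecomposable_nonzero[OF MI])
    have "j x \<noteq> \<zero>\<^bsub>E\<^esub>"
    proof
      assume "j x = \<zero>\<^bsub>E\<^esub>"
      then have "j x = j \<zero>\<^bsub>M\<^esub>" using mod_hom_zero[OF Mm Em j] by simp
      then show False using inj_onD[OF jinj _ x(1) M.M.zero_closed] x(2) by blast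
    qed
    then show ?thesis using jN[OF x(1)] by blast
  qed

  have cover: "V = carrier E" if V: "submodule V A E" and s: "V <+>\<^bsub>E\<^esub> N = carrier E" for V
  proof -
    let ?N = "E\<lparr>carrier := N\<rparr>"
    note qV = quot_mod_proj[OF Em V]
    let ?q = "\<lambda>x. V +>\<^bsub>E\<^esub> x"
    have qVh: "?q \<in> mod_hom A E (quot_mod E V)" by (rule mod_epiD(1)[OF qV(2)])
    have Nm: "right_module A ?N" by (rule right_module_restrict[OF Em Ns])
    have qN: "?q \<in> mod_hom A ?N (quot_mod E V)" by (rule mod_hom_restrict[OF qVh submodule_subset[OF Ns]])
    have "y \<in> ?q ` carrier ?N" if y: "y \<in> carrier (quot_mod E V)" for y
    proof -
      obtain x where x: "x \<in> carrier E" "y = ?q x" using mod_epi_surj[OF qV(2) y] by blast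
      obtain w n where w: "w \<in> V" "n \<in> N" "x = w \<oplus>\<^bsub>E\<^esub> n" using x(1) unfolding s[symmetric] submodule_sum_iff by blast
      have wc: "w \<in> carrier E" "n \<in> carrier E" using w(1) submodule_subset[OF V] Nc[OF w(2)] by blast+
      have "x \<ominus>\<^bsub>E\<^esub> n = w" unfolding w(3) using wc by (simp add: E.M.add_diff_cancel)
      then have "?q (x \<ominus>\<^bsub>E\<^esub> n) = \<zero>\<^bsub>quot_mod E V\<^esub>" using qV(3)[OF wc(1)] w(1) by simp
      then have "?q x = ?q n" using mod_hom_eq_iff[OF Em qV(1) qVh x(1) wc(2)] by simp
      then show ?thesis using x(2) w(2) by simp
    qed
    then have qNe: "?q \<in> mod_epi A ?N (quot_mod E V)" using qN mod_hom_closed[OF qN] by (auto simp: mod_epi_def)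
    obtain \<phi> where \<phi>: "\<phi> \<in> mod_hom A E ?N" "\<forall>x\<in>carrier E. ?q (\<phi> x) = ?q x"
      using summand_of_regular_lift[OF Es Nm qNe qVh] by blast
    have \<phi>E: "\<phi> \<in> mod_hom A E E" by (rule mod_hom_expand[OF \<phi>(1) submodule_subset[OF Ns]])
    obtain n where n: "(\<phi> ^^ n) \<in> mod_hom A E E"
      "submodule (a_kernel E E (\<phi> ^^ n)) A E" "submodule ((\<phi> ^^ n) ` carrier E) A E"
      "a_kernel E E (\<phi> ^^ n) \<inter> (\<phi> ^^ n) ` carrier E = {\<zero>\<^bsub>E\<^esub>}"
      "a_kernel E E (\<phi> ^^ n) <+>\<^bsub>E\<^esub> (\<phi> ^^ n) ` carrier E = carrier E" "n \<noteq> 0"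
      by (rule fitting_decomposition[OF Em El \<phi>E])
    have pc: "(\<phi> ^^ m) x \<in> carrier E \<and> ?q ((\<phi> ^^ m) x) = ?q x" if x: "x \<in> carrier E" for m x
    proof (induction m)
      case (Suc m)
      have "\<phi> ((\<phi> ^^ m) x) \<in> carrier E" using mod_hom_closed[OF \<phi>E] Suc by blast
      moreover have "?q (\<phi> ((\<phi> ^^ m) x)) = ?q x" using \<phi>(2) Suc by simp
      ultimately show ?case by simp
    qed (use x in simp)
    obtain m where m: "n = Suc m" using n(6) not0_implies_Suc by blast
    have im: "(\<phi> ^^ n) ` carrier E \<subseteq> N"
    proof (rule image_subsetI)
      fix x assume x: "x \<in> carrier E"
      have "\<phi> ((\<phi> ^^ m) x) \<in> carrier ?N" by (rule mod_hom_closed[OF \<phi>(1)]) (use pc[OF x] in blast)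
      then show "(\<phi> ^^ n) x \<in> N" by (simp add: m)
    qed
    have s': "(\<phi> ^^ n) ` carrier E <+>\<^bsub>E\<^esub> a_kernel E E (\<phi> ^^ n) = carrier E"
      using submodule_sum_comm[OF Em n(3,2)] n(5) by simp
    have i': "(\<phi> ^^ n) ` carrier E \<inter> a_kernel E E (\<phi> ^^ n) = {\<zero>\<^bsub>E\<^esub>}" using n(4) by blast
    have z: "(\<phi> ^^ n) ` carrier E = {\<zero>\<^bsub>E\<^esub>}" by (rule small[OF n(3,2) s' i' im])
    have "x \<in> V" if x: "x \<in> carrier E" for x
    proof -
      have "(\<phi> ^^ n) x = \<zero>\<^bsub>E\<^esub>" using z x by blast
      then have "?q x = \<zero>\<^bsub>quot_mod E V\<^esub>" using pc[OF x, of n] mod_hom_zero[OF Em qV(1) qVh] by simp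
      then show ?thesis using qV(3)[OF x] by blast
    qed
    then show ?thesis using submodule_subset[OF V] by blast
  qed

  have CI: "indecomposable_mod A C"
  proof -
    have "N \<noteq> carrier E"
    proof
      assume NE: "N = carrier E"
      show False
      proof (rule N_not_summand[OF submodule_zero_set[OF Em]])
        show "N <+>\<^bsub>E\<^esub> {\<zero>\<^bsub>E\<^esub>} = carrier E"
          using submodule_sum_comm[OF Em Ns submodule_zero_set[OF Em]] submodule_sum_zero[OF Em Ns] NE by simp
        show "N \<inter> {\<zero>\<^bsub>E\<^esub>} = {\<zero>\<^bsub>E\<^esub>}" using submodule_zero[OF Ns] by blast
      qed
    qed
    then obtain x0 where x0: "x0 \<in> carrier E" "x0 \<notin> N" using submodule_subset[OF Ns] by blast
    show ?thesis
    proof (rule indecomposableI[OF C(1) mod_hom_closed[OF ch x0(1)]])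
      show "c x0 \<noteq> \<zero>\<^bsub>C\<^esub>" using c0[OF x0(1)] x0(2) by blast
      fix C1 C2 assume C12: "submodule C1 A C" "submodule C2 A C" "C1 <+>\<^bsub>C\<^esub> C2 = carrier C" "C1 \<inter> C2 = {\<zero>\<^bsub>C\<^esub>}"
      obtain p p' where p: "p \<in> mod_hom A C (C\<lparr>carrier := C1\<rparr>)" "p' \<in> mod_hom A C (C\<lparr>carrier := C2\<rparr>)"
        and pp': "\<And>x. x \<in> carrier C \<Longrightarrow> x = p x \<oplus>\<^bsub>C\<^esub> p' x"
        and pq: "\<And>u v. \<lbrakk>u \<in> C1; v \<in> C2\<rbrakk> \<Longrightarrow> p (u \<oplus>\<^bsub>C\<^esub> v) = u \<and> p' (u \<oplus>\<^bsub>C\<^esub> v) = v"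
        by (rule direct_sum_projections[OF Cm C12]) (erule that)
      have c1: "\<And>x. x \<in> C1 \<Longrightarrow> x \<in> carrier C" and c2: "\<And>x. x \<in> C2 \<Longrightarrow> x \<in> carrier C"
        using submodule_subset[OF C12(1)] submodule_subset[OF C12(2)] by blast+
      have p1: "p x = x" if x: "x \<in> C1" for x
        using pq[OF x submodule_zero[OF C12(2)]] c1[OF x] by simp
      have pC: "p \<in> mod_hom A C C" by (rule mod_hom_expand[OF p(1) submodule_subset[OF C12(1)]])
      \<comment> \<open>\<phi> lifts the projection of C onto C1. Fitting's lemma splits E into an
        image lying over C1 and a kernel lying over C2.\<close>
      obtain \<phi> where \<phi>: "\<phi> \<in> mod_hom A E E" "\<forall>x\<in>carrier E. c (\<phi> x) = p (c x)"
        using summand_of_regular_lift[OF Es Em ce mod_hom_comp[OF ch pC]] by blast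
      obtain n where n: "(\<phi> ^^ n) \<in> mod_hom A E E"
        "submodule (a_kernel E E (\<phi> ^^ n)) A E" "submodule ((\<phi> ^^ n) ` carrier E) A E"
        "a_kernel E E (\<phi> ^^ n) \<inter> (\<phi> ^^ n) ` carrier E = {\<zero>\<^bsub>E\<^esub>}"
        "a_kernel E E (\<phi> ^^ n) <+>\<^bsub>E\<^esub> (\<phi> ^^ n) ` carrier E = carrier E" "n \<noteq> 0"
        by (rule fitting_decomposition[OF Em El \<phi>(1)])
      let ?k = "a_kernel E E (\<phi> ^^ n)" and ?i = "(\<phi> ^^ n) ` carrier E"
      obtain m where m: "n = Suc m" using n(6) not0_implies_Suc by blast
      \<comment> \<open>Every positive power of \<phi> lies over the idempotent p, while the zeroth
        power lies over the identity; hence the \<open>Suc\<close>.\<close>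
      have pw: "(\<phi> ^^ Suc m) x \<in> carrier E \<and> c ((\<phi> ^^ Suc m) x) = p (c x)" if x: "x \<in> carrier E" for m x
      proof (induction m)
        case 0
        show ?case using \<phi>(2) x mod_hom_closed[OF \<phi>(1) x] by simp
      next
        case (Suc m)
        have px: "p (c x) \<in> C1" using mod_hom_closed[OF p(1) mod_hom_closed[OF ch x]] by simp
        let ?y = "(\<phi> ^^ Suc m) x"
        have "\<phi> ?y \<in> carrier E" using mod_hom_closed[OF \<phi>(1)] Suc by blast
        moreover have "c (\<phi> ?y) = p (c x)" using \<phi>(2) Suc p1[OF px] by simp
        moreover have "(\<phi> ^^ Suc (Suc m)) x = \<phi> ?y" by simp
        ultimately show ?case by (simp only:)
      qed
      have kc': "x \<in> carrier E" "c x \<in> C2" if x: "x \<in> ?k" for x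
      proof -
        show xc: "x \<in> carrier E" using x by (simp add: a_kernel_iff)
        have "(\<phi> ^^ n) x = \<zero>\<^bsub>E\<^esub>" using x by (simp only: a_kernel_iff)
        then have "p (c x) = \<zero>\<^bsub>C\<^esub>" using pw[OF xc, of m] mod_hom_zero[OF Em Cm ch] by (simp only: m)
        moreover have "p' (c x) \<in> C2" using mod_hom_closed[OF p(2) mod_hom_closed[OF ch xc]] by simp
        ultimately show "c x \<in> C2" using pp'[OF mod_hom_closed[OF ch xc]] c2 by simp
      qed
      have ic: "x \<in> carrier E" "c x \<in> C1" if x: "x \<in> ?i" for x
      proof -
        obtain y where y: "y \<in> carrier E" "x = (\<phi> ^^ n) y" using x by blast
        have "x \<in> carrier E \<and> c x = p (c y)" using pw[OF y(1), of m] unfolding y(2) m .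
        moreover have "p (c y) \<in> C1" using mod_hom_closed[OF p(1) mod_hom_closed[OF ch y(1)]] by simp
        ultimately show "x \<in> carrier E" "c x \<in> C1" by simp_all
      qed
      \<comment> \<open>The two components of an element of N go to C1 and C2 with sum zero, so both
        go to zero and lie in N.\<close>
      have dec: "\<exists>w\<in>?k \<inter> N. \<exists>w'\<in>?i \<inter> N. y = w \<oplus>\<^bsub>E\<^esub> w'" if y: "y \<in> N" for y
      proof -
        have "y \<in> ?k <+>\<^bsub>E\<^esub> ?i" using Nc[OF y] n(5) by simp
        then obtain w w' where w: "w \<in> ?k" "w' \<in> ?i" "y = w \<oplus>\<^bsub>E\<^esub> w'" unfolding submodule_sum_iff by blast
        have "\<zero>\<^bsub>C\<^esub> = c w \<oplus>\<^bsub>C\<^esub> c w'"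
          using c0[OF Nc[OF y]] y mod_hom_add[OF ch kc'(1)[OF w(1)] ic(1)[OF w(2)]] w(3) by simp
        then have s: "c w' \<oplus>\<^bsub>C\<^esub> c w = \<zero>\<^bsub>C\<^esub> \<oplus>\<^bsub>C\<^esub> \<zero>\<^bsub>C\<^esub>"
          using c1[OF ic(2)[OF w(2)]] c2[OF kc'(2)[OF w(1)]] by (simp add: C.M.a_comm)
        have "c w' = \<zero>\<^bsub>C\<^esub>" "c w = \<zero>\<^bsub>C\<^esub>"
          using pq[OF ic(2)[OF w(2)] kc'(2)[OF w(1)]]
            pq[OF submodule_zero[OF C12(1)] submodule_zero[OF C12(2)]] unfolding s by simp_all
        then have "w \<in> N" "w' \<in> N" using c0[OF kc'(1)[OF w(1)]] c0[OF ic(1)[OF w(2)]] by blast+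
        then show ?thesis using w by blast
      qed
      have cE: "C1 \<subseteq> c ` carrier E" "C2 \<subseteq> c ` carrier E"
        using mod_epiD(2)[OF ce] submodule_subset[OF C12(1)] submodule_subset[OF C12(2)] by simp_all
      have "{x \<in> carrier M. j x \<in> ?k} = {\<zero>\<^bsub>M\<^esub>} \<or> {x \<in> carrier M. j x \<in> ?i} = {\<zero>\<^bsub>M\<^esub>}"
        by (rule preimages[OF n(2,3,4) dec])
      then show "C1 = {\<zero>\<^bsub>C\<^esub>} \<or> C2 = {\<zero>\<^bsub>C\<^esub>}"
      proof
        assume "{x \<in> carrier M. j x \<in> ?k} = {\<zero>\<^bsub>M\<^esub>}"
        then have z: "?k \<inter> N = {\<zero>\<^bsub>E\<^esub>}" by (rule N_cap[OF n(2)])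
        \<comment> \<open>With no share of N in the kernel, j maps into the image. By left
          minimality the image is all of E, so C lies over C1 alone and C2 = 0.\<close>
        have ji: "j x \<in> ?i" if x: "x \<in> carrier M" for x
        proof -
          obtain w w' where w: "w \<in> ?k \<inter> N" "w' \<in> ?i" "j x = w \<oplus>\<^bsub>E\<^esub> w'" using dec[OF jN[OF x]] by blast
          have "w = \<zero>\<^bsub>E\<^esub>" using w(1) z by blast
          then show ?thesis using w(2,3) ic(1)[OF w(2)] by simp
        qed
        have "?i = carrier E"
          by (rule top[OF n(3,2) _ _ ji]) (use submodule_sum_comm[OF Em n(3,2)] n(4,5) in auto)
        then have "C2 \<subseteq> C1" using cE(2) ic(2) by auto
        then have "C2 = {\<zero>\<^bsub>C\<^esub>}" using C12(4) by blast
        then show ?thesis by simp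
      next
        assume "{x \<in> carrier M. j x \<in> ?i} = {\<zero>\<^bsub>M\<^esub>}"
        then have z: "?i \<inter> N = {\<zero>\<^bsub>E\<^esub>}" by (rule N_cap[OF n(3)])
        have jk: "j x \<in> ?k" if x: "x \<in> carrier M" for x
        proof -
          obtain w w' where w: "w \<in> ?k" "w' \<in> ?i \<inter> N" "j x = w \<oplus>\<^bsub>E\<^esub> w'" using dec[OF jN[OF x]] by blast
          have "w' = \<zero>\<^bsub>E\<^esub>" using w(2) z by blast
          then show ?thesis using w(1,3) kc'(1)[OF w(1)] by simp
        qed
        have "?k = carrier E" by (rule top[OF n(2,3,5,4) jk])
        then have "C1 \<subseteq> C2" using cE(1) kc'(2) by auto
        then have "C1 = {\<zero>\<^bsub>C\<^esub>}" using C12(4) by blast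
        then show ?thesis by simp
      qed
    qed
  qed
  \<comment> \<open>If C were projective, c would split and N would have a complement.\<close>
  have "\<not> projective_mod A C"
  proof
    assume "projective_mod A C"
    then have "summand_of A ?R C" by (simp add: projective_iff_summand[OF rings(3)])
    then obtain s where s: "s \<in> mod_hom A C E" "\<forall>y\<in>carrier C. c (s y) = y"
      using summand_of_regular_lift[OF _ Em ce mod_hom_id] by blast
    note rc = retract_complement[OF Cm Em s(1) ch s(2)[rule_format]]
    show False
    proof (rule N_not_summand[OF rc(1)])
      show "N <+>\<^bsub>E\<^esub> s ` carrier C = carrier E"
        using submodule_sum_comm[OF Em rc(1) Ns] rc(3) by (simp add: kc)
      show "N \<inter> s ` carrier C = {\<zero>\<^bsub>E\<^esub>}" using rc(4) by (simp add: kc Int_commute)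
    qed
  qed
  then have "injective_mod A C" using indecomposable_gencogen_cases[OF J CI CsT] by blast
  moreover have "iso_syzygy A M C"
    unfolding iso_syzygy_def projective_cover_def
  proof (intro exI[of _ E] exI[of _ c] conjI allI impI)
    show "projective_mod A E" by (rule Ep)
    show "c \<in> mod_epi A E C" by (rule ce)
    show "V = carrier E" if "submodule V A E \<and> V <+>\<^bsub>E\<^esub> a_kernel E C c = carrier E" for V
      using that cover by (simp add: kc)
    have "j \<in> mod_hom A M (E\<lparr>carrier := N\<rparr>)" by (rule mod_hom_corestrict[OF j]) (simp add: N_def)
    then show "mod_isomorphic A M (E\<lparr>carrier := a_kernel E C c\<rparr>)"
      unfolding mod_isomorphic_def kc using jinj by (intro bexI[of _ j]) (simp_all add: bij_betw_def N_def)
  qed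
  ultimately show ?thesis using CI by blast
qed

end

section \<open>Finiteness\<close>

lemma in_add_retract:
  assumes T: "right_module R T" and X: "in_add R T X"
  obtains n s r where "s \<in> mod_hom R X (mod_pow T n)" "r \<in> mod_hom R (mod_pow T n) X"
    "\<forall>x\<in>carrier X. r (s x) = x"
proof -
  obtain n and Y :: "'a umod" where Y: "fg_mod R Y" "mod_isomorphic R (mod_sum X Y) (mod_pow T n)"
    using X unfolding in_add_def by (elim exE conjE)
  have Xm: "right_module R X" and Ym: "right_module R Y" using X Y(1) by (simp_all add: in_add_def fg_mod_def)
  obtain h k where h: "h \<in> mod_hom R (mod_sum X Y) (mod_pow T n)" "k \<in> mod_hom R (mod_pow T n) (mod_sum X Y)"
    and kh: "\<And>x. x \<in> carrier (mod_sum X Y) \<Longrightarrow> k (h x) = x"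
    by (rule mod_isomorphicE[OF right_module_mod_sum[OF Xm Ym] right_module_mod_pow[OF T] Y(2)]) (rule that)
  have l: "(\<lambda>x. (x, \<zero>\<^bsub>Y\<^esub>)) \<in> mod_hom R X (mod_sum X Y)" by (rule mod_hom_inl[OF Ym])
  show thesis
  proof (rule that[OF mod_hom_comp[OF l h(1)] mod_hom_comp[OF h(2) mod_hom_fst]], intro ballI)
    fix x assume "x \<in> carrier X"
    then show "fst (k (h (x, \<zero>\<^bsub>Y\<^esub>))) = x" using kh[OF mod_hom_closed[OF l]] by simp
  qed
qed

lemma projective_embedding:
  assumes R: "ring R" and P: "projective_mod R P"
  obtains n s where "s \<in> mod_mono R P (mod_pow (regular_mod R) n)"
proof -
  have Pf: "fg_mod R P" using P by (simp add: projective_mod_def)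
  obtain n g where g: "g \<in> mod_epi R (mod_pow (regular_mod R) n) P" by (rule free_cover[OF Pf])
  have P': "summand_of R (regular_mod R) P" using P projective_iff_summand[OF R] by blast
  obtain s where s: "s \<in> mod_hom R P (mod_pow (regular_mod R) n)" "\<forall>x\<in>carrier P. g (s x) = x"
    using summand_of_regular_lift[OF P' right_module_mod_pow[OF right_module_regular[OF R]] g mod_hom_id] by blast
  have "inj_on s (carrier P)" by (rule inj_on_inverseI[of _ g]) (use s(2) in blast)
  then show thesis using s(1) by (intro that[of s n]) (simp add: mod_mono_def)
qed

lemma syzygy_unique:
  assumes C: "fg_mod R C" and C': "fg_mod R C'" and iso: "mod_isomorphic R C C'"
    and P: "projective_cover R P p C" and P': "projective_cover R P' p' C'"
  shows "mod_isomorphic R (P\<lparr>carrier := a_kernel P C p\<rparr>) (P'\<lparr>carrier := a_kernel P' C' p'\<rparr>)"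
proof -
  have Cm: "right_module R C" "right_module R C'" using C C' by (simp_all add: fg_mod_def)
  have Pp: "projective_mod R P" "projective_mod R P'" and p: "p \<in> mod_epi R P C" and p': "p' \<in> mod_epi R P' C'"
    and sP: "\<And>V. \<lbrakk>submodule V R P; V <+>\<^bsub>P\<^esub> a_kernel P C p = carrier P\<rbrakk> \<Longrightarrow> V = carrier P"
    and sP': "\<And>V. \<lbrakk>submodule V R P'; V <+>\<^bsub>P'\<^esub> a_kernel P' C' p' = carrier P'\<rbrakk> \<Longrightarrow> V = carrier P'"
    using P P' by (simp_all add: projective_cover_def)
  have Pf: "fg_mod R P" "fg_mod R P'" using Pp by (simp_all add: projective_mod_def)
  then have Pm: "right_module R P" "right_module R P'" by (simp_all add: fg_mod_def)
  interpret P: right_module R P by (rule Pm)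
  interpret P': right_module R P' by (rule Pm)
  note ph = mod_epiD(1)[OF p] and ph' = mod_epiD(1)[OF p']
  obtain h k where h: "h \<in> mod_hom R C C'" "k \<in> mod_hom R C' C"
    and kh: "\<And>x. x \<in> carrier C \<Longrightarrow> k (h x) = x" and hk: "\<And>y. y \<in> carrier C' \<Longrightarrow> h (k y) = y"
    by (rule mod_isomorphicE[OF Cm iso]) (rule that)
  obtain f where f: "f \<in> mod_hom R P P'" "\<forall>x\<in>carrier P. p' (f x) = h (p x)"
    using projective_lift[OF Pp(1) Pf(2) C' p' mod_hom_comp[OF ph h(1)]] by blast
  have "h (p x) = \<zero>\<^bsub>C'\<^esub> \<longleftrightarrow> p x = \<zero>\<^bsub>C\<^esub>" if x: "x \<in> carrier P" for x
  proof
    assume "h (p x) = \<zero>\<^bsub>C'\<^esub>"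
    then have "k (h (p x)) = \<zero>\<^bsub>C\<^esub>" using mod_hom_zero[OF Cm(2,1) h(2)] by simp
    then show "p x = \<zero>\<^bsub>C\<^esub>" using kh[OF mod_hom_closed[OF ph x]] by simp
  qed (simp add: mod_hom_zero[OF Cm h(1)])
  then have ker: "f x \<in> a_kernel P' C' p' \<longleftrightarrow> x \<in> a_kernel P C p" if x: "x \<in> carrier P" for x
    using x f(2) mod_hom_closed[OF f(1) x] by (simp add: a_kernel_iff)
  note ks = submodule_kernel[OF Pm(1) Cm(1) ph] and ks' = submodule_kernel[OF Pm(2) Cm(2) ph']
  have fP: "submodule (f ` carrier P) R P'" by (rule submodule_image[OF Pm f(1) submodule_carrier[OF Pm(1)]])
  have "f ` carrier P = carrier P'"
  proof (rule sP'[OF fP], rule subset_antisym)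
    show "f ` carrier P <+>\<^bsub>P'\<^esub> a_kernel P' C' p' \<subseteq> carrier P'"
      by (rule submodule_subset[OF submodule_sum(1)[OF Pm(2) fP ks']])
    show "carrier P' \<subseteq> f ` carrier P <+>\<^bsub>P'\<^esub> a_kernel P' C' p'"
    proof
      fix y assume y: "y \<in> carrier P'"
      have yc: "p' y \<in> carrier C'" by (rule mod_hom_closed[OF ph' y])
      obtain x where x: "x \<in> carrier P" "k (p' y) = p x"
        using mod_epi_surj[OF p mod_hom_closed[OF h(2) yc]] by blast
      have fx: "f x \<in> carrier P'" by (rule mod_hom_closed[OF f(1) x(1)])
      have "p' (f x) = p' y" using f(2) x hk[OF yc] by (simp flip: x(2))
      then have "y \<ominus>\<^bsub>P'\<^esub> f x \<in> a_kernel P' C' p'"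
        using mod_hom_eq_iff[OF Pm(2) Cm(2) ph' y fx] y fx by (simp add: a_kernel_iff)
      moreover have "y = f x \<oplus>\<^bsub>P'\<^esub> (y \<ominus>\<^bsub>P'\<^esub> f x)" using y fx by (simp add: P'.M.diff_add_cancel)
      ultimately show "y \<in> f ` carrier P <+>\<^bsub>P'\<^esub> a_kernel P' C' p'"
        unfolding submodule_sum_iff using x(1) by blast
    qed
  qed
  then have fe: "f \<in> mod_epi R P P'" using f(1) by (simp add: mod_epi_def)
  obtain s where s: "s \<in> mod_hom R P' P" "\<forall>y\<in>carrier P'. f (s y) = y"
    using projective_lift[OF Pp(2) Pf(1) Pf(2) fe mod_hom_id] by blast
  have fs: "f (s y) = y" if "y \<in> carrier P'" for y using s(2) that by blast
  note rc = retract_complement[OF Pm(2,1) s(1) f(1) fs]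
  have kf: "a_kernel P P' f \<subseteq> a_kernel P C p"
  proof
    fix x assume "x \<in> a_kernel P P' f"
    then have x: "x \<in> carrier P" "f x = \<zero>\<^bsub>P'\<^esub>" by (simp_all add: a_kernel_iff)
    then show "x \<in> a_kernel P C p" using ker[OF x(1)] submodule_zero[OF ks'] by simp
  qed
  have "s ` carrier P' = carrier P"
  proof (rule sP[OF rc(1)])
    have "carrier P \<subseteq> s ` carrier P' <+>\<^bsub>P\<^esub> a_kernel P C p"
      using rc(3) kf unfolding set_add_def' by blast
    then show "s ` carrier P' <+>\<^bsub>P\<^esub> a_kernel P C p = carrier P"
      using submodule_subset[OF submodule_sum(1)[OF Pm(1) rc(1) ks]] by blast
  qed
  then have sf: "s (f x) = x" if x: "x \<in> carrier P" for x
  proof -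
    obtain y where "y \<in> carrier P'" "x = s y" using x \<open>s ` carrier P' = carrier P\<close> by blast
    then show ?thesis using fs by simp
  qed
  show ?thesis
  proof (rule mod_isomorphicI[of f _ _ _ s])
    show "f \<in> mod_hom R (P\<lparr>carrier := a_kernel P C p\<rparr>) (P'\<lparr>carrier := a_kernel P' C' p'\<rparr>)"
      by (rule mod_hom_corestrict[OF mod_hom_restrict[OF f(1) submodule_subset[OF ks]]])
        (use ker submodule_subset[OF ks] in auto)
    show "s \<in> mod_hom R (P'\<lparr>carrier := a_kernel P' C' p'\<rparr>) (P\<lparr>carrier := a_kernel P C p\<rparr>)"
    proof (rule mod_hom_corestrict[OF mod_hom_restrict[OF s(1) submodule_subset[OF ks']]], rule image_subsetI)
      fix y assume "y \<in> carrier (P'\<lparr>carrier := a_kernel P' C' p'\<rparr>)"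
      then have y: "y \<in> a_kernel P' C' p'" by simp
      then have yc: "y \<in> carrier P'" using submodule_subset[OF ks'] by blast
      show "s y \<in> a_kernel P C p" using ker[OF mod_hom_closed[OF s(1) yc]] fs[OF yc] y by simp
    qed
    show "s (f x) = x" if "x \<in> carrier (P\<lparr>carrier := a_kernel P C p\<rparr>)" for x
      using that submodule_subset[OF ks] by (intro sf) auto
    show "f (s y) = y" if "y \<in> carrier (P'\<lparr>carrier := a_kernel P' C' p'\<rparr>)" for y
      using that submodule_subset[OF ks'] by (intro fs) auto
  qed
qed

text \<open>Members of S with a common index are related in both directions, and transitivity then
  makes their classes equal; so there are at most as many classes as indices.\<close>

lemma finite_quotient_of_index:
  assumes D: "finite D" and ex: "\<And>M. M \<in> S \<Longrightarrow> \<exists>i\<in>D. Q M i"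
    and rel: "\<And>M M' i. \<lbrakk>M \<in> S; M' \<in> S; Q M i; Q M' i\<rbrakk> \<Longrightarrow> E M M'"
    and tr: "\<And>M N L. \<lbrakk>E M N; E N L\<rbrakk> \<Longrightarrow> E M L"
  shows "finite (S // {(M, N). E M N})"
proof -
  let ?r = "{(M, N). E M N}"
  let ?c = "\<lambda>i. ?r `` {SOME M. M \<in> S \<and> Q M i}"
  have "S // ?r \<subseteq> ?c ` D"
  proof
    fix X assume "X \<in> S // ?r"
    then obtain M where M: "M \<in> S" "X = ?r `` {M}" by (rule quotientE)
    obtain i where i: "i \<in> D" "Q M i" using ex[OF M(1)] by blast
    define M0 where "M0 = (SOME M. M \<in> S \<and> Q M i)"
    have M0: "M0 \<in> S \<and> Q M0 i" unfolding M0_def by (rule someI[of _ M]) (use M(1) i(2) in blast)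
    have "E M M0" "E M0 M" using rel M(1) M0 i(2) by blast+
    then have "X = ?r `` {M0}" unfolding M(2) using tr by blast
    then show "X \<in> ?c ` D" using i(1) unfolding M0_def by blast
  qed
  then show ?thesis using D finite_subset by blast
qed

context artin_algebra
begin

text \<open>A projective torsionless indecomposable is isomorphic to one of finitely many submodules
  of A. Any other one is the syzygy of an indecomposable injective, which is isomorphic to one of
  finitely many submodules of DA.\<close>

lemma torsionless_finite_of_gl_dim:
  assumes J: "dualizing_mod K J" and gl: "gl_dim (end_ring A (gencogen J)) \<le> enat 3"
  shows "torsionless_finite A"
proof -
  let ?D = "dual_mod K A J" and ?R = "regular_mod A"
  have Di: "injective_mod A ?D" by (rule injective_dual[OF dualizing_mod_injective[OF J]])
  have Df: "fg_mod A ?D" and D: "right_module A ?D" using Di by (simp_all add: injective_mod_def fg_mod_def)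
  note Rm = right_module_regular[OF rings(3)]
  have Rf: "fg_mod A ?R" by (simp add: fg_mod_def Rm fin_gen_regular rings(3))
  obtain DR where DR: "finite DR" "\<forall>U\<in>DR. submodule U A ?R"
    "\<forall>M :: 'a umod. indecomposable_mod A M \<and> finite_length A M \<and>
        summand_of A (?R\<lparr>carrier := carrier ?R\<rparr>) M \<longrightarrow> (\<exists>U\<in>DR. mod_isomorphic A M (?R\<lparr>carrier := U\<rparr>))"
    using finitely_many_indecomposable_summands[OF Rm fg_finite_length_A[OF Rf] submodule_carrier[OF Rm]]
    by (elim exE conjE)
  obtain DD where DD: "finite DD" "\<forall>U\<in>DD. submodule U A ?D"
    "\<forall>M :: 'a umod. indecomposable_mod A M \<and> finite_length A M \<and>
        summand_of A (?D\<lparr>carrier := carrier ?D\<rparr>) M \<longrightarrow> (\<exists>U\<in>DD. mod_isomorphic A M (?D\<lparr>carrier := U\<rparr>))"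
    using finitely_many_indecomposable_summands[OF D fg_finite_length_A[OF Df] submodule_carrier[OF D]]
    by (elim exE conjE)
  have fgI: "fg_mod A M" if "indecomposable_mod A M" for M :: "'a umod"
    using that by (simp add: indecomposable_mod_def)
  \<comment> \<open>\<open>Inl\<close> and \<open>Inr\<close> separate the projective case from the
    syzygy case. In the latter only the isomorphism class of I is recorded, through its copy inside
    DA.\<close>
  define Q where "Q M i = (case i of
      Inl U \<Rightarrow> U \<in> DR \<and> mod_isomorphic A M (?R\<lparr>carrier := U\<rparr>)
    | Inr U \<Rightarrow> U \<in> DD \<and> (\<exists>I :: 'a umod. fg_mod A I \<and> iso_syzygy A M I \<and> mod_isomorphic A I (?D\<lparr>carrier := U\<rparr>)))"
    for M :: "'a umod" and i
  let ?S = "{M :: 'a umod. indecomposable_mod A M \<and>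
         (\<exists>P :: 'a umod. projective_mod A P \<and> mod_mono A M P \<noteq> {})}"
  have "finite (?S // {(M, N). mod_isomorphic A M N})"
  proof (rule finite_quotient_of_index[where D = "Inl ` DR \<union> Inr ` DD" and Q = Q])
    show "finite (Inl ` DR \<union> Inr ` DD)" using DR(1) DD(1) by simp
    show "mod_isomorphic A M L" if "mod_isomorphic A M N" "mod_isomorphic A N L" for M N L :: "'a umod"
      using that by (rule mod_isomorphic_trans)
  next
    fix M assume "M \<in> ?S"
    then obtain P :: "'a umod" and i where MI: "indecomposable_mod A M" and P: "projective_mod A P" "i \<in> mod_mono A M P"
      by blast
    show "\<exists>i\<in>Inl ` DR \<union> Inr ` DD. Q M i"
    proof (cases "projective_mod A M")
      case True
      then have "summand_of A (?R\<lparr>carrier := carrier ?R\<rparr>) M"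
        by (simp add: projective_iff_summand[OF rings(3)])
      then obtain U where "U \<in> DR" "mod_isomorphic A M (?R\<lparr>carrier := U\<rparr>)"
        using DR(3) MI fg_finite_length_A[OF fgI[OF MI]] by blast
      then have "Q M (Inl U)" "Inl U \<in> Inl ` DR \<union> Inr ` DD" by (simp_all add: Q_def)
      then show ?thesis by (rule bexI)
    next
      case False
      obtain k s where s: "s \<in> mod_mono A P (mod_pow ?R k)" by (rule projective_embedding[OF rings(3) P(1)])
      have "(\<lambda>x. s (i x)) \<in> mod_mono A M (mod_pow ?R k)"
      proof -
        have "inj_on (s \<circ> i) (carrier M)"
          using comp_inj_on[OF mod_monoD(2)[OF P(2)] inj_on_subset[OF mod_monoD(2)[OF s]]]
            mod_hom_closed[OF mod_monoD(1)[OF P(2)]] by blast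
        then show ?thesis
          using mod_hom_comp[OF mod_monoD(1)[OF P(2)] mod_monoD(1)[OF s]] by (simp add: mod_mono_def comp_def)
      qed
      then obtain I :: "'a umod" where I: "indecomposable_mod A I" "injective_mod A I" "iso_syzygy A M I"
        using cogenerated_syzygy[OF J gl MI False] by blast
      have If: "fg_mod A I" by (rule fgI[OF I(1)])
      have Im: "right_module A I" using If by (simp add: fg_mod_def)
      \<comment> \<open>An injective module embeds in a power of DA and splits off, so it lies in
        add DA.\<close>
      obtain k f where f: "f \<in> mod_mono A I (mod_pow ?D k)" by (rule dual_embedding[OF J If])
      have "fg_mod A (mod_pow ?D k)"
        by (rule summand_of_fin_gen[OF D _ summand_of_mod_pow[OF D]]) (use Df in \<open>simp add: fg_mod_def\<close>)
      then obtain g where g: "g \<in> mod_hom A (mod_pow ?D k) I" "\<forall>x\<in>carrier I. g (f x) = x"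
        using injective_extend[OF I(2) If _ f mod_hom_id] by blast
      have "summand_of A ?D I"
        using g(2) by (intro summand_of_retract[OF Im summand_of_mod_pow[OF D] mod_monoD(1)[OF f] g(1)]) simp
      then have "summand_of A (?D\<lparr>carrier := carrier ?D\<rparr>) I" by (simp del: dual_mod_simps)
      then obtain U where U: "U \<in> DD" "mod_isomorphic A I (?D\<lparr>carrier := U\<rparr>)"
        using DD(3) I(1) fg_finite_length_A[OF If] by blast
      have "Q M (Inr U)" using U If I(3) by (auto simp: Q_def)
      moreover have "Inr U \<in> Inl ` DR \<union> Inr ` DD" using U(1) by simp
      ultimately show ?thesis by (rule bexI)
    qed
  next
    fix M M' i assume M: "M \<in> ?S" "M' \<in> ?S" and q: "Q M i" "Q M' i"
    have m: "right_module A M" "right_module A M'"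
      using M fgI by (simp_all add: fg_mod_def)
    show "mod_isomorphic A M M'"
    proof (cases i)
      case (Inl U)
      then have U: "U \<in> DR" "mod_isomorphic A M (?R\<lparr>carrier := U\<rparr>)" "mod_isomorphic A M' (?R\<lparr>carrier := U\<rparr>)"
        using q by (simp_all add: Q_def)
      have "right_module A (?R\<lparr>carrier := U\<rparr>)" using right_module_restrict[OF Rm] DR(2) U(1) by blast
      then show ?thesis using mod_isomorphic_trans[OF U(2) mod_isomorphic_sym[OF m(2) _ U(3)]] by blast
    next
      case (Inr U)
      obtain I I' :: "'a umod" where U: "U \<in> DD"
        and I: "fg_mod A I" "iso_syzygy A M I" "mod_isomorphic A I (?D\<lparr>carrier := U\<rparr>)"
        and I': "fg_mod A I'" "iso_syzygy A M' I'" "mod_isomorphic A I' (?D\<lparr>carrier := U\<rparr>)"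
        using q unfolding Q_def Inr by auto
      have Im: "right_module A I" "right_module A I'" using I(1) I'(1) by (simp_all add: fg_mod_def)
      have "right_module A (?D\<lparr>carrier := U\<rparr>)" using right_module_restrict[OF D] DD(2) U by blast
      then have iso: "mod_isomorphic A I I'"
        using mod_isomorphic_trans[OF I(3) mod_isomorphic_sym[OF Im(2) _ I'(3)]] by blast
      obtain P :: "'a umod" and p where P: "projective_cover A P p I" "mod_isomorphic A M (P\<lparr>carrier := a_kernel P I p\<rparr>)"
        using I(2) unfolding iso_syzygy_def by (elim exE conjE)
      obtain P' :: "'a umod" and p' where P': "projective_cover A P' p' I'" "mod_isomorphic A M' (P'\<lparr>carrier := a_kernel P' I' p'\<rparr>)"
        using I'(2) unfolding iso_syzygy_def by (elim exE conjE)
      have P'm: "right_module A P'" and p'h: "p' \<in> mod_hom A P' I'"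
        using P'(1) by (simp_all add: projective_cover_def projective_mod_def fg_mod_def mod_epi_def)
      note k' = right_module_restrict[OF P'm submodule_kernel[OF P'm Im(2) p'h]]
      show ?thesis
        by (rule mod_isomorphic_trans[OF P(2) mod_isomorphic_trans[OF syzygy_unique[OF I(1) I'(1) iso P(1) P'(1)]
                mod_isomorphic_sym[OF m(2) k' P'(2)]]])
    qed
  qed
  then show ?thesis unfolding torsionless_finite_def .
qed

end

theorem theorem4:
  fixes K :: "('k, 'z) ring_scheme"
    and A :: "('k, 'a) module"
    and J :: "('k, 'j) module"
  assumes "artin_algebra K A"
    and "dualizing_mod K J"
    and "representation_hereditary K J A"
  shows "(\<forall>M :: ('a, 'm) module.
            indecomposable_mod A M \<and> \<not> injective_mod A M \<and> in_Gen A (dual_mod K A J) M \<longrightarrow>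
            (\<exists>P :: 'a umod. indecomposable_mod A P \<and> projective_mod A P \<and> iso_cosyzygy A M P))
       \<and> (\<forall>M :: ('a, 'm) module.
            indecomposable_mod A M \<and> \<not> projective_mod A M \<and> in_Cogen A (regular_mod A) M \<longrightarrow>
            (\<exists>I :: 'a umod. indecomposable_mod A I \<and> injective_mod A I \<and> iso_syzygy A M I))
       \<and> torsionless_finite A"
proof (intro conjI allI impI)
  interpret artin_algebra K A by fact
  have J: "dualizing_mod K J" by fact
  have gl: "gl_dim (end_ring A (gencogen J)) \<le> enat 3"
    using assms(3) by (simp add: representation_hereditary_def numeral_eq_enat)
  have D: "right_module A (dual_mod K A J)"
    using injective_dual[OF dualizing_mod_injective[OF J]] by (simp add: injective_mod_def fg_mod_def)
  note Rm = right_module_regular[OF rings(3)]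
  show "torsionless_finite A" by (rule torsionless_finite_of_gl_dim[OF J gl])
  {
    fix M :: "('a, 'm) module"
    assume M: "indecomposable_mod A M \<and> \<not> injective_mod A M \<and> in_Gen A (dual_mod K A J) M"
    then obtain X :: "'a umod" and h where X: "in_add A (dual_mod K A J) X" and h: "h \<in> mod_epi A X M"
      unfolding in_Gen_def by blast
    obtain n s r where s: "s \<in> mod_hom A X (mod_pow (dual_mod K A J) n)"
      "r \<in> mod_hom A (mod_pow (dual_mod K A J) n) X" "\<forall>x\<in>carrier X. r (s x) = x"
      by (rule in_add_retract[OF D X])
    \<comment> \<open>The retraction onto X is surjective, so M is a quotient of a power of DA and
      not only of a summand X.\<close>
    have c: "(\<lambda>x. h (r x)) \<in> mod_hom A (mod_pow (dual_mod K A J) n) M"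
      by (rule mod_hom_comp[OF s(2) mod_epiD(1)[OF h]])
    have "y \<in> (\<lambda>x. h (r x)) ` carrier (mod_pow (dual_mod K A J) n)" if y: "y \<in> carrier M" for y
    proof -
      obtain x where x: "x \<in> carrier X" "y = h x" using mod_epi_surj[OF h y] by blast
      show ?thesis by (rule image_eqI[of _ _ "s x"]) (use x s(3) mod_hom_closed[OF s(1)] in auto)
    qed
    then have "(\<lambda>x. h (r x)) \<in> mod_epi A (mod_pow (dual_mod K A J) n) M"
      using c mod_hom_closed[OF c] by (auto simp: mod_epi_def)
    then show "\<exists>P :: 'a umod. indecomposable_mod A P \<and> projective_mod A P \<and> iso_cosyzygy A M P"
      using M by (intro generated_cosyzygy[OF J gl]) simp_all
  next
    fix M :: "('a, 'm) module"
    assume M: "indecomposable_mod A M \<and> \<not> projective_mod A M \<and> in_Cogen A (regular_mod A) M"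
    then obtain X :: "'a umod" and h where X: "in_add A (regular_mod A) X" and h: "h \<in> mod_mono A M X"
      unfolding in_Cogen_def by blast
    obtain n s r where s: "s \<in> mod_hom A X (mod_pow (regular_mod A) n)"
      "r \<in> mod_hom A (mod_pow (regular_mod A) n) X" "\<forall>x\<in>carrier X. r (s x) = x"
      by (rule in_add_retract[OF Rm X])
    \<comment> \<open>In the same way the section of the retraction embeds M in a power of
      A.\<close>
    have c: "(\<lambda>x. s (h x)) \<in> mod_hom A M (mod_pow (regular_mod A) n)"
      by (rule mod_hom_comp[OF mod_monoD(1)[OF h] s(1)])
    have "inj_on (\<lambda>x. s (h x)) (carrier M)"
    proof (rule inj_onI)
      fix x y assume xy: "x \<in> carrier M" "y \<in> carrier M" "s (h x) = s (h y)"
      have "r (s (h x)) = r (s (h y))" using xy(3) by simp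
      then have "h x = h y" using s(3) mod_hom_closed[OF mod_monoD(1)[OF h]] xy(1,2) by simp
      then show "x = y" by (rule inj_onD[OF mod_monoD(2)[OF h] _ xy(1,2)])
    qed
    then have "(\<lambda>x. s (h x)) \<in> mod_mono A M (mod_pow (regular_mod A) n)" using c by (simp add: mod_mono_def)
    then show "\<exists>I :: 'a umod. indecomposable_mod A I \<and> injective_mod A I \<and> iso_syzygy A M I"
      using M by (intro cogenerated_syzygy[OF J gl]) simp_all
  }
qed

end
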